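(* For $q\in(0,1)$ and $r>0$ let $G^{\vee}_{\mathbb{A}_q}(x;r):=g_{\mathbb{A}_q}(-x,x;r)$, $x\in(q,1)$, where $g_{\mathbb{A}_q}$ is the unfolded 2-correlation function defined in the context; $\wp(\phi_{-r})$, $e_1,e_2,e_3$, $g_2$ (all depending on $q$) are also defined there. (i) For $r>0$, $$G^{\vee}_{\mathbb{A}_q}(x;r)\sim1+\kappa(r)(1-x^2)^{\eta}\ \text{ as }x\uparrow1,\qquad G^{\vee}_{\mathbb{A}_q}(x;r)\sim1+\frac{\kappa(r)}{q^8}(x^2-q^2)^{\eta}\ \text{ as }x\downarrow q,$$ with $\eta=4$, where $$\kappa(r)=\kappa(r;q):=5\wp(\phi_{-r})^2+2e_1\wp(\phi_{-r})-(e_1^2+g_2/2).$$ The coefficient $\kappa$ satisfies $\kappa(1/r)=\kappa(r)$, $\kappa(q^2r)=\kappa(r)$ and $\kappa(q^2/r)=\kappa(r)$. Hence, for the parameter space $\{(q,r):q\in(0,1),r>0\}$, a fundamental cell (for the symmetries $r\mapsto1/r$, $r\mapsto q^2r$) is $\Omega:=\{(q,r):q\in(0,1),\ q\le r\le1\}$. (ii) Let $$\wp_+=\wp_+(q):=-\frac{e_1}{5}+\frac1{10}\sqrt{24e_1^2+10g_2}.$$ Then $e_1>\wp_+>e_2>e_3$, and $$r_0=r_0(q):=\exp\Big[-\frac12\int_{\wp_+}^{e_1}\frac{ds}{\sqrt{(e_1-s)(s-e_2)(s-e_3)}}\Big]$$ satisfies $q<r_0(q)<1$ for $q\in(0,1)$.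 The coefficient $\kappa(r)$ changes its sign at $r=r_0$: $\kappa(r)<0$ if $r\in(q,r_0)$, and $\kappa(r)>0$ if $r\in(r_0,1)$. (iii) The curve $\{r=r_0(q):q\in(0,1)\}\subset\Omega$ satisfies the following. (a) $$r_{\mathrm c}:=\lim_{q\to0}r_0(q)=\frac{1-\frac{\sqrt{4-\sqrt6}}{\sqrt5}}{1+\frac{\sqrt{4-\sqrt6}}{\sqrt5}}=2\sqrt6-3-2\sqrt{8-3\sqrt6}=0.2846303639\cdots;$$ (b) $r_0(q)\sim r_{\mathrm c}+cq^2$ as $q\to0$, with $$c=\frac83\Big[-72+22\sqrt6+3(4\sqrt6-1)\sqrt{8-3\sqrt6}\Big]=8.515307593\cdots;$$ (c) $r_0(q)\sim1-\frac12(1-q)$ as $q\to1$.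
   Context: Notation: $\mathbb{A}_q=\{z\in\mathbb{C}:q<|z|<1\}$, $\theta(z)=\prod_{n=0}^\infty(1-zq^{2n})(1-q^{2n+2}/z)$ for $z\in\mathbb{C}\setminus\{0\}$, $q_0=\prod_{n=1}^\infty(1-q^{2n})$, and for $s>0$, $S_{\mathbb{A}_q}(z,w;s)=\sum_{n\in\mathbb{Z}}\frac{(z\overline{w})^n}{1+sq^{2n}}=\frac{q_0^2\theta(-sz\overline{w})}{\theta(-s)\theta(z\overline{w})}$. Put $$\rho^1_{\mathbb{A}_q}(z;r)=\frac{\theta(-r)}{\theta(-r|z|^4)}S_{\mathbb{A}_q}(z,z;r|z|^2)^2,\qquad\rho^2_{\mathbb{A}_q}(z_1,z_2;r)=\frac{\theta(-r)}{\theta(-r|z_1|^4|z_2|^4)}\det_{1\le i,j\le2}\big[S_{\mathbb{A}_q}(z_i,z_j;r|z_1|^2|z_2|^2)^2\big]$$ (the one- and two-point correlation functions, with respect to Lebesgue measure divided by $\pi$, of the zeros of the Gaussian Laurent series $\sum_{n\in\mathbb{Z}}\zeta_nz^n/\sqrt{1+rq^{2n}}$, $\zeta_n$ i.i.d. standard complex Gaussian). The unfolded 2-correlation function is $g_{\mathbb{A}_q}(z,w;r)=\rho^2_{\mathbb{A}_q}(z,w;r)/(\rho^1_{\mathbb{A}_q}(z;r)\rho^1_{\mathbb{A}_q}(w;r))$. Let $\tau_q=-\sqrt{-1}\,\log q/\pi$ (so $q=e^{\sqrt{-1}\pi\tau_q}$), and let $\wp$ be the Weierstrass $\wp$-function of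 the lattice $\{2\pi m+2\pi\tau_qn:m,n\in\mathbb{Z}\}$. For $z\ne0$, $\phi_z$ is defined by $z=e^{\sqrt{-1}\phi_z}$ (modulo $2\pi$), so $\wp(\phi_{-r})=\wp(\pi-\sqrt{-1}\log r)$. Equivalently $$\wp(\phi_z)=-\frac1{12}+2\sum_{n=1}^\infty\frac{q^{2n}}{(1-q^{2n})^2}-\sum_{n=-\infty}^\infty\frac{zq^{2n}}{(1-zq^{2n})^2}.$$ Set $e_1=\wp(\pi)$, $e_2=\wp(\pi+\pi\tau_q)$, $e_3=\wp(\pi\tau_q)$ (real numbers with $e_1+e_2+e_3=0$), and $g_2=2(e_1^2+e_2^2+e_3^2)$. Meaning of the asymptotic relations: $G\sim1+\kappa\,\epsilon^4$ as $\epsilon\to0$ means $G=1+\kappa\epsilon^4+o(\epsilon^4)$; (b) means $r_0(q)=r_{\mathrm c}+cq^2+o(q^2)$; (c) means $r_0(q)=1-\frac12(1-q)+o(1-q)$. That $\Omega$ is a fundamental cell means that for each $q\in(0,1)$ every orbit in $(0,\infty)$ of the group generated by $r\mapsto1/r$ and $r\mapsto q^2r$ meets $[q,1]$ in exactly one point. *)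

theory Defs
  imports
    "HOL-Analysis.Analysis"
    "HOL-Library.Landau_Symbols"
    "HOL-Algebra.Bij"
    "HOL-Algebra.Generated_Groups"
begin

definition theta :: "real \<Rightarrow> complex \<Rightarrow> complex" where
  "theta q z = (\<Prod>n. (1 - z * of_real (q ^ (2 * n))) * (1 - of_real (q ^ (2 * n + 2)) / z))"

definition szego :: "real \<Rightarrow> complex \<Rightarrow> complex \<Rightarrow> real \<Rightarrow> complex" where
  "szego q z w s =
     (\<Sum>\<^sub>\<infinity>n::int. (z * cnj w) powi n / of_real (1 + s * q powi (2 * n)))"

definition rho1 :: "real \<Rightarrow> complex \<Rightarrow> real \<Rightarrow> complex" where
  "rho1 q z r =
     theta q (of_real (- r)) / theta q (of_real (- r * norm z ^ 4)) *
     (szego q z z (r * (norm z)\<^sup>2))\<^sup>2"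

definition rho2 :: "real \<Rightarrow> complex \<Rightarrow> complex \<Rightarrow> real \<Rightarrow> complex" where
  "rho2 q z1 z2 r =
     (let z = (vector [z1, z2] :: complex ^ 2) in
      theta q (of_real (- r)) / theta q (of_real (- r * norm z1 ^ 4 * norm z2 ^ 4)) *
      det ((\<chi> i j. (szego q (z $ i) (z $ j) (r * (norm z1)\<^sup>2 * (norm z2)\<^sup>2))\<^sup>2) ::
        complex ^ 2 ^ 2))"

definition unfolded_corr :: "real \<Rightarrow> complex \<Rightarrow> complex \<Rightarrow> real \<Rightarrow> complex" where
  "unfolded_corr q z w r = rho2 q z w r / (rho1 q z r * rho1 q w r)"

definition G_vee :: "real \<Rightarrow> real \<Rightarrow> real \<Rightarrow> complex" where
  "G_vee q x r = unfolded_corr q (of_real (- x)) (of_real x) r"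

definition tau :: "real \<Rightarrow> complex" where
  "tau q = - \<i> * of_real (ln q) / of_real pi"

definition lattice_pt :: "real \<Rightarrow> int \<times> int \<Rightarrow> complex" where
  "lattice_pt q = (\<lambda>(m, n). 2 * of_real pi * of_int m + 2 * of_real pi * tau q * of_int n)"

definition wp :: "real \<Rightarrow> complex \<Rightarrow> complex" where
  "wp q z = 1 / z\<^sup>2 +
     (\<Sum>\<^sub>\<infinity>p\<in>UNIV - {(0, 0)}. 1 / (z - lattice_pt q p)\<^sup>2 - 1 / (lattice_pt q p)\<^sup>2)"

(* exp (\<i> * phi z) = z for z \<noteq> 0; the choice of the branch is immaterial inside wp q,
   which has period 2 * pi. *)
definition phi :: "complex \<Rightarrow> complex" where
  "phi z = - \<i> * Ln z"

(* For 0 < q < 1 and r > 0 the lattice is invariant under complex conjugation, so wp q is real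
   at the half periods and at phi (- r) = pi - \<i> * ln r; Re below only changes the type. *)
definition e1 :: "real \<Rightarrow> real" where
  "e1 q = Re (wp q (of_real pi))"

definition e2 :: "real \<Rightarrow> real" where
  "e2 q = Re (wp q (of_real pi + of_real pi * tau q))"

definition e3 :: "real \<Rightarrow> real" where
  "e3 q = Re (wp q (of_real pi * tau q))"

definition g2 :: "real \<Rightarrow> real" where
  "g2 q = 2 * ((e1 q)\<^sup>2 + (e2 q)\<^sup>2 + (e3 q)\<^sup>2)"

definition wp_phi_neg :: "real \<Rightarrow> real \<Rightarrow> real" where
  "wp_phi_neg q r = Re (wp q (phi (of_real (- r))))"

definition kappa :: "real \<Rightarrow> real \<Rightarrow> real" where
  "kappa q r =
     5 * (wp_phi_neg q r)\<^sup>2 + 2 * e1 q * wp_phi_neg q r - ((e1 q)\<^sup>2 + g2 q / 2)"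

definition wp_plus :: "real \<Rightarrow> real" where
  "wp_plus q = - e1 q / 5 + 1 / 10 * sqrt (24 * (e1 q)\<^sup>2 + 10 * g2 q)"

(* The integrand has an integrable singularity at the upper limit. *)
definition r0 :: "real \<Rightarrow> real" where
  "r0 q = exp (- (1 / 2) *
     integral {wp_plus q..e1 q} (\<lambda>s. 1 / sqrt ((e1 q - s) * (s - e2 q) * (s - e3 q))))"

definition r_crit :: real where
  "r_crit = Lim (at_right 0) r0"

definition Omega :: "(real \<times> real) set" where
  "Omega = {(q, r). 0 < q \<and> q < 1 \<and> q \<le> r \<and> r \<le> 1}"

definition sym_orbit :: "real \<Rightarrow> real \<Rightarrow> real set" where
  "sym_orbit q r =
     (\<lambda>h. h r) ` generate (BijGroup {0<..})
       {restrict (\<lambda>t. 1 / t) {0<..}, restrict (\<lambda>t. q\<^sup>2 * t) {0<..}}"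

definition fundamental_cell :: "(real \<times> real) set \<Rightarrow> bool" where
  "fundamental_cell D \<longleftrightarrow>
     D \<subseteq> {0<..<1} \<times> {0<..} \<and>
     (\<forall>q\<in>{0<..<1}. \<forall>r>0. \<exists>!s. s \<in> sym_orbit q r \<and> (q, s) \<in> D)"

end

theory Submission
  imports Defs "HOL-Real_Asymp.Real_Asymp"
begin

text \<open>Put \<open>p = q\<^sup>2\<close>, \<open>u = x\<^sup>2\<close>. All quantities reduce to the bilateral series
  \<open>S u s = \<Sum>\<^sub>n u\<^sup>n / (1 + s p\<^sup>n)\<close> and \<open>Q s = \<Sum>\<^sub>n s p\<^sup>n / (1 + s p\<^sup>n)\<^sup>2\<close>, and no elliptic function
  theory is used. Partial fractions and telescoping in the double series give
  \<open>S u s * S u (1 / s) = V u + Q s\<close>, and summing the lattice along its horizontal rows by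
  \<open>\<Sum>\<^sub>m 1 / (z + m)\<^sup>2 = \<pi>\<^sup>2 / sin\<^sup>2 (\<pi> z)\<close> shows that \<open>\<wp>(\<phi>\<^bsub>-s\<^esub>)\<close> is \<open>Q s\<close> up to a constant. Specialising
  \<open>u\<close> to \<open>-q\<close>, \<open>q\<close> and (in the limit) \<open>-1\<close> turns \<open>\<wp>(\<phi>\<^bsub>-s\<^esub>) - e\<^sub>2\<close>, \<open>\<wp>(\<phi>\<^bsub>-s\<^esub>) - e\<^sub>3\<close>, \<open>e\<^sub>1 - \<wp>(\<phi>\<^bsub>-s\<^esub>)\<close> into squares.

  For (i), the two factors \<open>S u (r u\<^sup>2) / S u (r u)\<close> and \<open>\<theta>(-r) \<theta>(-r u\<^sup>4) / \<theta>(-r u\<^sup>2)\<^sup>2\<close> of \<open>G\<^sup>\<or>\<close> are expanded to second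
  order in \<open>(1 - u)\<^sup>2 / u\<close>. The first-order terms cancel, which leaves
  \<open>\<kappa>(r) = 6 \<Sum>\<^sub>n (r p\<^sup>n / (1 + r p\<^sup>n)\<^sup>2)\<^sup>2 - Q r - (Q 1 - Q r)\<^sup>2\<close>; the behaviour at \<open>q\<close> follows from the exact
  symmetry \<open>x \<mapsto> q / x\<close>, \<open>r \<mapsto> 1 / r\<close>.

  For (ii), \<open>t \<mapsto> \<wp>(\<phi>\<^bsub>-exp t\<^esub>)\<close> increases from \<open>e\<^sub>2\<close> to \<open>e\<^sub>1\<close> on \<open>[ln q, 0]\<close> and satisfies the Weierstrass
  differential equation, so \<open>r\<^sub>0\<close> is the point where it equals \<open>\<wp>\<^sub>+\<close>.

  For (iii), as \<open>q \<rightarrow> 0\<close> one evaluates \<open>\<kappa>\<close> at \<open>r\<^sub>c + (c \<plusminus> \<epsilon>) q\<^sup>2\<close>; as \<open>q \<rightarrow> 1\<close> the arcsine of the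
  affine image of \<open>\<wp>\<close> in \<open>[-1, 1]\<close> has almost constant derivative, because
  \<open>(e\<^sub>1 - e\<^sub>2) / (e\<^sub>1 - e\<^sub>3) \<rightarrow> 0\<close>, so that \<open>ln r\<^sub>0 / ln q \<rightarrow> 1 / 2\<close>.\<close>

subsection \<open>Bilateral series\<close>

text \<open>Squares arise at the fixed points of a symmetry: at \<open>u = q\<close> and
  \<open>u = - q\<close> the partner \<open>S u (1 / s)\<close> equals \<open>s * S u s\<close>, and
  the limit at \<open>u = - 1\<close> is odd under \<open>s\<close> to \<open>1 / s\<close>. The
  quotient \<open>S u (r * u\<^sup>2) / S u (r * u)\<close> is accessible because both series have
  the common partner \<open>S u (1 / (r * u\<^sup>2))\<close>, with which each multiplies to
  something explicit. The engine of the whole proof is that \<open>(Q s)\<^sup>2 - Q2 s\<close> is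
  affine in \<open>Q s\<close>. It yields the differential equation, and half of it is the
  second-order coefficient of both factors of the correlation function. The obstacle is strictness.
  Squares give only e2 <= wp <= e1. That \<open>theta4 q\<close> is not zero and that
  \<open>S (- q)\<close> has no zero on (q, 1) would usually be read off from theta products. Here
  both are checked by hand for q < 1/5 and then carried from the nome q^2 to the nome q. Repeated
  squaring brings every nome below 1/5, so all q are reached.\<close>

lemma int_UNIV_split: "(UNIV :: int set) = range int \<union> range (\<lambda>n. - int (Suc n))"
proof -
  have "x \<in> range int \<union> range (\<lambda>n. - int (Suc n))" for x :: int
    by (cases x rule: int_cases) auto
  then show ?thesis by blast
qed

lemma summable_on_int_split:
  fixes f :: "int \<Rightarrow> 'a::banach"
  assumes "(\<lambda>n. f (int n)) summable_on UNIV" "(\<lambda>n. f (- int (Suc n))) summable_on UNIV"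
  shows "f summable_on UNIV"
proof -
  have "f summable_on range int"
    using assms(1) by (subst summable_on_reindex) (auto simp: o_def)
  moreover have "f summable_on range (\<lambda>n. - int (Suc n))"
    using assms(2) by (subst summable_on_reindex) (auto simp: o_def inj_on_def)
  moreover have "range int \<inter> range (\<lambda>n. - int (Suc n)) = {}"
    by auto
  ultimately show ?thesis
    unfolding int_UNIV_split by (rule summable_on_Un_disjoint)
qed

lemma geometric_summable_on_int:
  fixes r :: real
  assumes "0 \<le> r" "r < 1"
  shows "(\<lambda>n::int. r ^ nat \<bar>n\<bar>) summable_on UNIV"
proof (rule summable_on_int_split)
  show "(\<lambda>n. r ^ nat \<bar>int n\<bar>) summable_on UNIV"
    using assms by (simp add: summable_on_UNIV_nonneg_real_iff summable_geometric)
  have "summable (\<lambda>n. r ^ Suc n)"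
    using assms by (simp add: summable_geometric)
  then show "(\<lambda>n. r ^ nat \<bar>- int (Suc n)\<bar>) summable_on UNIV"
    using assms by (subst summable_on_UNIV_nonneg_real_iff) (simp_all add: nat_add_distrib del: of_nat_Suc)
qed

lemma int_abs_summable_bound:
  fixes f :: "int \<Rightarrow> 'a::banach"
  assumes "\<And>n. norm (f n) \<le> C * r ^ nat \<bar>n\<bar>" "0 \<le> r" "r < 1"
  shows "(\<lambda>n. norm (f n)) summable_on UNIV"
  by (rule summable_on_comparison_test[OF summable_on_cmult_right[OF geometric_summable_on_int]])
     (use assms in auto)

lemma int_summable_bound:
  fixes f :: "int \<Rightarrow> 'a::banach"
  assumes "\<And>n. norm (f n) \<le> C * r ^ nat \<bar>n\<bar>" "0 \<le> r" "r < 1"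
  shows "f summable_on UNIV"
  using int_abs_summable_bound[OF assms] by (rule abs_summable_summable)

text \<open>Two foldings of a bilateral sum. The first pairs n with - n - 1 and serves the
  alternating estimate at small nome. The second is symmetric about 0 and splits off the central
  term, which often needs separate treatment.\<close>

lemma
  fixes f :: "int \<Rightarrow> 'a::banach"
  assumes "f summable_on UNIV"
  shows int_infsum_pair_sums: "(\<lambda>n. f (int n) + f (- int (Suc n))) sums infsum f UNIV"
    and int_infsum_sums: "(\<lambda>n. f (int (Suc n)) + f (- int (Suc n))) sums (infsum f UNIV - f 0)"
proof -
  let ?A = "range int" and ?B = "range (\<lambda>n. - int (Suc n))"
  have sA: "f summable_on ?A" and sB: "f summable_on ?B"
    using assms summable_on_subset_banach by blast+
  have E: "infsum f UNIV = infsum f ?A + infsum f ?B"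
    unfolding int_UNIV_split by (rule infsum_Un_disjoint[OF sA sB]) auto
  have "(f \<circ> int has_sum infsum f ?A) UNIV"
    using has_sum_infsum[OF sA] by (subst has_sum_reindex[symmetric]) auto
  then have A: "(\<lambda>n. f (int n)) sums infsum f ?A"
    unfolding o_def by (rule has_sum_imp_sums)
  have "(f \<circ> (\<lambda>n. - int (Suc n)) has_sum infsum f ?B) UNIV"
    using has_sum_infsum[OF sB] by (subst has_sum_reindex[symmetric]) (auto simp: inj_on_def)
  then have B: "(\<lambda>n. f (- int (Suc n))) sums infsum f ?B"
    unfolding o_def by (rule has_sum_imp_sums)
  show "(\<lambda>n. f (int n) + f (- int (Suc n))) sums infsum f UNIV"
    unfolding E by (rule sums_add[OF A B])
  have A': "(\<lambda>n. f (int (Suc n))) sums (infsum f ?A - f 0)"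
    using A by (subst sums_Suc_iff) simp
  have "infsum f UNIV - f 0 = infsum f ?A - f 0 + infsum f ?B"
    unfolding E by (simp del: of_nat_Suc)
  then show "(\<lambda>n. f (int (Suc n)) + f (- int (Suc n))) sums (infsum f UNIV - f 0)"
    using sums_add[OF A' B] by (simp only:)
qed

lemma int_infsum_shift:
  fixes f :: "int \<Rightarrow> 'a::{comm_monoid_add,t2_space}"
  shows "(\<Sum>\<^sub>\<infinity>n. f (n + k)) = infsum f UNIV"
  by (rule infsum_reindex_bij_betw[where g = "\<lambda>n. n + k"])
     (auto intro!: bij_betwI[where g = "\<lambda>n. n - k"])

lemma int_summable_shift:
  fixes f :: "int \<Rightarrow> 'a::{comm_monoid_add,t2_space}"
  shows "(\<lambda>n. f (n + k)) summable_on UNIV \<longleftrightarrow> f summable_on UNIV"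
  by (rule summable_on_reindex_bij_betw[where g = "\<lambda>n. n + k"])
     (auto intro!: bij_betwI[where g = "\<lambda>n. n - k"])

lemma int_infsum_minus:
  fixes f :: "int \<Rightarrow> 'a::{comm_monoid_add,t2_space}"
  shows "(\<Sum>\<^sub>\<infinity>n. f (- n)) = infsum f UNIV"
  by (rule infsum_reindex_bij_betw[where g = "\<lambda>n. - n"])
     (auto intro!: bij_betwI[where g = "\<lambda>n. - n"])

lemma int_summable_minus:
  fixes f :: "int \<Rightarrow> 'a::{comm_monoid_add,t2_space}"
  shows "(\<lambda>n. f (- n)) summable_on UNIV \<longleftrightarrow> f summable_on UNIV"
  by (rule summable_on_reindex_bij_betw[where g = "\<lambda>n. - n"])
     (auto intro!: bij_betwI[where g = "\<lambda>n. - n"])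

text \<open>A product of two absolutely convergent bilateral sums is collected by the difference k
  of the indices. Every product formula below evaluates the inner sum over n in closed form.\<close>

lemma infsum_diagonal:
  fixes f g :: "int \<Rightarrow> real"
  assumes f: "f summable_on UNIV" and g: "g summable_on UNIV"
  shows "((\<lambda>k. \<Sum>\<^sub>\<infinity>n. f (n + k) * g n) has_sum infsum f UNIV * infsum g UNIV) UNIV"
proof -
  have "(\<lambda>n. norm (f n)) summable_on UNIV" "(\<lambda>n. norm (g n)) summable_on UNIV"
    using f g summable_on_iff_abs_summable_on_real by blast+
  then have "(\<lambda>x. norm ((\<lambda>(m, n). f m * g n) x)) summable_on UNIV \<times> UNIV"
    by (subst Infinite_Sum.abs_summable_on_Sigma_iff) (auto simp: abs_mult infsum_cmult_right' intro!: summable_on_cmult_right summable_on_cmult_left)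
  then have s: "(\<lambda>(m, n). f m * g n) summable_on UNIV \<times> UNIV"
    by (rule abs_summable_summable)
  have "((\<lambda>m. f m * infsum g UNIV) has_sum infsum f UNIV * infsum g UNIV) UNIV"
    using f by (intro has_sum_cmult_left) auto
  then have "((\<lambda>(m, n). f m * g n) has_sum infsum f UNIV * infsum g UNIV) (UNIV \<times> UNIV)"
    by (intro has_sum_SigmaI[OF _ _ s]) (auto intro!: has_sum_cmult_right has_sum_infsum[OF g])
  \<comment> \<open>The shear of the integer lattice that turns the index pair into (difference,
    second index).\<close>
  moreover have "bij_betw (\<lambda>(k, n). (n + k, n)) (UNIV \<times> UNIV) (UNIV \<times> (UNIV :: int set))"
    by (rule bij_betwI[where g = "\<lambda>(m, n). (m - n, n)"]) auto
  ultimately have h: "((\<lambda>(k, n). f (n + k) * g n) has_sum infsum f UNIV * infsum g UNIV) (UNIV \<times> UNIV)"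
    by (subst (asm) has_sum_reindex_bij_betw[symmetric]) (auto simp: case_prod_unfold)
  then have "(\<lambda>n. f (n + k) * g n) summable_on UNIV" for k
    using summable_on_SigmaD1[where f = "\<lambda>k n. f (n + k) * g n" and A = UNIV and B = "\<lambda>_. UNIV" and x = k]
    by (auto dest: has_sum_imp_summable)
  then show ?thesis
    by (intro has_sum_SigmaD[OF h]) auto
qed

text \<open>The sequence \<open>a\<close> has two different limits and is not summable itself. Each
  unit step contributes \<open>A - B\<close>, so a shift by k contributes k times that, for either
  sign of k.\<close>

lemma infsum_telescope_int:
  fixes a :: "int \<Rightarrow> real"
  assumes s: "(\<lambda>n. a (n + 1) - a n) summable_on UNIV"
    and l: "(\<lambda>n. a (int n)) \<longlonglongrightarrow> A" "(\<lambda>n. a (- int n)) \<longlonglongrightarrow> B"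
  shows "((\<lambda>n. a (n + k) - a n) has_sum of_int k * (A - B)) UNIV"
proof -
  let ?f = "\<lambda>n. a (n + 1) - a n"
  have "(\<Sum>i<n. ?f (int (Suc i)) + ?f (- int (Suc i))) = a (int (Suc n)) - a (- int n) - ?f 0" for n
    by (induction n) (auto simp: algebra_simps)
  moreover have "(\<lambda>n. a (int (Suc n)) - a (- int n) - ?f 0) \<longlonglongrightarrow> A - B - ?f 0"
    using l by (intro tendsto_intros LIMSEQ_Suc[where f = "\<lambda>n. a (int n)"])
  ultimately have "(\<lambda>n. ?f (int (Suc n)) + ?f (- int (Suc n))) sums (A - B - ?f 0)"
    by (simp add: sums_def)
  with int_infsum_sums[OF s] have "infsum ?f UNIV = A - B"
    using sums_unique2 by fastforce
  with s have 1: "(?f has_sum A - B) UNIV"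
    by (metis has_sum_infsum)
  have step: "((\<lambda>n. a (n + i + 1) - a (n + i)) has_sum A - B) UNIV" for i
    by (rule has_sum_reindex_bij_betw[where g = "\<lambda>n. n + i" and f = ?f, THEN iffD2, OF _ 1])
       (auto intro!: bij_betwI[where g = "\<lambda>n. n - i"])
  show ?thesis
  proof (induction k rule: int_induct[where k = 0])
    case base
    show ?case by simp
  next
    case (step1 i)
    from has_sum_add[OF step1(2) step[of i]] show ?case
      by (simp add: algebra_simps)
  next
    case (step2 i)
    from has_sum_add[OF step2(2) has_sum_cmult_right[OF step[of "i - 1"], of "-1"]] show ?case
      by (simp add: algebra_simps)
  qed
qed

subsection \<open>Products of the bilateral series\<close>

text \<open>At \<open>x = exp t\<close> this is 1 / (4 cosh(t/2)^2), an even function of t. Its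
  periodisation over the powers of p is wp on the line through pi, up to a constant.\<close>

definition lor :: "real \<Rightarrow> real" where
  "lor x = x / (1 + x)\<^sup>2"

lemma lor_nonneg: "x \<ge> 0 \<Longrightarrow> lor x \<ge> 0"
  by (simp add: lor_def)

lemma lor_pos: "x > 0 \<Longrightarrow> lor x > 0"
  by (simp add: lor_def)

lemma lor_le: "x \<ge> 0 \<Longrightarrow> lor x \<le> x"
proof -
  assume x: "x \<ge> 0"
  then have "x / (1 + x)\<^sup>2 \<le> x / 1"
    by (intro divide_left_mono) auto
  then show ?thesis by (simp add: lor_def)
qed

lemma lor_inverse: "x > 0 \<Longrightarrow> lor (1 / x) = lor x"
  by (simp add: lor_def power2_eq_square field_simps)

lemma lor_le_inverse: "x > 0 \<Longrightarrow> lor x \<le> 1 / x"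
  using lor_le[of "1 / x"] by (simp add: lor_inverse)

text \<open>Only p = q^2 enters the bilateral series. Keeping q out of this context lets its results
  be used at the nome q and at the nome q^2 alike.\<close>

locale nome_square =
  fixes p :: real
  assumes p_pos: "0 < p" and p_less_1: "p < 1"
begin

lemma powi_pos [simp]: "p powi n > 0"
  using p_pos by simp

lemma powi_nonneg [simp]: "p powi n \<ge> 0"
  using powi_pos[of n] by linarith

lemma p_nz [simp]: "p \<noteq> 0"
  using p_pos by simp

lemma powi_add: "p powi (m + n) = p powi m * p powi n"
  by (simp add: power_int_add)

lemma one_plus_nz: "s > 0 \<Longrightarrow> 1 + s * p powi n \<noteq> 0"
  using powi_pos[of n] by (smt (verit) mult_pos_pos)

lemma one_plus_pos: "s > 0 \<Longrightarrow> 1 + s * p powi n > 0"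
  using powi_pos[of n] by (smt (verit) mult_pos_pos)

definition Q :: "real \<Rightarrow> real" where
  "Q s = (\<Sum>\<^sub>\<infinity>n::int. lor (s * p powi n))"

definition Q2 :: "real \<Rightarrow> real" where
  "Q2 s = (\<Sum>\<^sub>\<infinity>n::int. (lor (s * p powi n))\<^sup>2)"

text \<open>For \<open>p = q\<^sup>2\<close> and \<open>u = z * cnj w\<close> this is the weighted Szego kernel \<open>S(z, w; s)\<close> of the annulus.\<close>

definition S :: "real \<Rightarrow> real \<Rightarrow> real" where
  "S u s = (\<Sum>\<^sub>\<infinity>n::int. u powi n / (1 + s * p powi n))"

lemma lor_bound:
  assumes "s > 0"
  shows "lor (s * p powi n) \<le> (s + 1 / s) * p ^ nat \<bar>n\<bar>"
proof (cases "n \<ge> 0")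
  case True
  have "lor (s * p powi n) \<le> s * p powi n"
    using assms by (intro lor_le) auto
  also have "\<dots> \<le> (s + 1 / s) * p powi n"
    using assms by (intro mult_right_mono) auto
  finally show ?thesis
    using True by (simp add: power_int_def)
next
  case False
  have "lor (s * p powi n) \<le> 1 / (s * p powi n)"
    using assms by (intro lor_le_inverse) auto
  also have "\<dots> = 1 / s * p ^ nat \<bar>n\<bar>"
    using False by (simp add: power_int_def power_inverse field_simps)
  also have "\<dots> \<le> (s + 1 / s) * p ^ nat \<bar>n\<bar>"
    using assms p_pos by (intro mult_right_mono) auto
  finally show ?thesis .
qed

lemma summable_Q: "s > 0 \<Longrightarrow> (\<lambda>n::int. lor (s * p powi n)) summable_on UNIV"
  using lor_bound[of s] p_pos p_less_1
  by (intro int_summable_bound[where C = "s + 1 / s" and r = p]) (auto simp: abs_of_nonneg lor_nonneg)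

lemma lor_sq_le: "x \<ge> 0 \<Longrightarrow> (lor x)\<^sup>2 \<le> lor x"
proof -
  assume x: "x \<ge> 0"
  have "x * 1 \<le> (1 + x)\<^sup>2" using x by (simp add: power2_eq_square algebra_simps)
  then have "lor x \<le> 1" using x by (simp add: lor_def divide_le_eq_1)
  then show ?thesis
    using lor_nonneg[OF x] by (simp add: power2_eq_square mult_left_le)
qed

lemma summable_Q2: "s > 0 \<Longrightarrow> (\<lambda>n::int. (lor (s * p powi n))\<^sup>2) summable_on UNIV"
  by (rule summable_on_comparison_test[OF summable_Q]) (auto intro!: lor_sq_le)

lemma Q_inverse: "s > 0 \<Longrightarrow> Q (1 / s) = Q s"
proof -
  assume s: "s > 0"
  have "lor (1 / s * p powi n) = lor (s * p powi (- n))" for n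
    using lor_inverse[of "s * p powi (- n)"] s by (simp add: power_int_minus field_simps)
  then show ?thesis
    unfolding Q_def using int_infsum_minus[of "\<lambda>n. lor (s * p powi n)"] by simp
qed

lemma Q_shift: "Q (p powi k * s) = Q s"
proof -
  have "lor (p powi k * s * p powi n) = lor (s * p powi (n + k))" for n
    by (simp add: powi_add mult_ac)
  then show ?thesis
    unfolding Q_def using int_infsum_shift[of "\<lambda>n. lor (s * p powi n)" k] by simp
qed

lemma summable_S:
  assumes "p < \<bar>u\<bar>" "\<bar>u\<bar> < 1" "s > 0"
  shows "(\<lambda>n::int. u powi n / (1 + s * p powi n)) summable_on UNIV"
proof (rule int_summable_bound)
  \<comment> \<open>For n >= 0 the terms decay like u^n. For n < 0 the denominator is about s p^n,
    which leaves (p / u)^|n| / s. The larger of the two ratios governs both halves.\<close>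
  let ?r = "max \<bar>u\<bar> (p / \<bar>u\<bar>)"
  have u: "u \<noteq> 0" using assms p_pos by auto
  show "0 \<le> ?r" "?r < 1" using assms p_pos u by (auto simp: max_def)
  fix n :: int
  have pos: "1 + s * p powi n > 0" using assms by (intro one_plus_pos)
  have abs: "norm (u powi n / (1 + s * p powi n)) = \<bar>u\<bar> powi n / (1 + s * p powi n)"
    using pos by (simp add: power_int_abs)
  show "norm (u powi n / (1 + s * p powi n)) \<le> (1 + 1 / s) * ?r ^ nat \<bar>n\<bar>"
  proof (cases "n \<ge> 0")
    case True
    have "norm (u powi n / (1 + s * p powi n)) \<le> \<bar>u\<bar> powi n / 1"
      unfolding abs using assms pos by (intro divide_left_mono) auto
    also have "\<dots> \<le> 1 * ?r ^ nat \<bar>n\<bar>"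
      using True by (auto simp: power_int_def intro: power_mono)
    also have "\<dots> \<le> (1 + 1 / s) * ?r ^ nat \<bar>n\<bar>"
      using assms by (intro mult_right_mono) auto
    finally show ?thesis .
  next
    case False
    have "norm (u powi n / (1 + s * p powi n)) \<le> \<bar>u\<bar> powi n / (s * p powi n)"
      unfolding abs using assms pos by (intro divide_left_mono) auto
    also have "\<dots> = 1 / s * (p / \<bar>u\<bar>) ^ nat \<bar>n\<bar>"
      using False u by (simp add: power_int_def power_inverse power_divide field_simps)
    also have "\<dots> \<le> 1 / s * ?r ^ nat \<bar>n\<bar>"
      using assms p_pos by (intro mult_left_mono power_mono) auto
    also have "\<dots> \<le> (1 + 1 / s) * ?r ^ nat \<bar>n\<bar>"
      using assms by (intro mult_right_mono) auto
    finally show ?thesis .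
  qed
qed

text \<open>Reversing the summation gives the series for 1 / s the same denominators as the series
  for s. Products of the two can then be split into partial fractions in n.\<close>

lemma S_inverse: "s > 0 \<Longrightarrow> S u (1 / s) = (\<Sum>\<^sub>\<infinity>n::int. u powi (- n) * (s * p powi n / (1 + s * p powi n)))"
proof -
  assume s: "s > 0"
  have "u powi (- n) / (1 + 1 / s * p powi (- n)) = u powi (- n) * (s * p powi n / (1 + s * p powi n))" for n
  proof -
    have "1 + 1 / s * p powi (- n) = (1 + s * p powi n) / (s * p powi n)"
      using s by (simp add: power_int_minus field_simps)
    then show ?thesis by simp
  qed
  then show ?thesis
    unfolding S_def using int_infsum_minus[of "\<lambda>n. u powi n / (1 + 1 / s * p powi n)"] by simp
qed

lemma summable_S_inverse:
  assumes "p < \<bar>u\<bar>" "\<bar>u\<bar> < 1" "s > 0"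
  shows "(\<lambda>n::int. u powi (- n) * (s * p powi n / (1 + s * p powi n))) summable_on UNIV"
proof -
  have eq: "u powi (- n) / (1 + 1 / s * p powi (- n)) = u powi (- n) * (s * p powi n / (1 + s * p powi n))" for n
  proof -
    have "1 + 1 / s * p powi (- n) = (1 + s * p powi n) / (s * p powi n)"
      using assms by (simp add: power_int_minus field_simps)
    then show ?thesis by simp
  qed
  have "(\<lambda>n::int. u powi (- n) / (1 + 1 / s * p powi (- n))) summable_on UNIV"
    using int_summable_minus[of "\<lambda>n. u powi n / (1 + 1 / s * p powi n)"] summable_S[of u "1 / s"] assms by simp
  then show ?thesis unfolding eq .
qed

text \<open>At a fixed point of u -> p / u, that is u = q or u = - q for p = q^2, this turns the
  product of \<open>S u s\<close> and its partner into \<open>s * (S u s)\<^sup>2\<close>.\<close>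

lemma S_swap: "s > 0 \<Longrightarrow> u \<noteq> 0 \<Longrightarrow> s * S (p / u) s = S u (1 / s)"
proof -
  assume s: "s > 0" and u: "u \<noteq> 0"
  have "s * ((p / u) powi n / (1 + s * p powi n)) = u powi (- n) * (s * p powi n / (1 + s * p powi n))" for n
    using u by (simp add: power_int_divide_distrib power_int_minus field_simps)
  then show ?thesis
    unfolding S_inverse[OF s] unfolding S_def infsum_cmult_right'[symmetric] by (intro infsum_cong) simp
qed

lemma S_shift: "u \<noteq> 0 \<Longrightarrow> S u (p * s) = S u s / u"
proof -
  assume u: "u \<noteq> 0"
  have "u powi n / (1 + p * s * p powi n) = u powi (n + 1) / (1 + s * p powi (n + 1)) / u" for n
    using u by (simp add: powi_add power_int_add mult_ac)
  then have "S u (p * s) = (\<Sum>\<^sub>\<infinity>n. (u powi (n + 1) / (1 + s * p powi (n + 1))) * inverse u)"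
    unfolding S_def by (simp add: divide_inverse)
  also have "\<dots> = (\<Sum>\<^sub>\<infinity>n. (u powi (n + 1) / (1 + s * p powi (n + 1)))) * inverse u"
    by (rule infsum_cmult_left')
  also have "\<dots> = S u s / u"
    unfolding S_def using int_infsum_shift[of "\<lambda>n. u powi n / (1 + s * p powi n)" 1] by (simp add: divide_inverse)
  finally show ?thesis .
qed

section \<open>Telescoping sums and the product with parameters s and 1 / s\<close>

definition fermi :: "real \<Rightarrow> int \<Rightarrow> real" where
  "fermi s n = 1 / (1 + s * p powi n)"

text \<open>The factor \<open>t - s * p powi k\<close> is free of n. Hence a product of two
  denominators is, for fixed k, a constant multiple of a difference that telescopes in n.\<close>

lemma fermi_diff:
  assumes "s > 0" "t > 0"
  shows "fermi s (n + k) - fermi t n = p powi n * (t - s * p powi k) / ((1 + s * p powi (n + k)) * (1 + t * p powi n))"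
  using one_plus_nz[OF assms(1), of "n + k"] one_plus_nz[OF assms(2), of n]
  by (simp add: fermi_def powi_add field_simps)

lemma fermi_diff_summable:
  assumes "s > 0" "t > 0"
  shows "(\<lambda>n. fermi s n - fermi t n) summable_on UNIV"
proof (rule int_summable_bound)
  show "0 \<le> p" "p < 1" using p_pos p_less_1 by auto
  fix n :: int
  have b: "0 < fermi s n" "0 < fermi t n" "fermi s n \<le> 1 / (s * p powi n)" "fermi t n \<le> 1 / (t * p powi n)"
    using assms one_plus_pos by (auto simp: fermi_def intro!: divide_left_mono mult_pos_pos)
  show "norm (fermi s n - fermi t n) \<le> (s + t + 1 / s + 1 / t) * p ^ nat \<bar>n\<bar>"
  proof (cases "n \<ge> 0")
    case True
    have "norm (fermi s n - fermi t n) = p powi n * \<bar>t - s\<bar> / ((1 + s * p powi n) * (1 + t * p powi n))"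
      using fermi_diff[OF assms, of n 0] one_plus_pos[OF assms(1), of n] one_plus_pos[OF assms(2), of n]
      by (simp add: abs_mult)
    also have "\<dots> \<le> p powi n * \<bar>t - s\<bar> / (1 * 1)"
      using assms by (intro divide_left_mono mult_mono) (auto intro!: mult_pos_pos one_plus_pos add_nonneg_nonneg)
    also have "\<dots> \<le> p powi n * (s + t + 1 / s + 1 / t)"
    proof -
      have "1 / s > 0" "1 / t > 0" using assms by auto
      then have "\<bar>t - s\<bar> \<le> s + t + 1 / s + 1 / t" using assms by linarith
      then show ?thesis by (simp add: mult_left_mono)
    qed
    finally show ?thesis using True by (simp add: power_int_def mult.commute)
  next
    case False
    have "norm (fermi s n - fermi t n) \<le> 1 / (s * p powi n) + 1 / (t * p powi n)"
      using b by (simp add: abs_le_iff)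
    also have "\<dots> = (1 / s + 1 / t) * p ^ nat \<bar>n\<bar>"
      using False by (simp add: power_int_def power_inverse field_simps)
    also have "\<dots> \<le> (s + t + 1 / s + 1 / t) * p ^ nat \<bar>n\<bar>"
      using assms p_pos by (intro mult_right_mono) auto
    finally show ?thesis .
  qed
qed

definition W :: "real \<Rightarrow> real \<Rightarrow> real" where
  "W s t = (\<Sum>\<^sub>\<infinity>n. fermi s n - fermi t n)"

lemma fermi_telescope_same:
  assumes s: "s > 0"
  shows "((\<lambda>n. fermi s (n + k) - fermi s n) has_sum of_int k) UNIV"
proof -
  have eq: "fermi s (n + 1) = fermi (s * p) n" for n
    by (simp add: fermi_def powi_add mult_ac)
  have sm: "(\<lambda>n. fermi s (n + 1) - fermi s n) summable_on UNIV"
    unfolding eq using s p_pos by (intro fermi_diff_summable) auto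
  have l1: "(\<lambda>n. fermi s (int n)) \<longlonglongrightarrow> 1"
  proof -
    have "(\<lambda>n. 1 / (1 + s * p ^ n)) \<longlonglongrightarrow> 1 / (1 + s * 0)"
      using p_pos p_less_1 by (intro tendsto_intros LIMSEQ_power_zero) auto
    then show ?thesis by (simp add: fermi_def)
  qed
  have l2: "(\<lambda>n. fermi s (- int n)) \<longlonglongrightarrow> 0"
  proof -
    have "(\<lambda>n. p ^ n / (p ^ n + s)) \<longlonglongrightarrow> 0 / (0 + s)"
      using p_pos p_less_1 s by (intro tendsto_intros LIMSEQ_power_zero) auto
    moreover have "fermi s (- int n) = p ^ n / (p ^ n + s)" for n
      using p_pos s by (simp add: fermi_def power_int_minus field_simps)
    ultimately show ?thesis by simp
  qed
  show ?thesis
    using infsum_telescope_int[OF sm l1 l2, of k] by simp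
qed

text \<open>Two different parameters add an offset \<open>W s t\<close> that does not depend on k.
  It disappears later because it multiplies a kernel in k whose sum is zero.\<close>

lemma fermi_telescope:
  assumes "s > 0" "t > 0"
  shows "((\<lambda>n. fermi s (n + k) - fermi t n) has_sum (of_int k + W s t)) UNIV"
  using has_sum_add[OF fermi_telescope_same[OF assms(1), of k] has_sum_infsum[OF fermi_diff_summable[OF assms]]]
  by (simp add: W_def)

text \<open>At k = 0 numerator and denominator both vanish, and the convention x / 0 = 0 removes the
  term.\<close>

definition V :: "real \<Rightarrow> real" where
  "V u = (\<Sum>\<^sub>\<infinity>k::int. of_int k * u powi k / (1 - p powi k))"

lemma powi_less_1: "k > 0 \<Longrightarrow> p powi k < 1"
proof -
  assume "k > 0"
  then obtain m where k: "k = int (Suc m)"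
    by (metis zero_less_imp_eq_int gr0_conv_Suc)
  have "p ^ Suc m < 1"
    using p_pos p_less_1 by (intro power_Suc_less_one)
  then show ?thesis by (simp add: k power_int_def nat_add_distrib)
qed

lemma powi_neq_1: "k \<noteq> 0 \<Longrightarrow> p powi k \<noteq> 1"
proof (cases "k > 0")
  case True
  then show ?thesis using powi_less_1[of k] by simp
next
  case False
  assume "k \<noteq> 0"
  with False have "p powi (- k) < 1" by (intro powi_less_1) auto
  then show ?thesis by (auto simp: power_int_minus)
qed

text \<open>In the product collected by k, the inner sum telescopes to
  \<open>k * u powi k / (1 - p powi k)\<close> for k nonzero. The diagonal k = 0 is the only part
  that depends on s, and it is exactly \<open>Q s\<close>.\<close>

lemma S_product_has_sum:
  assumes u: "p < \<bar>u\<bar>" "\<bar>u\<bar> < 1" and s: "s > 0"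
  shows "((\<lambda>k. of_int k * u powi k / (1 - p powi k)) has_sum (S u s * S u (1 / s) - Q s)) UNIV"
proof -
  have u0: "u \<noteq> 0" using u p_pos by auto
  let ?f = "\<lambda>n. u powi n / (1 + s * p powi n)"
  let ?g = "\<lambda>n. u powi (- n) * (s * p powi n / (1 + s * p powi n))"
  have H: "((\<lambda>k. \<Sum>\<^sub>\<infinity>n. ?f (n + k) * ?g n) has_sum S u s * S u (1 / s)) UNIV"
    using infsum_diagonal[OF summable_S[OF u s] summable_S_inverse[OF u s]]
    unfolding S_inverse[OF s] unfolding S_def .
  have "(\<Sum>\<^sub>\<infinity>n. ?f (n + k) * ?g n) = of_int k * u powi k / (1 - p powi k) + (if k = 0 then Q s else 0)" for k
  proof (cases "k = 0")
    case True
    have "?f n * ?g n = lor (s * p powi n)" for n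
      using u0 one_plus_nz[OF s, of n] by (simp add: lor_def power_int_minus power2_eq_square)
    with True show ?thesis by (simp add: Q_def)
  next
    case False
    have "?f (n + k) * ?g n = u powi k / (1 - p powi k) * (fermi s (n + k) - fermi s n)" for n
    proof -
      have "?f (n + k) * ?g n = u powi k * (s * p powi n / ((1 + s * p powi (n + k)) * (1 + s * p powi n)))"
        using u0 by (simp add: power_int_add power_int_minus)
      also have "\<dots> = u powi k / (1 - p powi k) * (fermi s (n + k) - fermi s n)"
      proof -
        have "s - s * p powi k = s * (1 - p powi k)" by (simp add: algebra_simps)
        then show ?thesis
          using powi_neq_1[OF False] unfolding fermi_diff[OF s s] by simp
      qed
      finally show ?thesis .
    qed
    then have "(\<Sum>\<^sub>\<infinity>n. ?f (n + k) * ?g n) = u powi k / (1 - p powi k) * (\<Sum>\<^sub>\<infinity>n. fermi s (n + k) - fermi s n)"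
      by (simp only: infsum_cmult_right')
    also have "(\<Sum>\<^sub>\<infinity>n. fermi s (n + k) - fermi s n) = of_int k"
      using fermi_telescope_same[OF s] by (rule infsumI)
    finally show ?thesis using False by (simp add: mult.commute)
  qed
  with H have H': "((\<lambda>k. of_int k * u powi k / (1 - p powi k) + (if k = 0 then Q s else 0)) has_sum S u s * S u (1 / s)) UNIV"
    by simp
  have "((\<lambda>k::int. if k = 0 then Q s else 0) has_sum Q s) UNIV"
    by (rule has_sum_finite_neutralI[of "{0}"]) auto
  then have "((\<lambda>k::int. - (if k = 0 then Q s else 0)) has_sum - Q s) UNIV"
    by (simp only: has_sum_uminus minus_minus)
  from has_sum_add[OF H' this] show ?thesis by simp
qed

lemma S_product:
  assumes "p < \<bar>u\<bar>" "\<bar>u\<bar> < 1" "s > 0"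
  shows "S u s * S u (1 / s) = V u + Q s"
  using infsumI[OF S_product_has_sum[OF assms]] by (simp add: V_def)

lemma summable_V:
  assumes "p < \<bar>u\<bar>" "\<bar>u\<bar> < 1"
  shows "(\<lambda>k. of_int k * u powi k / (1 - p powi k)) summable_on UNIV"
  using S_product_has_sum[OF assms, of 1] has_sum_imp_summable by force

end

subsection \<open>Lambert series\<close>

lemma suminf_swap:
  fixes h :: "nat \<Rightarrow> nat \<Rightarrow> real"
  assumes bound: "\<And>i j. \<bar>h i j\<bar> \<le> A i * B j"
    and A: "summable A" "\<And>i. A i \<ge> 0" and B: "summable B" "\<And>j. B j \<ge> 0"
  shows "summable (\<lambda>i. \<Sum>j. h i j)" "summable (\<lambda>j. \<Sum>i. h i j)"
    "(\<Sum>i. \<Sum>j. h i j) = (\<Sum>j. \<Sum>i. h i j)"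
proof -
  have sA: "A summable_on UNIV" and sB: "B summable_on UNIV"
    using A B by (simp_all add: summable_on_UNIV_nonneg_real_iff)
  have "(\<lambda>x. norm ((\<lambda>(i, j). A i * B j) x)) summable_on UNIV \<times> UNIV"
    using sA sB A(2) B(2)
    by (subst Infinite_Sum.abs_summable_on_Sigma_iff)
      (auto simp: abs_mult infsum_cmult_right' intro!: summable_on_cmult_right summable_on_cmult_left)
  then have "(\<lambda>x. norm ((\<lambda>(i, j). h i j) x)) summable_on UNIV \<times> UNIV"
    by (rule summable_on_comparison_test) (use bound in \<open>auto intro: order_trans[OF _ abs_ge_self]\<close>)
  then have s: "(\<lambda>(i, j). h i j) summable_on UNIV \<times> UNIV"
    by (rule abs_summable_summable)
  then have s': "(\<lambda>(j, i). h i j) summable_on UNIV \<times> UNIV"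
    by (subst (asm) summable_on_swap) simp
  have eq: "infsum f UNIV = suminf f" if "f summable_on UNIV" for f :: "nat \<Rightarrow> real"
    using that has_sum_imp_sums[OF has_sum_infsum] sums_unique by blast
  have r: "(\<lambda>j. h i j) summable_on UNIV" for i
    using summable_on_SigmaD1[where f = h and A = UNIV and B = "\<lambda>_. UNIV" and x = i] s by auto
  have c: "(\<lambda>i. h i j) summable_on UNIV" for j
    using summable_on_SigmaD1[where f = "\<lambda>j i. h i j" and A = UNIV and B = "\<lambda>_. UNIV" and x = j] s' by auto
  have R: "(\<lambda>i. \<Sum>j. h i j) summable_on UNIV"
    using summable_on_Sigma_banach[OF s] by (simp add: eq[OF r])
  have C: "(\<lambda>j. \<Sum>i. h i j) summable_on UNIV"
    using summable_on_Sigma_banach[OF s'] by (simp add: eq[OF c])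
  show "summable (\<lambda>i. \<Sum>j. h i j)" "summable (\<lambda>j. \<Sum>i. h i j)"
    using R C by (auto intro: summable_on_imp_summable)
  show "(\<Sum>i. \<Sum>j. h i j) = (\<Sum>j. \<Sum>i. h i j)"
    using infsum_swap_banach[OF s] by (simp add: eq[OF r] eq[OF c] eq[OF R] eq[OF C])
qed

lemma arith_geometric_sums:
  fixes y :: real
  assumes "\<bar>y\<bar> < 1"
  shows "(\<lambda>n. real (Suc n) * y ^ Suc n) sums (y / (1 - y)\<^sup>2)"
proof -
  have "(\<lambda>n. of_nat (Suc n) * y ^ n) sums (1 / (1 - y)\<^sup>2)"
    using assms by (intro geometric_deriv_sums) auto
  from sums_mult[OF this, of y] show ?thesis
    by (simp add: mult_ac)
qed

text \<open>Termwise differentiation of the series for 1 / (1 - z)^2, combined with (n+1)^2 =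
  (n+1)(n+2) - (n+1).\<close>

lemma square_geometric_sums:
  fixes y :: real
  assumes "\<bar>y\<bar> < 1"
  shows "(\<lambda>n. (real (Suc n))\<^sup>2 * y ^ Suc n) sums (y * (1 + y) / (1 - y) ^ 3)"
proof -
  have d: "diffs (\<lambda>n. of_nat (Suc n)) = (\<lambda>n. of_nat (Suc n) * of_nat (Suc (Suc n)) :: real)"
    by (simp add: diffs_def fun_eq_iff)
  have "(\<lambda>n. diffs (\<lambda>n. of_nat (Suc n)) n * y ^ n) sums (2 / (1 - y) ^ 3)"
  proof (rule termdiffs_sums_strong[where K = 1 and f = "\<lambda>z. 1 / (1 - z)\<^sup>2"])
    show "(\<lambda>n. of_nat (Suc n) * z ^ n) sums (1 / (1 - z)\<^sup>2)" if "norm z < 1" for z :: real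
      using that by (intro geometric_deriv_sums) auto
    show "((\<lambda>z. 1 / (1 - z)\<^sup>2) has_field_derivative 2 / (1 - y) ^ 3) (at y)"
      using assms by (auto intro!: derivative_eq_intros simp: power2_eq_square power3_eq_cube divide_simps)
    show "norm y < 1" using assms by simp
  qed
  then have "(\<lambda>n. (real (Suc n) * real (Suc (Suc n))) * y ^ n) sums (2 / (1 - y) ^ 3)"
    unfolding d .
  moreover have "(\<lambda>n. real (Suc n) * y ^ n) sums (1 / (1 - y)\<^sup>2)"
    using assms by (intro geometric_deriv_sums) auto
  ultimately have "(\<lambda>n. y * ((real (Suc n) * real (Suc (Suc n))) * y ^ n - real (Suc n) * y ^ n))
      sums (y * (2 / (1 - y) ^ 3 - 1 / (1 - y)\<^sup>2))"
    by (intro sums_mult sums_diff)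
  moreover have "y * ((real (Suc n) * real (Suc (Suc n))) * y ^ n - real (Suc n) * y ^ n) =
      (real (Suc n))\<^sup>2 * y ^ Suc n" for n
    by (simp add: power2_eq_square algebra_simps)
  moreover have "y * (2 / (1 - y) ^ 3 - 1 / (1 - y)\<^sup>2) = y * (1 + y) / (1 - y) ^ 3"
    using assms by (simp add: power2_eq_square power3_eq_cube divide_simps)
  ultimately show ?thesis by (simp only:)
qed

text \<open>The counterpart of \<open>lor\<close> with a double pole at 1. Division by zero makes
  \<open>lorm 1 = 0\<close>, so bilateral sums over powers of p silently omit the pole.\<close>

definition lorm :: "real \<Rightarrow> real" where
  "lorm x = x / (1 - x)\<^sup>2"

lemma lorm_uminus: "lorm (- x) = - lor x"
  by (simp add: lorm_def lor_def)

lemma lorm_inverse: "x \<noteq> 0 \<Longrightarrow> lorm (1 / x) = lorm x"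
  by (cases "x = 1") (simp_all add: lorm_def power2_eq_square field_simps)

lemma lorm_bound: "\<bar>x\<bar> \<le> c \<Longrightarrow> c < 1 \<Longrightarrow> \<bar>lorm x\<bar> \<le> \<bar>x\<bar> / (1 - c)\<^sup>2"
proof -
  assume "\<bar>x\<bar> \<le> c" "c < 1"
  then have "(1 - c)\<^sup>2 \<le> (1 - x)\<^sup>2" "(1 - c)\<^sup>2 > 0" by (auto intro!: power_mono)
  then have "\<bar>x\<bar> / (1 - x)\<^sup>2 \<le> \<bar>x\<bar> / (1 - c)\<^sup>2"
    by (intro divide_left_mono mult_pos_pos) auto
  then show ?thesis by (simp add: lorm_def)
qed

lemma power_int_minus_of_nat: "x powi (- int n) = (1 / x) ^ n" for x :: "'a::field"
  by (simp add: power_int_minus power_one_over inverse_eq_divide)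

context nome_square
begin

lemma pow_less_1: "p ^ Suc n < 1"
  using p_pos p_less_1 by (intro power_Suc_less_one)

lemma pow_le_p: "p ^ Suc n \<le> p"
  using p_pos p_less_1 by (simp add: mult_left_le power_le_one)

lemma summable_pow: "0 \<le> x \<Longrightarrow> x < 1 \<Longrightarrow> summable (\<lambda>n. x ^ n :: real)"
  by (simp add: summable_geometric)

text \<open>Both sides are iterated sums of n x^n p^(n i), taken in opposite orders: a geometric
  series in i on one side, the series of n y^n on the other.\<close>

lemma lambert:
  assumes "\<bar>x\<bar> * p < 1"
  shows "(\<lambda>n. real (Suc n) * x ^ Suc n * p ^ Suc n / (1 - p ^ Suc n)) sums (\<Sum>n. lorm (x * p ^ Suc n))"
    "summable (\<lambda>n. lorm (x * p ^ Suc n))"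
proof -
  define h where "h = (\<lambda>n i. real (Suc n) * (x * p ^ Suc i) ^ Suc n)"
  have bound: "\<bar>h n i\<bar> \<le> (real (Suc n) * (\<bar>x\<bar> * p) ^ Suc n) * p ^ i" for n i
  proof -
    have "\<bar>h n i\<bar> = real (Suc n) * (\<bar>x\<bar> * p) ^ Suc n * (p ^ i) ^ Suc n"
      using p_pos by (simp add: h_def abs_mult power_abs power_mult_distrib mult_ac)
    also have "(p ^ i) ^ Suc n \<le> p ^ i"
      using p_pos p_less_1 by (simp add: mult_left_le power_le_one)
    finally show ?thesis using p_pos by (simp add: mult_left_mono)
  qed
  have A: "summable (\<lambda>n. real (Suc n) * (\<bar>x\<bar> * p) ^ Suc n)"
    using arith_geometric_sums[of "\<bar>x\<bar> * p"] assms p_pos by (simp add: sums_iff)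
  have B: "summable (\<lambda>i. p ^ i)"
    using p_pos p_less_1 by (intro summable_pow) auto
  note sw = suminf_swap[OF bound A _ B]
  have xp: "\<bar>x * p ^ Suc i\<bar> < 1" for i
  proof -
    have "\<bar>x * p ^ Suc i\<bar> \<le> \<bar>x\<bar> * p"
      using p_pos pow_le_p[of i] by (simp add: abs_mult mult_left_mono)
    with assms show ?thesis by linarith
  qed
  have c: "(\<Sum>n. h n i) = lorm (x * p ^ Suc i)" for i
    using arith_geometric_sums[OF xp[of i]] by (simp add: h_def lorm_def sums_iff)
  have r: "(\<Sum>i. h n i) = real (Suc n) * x ^ Suc n * p ^ Suc n / (1 - p ^ Suc n)" for n
  proof -
    have "(\<lambda>i. (p ^ Suc n) ^ i) sums (1 / (1 - p ^ Suc n))"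
      using pow_less_1[of n] p_pos by (intro geometric_sums) auto
    from sums_mult[OF this, of "real (Suc n) * x ^ Suc n * p ^ Suc n"]
    have "(\<lambda>i. h n i) sums (real (Suc n) * x ^ Suc n * p ^ Suc n / (1 - p ^ Suc n))"
      by (simp add: h_def power_mult_distrib power_mult[symmetric] mult_ac)
    then show ?thesis by (simp add: sums_iff)
  qed
  show "summable (\<lambda>n. lorm (x * p ^ Suc n))"
    using sw(2) p_pos unfolding c by simp
  show "(\<lambda>n. real (Suc n) * x ^ Suc n * p ^ Suc n / (1 - p ^ Suc n)) sums (\<Sum>n. lorm (x * p ^ Suc n))"
    using sw(1,3) p_pos unfolding c r by (simp add: sums_iff)
qed

text \<open>Writing 1 / (1 - p^k) = 1 + p^k / (1 - p^k) separates the sum of k u^k, which is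
  \<open>lorm u\<close>. This is the whole double pole of V at u = 1; the rest stays regular
  there.\<close>

lemma V_sums1:
  assumes u: "p < \<bar>u\<bar>" "\<bar>u\<bar> < 1"
  shows "(\<lambda>n. real (Suc n) * p ^ Suc n / (1 - p ^ Suc n) * (u ^ Suc n + (1 / u) ^ Suc n)) sums (V u - lorm u)"
proof -
  let ?f = "\<lambda>k::int. of_int k * u powi k / (1 - p powi k)"
  have "(\<lambda>n. ?f (int (Suc n)) + ?f (- int (Suc n))) sums V u"
    using int_infsum_sums[OF summable_V[OF u]] by (simp add: V_def)
  moreover have "?f (int (Suc n)) + ?f (- int (Suc n)) =
      real (Suc n) * u ^ Suc n + real (Suc n) * p ^ Suc n / (1 - p ^ Suc n) * (u ^ Suc n + (1 / u) ^ Suc n)" for n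
  proof -
    have p1: "1 - p ^ Suc n \<noteq> 0" "p ^ Suc n \<noteq> 0"
      using pow_less_1[of n] by auto
    have a: "?f (int (Suc n)) = real (Suc n) * u ^ Suc n / (1 - p ^ Suc n)"
      by (simp only: power_int_of_nat of_int_of_nat_eq)
    have "?f (- int (Suc n)) = - (real (Suc n) * (1 / u) ^ Suc n / (1 - 1 / p ^ Suc n))"
      by (simp only: power_int_minus_of_nat of_int_of_nat_eq of_int_minus power_one_over mult_minus_left minus_divide_left)
    also have "1 - 1 / p ^ Suc n = - (1 - p ^ Suc n) / p ^ Suc n"
      using p1 by (simp add: field_simps)
    also have "- (real (Suc n) * (1 / u) ^ Suc n / (- (1 - p ^ Suc n) / p ^ Suc n)) =
        real (Suc n) * p ^ Suc n / (1 - p ^ Suc n) * (1 / u) ^ Suc n"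
    proof -
      have "- (a / (- D / P)) = a * P / D" if "P \<noteq> 0" "D \<noteq> 0" for a D P :: real
        using that by (simp add: field_simps)
      from this[OF p1(2,1)] show ?thesis by (simp only: mult_ac times_divide_eq_left times_divide_eq_right)
    qed
    finally have b: "?f (- int (Suc n)) = real (Suc n) * p ^ Suc n / (1 - p ^ Suc n) * (1 / u) ^ Suc n" .
    have "real (Suc n) * u ^ Suc n / (1 - p ^ Suc n) =
        real (Suc n) * u ^ Suc n + real (Suc n) * p ^ Suc n / (1 - p ^ Suc n) * u ^ Suc n"
      using p1(1) by (simp add: field_simps)
    with a b show ?thesis by (simp only: distrib_left)
  qed
  ultimately have "(\<lambda>n. real (Suc n) * u ^ Suc n + real (Suc n) * p ^ Suc n / (1 - p ^ Suc n) * (u ^ Suc n + (1 / u) ^ Suc n)) sums V u"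
    by simp
  from sums_diff[OF this arith_geometric_sums[OF u(2)]] show ?thesis
    by (simp add: lorm_def)
qed

lemma V_sums2:
  assumes u: "p < \<bar>u\<bar>" "\<bar>u\<bar> < 1"
  shows "(\<lambda>n. lorm (u * p ^ Suc n) + lorm (p ^ Suc n / u)) sums (V u - lorm u)"
proof -
  have u0: "u \<noteq> 0" using u p_pos by auto
  have 1: "\<bar>u\<bar> * p < 1" using u p_pos p_less_1 mult_strict_mono[of "\<bar>u\<bar>" 1 p 1] by auto
  have 2: "\<bar>1 / u\<bar> * p < 1" using u p_pos u0 by (simp add: field_simps)
  from sums_add[OF lambert(1)[OF 1] lambert(1)[OF 2]]
  have "(\<lambda>n. real (Suc n) * p ^ Suc n / (1 - p ^ Suc n) * (u ^ Suc n + (1 / u) ^ Suc n)) sums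
     ((\<Sum>n. lorm (u * p ^ Suc n)) + (\<Sum>n. lorm (1 / u * p ^ Suc n)))"
    by (rule sums_cong[THEN iffD1, rotated]) (simp add: algebra_simps add_divide_distrib)
  with V_sums1[OF u] have "V u - lorm u = (\<Sum>n. lorm (u * p ^ Suc n)) + (\<Sum>n. lorm (1 / u * p ^ Suc n))"
    using sums_unique2 by blast
  also have "(\<lambda>n. lorm (u * p ^ Suc n) + lorm (1 / u * p ^ Suc n)) sums \<dots>"
    using lambert(2)[OF 1] lambert(2)[OF 2] by (intro sums_add summable_sums)
  finally show ?thesis by simp
qed

section \<open>The twisted product, whose two parameters differ by the factor u\<close>

lemma u_minus_powi_nz:
  assumes "p < u" "u < 1"
  shows "u - p powi k \<noteq> 0"
proof (cases "k > 0")
  case True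
  then obtain m where "k = int (Suc m)"
    by (metis zero_less_imp_eq_int gr0_conv_Suc)
  then have "p powi k \<le> p" using pow_le_p[of m] by (simp add: power_int_def nat_add_distrib)
  then show ?thesis using assms by auto
next
  case False
  have "p powi k \<ge> 1"
  proof (cases "k = 0")
    case False
    with \<open>\<not> k > 0\<close> have "p powi (- k) < 1" by (intro powi_less_1) auto
    then show ?thesis using powi_pos[of k] unfolding power_int_minus inverse_less_1_iff by linarith
  qed auto
  then show ?thesis using assms by auto
qed

text \<open>Closed forms of the two halves of the kernel. Splitting u^n off the first half leaves
  series that match those of the second half after an exchange of summations.\<close>

lemma kernel_bounds:
  assumes u: "p < u" "u < 1"
  shows "u powi (int (Suc n) + 1) / (u - p powi int (Suc n)) = u * (u ^ n + u ^ n * p ^ Suc n / (u - p ^ Suc n))"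
    "u powi (- int (Suc n) + 1) / (u - p powi (- int (Suc n))) = - u * ((p / u) ^ Suc n / (1 - u * p ^ Suc n))"
proof -
  have u0: "u \<noteq> 0" using u p_pos by auto
  have nz: "u - p ^ Suc n \<noteq> 0" using pow_le_p[of n] u by auto
  have "u * p ^ Suc n < 1 * 1"
    using u p_pos pow_less_1[of n] by (intro mult_strict_mono) auto
  then have nz2: "1 - u * p ^ Suc n \<noteq> 0" by auto
  have "u powi (int (Suc n) + 1) / (u - p powi int (Suc n)) = u * u * u ^ n / (u - p ^ Suc n)"
  proof -
    have "int (Suc n) + 1 = int (n + 2)" by simp
    then show ?thesis by (simp only: power_int_of_nat) (simp add: mult_ac)
  qed
  also have "\<dots> = u * (u ^ n + u ^ n * p ^ Suc n / (u - p ^ Suc n))"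
    using nz by (simp add: field_simps)
  finally show "u powi (int (Suc n) + 1) / (u - p powi int (Suc n)) = u * (u ^ n + u ^ n * p ^ Suc n / (u - p ^ Suc n))" .
  have "u powi (- int (Suc n) + 1) / (u - p powi (- int (Suc n))) = u * (1 / u ^ Suc n) / (u - 1 / p ^ Suc n)"
    using u0 by (simp only: power_int_add power_int_minus_of_nat power_int_1_right power_one_over mult.commute simp_thms)
  also have "u - 1 / p ^ Suc n = - (1 - u * p ^ Suc n) / p ^ Suc n"
    by (simp add: field_simps)
  also have "u * (1 / u ^ Suc n) / (- (1 - u * p ^ Suc n) / p ^ Suc n) = - u * ((p / u) ^ Suc n / (1 - u * p ^ Suc n))"
  proof -
    have "u * (1 / U) / (- D / P) = - u * ((P / U) / D)" if "P \<noteq> 0" "D \<noteq> 0" "U \<noteq> 0" for D P U :: real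
      using that by (simp add: field_simps)
    from this[of "p ^ Suc n" "1 - u * p ^ Suc n" "u ^ Suc n"] nz2 u0 show ?thesis
      by (simp add: power_divide)
  qed
  finally show "u powi (- int (Suc n) + 1) / (u - p powi (- int (Suc n))) = - u * ((p / u) ^ Suc n / (1 - u * p ^ Suc n))" .
qed

text \<open>Formally this is the Szego series at the parameter s = - 1 / u, where the numerator
  theta(- s u) = theta(1) vanishes. Directly: both halves expand into one double series with
  opposite signs, and the leftover geometric sum u / (1 - u) cancels the term k = 0.\<close>

lemma kernel_vanishing:
  assumes u: "p < u" "u < 1"
  shows "((\<lambda>k. u powi (k + 1) / (u - p powi k)) has_sum 0) UNIV"
proof -
  have u0: "u > 0" using u p_pos by auto
  let ?f = "\<lambda>k. u powi (k + 1) / (u - p powi k)"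
  \<comment> \<open>The common double series: its row sums give the positive half of the kernel, its
    column sums the negative half.\<close>
  define h where "h = (\<lambda>n i. u ^ n / u ^ Suc i * p ^ (Suc n * Suc i))"
  have bound: "\<bar>h n i\<bar> \<le> (u * p) ^ n * ((p / u) ^ Suc i)" for n i
  proof -
    have "\<bar>h n i\<bar> = u ^ n / u ^ Suc i * p ^ (Suc n * Suc i)"
      using u0 p_pos by (simp add: h_def abs_mult power_abs)
    also have "\<dots> \<le> u ^ n / u ^ Suc i * p ^ (n + Suc i)"
      using u0 p_pos p_less_1 by (intro mult_left_mono power_decreasing) auto
    also have "\<dots> = (u * p) ^ n * ((p / u) ^ Suc i)"
      by (simp add: power_mult_distrib power_divide power_add)
    finally show ?thesis .
  qed
  have A: "summable (\<lambda>n. (u * p) ^ n)"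
    using u u0 p_pos p_less_1 by (intro summable_pow) (auto intro!: mult_strict_mono[of u 1 p 1, simplified])
  have "summable (\<lambda>i. (p / u) ^ i)"
    using u u0 p_pos by (intro summable_pow) auto
  then have B: "summable (\<lambda>i. (p / u) ^ Suc i)"
    by (subst summable_Suc_iff)
  note sw = suminf_swap[OF bound A _ B]
  have r: "(\<lambda>i. h n i) sums (u ^ n * p ^ Suc n / (u - p ^ Suc n))" for n
  proof -
    have lt: "p ^ Suc n < u" using pow_le_p[of n] u by auto
    then have "(\<lambda>i. (p ^ Suc n / u) ^ i) sums (1 / (1 - p ^ Suc n / u))"
      using p_pos u0 by (intro geometric_sums) (auto simp: field_simps abs_mult)
    from sums_mult[OF this, of "u ^ n / u * p ^ Suc n"]
    have "(\<lambda>i. h n i) sums (u ^ n / u * p ^ Suc n * (1 / (1 - p ^ Suc n / u)))"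
      by (simp add: h_def power_divide power_add power_mult[symmetric] power_mult_distrib mult_ac)
    also have "u ^ n / u * p ^ Suc n * (1 / (1 - p ^ Suc n / u)) = u ^ n * p ^ Suc n / (u - p ^ Suc n)"
      using u0 lt by (simp add: field_simps)
    finally show ?thesis .
  qed
  have c: "(\<lambda>n. h n i) sums ((p / u) ^ Suc i / (1 - u * p ^ Suc i))" for i
  proof -
    have "u * p ^ Suc i < 1 * 1"
      using u u0 p_pos pow_less_1[of i] by (intro mult_strict_mono) auto
    then have "(\<lambda>n. (u * p ^ Suc i) ^ n) sums (1 / (1 - u * p ^ Suc i))"
      using p_pos u0 by (intro geometric_sums) (auto simp: abs_mult)
    from sums_mult[OF this, of "(p / u) ^ Suc i"]
    show ?thesis
      by (simp add: h_def power_divide power_add power_mult[symmetric] power_mult_distrib mult_ac)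
  qed
  have SA: "summable (\<lambda>n. u ^ n * p ^ Suc n / (u - p ^ Suc n))"
    using sw(1) u0 p_pos r by (simp add: sums_unique[OF r, symmetric] del: power_Suc)
  have SB: "summable (\<lambda>n. (p / u) ^ Suc n / (1 - u * p ^ Suc n))"
    using sw(2) u0 p_pos c by (simp add: sums_unique[OF c, symmetric] del: power_Suc)
  have eq: "(\<Sum>n. u ^ n * p ^ Suc n / (u - p ^ Suc n)) = (\<Sum>n. (p / u) ^ Suc n / (1 - u * p ^ Suc n))"
    using sw(3) u0 p_pos by (simp add: sums_unique[OF c, symmetric] sums_unique[OF r, symmetric] del: power_Suc)
  have G: "(\<lambda>n. u ^ n) sums (1 / (1 - u))"
    using u u0 by (intro geometric_sums) auto
  have F1: "(\<lambda>n. ?f (int (Suc n))) sums (u * (1 / (1 - u) + (\<Sum>n. u ^ n * p ^ Suc n / (u - p ^ Suc n))))"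
    unfolding kernel_bounds(1)[OF u] by (intro sums_mult sums_add G summable_sums SA)
  have F2: "(\<lambda>n. ?f (- int (Suc n))) sums (- u * (\<Sum>n. (p / u) ^ Suc n / (1 - u * p ^ Suc n)))"
    unfolding kernel_bounds(2)[OF u] by (intro sums_mult summable_sums SB)
  have pos1: "?f (int (Suc n)) \<ge> 0" for n
  proof -
    have "u - p ^ Suc n \<ge> 0" using pow_le_p[of n] u by linarith
    then show ?thesis
      using u0 p_pos unfolding kernel_bounds(1)[OF u]
      by (intro mult_nonneg_nonneg add_nonneg_nonneg divide_nonneg_nonneg) auto
  qed
  have pos2: "(p / u) ^ Suc n / (1 - u * p ^ Suc n) \<ge> 0" for n
  proof -
    have "u * p ^ Suc n < 1 * 1"
      using u u0 p_pos pow_less_1[of n] by (intro mult_strict_mono) auto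
    then show ?thesis using u0 p_pos by (intro divide_nonneg_nonneg) auto
  qed
  have sm: "?f summable_on UNIV"
  proof (rule summable_on_int_split)
    have "summable (\<lambda>n. norm (?f (int (Suc n))))"
    proof -
      have "norm (?f (int (Suc n))) = ?f (int (Suc n))" for n
        using pos1[of n] by (simp only: real_norm_def abs_of_nonneg)
      with F1 show ?thesis by (simp only: sums_iff)
    qed
    then have "summable (\<lambda>n. norm (?f (int n)))"
      using summable_Suc_iff[of "\<lambda>n. norm (?f (int n))"] by simp
    then show "(\<lambda>n. ?f (int n)) summable_on UNIV"
      by (rule norm_summable_imp_summable_on)
    have "summable (\<lambda>n. norm (- u * ((p / u) ^ Suc n / (1 - u * p ^ Suc n))))"
    proof -
      have "norm (- u * ((p / u) ^ Suc n / (1 - u * p ^ Suc n))) = u * ((p / u) ^ Suc n / (1 - u * p ^ Suc n))" for n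
        using pos2[of n] u0 by (simp only: real_norm_def abs_mult abs_minus abs_of_nonneg abs_of_pos)
      with summable_mult[OF SB, of u] show ?thesis by (simp only:)
    qed
    then have "summable (\<lambda>n. norm (?f (- int (Suc n))))"
      unfolding kernel_bounds(2)[OF u] .
    then show "(\<lambda>n. ?f (- int (Suc n))) summable_on UNIV"
      by (rule norm_summable_imp_summable_on)
  qed
  have "infsum ?f UNIV - ?f 0 = u / (1 - u)"
    using sums_unique2[OF int_infsum_sums[OF sm] sums_add[OF F1 F2]] unfolding eq by (simp add: algebra_simps)
  moreover have "?f 0 = - (u / (1 - u))"
    using u by (simp add: field_simps)
  ultimately have "infsum ?f UNIV = 0" by simp
  with sm show ?thesis using has_sum_infsum by metis
qed

text \<open>Through the theta quotient for the Szego kernel this is q_0^4 u / theta(u)^2, so it does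
  not depend on the parameter s.\<close>

definition V_twist :: "real \<Rightarrow> real" where
  "V_twist u = (\<Sum>\<^sub>\<infinity>k::int. of_int k * u powi (k + 1) / (u - p powi k))"

text \<open>With t = s u the partial fraction has the denominator u - p^k, which never vanishes, so
  k = 0 is no exception. Telescoping gives k + \<open>W s t\<close>, and the part with W is removed
  by \<open>kernel_vanishing\<close>.\<close>

lemma S_product2_has_sum:
  assumes u: "p < u" "u < 1" and s: "s > 0"
  shows "((\<lambda>k. of_int k * u powi (k + 1) / (u - p powi k)) has_sum (S u s * S u (1 / (s * u)))) UNIV"
proof -
  have u0: "u > 0" using u p_pos by auto
  have u': "p < \<bar>u\<bar>" "\<bar>u\<bar> < 1" using u u0 by auto
  define t where "t = s * u"
  have t: "t > 0" using s u0 by (simp add: t_def)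
  let ?f = "\<lambda>n. u powi n / (1 + s * p powi n)"
  let ?g = "\<lambda>n. u powi (- n) * (t * p powi n / (1 + t * p powi n))"
  have H: "((\<lambda>k. \<Sum>\<^sub>\<infinity>n. ?f (n + k) * ?g n) has_sum S u s * S u (1 / t)) UNIV"
    using infsum_diagonal[OF summable_S[OF u' s] summable_S_inverse[OF u' t]]
    unfolding S_inverse[OF t] unfolding S_def .
  have "(\<Sum>\<^sub>\<infinity>n. ?f (n + k) * ?g n) = of_int k * u powi (k + 1) / (u - p powi k) + u powi (k + 1) / (u - p powi k) * W s t" for k
  proof -
    have "?f (n + k) * ?g n = u powi (k + 1) / (u - p powi k) * (fermi s (n + k) - fermi t n)" for n
    proof -
      have "?f (n + k) * ?g n = u powi k * (s * u * p powi n / ((1 + s * p powi (n + k)) * (1 + t * p powi n)))"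
        using u0 by (simp add: power_int_add power_int_minus t_def)
      also have "\<dots> = u powi (k + 1) / (u - p powi k) * (fermi s (n + k) - fermi t n)"
      proof -
        have "t - s * p powi k = s * (u - p powi k)" by (simp add: algebra_simps t_def)
        then show ?thesis
          using u_minus_powi_nz[OF u, of k] u0 unfolding fermi_diff[OF s t] by (simp add: power_int_add)
      qed
      finally show ?thesis .
    qed
    then have "(\<Sum>\<^sub>\<infinity>n. ?f (n + k) * ?g n) = u powi (k + 1) / (u - p powi k) * (\<Sum>\<^sub>\<infinity>n. fermi s (n + k) - fermi t n)"
      by (simp only: infsum_cmult_right')
    also have "(\<Sum>\<^sub>\<infinity>n. fermi s (n + k) - fermi t n) = of_int k + W s t"
      using fermi_telescope[OF s t] by (rule infsumI)
    finally show ?thesis by (simp add: algebra_simps add_divide_distrib)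
  qed
  with H have H': "((\<lambda>k. of_int k * u powi (k + 1) / (u - p powi k) + u powi (k + 1) / (u - p powi k) * W s t)
     has_sum S u s * S u (1 / t)) UNIV"
    by simp
  from has_sum_add[OF H' has_sum_cmult_left[OF kernel_vanishing[OF u], of "- W s t"]] show ?thesis
    by (simp add: t_def)
qed

lemma S_product2:
  assumes "p < u" "u < 1" "s > 0"
  shows "S u s * S u (1 / (s * u)) = V_twist u"
  using infsumI[OF S_product2_has_sum[OF assms]] by (simp add: V_twist_def)

text \<open>The pole removed here is the same \<open>lorm u\<close> as for V. This is why V -
  V_twist can be compared term by term near u = 1.\<close>

lemma V_twist_sums:
  assumes u: "p < u" "u < 1"
  shows "(\<lambda>n. real (Suc n) * p ^ Suc n * (u ^ Suc n / (u - p ^ Suc n) + (1 / u) ^ n / (1 - u * p ^ Suc n))) sums (V_twist u - lorm u)"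
proof -
  have u0: "u > 0" using u p_pos by auto
  have u': "\<bar>u\<bar> < 1" using u u0 by auto
  let ?f = "\<lambda>k::int. of_int k * u powi (k + 1) / (u - p powi k)"
  have "?f summable_on UNIV"
    using S_product2_has_sum[OF u, of 1] has_sum_imp_summable by force
  from int_infsum_sums[OF this]
  have "(\<lambda>n. ?f (int (Suc n)) + ?f (- int (Suc n))) sums V_twist u"
    by (simp add: V_twist_def)
  moreover have "?f (int (Suc n)) + ?f (- int (Suc n)) = real (Suc n) * u ^ Suc n +
     real (Suc n) * p ^ Suc n * (u ^ Suc n / (u - p ^ Suc n) + (1 / u) ^ n / (1 - u * p ^ Suc n))" for n
  proof -
    have a: "?f (int (Suc n)) = real (Suc n) * (u * (u ^ n + u ^ n * p ^ Suc n / (u - p ^ Suc n)))"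
      unfolding kernel_bounds(1)[OF u, symmetric] by simp
    have b: "?f (- int (Suc n)) = - real (Suc n) * (- u * ((p / u) ^ Suc n / (1 - u * p ^ Suc n)))"
      unfolding kernel_bounds(2)[OF u, symmetric] by simp
    have "u * (p / u) ^ Suc n = p ^ Suc n * (1 / u) ^ n"
      using u0 by (simp add: power_divide)
    then have c: "u * ((p / u) ^ Suc n / (1 - u * p ^ Suc n)) = p ^ Suc n * ((1 / u) ^ n / (1 - u * p ^ Suc n))"
      by (metis times_divide_eq_right)
    have d: "u * (u ^ n * p ^ Suc n / (u - p ^ Suc n)) = p ^ Suc n * (u ^ Suc n / (u - p ^ Suc n))"
      by simp
    have "- real (Suc n) * (- u * ((p / u) ^ Suc n / (1 - u * p ^ Suc n))) =
        real (Suc n) * (u * ((p / u) ^ Suc n / (1 - u * p ^ Suc n)))"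
      by (simp only: mult_minus_left mult_minus_right minus_minus)
    then show ?thesis
      unfolding a b distrib_left d c by (simp add: mult.assoc)
  qed
  ultimately have "(\<lambda>n. real (Suc n) * u ^ Suc n + real (Suc n) * p ^ Suc n * (u ^ Suc n / (u - p ^ Suc n) + (1 / u) ^ n / (1 - u * p ^ Suc n))) sums V_twist u"
    by simp
  from sums_diff[OF this arith_geometric_sums[OF u']] show ?thesis
    by (simp add: lorm_def)
qed

end

subsection \<open>A quadratic relation\<close>

text \<open>Partial fractions in x for a product of two double poles. The double poles reproduce
  \<open>lor\<close>, and the simple poles have opposite residues and combine into a telescoping
  difference.\<close>

lemma lor_product:
  assumes "x > 0" "P > 0" "P \<noteq> 1"
  shows "lor (x * P) * lor x = P / (1 - P)\<^sup>2 * ((1 + P) / (1 - P) * (1 / (1 + x * P) - 1 / (1 + x)) - lor (x * P) - lor x)"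
proof -
  define X where "X = 1 + x"
  define Y where "Y = 1 + x * P"
  have nz: "X \<noteq> 0" "Y \<noteq> 0" "1 - P \<noteq> 0" "x \<noteq> 0"
    using assms mult_pos_pos[of x P] unfolding X_def Y_def by linarith+
  have XY: "X - Y = x * (1 - P)" and YX: "Y - P * X = 1 - P"
    by (simp_all add: X_def Y_def algebra_simps)
  have d: "1 / Y - 1 / X = x * (1 - P) / (X * Y)"
    using nz XY by (simp add: divide_simps)
  have "(1 + P) / (1 - P) * (1 / Y - 1 / X) - x * P / Y\<^sup>2 - x / X\<^sup>2 =
      x * ((1 + P) * X * Y - P * X\<^sup>2 - Y\<^sup>2) / (X\<^sup>2 * Y\<^sup>2)"
    unfolding d using nz(1-3) by (simp add: divide_simps power2_eq_square) (simp add: algebra_simps)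
  also have "(1 + P) * X * Y - P * X\<^sup>2 - Y\<^sup>2 = (X - Y) * (Y - P * X)"
    by (simp add: power2_eq_square algebra_simps)
  finally have "P / (1 - P)\<^sup>2 * ((1 + P) / (1 - P) * (1 / Y - 1 / X) - x * P / Y\<^sup>2 - x / X\<^sup>2) =
      P * x * x / (X\<^sup>2 * Y\<^sup>2)"
    unfolding XY YX using nz(3) by (simp add: power2_eq_square)
  then show ?thesis
    by (simp add: lor_def X_def Y_def mult_ac)
qed

context nome_square
begin

definition sigma :: real where
  "sigma = (\<Sum>n. lorm (p ^ Suc n))"

text \<open>While \<open>sigma\<close> is the sum of sigma_1(N) p^N over N >= 1, this is the sum of
  N sigma_1(N) p^N, that is p times the derivative of \<open>sigma\<close> in p.\<close>

definition sigma_cubic :: real where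
  "sigma_cubic = (\<Sum>n. real (Suc n) * (p ^ Suc n * (1 + p ^ Suc n) / (1 - p ^ Suc n) ^ 3))"

lemma summable_sigma: "summable (\<lambda>n. lorm (p ^ Suc n))"
  using lambert(2)[of 1] p_less_1 by simp

lemma sigma_cubic_sums:
  "(\<lambda>n. real (Suc n) * (p ^ Suc n * (1 + p ^ Suc n) / (1 - p ^ Suc n) ^ 3)) sums sigma_cubic"
  "(\<lambda>n. (real (Suc n))\<^sup>2 * lorm (p ^ Suc n)) sums sigma_cubic"
proof -
  define h where "h = (\<lambda>j k. (real (Suc k))\<^sup>2 * real (Suc j) * p ^ (Suc j * Suc k))"
  have bound: "\<bar>h j k\<bar> \<le> (real (Suc j) * p ^ Suc j / p) * ((real (Suc k))\<^sup>2 * p ^ Suc k)" for j k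
  proof -
    have "\<bar>h j k\<bar> = (real (Suc k))\<^sup>2 * real (Suc j) * p ^ (Suc j * Suc k)"
      using p_pos by (simp add: h_def abs_mult)
    also have "\<dots> \<le> (real (Suc k))\<^sup>2 * real (Suc j) * p ^ (j + Suc k)"
      using p_pos p_less_1 by (intro mult_left_mono power_decreasing) auto
    also have "\<dots> = (real (Suc j) * p ^ Suc j / p) * ((real (Suc k))\<^sup>2 * p ^ Suc k)"
      by (simp add: power_add)
    finally show ?thesis .
  qed
  have A: "summable (\<lambda>j. real (Suc j) * p ^ Suc j / p)"
    using arith_geometric_sums[of p] p_pos p_less_1 by (intro summable_divide) (auto simp: sums_iff)
  have B: "summable (\<lambda>k. (real (Suc k))\<^sup>2 * p ^ Suc k)"
    using square_geometric_sums[of p] p_pos p_less_1 by (auto simp: sums_iff)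
  have nnA: "real (Suc j) * p ^ Suc j / p \<ge> 0" for j using p_pos by auto
  have nnB: "(real (Suc k))\<^sup>2 * p ^ Suc k \<ge> 0" for k using p_pos by auto
  note sw = suminf_swap[OF bound A nnA B nnB]
  have pw: "\<bar>p ^ Suc j\<bar> < 1" for j using pow_less_1[of j] p_pos by simp
  have r: "(\<lambda>k. h j k) sums (real (Suc j) * (p ^ Suc j * (1 + p ^ Suc j) / (1 - p ^ Suc j) ^ 3))" for j
    using sums_mult[OF square_geometric_sums[OF pw[of j]], of "real (Suc j)"]
    unfolding h_def power_mult by (simp only: mult_ac)
  have c: "(\<lambda>j. h j k) sums ((real (Suc k))\<^sup>2 * lorm (p ^ Suc k))" for k
  proof -
    have "(\<lambda>j. real (Suc j) * (p ^ Suc k) ^ Suc j) sums lorm (p ^ Suc k)"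
      using arith_geometric_sums[OF pw[of k]] unfolding lorm_def .
    from sums_mult[OF this, of "(real (Suc k))\<^sup>2"] show ?thesis
      unfolding h_def by (simp only: power_mult[symmetric] mult_ac)
  qed
  show 1: "(\<lambda>n. real (Suc n) * (p ^ Suc n * (1 + p ^ Suc n) / (1 - p ^ Suc n) ^ 3)) sums sigma_cubic"
    using sw(1) unfolding sums_unique[OF r, symmetric] sigma_cubic_def by (rule summable_sums)
  have "(\<Sum>k. (real (Suc k))\<^sup>2 * lorm (p ^ Suc k)) = sigma_cubic"
    using sw(3) unfolding sums_unique[OF r, symmetric] sums_unique[OF c, symmetric] sigma_cubic_def by simp
  with sw(2) show "(\<lambda>n. (real (Suc n))\<^sup>2 * lorm (p ^ Suc n)) sums sigma_cubic"
    unfolding sums_unique[OF c, symmetric] by (simp only: sums_iff)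
qed

text \<open>Collecting Q^2 by the index difference, the diagonal is Q2. Every other inner sum is
  affine in Q, because its double poles sum to Q and its simple poles telescope.\<close>

lemma Q_square:
  assumes s: "s > 0"
  shows "(Q s)\<^sup>2 - Q2 s = 2 * sigma_cubic - 4 * sigma * Q s"
proof -
  let ?f = "\<lambda>n. lor (s * p powi n)"
  \<comment> \<open>The inner sum for index difference k; it is even in k, so folding k with - k
    doubles it.\<close>
  define G where "G = (\<lambda>k::int. p powi k / (1 - p powi k)\<^sup>2 * ((1 + p powi k) / (1 - p powi k) * of_int k - 2 * Q s))"
  have fs: "?f summable_on UNIV" by (rule summable_Q[OF s])
  have H: "((\<lambda>k. \<Sum>\<^sub>\<infinity>n. ?f (n + k) * ?f n) has_sum (Q s)\<^sup>2) UNIV"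
    using infsum_diagonal[OF fs fs] by (simp add: Q_def power2_eq_square)
  have "(\<Sum>\<^sub>\<infinity>n. ?f (n + k) * ?f n) = (if k = 0 then Q2 s else G k)" for k
  proof (cases "k = 0")
    case True
    then show ?thesis by (simp add: Q2_def power2_eq_square)
  next
    case False
    have "?f (n + k) * ?f n = p powi k / (1 - p powi k)\<^sup>2 * ((1 + p powi k) / (1 - p powi k) * (fermi s (n + k) - fermi s n) + - ?f (n + k) + - ?f n)" for n
      using lor_product[of "s * p powi n" "p powi k"] s powi_neq_1[OF False]
      by (simp add: powi_add fermi_def mult.assoc)
    moreover have "p powi k / (1 - p powi k)\<^sup>2 * ((1 + p powi k) / (1 - p powi k) * of_int k + - Q s + - Q s) = G k"
      by (simp add: G_def)
    moreover have "((\<lambda>n. p powi k / (1 - p powi k)\<^sup>2 * ((1 + p powi k) / (1 - p powi k) * (fermi s (n + k) - fermi s n) + - ?f (n + k) + - ?f n)) has_sum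
       p powi k / (1 - p powi k)\<^sup>2 * ((1 + p powi k) / (1 - p powi k) * of_int k + - Q s + - Q s)) UNIV"
    proof (intro has_sum_cmult_right has_sum_add fermi_telescope_same s)
      show "((\<lambda>n. - ?f n) has_sum - Q s) UNIV"
        using fs by (simp add: has_sum_uminus Q_def)
      have "((\<lambda>n. ?f (n + k)) has_sum Q s) UNIV"
        using has_sum_infsum[OF int_summable_shift[THEN iffD2, OF fs], of k] int_infsum_shift[of ?f k]
        by (simp add: Q_def)
      then show "((\<lambda>n. - ?f (n + k)) has_sum - Q s) UNIV"
        by (simp add: has_sum_uminus)
    qed
    ultimately have "((\<lambda>n. ?f (n + k) * ?f n) has_sum G k) UNIV"
      by (simp only:)
    then show ?thesis using False by (simp add: infsumI)
  qed
  with H have H': "((\<lambda>k. if k = 0 then Q2 s else G k) has_sum (Q s)\<^sup>2) UNIV" by simp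
  have "(\<lambda>n. G (int (Suc n)) + G (- int (Suc n))) sums ((Q s)\<^sup>2 - Q2 s)"
    using int_infsum_sums[OF has_sum_imp_summable[OF H']] infsumI[OF H'] by (simp del: of_nat_Suc)
  moreover have "G (int (Suc n)) + G (- int (Suc n)) =
      2 * (real (Suc n) * (p ^ Suc n * (1 + p ^ Suc n) / (1 - p ^ Suc n) ^ 3)) - 4 * Q s * lorm (p ^ Suc n)" for n
  proof -
    define P where "P = p ^ Suc n"
    have P: "P \<noteq> 0" "1 - P \<noteq> 0" using pow_less_1[of n] by (auto simp: P_def)
    have i1: "1 - 1 / P = - (1 - P) / P" and i2: "1 + 1 / P = (1 + P) / P"
      using P by (simp_all add: field_simps)
    have a: "G (int (Suc n)) = P / (1 - P)\<^sup>2 * ((1 + P) / (1 - P) * real (Suc n) - 2 * Q s)"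
      unfolding G_def power_int_of_nat of_int_of_nat_eq P_def ..
    have "G (- int (Suc n)) = (1 / P) / (1 - 1 / P)\<^sup>2 * ((1 + 1 / P) / (1 - 1 / P) * - real (Suc n) - 2 * Q s)"
      unfolding G_def power_int_minus_of_nat of_int_minus of_int_of_nat_eq P_def power_one_over ..
    also have "(1 / P) / (1 - 1 / P)\<^sup>2 = P / (1 - P)\<^sup>2"
      unfolding i1 power_divide power2_minus using P by (simp add: power2_eq_square)
    also have "(1 + 1 / P) / (1 - 1 / P) * - real (Suc n) = (1 + P) / (1 - P) * real (Suc n)"
      unfolding i1 i2 using P by (auto simp: divide_simps) (simp_all add: algebra_simps)
    finally have b: "G (- int (Suc n)) = P / (1 - P)\<^sup>2 * ((1 + P) / (1 - P) * real (Suc n) - 2 * Q s)" .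
    have c: "real (Suc n) * (P * (1 + P) / (1 - P) ^ 3) = P / (1 - P)\<^sup>2 * ((1 + P) / (1 - P) * real (Suc n))"
      by (simp add: power2_eq_square power3_eq_cube)
    have "X * (Y - 2 * Z) + X * (Y - 2 * Z) = 2 * (X * Y) - 4 * Z * X" for X Y Z :: real
      by (simp add: algebra_simps)
    then show ?thesis
      unfolding a b P_def[symmetric] c lorm_def .
  qed
  moreover have "(\<lambda>n. 2 * (real (Suc n) * (p ^ Suc n * (1 + p ^ Suc n) / (1 - p ^ Suc n) ^ 3)) - 4 * Q s * lorm (p ^ Suc n))
      sums (2 * sigma_cubic - 4 * Q s * sigma)"
    unfolding sigma_def by (intro sums_diff sums_mult sigma_cubic_sums summable_sums summable_sigma)
  ultimately show ?thesis
    using sums_unique2 by (fastforce simp: mult_ac)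
qed

lemma lorm_powi_bound:
  assumes u: "p < \<bar>u\<bar>" "\<bar>u\<bar> < 1"
  obtains C where "\<And>n. \<bar>lorm (u * p powi n)\<bar> \<le> C * p ^ nat \<bar>n\<bar>"
proof -
  have u0: "u \<noteq> 0" using u p_pos by auto
  define c where "c = max \<bar>u\<bar> (p / \<bar>u\<bar>)"
  have c: "c < 1" "0 < c" "\<bar>u\<bar> \<le> c" "p / \<bar>u\<bar> \<le> c" using u p_pos u0 by (auto simp: c_def max_def)
  define C where "C = (\<bar>u\<bar> + 1 / \<bar>u\<bar>) / (1 - c)\<^sup>2"
  have "\<bar>lorm (u * p powi n)\<bar> \<le> C * p ^ nat \<bar>n\<bar>" for n
  proof (cases "n \<ge> 0")
    case True
    then have e: "u * p powi n = u * p ^ nat \<bar>n\<bar>" by (simp add: power_int_def)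
    have "\<bar>u * p ^ nat \<bar>n\<bar>\<bar> \<le> \<bar>u\<bar> * 1"
      using p_pos p_less_1 unfolding abs_mult by (intro mult_left_mono) (auto simp: power_le_one)
    then have "\<bar>lorm (u * p powi n)\<bar> \<le> \<bar>u * p ^ nat \<bar>n\<bar>\<bar> / (1 - c)\<^sup>2"
      unfolding e using c by (intro lorm_bound) auto
    also have "\<dots> = \<bar>u\<bar> / (1 - c)\<^sup>2 * p ^ nat \<bar>n\<bar>"
      using p_pos by (simp add: abs_mult)
    also have "\<dots> \<le> C * p ^ nat \<bar>n\<bar>"
      unfolding C_def using p_pos by (intro mult_right_mono divide_right_mono) auto
    finally show ?thesis .
  next
    case False
    then have e: "u * p powi n = 1 / (p ^ nat \<bar>n\<bar> / u)" using u0 by (simp add: power_int_def power_inverse field_simps)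
    obtain m where m: "nat \<bar>n\<bar> = Suc m" using False by (metis gr0_conv_Suc zero_less_nat_eq zero_less_abs_iff less_irrefl order_refl)
    have "\<bar>p ^ nat \<bar>n\<bar> / u\<bar> \<le> p / \<bar>u\<bar>"
      using p_pos pow_le_p[of m] unfolding m by (simp add: divide_right_mono)
    then have "\<bar>lorm (p ^ nat \<bar>n\<bar> / u)\<bar> \<le> \<bar>p ^ nat \<bar>n\<bar> / u\<bar> / (1 - c)\<^sup>2"
      using c by (intro lorm_bound) auto
    also have "\<dots> = (1 / \<bar>u\<bar>) / (1 - c)\<^sup>2 * p ^ nat \<bar>n\<bar>"
      using p_pos by (simp add: abs_mult)
    also have "\<dots> \<le> C * p ^ nat \<bar>n\<bar>"
      unfolding C_def using p_pos by (intro mult_right_mono divide_right_mono) auto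
    finally show ?thesis
      unfolding e using lorm_inverse[of "p ^ nat \<bar>n\<bar> / u"] u0 by simp
  qed
  then show ?thesis using that by blast
qed

text \<open>This shows V to be the analogue of - Q at a positive argument. It is what identifies
  \<open>V q\<close> with the half-period value e3 and \<open>V (- q)\<close> with - Q q.\<close>

lemma V_eq_lorm_sum:
  assumes u: "p < \<bar>u\<bar>" "\<bar>u\<bar> < 1"
  shows "((\<lambda>n. lorm (u * p powi n)) has_sum V u) UNIV"
proof -
  have u0: "u \<noteq> 0" using u p_pos by auto
  obtain C where C: "\<And>n. \<bar>lorm (u * p powi n)\<bar> \<le> C * p ^ nat \<bar>n\<bar>"
    using lorm_powi_bound[OF u] by blast
  have s: "(\<lambda>n. lorm (u * p powi n)) summable_on UNIV"
    using C p_pos p_less_1 by (intro int_summable_bound[where C = C and r = p]) auto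
  have eq: "lorm (u * p powi (- int (Suc n))) = lorm (p ^ Suc n / u)" for n
    using lorm_inverse[of "p ^ Suc n / u"] u0 unfolding power_int_minus_of_nat power_one_over by simp
  have eq': "lorm (u * p powi int (Suc n)) = lorm (u * p ^ Suc n)" for n
    unfolding power_int_of_nat ..
  have "infsum (\<lambda>n. lorm (u * p powi n)) UNIV - lorm u = V u - lorm u"
    using sums_unique2[OF int_infsum_sums[OF s] V_sums2[OF u, folded eq eq']] by simp
  with s show ?thesis using has_sum_infsum by force
qed

end

subsection \<open>Differentiation in the logarithmic variable\<close>

lemma int_infsum_decode:
  fixes f :: "int \<Rightarrow> real"
  assumes "f summable_on UNIV"
  shows "(\<lambda>n. f (int_decode n)) sums infsum f UNIV"
proof -
  have "((\<lambda>n. f (int_decode n)) has_sum infsum f UNIV) UNIV"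
    using has_sum_infsum[OF assms] has_sum_reindex_bij_betw[OF bij_int_decode, of f] by simp
  then show ?thesis by (rule has_sum_imp_sums)
qed

lemma tendsto_suminf:
  fixes a :: "nat \<Rightarrow> 'b \<Rightarrow> real"
  assumes "\<And>n. (a n \<longlongrightarrow> b n) F" "\<forall>\<^sub>F u in F. \<forall>n. norm (a n u) \<le> M n" "summable M" "F \<noteq> bot"
  shows "((\<lambda>u. \<Sum>n. a n u) \<longlongrightarrow> (\<Sum>n. b n)) F"
proof -
  have "\<forall>\<^sub>F (n, u) in sequentially \<times>\<^sub>F F. \<forall>n. norm (a n u) \<le> M n"
    using assms(2) by (subst eventually_prod2) auto
  then have "\<forall>\<^sub>F (n, u) in sequentially \<times>\<^sub>F F. norm (a n u) \<le> M n"
    by eventually_elim auto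
  from tannerys_theorem[where a = a, OF assms(1) this assms(3,4)] show ?thesis by simp
qed

text \<open>The derivative of \<open>lor\<close> in the logarithmic variable, x d/dx.\<close>

definition lor1 :: "real \<Rightarrow> real" where
  "lor1 x = x * (1 - x) / (1 + x) ^ 3"

lemma lor1_bound: "x \<ge> 0 \<Longrightarrow> \<bar>lor1 x\<bar> \<le> lor x"
proof -
  assume x: "x \<ge> 0"
  have "\<bar>lor1 x\<bar> = lor x * (\<bar>1 - x\<bar> / (1 + x))"
    using x by (simp add: lor1_def lor_def abs_mult power2_eq_square power3_eq_cube)
  moreover have "\<bar>1 - x\<bar> / (1 + x) \<le> 1"
    using x by (simp add: divide_le_eq_1)
  then have "lor x * (\<bar>1 - x\<bar> / (1 + x)) \<le> lor x * 1"
    using lor_nonneg[OF x] by (intro mult_left_mono)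
  ultimately show ?thesis by simp
qed

lemma DERIV_lor: "x > 0 \<Longrightarrow> (lor has_real_derivative (1 - x) / (1 + x) ^ 3) (at x)"
proof -
  assume x: "x > 0"
  define y where "y = 1 + x"
  have y: "y \<noteq> 0" "x = y - 1" using x by (auto simp: y_def)
  have "((\<lambda>x. x / (1 + x)\<^sup>2) has_real_derivative (1 * (1 + x)\<^sup>2 - x * (2 * (1 + x))) / ((1 + x)\<^sup>2 * (1 + x)\<^sup>2)) (at x)"
    using x by (auto intro!: derivative_eq_intros)
  also have "(1 * (1 + x)\<^sup>2 - x * (2 * (1 + x))) / ((1 + x)\<^sup>2 * (1 + x)\<^sup>2) = (1 - x) / (1 + x) ^ 3"
    unfolding y_def[symmetric] using y(1) unfolding y(2)
    by (simp add: field_simps power2_eq_square power3_eq_cube)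
  finally show ?thesis unfolding lor_def .
qed

lemma DERIV_lor1: "x > 0 \<Longrightarrow> (lor1 has_real_derivative (1 - 4 * x + x\<^sup>2) / (1 + x) ^ 4) (at x)"
proof -
  assume x: "x > 0"
  define y where "y = 1 + x"
  have y: "y \<noteq> 0" "x = y - 1" using x by (auto simp: y_def)
  have "((\<lambda>x. x * (1 - x) / (1 + x) ^ 3) has_real_derivative ((1 - 2 * x) * (1 + x) ^ 3 - x * (1 - x) * (3 * (1 + x)\<^sup>2)) / ((1 + x) ^ 3 * (1 + x) ^ 3)) (at x)"
    using x by (auto intro!: derivative_eq_intros)
  also have "((1 - 2 * x) * (1 + x) ^ 3 - x * (1 - x) * (3 * (1 + x)\<^sup>2)) / ((1 + x) ^ 3 * (1 + x) ^ 3) = (1 - 4 * x + x\<^sup>2) / (1 + x) ^ 4"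
    unfolding y_def[symmetric] using y(1) unfolding y(2)
    by (simp add: field_simps power2_eq_square power3_eq_cube power4_eq_xxxx)
  finally show ?thesis unfolding lor1_def .
qed

lemma DERIV_lor_exp: "((\<lambda>t. lor (exp t)) has_real_derivative lor1 (exp t)) (at t)"
  using DERIV_chain2[OF DERIV_lor DERIV_exp, of t] by (simp add: lor1_def mult.commute)

text \<open>The pointwise second-order equation for one summand. Summed over the powers of p it
  produces Q2, which \<open>Q_square\<close> then expresses through Q.\<close>

lemma DERIV_lor1_exp: "((\<lambda>t. lor1 (exp t)) has_real_derivative (lor (exp t) - 6 * (lor (exp t))\<^sup>2)) (at t)"
proof -
  define y where "y = 1 + exp t"
  have y: "y \<noteq> 0" "exp t = y - 1" using exp_gt_zero[of t] unfolding y_def by linarith+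
  have "(1 - 4 * exp t + (exp t)\<^sup>2) / (1 + exp t) ^ 4 * exp t = lor (exp t) - 6 * (lor (exp t))\<^sup>2"
    unfolding lor_def y_def[symmetric] using y(1) unfolding y(2)
    by (simp add: field_simps power2_eq_square power4_eq_xxxx)
  then show ?thesis
    using DERIV_chain2[OF DERIV_lor1 DERIV_exp, of t] by simp
qed

context nome_square
begin

lemma summable_pow_decode: "summable (\<lambda>n. p ^ nat \<bar>int_decode n\<bar>)"
  using int_infsum_decode[OF geometric_summable_on_int[of p]] p_pos p_less_1 by (simp add: sums_iff)

lemma summable_lor_dominated:
  assumes "\<And>x. x > 0 \<Longrightarrow> \<bar>F x\<bar> \<le> K * lor x" "K \<ge> 0" "s > 0"
  shows "(\<lambda>n. F (s * p powi n)) summable_on UNIV"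
proof (rule int_summable_bound)
  fix n :: int
  have "norm (F (s * p powi n)) \<le> K * lor (s * p powi n)"
    using assms by auto
  also have "\<dots> \<le> K * ((s + 1 / s) * p ^ nat \<bar>n\<bar>)"
    using assms by (intro mult_left_mono lor_bound) auto
  finally show "norm (F (s * p powi n)) \<le> K * (s + 1 / s) * p ^ nat \<bar>n\<bar>"
    by (simp add: mult.assoc)
qed (use p_pos p_less_1 in auto)

text \<open>Domination of function and derivative by \<open>lor\<close> gives a geometric majorant
  that is uniform on [t - 1, t + 1], which permits termwise differentiation.\<close>

lemma DERIV_infsum_exp:
  assumes der: "\<And>t. ((\<lambda>t. F (exp t)) has_real_derivative F' (exp t)) (at t)"
    and bF: "\<And>x. x > 0 \<Longrightarrow> \<bar>F x\<bar> \<le> K * lor x" and bF': "\<And>x. x > 0 \<Longrightarrow> \<bar>F' x\<bar> \<le> K * lor x"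
    and K: "K \<ge> 0"
  shows "((\<lambda>t. \<Sum>\<^sub>\<infinity>n. F (exp t * p powi n)) has_real_derivative (\<Sum>\<^sub>\<infinity>n. F' (exp t * p powi n))) (at t)"
proof -
  let ?S = "{t - 1..t + 1}"
  let ?f = "\<lambda>n x. F (exp x * p powi int_decode n)" and ?f' = "\<lambda>n x. F' (exp x * p powi int_decode n)"
  have "((\<lambda>x. \<Sum>n. ?f n x) has_field_derivative (\<Sum>n. ?f' n t)) (at t)"
  proof (rule has_field_derivative_series'(2)[where S = ?S and ?x0.0 = t])
    show "convex ?S" by simp
    show "(?f n has_field_derivative ?f' n x) (at x within ?S)" for n x
    proof -
      have e: "exp x * p powi int_decode n = exp (x + ln (p powi int_decode n))" for x
        by (simp add: exp_add)
      have "((\<lambda>x. F (exp (x + ln (p powi int_decode n)))) has_real_derivative F' (exp (x + ln (p powi int_decode n))) * 1) (at x)"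
        by (rule DERIV_chain2[OF der]) (auto intro!: derivative_eq_intros)
      then show ?thesis
        unfolding e by (simp add: has_field_derivative_at_within)
    qed
    show "uniformly_convergent_on ?S (\<lambda>n x. \<Sum>i<n. ?f' i x)"
    proof (rule Weierstrass_m_test')
      show "summable (\<lambda>n. K * (2 * exp (\<bar>t\<bar> + 1)) * p ^ nat \<bar>int_decode n\<bar>)"
        by (intro summable_mult summable_pow_decode)
      fix n x assume x: "x \<in> ?S"
      have "norm (?f' n x) \<le> K * lor (exp x * p powi int_decode n)"
        using bF' by auto
      also have "\<dots> \<le> K * ((exp x + 1 / exp x) * p ^ nat \<bar>int_decode n\<bar>)"
        using K by (intro mult_left_mono lor_bound) auto
      also have "\<dots> \<le> K * ((exp (\<bar>t\<bar> + 1) + exp (\<bar>t\<bar> + 1)) * p ^ nat \<bar>int_decode n\<bar>)"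
        using K x p_pos by (intro mult_left_mono mult_right_mono add_mono) (auto simp: exp_minus[symmetric] inverse_eq_divide[symmetric])
      finally show "norm (?f' n x) \<le> K * (2 * exp (\<bar>t\<bar> + 1)) * p ^ nat \<bar>int_decode n\<bar>"
        by (simp add: mult.assoc)
    qed
    show "t \<in> ?S" "t \<in> interior ?S" by auto
    show "summable (\<lambda>n. ?f n t)"
      using int_infsum_decode[OF summable_lor_dominated[OF bF K]] by (simp add: sums_iff)
  qed
  moreover have "(\<lambda>x. \<Sum>n. ?f n x) = (\<lambda>t. \<Sum>\<^sub>\<infinity>n. F (exp t * p powi n))"
    using int_infsum_decode[OF summable_lor_dominated[OF bF K]] by (auto simp: sums_iff fun_eq_iff)
  moreover have "(\<Sum>n. ?f' n t) = (\<Sum>\<^sub>\<infinity>n. F' (exp t * p powi n))"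
    using int_infsum_decode[OF summable_lor_dominated[OF bF' K]] by (auto simp: sums_iff)
  ultimately show ?thesis by simp
qed

definition Qd :: "real \<Rightarrow> real" where
  "Qd s = (\<Sum>\<^sub>\<infinity>n::int. lor1 (s * p powi n))"

lemma DERIV_Q: "((\<lambda>t. Q (exp t)) has_real_derivative Qd (exp t)) (at t)"
  unfolding Q_def Qd_def
  by (rule DERIV_infsum_exp[where K = 1]) (auto intro: DERIV_lor_exp lor1_bound simp: abs_of_nonneg lor_nonneg)

lemma DERIV_Qd: "((\<lambda>t. Qd (exp t)) has_real_derivative (Q (exp t) - 6 * Q2 (exp t))) (at t)"
proof -
  have "((\<lambda>t. Qd (exp t)) has_real_derivative (\<Sum>\<^sub>\<infinity>n. lor (exp t * p powi n) - 6 * (lor (exp t * p powi n))\<^sup>2)) (at t)"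
    unfolding Qd_def
  proof (rule DERIV_infsum_exp[where K = 7])
    show "\<bar>lor1 x\<bar> \<le> 7 * lor x" if "x > 0" for x
      using lor1_bound[of x] lor_nonneg[of x] that by linarith
    show "\<bar>lor x - 6 * (lor x)\<^sup>2\<bar> \<le> 7 * lor x" if "x > 0" for x
      using lor_sq_le[of x] lor_nonneg[of x] that zero_le_power2[of "lor x"] by linarith
  qed (auto intro: DERIV_lor1_exp)
  also have "(\<Sum>\<^sub>\<infinity>n. lor (exp t * p powi n) - 6 * (lor (exp t * p powi n))\<^sup>2) = Q (exp t) - 6 * Q2 (exp t)"
  proof (rule infsumI)
    have "((\<lambda>n. lor (exp t * p powi n) + (-6) * (lor (exp t * p powi n))\<^sup>2) has_sum (Q (exp t) + (-6) * Q2 (exp t))) UNIV"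
      unfolding Q_def Q2_def
      by (intro has_sum_add has_sum_cmult_right has_sum_infsum summable_Q summable_Q2) auto
    then show "((\<lambda>n. lor (exp t * p powi n) - 6 * (lor (exp t * p powi n))\<^sup>2) has_sum (Q (exp t) - 6 * Q2 (exp t))) UNIV"
      by simp
  qed
  finally show ?thesis .
qed

lemma isCont_Q: "s > 0 \<Longrightarrow> isCont Q s"
proof -
  assume s: "s > 0"
  have "isCont (\<lambda>t. Q (exp t)) (ln s)" using DERIV_Q DERIV_isCont by blast
  then have "isCont (\<lambda>x. (\<lambda>t. Q (exp t)) (ln x)) s"
    using s by (intro isCont_o2[of s ln "\<lambda>t. Q (exp t)"] DERIV_isCont[OF DERIV_ln])
  moreover have "\<forall>\<^sub>F x in nhds s. Q (exp (ln x)) = Q x"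
    using eventually_nhds_in_open[of "{0<..}" s] s by (auto elim: eventually_mono)
  ultimately show ?thesis
    using isCont_cong by fast
qed

lemma Q2_eq: "s > 0 \<Longrightarrow> Q2 s = (Q s)\<^sup>2 - 2 * sigma_cubic + 4 * sigma * Q s"
  using Q_square[of s] by simp

lemma tendsto_Q: "s > 0 \<Longrightarrow> (f \<longlongrightarrow> s) F \<Longrightarrow> ((\<lambda>x. Q (f x)) \<longlongrightarrow> Q s) F"
  using isCont_Q isCont_tendsto_compose by blast

lemma Qd_inverse: "s > 0 \<Longrightarrow> Qd (1 / s) = - Qd s"
proof -
  assume s: "s > 0"
  have l: "lor1 (1 / x) = - lor1 x" if "x > 0" for x
  proof -
    have "1 + 1 / x = (1 + x) / x" "1 - 1 / x = - (1 - x) / x" using that by (simp_all add: field_simps)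
    then show ?thesis using that by (simp add: lor1_def power_divide power3_eq_cube divide_simps) (simp add: algebra_simps)
  qed
  have "lor1 (1 / s * p powi n) = - lor1 (s * p powi (- n))" for n
    using l[of "s * p powi (- n)"] s by (simp add: power_int_minus field_simps)
  then show ?thesis
    unfolding Qd_def using int_infsum_minus[of "\<lambda>n. lor1 (s * p powi n)"] by (simp add: infsum_uminus)
qed

lemma Qd_shift: "Qd (p powi k * s) = Qd s"
proof -
  have "lor1 (p powi k * s * p powi n) = lor1 (s * p powi (n + k))" for n
    by (simp add: powi_add mult_ac)
  then show ?thesis
    unfolding Qd_def using int_infsum_shift[of "\<lambda>n. lor1 (s * p powi n)" k] by simp
qed

subsection \<open>Behaviour near the boundary\<close>

text \<open>Replacing the positive half by w^n minus a term of order p^n isolates the pole w / (1 -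
  w). The remaining series still converges for |w| = 1, so boundary values can be taken in
  it.\<close>

lemma S_sums:
  assumes w: "p < \<bar>w\<bar>" "\<bar>w\<bar> < 1" and s: "s > 0"
  shows "(\<lambda>n. (1 / w) ^ Suc n * p ^ Suc n / (p ^ Suc n + s) - w ^ Suc n * (s * p ^ Suc n / (1 + s * p ^ Suc n)))
     sums (S w s - w / (1 - w) - 1 / (1 + s))"
proof -
  let ?f = "\<lambda>n. w powi n / (1 + s * p powi n)"
  have "(\<lambda>n. ?f (int (Suc n)) + ?f (- int (Suc n))) sums (S w s - 1 / (1 + s))"
    using int_infsum_sums[OF summable_S[OF w s]] by (simp add: S_def)
  moreover have "?f (int (Suc n)) + ?f (- int (Suc n)) = w ^ Suc n +
     ((1 / w) ^ Suc n * p ^ Suc n / (p ^ Suc n + s) - w ^ Suc n * (s * p ^ Suc n / (1 + s * p ^ Suc n)))" for n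
  proof -
    define P where "P = p ^ Suc n"
    have P: "P > 0" using p_pos by (simp add: P_def)
    have nz: "1 + s * P > 0" "P + s > 0" using P s by (auto intro!: add_pos_pos)
    have a: "?f (int (Suc n)) = w ^ Suc n / (1 + s * P)"
      unfolding power_int_of_nat P_def ..
    have b: "?f (- int (Suc n)) = (1 / w) ^ Suc n / (1 + s * (1 / P))"
      unfolding power_int_minus_of_nat P_def power_one_over ..
    have c: "w ^ Suc n / (1 + s * P) = w ^ Suc n - w ^ Suc n * (s * P / (1 + s * P))"
      using nz(1) by (simp add: field_simps)
    have d: "x / (1 + s * (1 / P)) = x * P / (P + s)" for x
      using nz P by (simp add: field_simps)
    show ?thesis unfolding a b P_def[symmetric] c d by simp
  qed
  moreover have "(\<lambda>n. w ^ Suc n) sums (w / (1 - w))"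
    using sums_mult[OF geometric_sums[of w], of w] w by simp
  ultimately have "(\<lambda>n. w ^ Suc n + ((1 / w) ^ Suc n * p ^ Suc n / (p ^ Suc n + s) - w ^ Suc n * (s * p ^ Suc n / (1 + s * p ^ Suc n))) - w ^ Suc n) sums (S w s - 1 / (1 + s) - w / (1 - w))"
    by (intro sums_diff) (simp_all only:)
  moreover have "S w s - 1 / (1 + s) - w / (1 - w) = S w s - w / (1 - w) - 1 / (1 + s)"
    by simp
  ultimately show ?thesis by (simp only: add_diff_cancel_left')
qed

definition Areg :: "real \<Rightarrow> real \<Rightarrow> real" where
  "Areg w s = (\<Sum>n. (1 / w) ^ Suc n * p ^ Suc n / (p ^ Suc n + s) - w ^ Suc n * (s * p ^ Suc n / (1 + s * p ^ Suc n)))"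

lemma S_eq_Areg: "p < \<bar>w\<bar> \<Longrightarrow> \<bar>w\<bar> < 1 \<Longrightarrow> s > 0 \<Longrightarrow> S w s = w / (1 - w) + 1 / (1 + s) + Areg w s"
  using S_sums[of w s] by (simp add: Areg_def sums_iff)

lemma eventually_at_left_1: "c < 1 \<Longrightarrow> \<forall>\<^sub>F u in at_left (1::real). c < u \<and> u < 1"
  by (rule eventually_at_leftI[of c]) auto

text \<open>The cut-off sqrt p serves both tails at once: u > sqrt p also forces p / u < sqrt
  p.\<close>

lemma sqrt_p: "0 < sqrt p" "sqrt p < 1" "p < sqrt p" "p / sqrt p = sqrt p"
proof -
  show a: "0 < sqrt p" "sqrt p < 1" using p_pos p_less_1 by auto
  have "p = sqrt p * sqrt p" using p_pos by simp
  also have "\<dots> < 1 * sqrt p" using a by (intro mult_strict_right_mono) auto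
  finally show "p < sqrt p" by simp
  show "p / sqrt p = sqrt p" using p_pos by (simp add: real_div_sqrt)
qed

text \<open>The number \<open>e\<close> is a sign. The case 1 gives the regular part at the pole,
  the case - 1 the boundary value of the off-diagonal kernel. The parameter may vary with u as long
  as it converges.\<close>

lemma tendsto_Areg:
  assumes e: "\<bar>e\<bar> = 1" and r: "r > 0" and f: "(f \<longlongrightarrow> r) (at_left 1)"
  shows "((\<lambda>u. Areg (e * u) (f u)) \<longlongrightarrow> Areg e r) (at_left 1)"
proof -
  have evf: "\<forall>\<^sub>F u in at_left 1. r / 2 < f u" "\<forall>\<^sub>F u in at_left 1. f u < 2 * r"
    by (rule order_tendstoD[OF f], use r in simp)+
  let ?a = "\<lambda>n u. (1 / (e * u)) ^ Suc n * p ^ Suc n / (p ^ Suc n + f u) - (e * u) ^ Suc n * (f u * p ^ Suc n / (1 + f u * p ^ Suc n))"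
  let ?b = "\<lambda>n. (1 / e) ^ Suc n * p ^ Suc n / (p ^ Suc n + r) - e ^ Suc n * (r * p ^ Suc n / (1 + r * p ^ Suc n))"
  let ?M = "\<lambda>n. 2 / r * sqrt p ^ Suc n + 2 * r * p ^ Suc n"
  have e0: "e \<noteq> 0" using e by auto
  have "((\<lambda>u. \<Sum>n. ?a n u) \<longlongrightarrow> (\<Sum>n. ?b n)) (at_left 1)"
  proof (rule tendsto_suminf[where M = ?M])
    have idt: "((\<lambda>u. u) \<longlongrightarrow> (1::real)) (at_left 1)" by (simp add: tendsto_ident_at)
    have nz: "p ^ Suc n + r \<noteq> 0" "1 + r * p ^ Suc n \<noteq> 0" for n
      using p_pos r by (auto simp: add_pos_pos intro!: less_imp_neq[THEN not_sym])
    have "((\<lambda>u. ?a n u) \<longlongrightarrow> (1 / (e * 1)) ^ Suc n * p ^ Suc n / (p ^ Suc n + r) - (e * 1) ^ Suc n * (r * p ^ Suc n / (1 + r * p ^ Suc n))) (at_left 1)" for n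
      using nz[of n] e0 by (intro tendsto_intros f idt) auto
    then show "((\<lambda>u. ?a n u) \<longlongrightarrow> ?b n) (at_left 1)" for n by simp
    have "summable (\<lambda>n. sqrt p ^ Suc n)" "summable (\<lambda>n. p ^ Suc n)"
      using sqrt_p p_pos p_less_1 by (auto simp: summable_Suc_iff intro!: summable_mult summable_geometric)
    then show "summable ?M"
      by (intro summable_add summable_mult)
    show "\<forall>\<^sub>F u in at_left 1. \<forall>n. norm (?a n u) \<le> ?M n"
      using evf eventually_at_left_1[OF sqrt_p(2)]
    proof eventually_elim
      case (elim u)
      have u: "u > 0" "\<bar>e * u\<bar> = u" using elim sqrt_p e by (auto simp: abs_mult)
      have fu: "f u > 0" using elim r by auto
      show ?case
      proof
        fix n
        have "(1 / u) ^ Suc n * p ^ Suc n = (p / u) ^ Suc n" by (simp add: power_divide)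
        also have "\<dots> \<le> (p / sqrt p) ^ Suc n"
          using elim p_pos sqrt_p u by (intro power_mono divide_left_mono) auto
        finally have 1: "(1 / u) ^ Suc n * p ^ Suc n \<le> sqrt p ^ Suc n" using sqrt_p by simp
        have "norm ((1 / (e * u)) ^ Suc n * p ^ Suc n / (p ^ Suc n + f u)) = (1 / u) ^ Suc n * p ^ Suc n / (p ^ Suc n + f u)"
          using u fu p_pos by (simp add: abs_mult power_abs add_pos_pos abs_of_pos del: power_Suc)
        also have "\<dots> \<le> sqrt p ^ Suc n / (r / 2)"
          using 1 elim p_pos r u fu by (intro frac_le) (auto intro: add_increasing)
        finally have A: "norm ((1 / (e * u)) ^ Suc n * p ^ Suc n / (p ^ Suc n + f u)) \<le> 2 / r * sqrt p ^ Suc n"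
          by (simp add: mult_ac)
        have "norm ((e * u) ^ Suc n * (f u * p ^ Suc n / (1 + f u * p ^ Suc n))) = u ^ Suc n * (f u * p ^ Suc n / (1 + f u * p ^ Suc n))"
          using u fu p_pos e by (simp add: abs_mult power_abs add_pos_pos abs_of_pos del: power_Suc)
        also have "\<dots> \<le> 1 * (2 * r * p ^ Suc n / 1)"
        proof (rule mult_mono)
          show "u ^ Suc n \<le> 1" using elim u by (intro power_le_one) auto
          have "f u * p ^ Suc n \<le> 2 * r * p ^ Suc n" using elim p_pos by (intro mult_right_mono) auto
          then show "f u * p ^ Suc n / (1 + f u * p ^ Suc n) \<le> 2 * r * p ^ Suc n / 1"
            using fu p_pos r by (intro frac_le) auto
        qed (use fu p_pos r in auto)
        finally have B: "norm ((e * u) ^ Suc n * (f u * p ^ Suc n / (1 + f u * p ^ Suc n))) \<le> 2 * r * p ^ Suc n" by simp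
        show "norm (?a n u) \<le> ?M n"
          by (rule order_trans[OF norm_triangle_ineq4 add_mono[OF A B]])
      qed
    qed
    show "at_left (1::real) \<noteq> bot" by simp
  qed
  then show ?thesis unfolding Areg_def .
qed

text \<open>The limit of \<open>S (- u) s\<close> as u tends to 1. The series itself is not summable
  at - 1, and - 1 / 2 is the value of w / (1 - w) there.\<close>

definition B :: "real \<Rightarrow> real" where
  "B s = 1 / (1 + s) - 1 / 2 + Areg (- 1) s"

lemma tendsto_B:
  assumes r: "r > 0" and f: "(f \<longlongrightarrow> r) (at_left 1)"
  shows "((\<lambda>u. S (- u) (f u)) \<longlongrightarrow> B r) (at_left 1)"
proof -
  have idt: "((\<lambda>u. u) \<longlongrightarrow> (1::real)) (at_left 1)" by (simp add: tendsto_ident_at)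
  have "((\<lambda>u. - u / (1 - - u) + 1 / (1 + f u) + Areg (- 1 * u) (f u)) \<longlongrightarrow> - 1 / (1 - - 1) + 1 / (1 + r) + Areg (- 1) r) (at_left 1)"
    using r by (intro tendsto_intros idt f tendsto_Areg) auto
  then have "((\<lambda>u. - u / (1 - - u) + 1 / (1 + f u) + Areg (- 1 * u) (f u)) \<longlongrightarrow> B r) (at_left 1)"
    by (simp add: B_def)
  moreover have "\<forall>\<^sub>F u in at_left 1. - u / (1 - - u) + 1 / (1 + f u) + Areg (- 1 * u) (f u) = S (- u) (f u)"
    using eventually_at_left_1[OF p_less_1] order_tendstoD(1)[OF f r]
  proof eventually_elim
    case (elim u)
    then show ?case using S_eq_Areg[of "- u" "f u"] p_pos by simp
  qed
  ultimately show ?thesis by (rule Lim_transform_eventually)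
qed

lemma tendsto_S_pole:
  assumes r: "r > 0" and f: "(f \<longlongrightarrow> r) (at_left 1)"
  shows "((\<lambda>u. (1 - u) * S u (f u)) \<longlongrightarrow> 1) (at_left 1)"
proof -
  have idt: "((\<lambda>u. u) \<longlongrightarrow> (1::real)) (at_left 1)" by (simp add: tendsto_ident_at)
  have "((\<lambda>u. u + (1 - u) * (1 / (1 + f u) + Areg (1 * u) (f u))) \<longlongrightarrow> 1 + (1 - 1) * (1 / (1 + r) + Areg 1 r)) (at_left 1)"
    using r by (intro tendsto_intros idt f tendsto_Areg) auto
  then have "((\<lambda>u. u + (1 - u) * (1 / (1 + f u) + Areg (1 * u) (f u))) \<longlongrightarrow> 1) (at_left 1)"
    by simp
  moreover have "\<forall>\<^sub>F u in at_left 1. u + (1 - u) * (1 / (1 + f u) + Areg (1 * u) (f u)) = (1 - u) * S u (f u)"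
    using eventually_at_left_1[OF p_less_1] order_tendstoD(1)[OF f r]
  proof eventually_elim
    case (elim u)
    then show ?case using S_eq_Areg[of u "f u"] p_pos by (simp add: distrib_left)
  qed
  ultimately show ?thesis by (rule Lim_transform_eventually)
qed

text \<open>For w = - 1 the contributions of the positive and the negative indices are exchanged by
  s -> 1 / s, with opposite signs.\<close>

lemma Areg_minus_one_inverse:
  assumes "s > 0" shows "Areg (- 1) (1 / s) = - Areg (- 1) s"
proof -
  have "(1 / - 1) ^ Suc n * p ^ Suc n / (p ^ Suc n + 1 / s) - (- 1) ^ Suc n * (1 / s * p ^ Suc n / (1 + 1 / s * p ^ Suc n)) =
     - ((1 / - 1) ^ Suc n * p ^ Suc n / (p ^ Suc n + s) - (- 1) ^ Suc n * (s * p ^ Suc n / (1 + s * p ^ Suc n)))" for n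
  proof -
    define P where "P = p ^ Suc n"
    have P: "P > 0" using p_pos by (simp add: P_def)
    have nz: "1 + s * P > 0" "P + s > 0" using P assms by (auto intro!: add_pos_pos)
    have "P / (P + 1 / s) = s * P / (1 + s * P)"
      using nz P assms by (simp add: field_simps)
    moreover have "1 / s * P / (1 + 1 / s * P) = P / (P + s)"
      using nz P assms by (simp add: field_simps)
    ultimately show ?thesis
      unfolding P_def[symmetric] times_divide_eq_right[symmetric, of _ P] by (simp del: times_divide_eq_right times_divide_eq_left)
  qed
  moreover have "(\<Sum>n. - ((1 / - 1) ^ Suc n * p ^ Suc n / (p ^ Suc n + s) - (- 1) ^ Suc n * (s * p ^ Suc n / (1 + s * p ^ Suc n)))) = - Areg (- 1) s"
  proof -
    have "summable (\<lambda>n. norm ((1 / - 1) ^ Suc n * p ^ Suc n / (p ^ Suc n + s) - (- 1) ^ Suc n * (s * p ^ Suc n / (1 + s * p ^ Suc n))))"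
    proof (rule summable_norm_comparison_test)
      have "summable (\<lambda>n. p ^ Suc n)"
        using p_pos p_less_1 by (subst summable_Suc_iff) (auto intro!: summable_geometric)
      then show "summable (\<lambda>n. (1 / s + s) * p ^ Suc n)" by (rule summable_mult)
      show "\<exists>N. \<forall>n\<ge>N. norm ((1 / - 1) ^ Suc n * p ^ Suc n / (p ^ Suc n + s) - (- 1) ^ Suc n * (s * p ^ Suc n / (1 + s * p ^ Suc n))) \<le> (1 / s + s) * p ^ Suc n"
      proof (intro exI[of _ 0] allI impI)
        fix n
        define P where "P = p ^ Suc n"
        have P: "P > 0" using p_pos by (simp add: P_def)
        have e: "\<bar>(1 / - 1 :: real) ^ Suc n\<bar> = 1" "\<bar>(- 1 :: real) ^ Suc n\<bar> = 1" by (simp_all add: power_abs)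
        have pos: "P + s > 0" "1 + s * P > 0" using P assms by (auto intro!: add_pos_pos)
        have A: "\<bar>(1 / - 1) ^ Suc n * P / (P + s)\<bar> \<le> 1 / s * P"
        proof -
          have "\<bar>(1 / - 1) ^ Suc n * P / (P + s)\<bar> = P / (P + s)"
            unfolding abs_divide abs_mult e using P pos by simp
          also have "\<dots> \<le> P / s" using P assms by (intro divide_left_mono) auto
          finally show ?thesis by simp
        qed
        have B: "\<bar>(- 1) ^ Suc n * (s * P / (1 + s * P))\<bar> \<le> s * P"
        proof -
          have "\<bar>(- 1) ^ Suc n * (s * P / (1 + s * P))\<bar> = s * P / (1 + s * P)"
            unfolding abs_divide abs_mult e using P pos assms by simp
          also have "\<dots> \<le> s * P / 1" using P assms pos by (intro divide_left_mono) auto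
          finally show ?thesis by simp
        qed
        have "\<bar>(1 / - 1) ^ Suc n * P / (P + s) - (- 1) ^ Suc n * (s * P / (1 + s * P))\<bar> \<le> (1 / s + s) * P"
          using A B unfolding distrib_right by (smt (verit, best))
        then show "norm ((1 / - 1) ^ Suc n * p ^ Suc n / (p ^ Suc n + s) - (- 1) ^ Suc n * (s * p ^ Suc n / (1 + s * p ^ Suc n))) \<le> (1 / s + s) * p ^ Suc n"
          unfolding P_def real_norm_def .
      qed
    qed
    then show ?thesis
      unfolding Areg_def by (intro suminf_minus) (rule summable_norm_cancel)
  qed
  ultimately show ?thesis unfolding Areg_def by (simp only:)
qed

lemma B_inverse: "s > 0 \<Longrightarrow> B (1 / s) = - B s"
  by (simp add: B_def Areg_minus_one_inverse) (simp add: field_simps)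

lemma tendsto_V_sums:
  assumes e: "\<bar>e\<bar> = 1"
  shows "((\<lambda>u. V (e * u) - lorm (e * u)) \<longlongrightarrow> (\<Sum>n. lorm (e * p ^ Suc n) + lorm (p ^ Suc n / e))) (at_left 1)"
proof -
  have e0: "e \<noteq> 0" using e by auto
  let ?a = "\<lambda>n u. lorm (e * u * p ^ Suc n) + lorm (p ^ Suc n / (e * u))"
  let ?b = "\<lambda>n. lorm (e * p ^ Suc n) + lorm (p ^ Suc n / e)"
  let ?c = "sqrt p"
  let ?M = "\<lambda>n. (1 + 1 / ?c) / (1 - ?c)\<^sup>2 * p ^ Suc n"
  have "((\<lambda>u. \<Sum>n. ?a n u) \<longlongrightarrow> (\<Sum>n. ?b n)) (at_left 1)"
  proof (rule tendsto_suminf[where M = ?M])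
    have idt: "((\<lambda>u. u) \<longlongrightarrow> (1::real)) (at_left 1)" by (simp add: tendsto_ident_at)
    have nz: "1 - e * 1 * p ^ Suc n \<noteq> 0" "1 - p ^ Suc n / (e * 1) \<noteq> 0" for n
    proof -
      have "e = 1 \<or> e = -1" using e by linarith
      then show "1 - e * 1 * p ^ Suc n \<noteq> 0" "1 - p ^ Suc n / (e * 1) \<noteq> 0"
        using pow_less_1[of n] zero_less_power[OF p_pos, of "Suc n"] by auto
    qed
    have "((\<lambda>u. ?a n u) \<longlongrightarrow> lorm (e * 1 * p ^ Suc n) + lorm (p ^ Suc n / (e * 1))) (at_left 1)" for n
      unfolding lorm_def using nz[of n] e0 by (intro tendsto_intros idt) auto
    then show "((\<lambda>u. ?a n u) \<longlongrightarrow> ?b n) (at_left 1)" for n by simp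
    have "summable (\<lambda>n. p ^ Suc n)"
      using p_pos p_less_1 by (subst summable_Suc_iff) (auto intro!: summable_geometric)
    then show "summable ?M" by (rule summable_mult)
    show "\<forall>\<^sub>F u in at_left 1. \<forall>n. norm (?a n u) \<le> ?M n"
      using eventually_at_left_1[OF sqrt_p(2)]
    proof eventually_elim
      case (elim u)
      have u: "u > 0" "\<bar>e * u\<bar> = u" using elim sqrt_p e by (auto simp: abs_mult)
      show ?case
      proof
        fix n
        have P: "0 < p ^ Suc n" "p ^ Suc n \<le> p" using p_pos pow_le_p by auto
        have x1: "\<bar>e * u * p ^ Suc n\<bar> \<le> p ^ Suc n"
          using P u elim unfolding abs_mult[of "e * u"] u(2) by (simp add: mult_left_le_one_le)
        have "\<bar>p ^ Suc n / (e * u)\<bar> = p ^ Suc n / u" unfolding abs_divide u(2) using P by simp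
        also have "\<dots> \<le> p ^ Suc n / ?c" using P elim u sqrt_p by (intro divide_left_mono) auto
        finally have x2: "\<bar>p ^ Suc n / (e * u)\<bar> \<le> p ^ Suc n / ?c" .
        also have "\<dots> \<le> p / ?c" using P sqrt_p by (intro divide_right_mono) auto
        finally have x2': "\<bar>p ^ Suc n / (e * u)\<bar> \<le> ?c" using sqrt_p by simp
        have "\<bar>lorm (e * u * p ^ Suc n)\<bar> \<le> \<bar>e * u * p ^ Suc n\<bar> / (1 - ?c)\<^sup>2"
          using x1 P sqrt_p by (intro lorm_bound) auto
        also have "\<dots> \<le> p ^ Suc n / (1 - ?c)\<^sup>2" using x1 by (intro divide_right_mono) auto
        finally have A: "\<bar>lorm (e * u * p ^ Suc n)\<bar> \<le> p ^ Suc n / (1 - ?c)\<^sup>2" .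
        have "\<bar>lorm (p ^ Suc n / (e * u))\<bar> \<le> \<bar>p ^ Suc n / (e * u)\<bar> / (1 - ?c)\<^sup>2"
          using x2' sqrt_p by (intro lorm_bound) auto
        also have "\<dots> \<le> (p ^ Suc n / ?c) / (1 - ?c)\<^sup>2" using x2 by (intro divide_right_mono) auto
        finally have B: "\<bar>lorm (p ^ Suc n / (e * u))\<bar> \<le> (p ^ Suc n / ?c) / (1 - ?c)\<^sup>2" .
        have "p ^ Suc n / (1 - ?c)\<^sup>2 + (p ^ Suc n / ?c) / (1 - ?c)\<^sup>2 = ?M n"
          by (simp add: add_divide_distrib distrib_right)
        with A B show "norm (?a n u) \<le> ?M n" unfolding real_norm_def by linarith
      qed
    qed
    show "at_left (1::real) \<noteq> bot" by simp
  qed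
  moreover have "\<forall>\<^sub>F u in at_left 1. (\<Sum>n. ?a n u) = V (e * u) - lorm (e * u)"
    using eventually_at_left_1[OF p_less_1]
  proof eventually_elim
    case (elim u)
    then have "\<bar>e * u\<bar> = u" using e p_pos by (simp add: abs_mult)
    then show ?case using V_sums2[of "e * u"] elim by (simp add: sums_iff)
  qed
  ultimately show ?thesis by (rule Lim_transform_eventually)
qed

lemma tendsto_V_plus: "((\<lambda>u. V u - lorm u) \<longlongrightarrow> 2 * sigma) (at_left 1)"
proof -
  have "(\<Sum>n. lorm (1 * p ^ Suc n) + lorm (p ^ Suc n / 1)) = (\<Sum>n. 2 * lorm (p ^ Suc n))" by simp
  also have "\<dots> = 2 * sigma"
    unfolding sigma_def by (rule suminf_mult[OF summable_sigma])
  finally show ?thesis using tendsto_V_sums[of 1] by simp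
qed

lemma tendsto_V_minus: "((\<lambda>u. V (- u)) \<longlongrightarrow> - Q 1) (at_left 1)"
proof -
  have idt: "((\<lambda>u. u) \<longlongrightarrow> (1::real)) (at_left 1)" by (simp add: tendsto_ident_at)
  \<comment> \<open>Folding Q 1 about its central term lor 1 = 1 / 4 gives, up to sign, the folded
    lorm series at u = - 1, since lor is invariant under inversion.\<close>
  have "(\<lambda>n. lor (1 * p powi int (Suc n)) + lor (1 * p powi (- int (Suc n)))) sums (Q 1 - lor (1 * p powi 0))"
    unfolding Q_def by (rule int_infsum_sums[OF summable_Q]) simp
  moreover have "lor (1 * p powi int (Suc n)) + lor (1 * p powi (- int (Suc n))) = - (lorm (- 1 * p ^ Suc n) + lorm (p ^ Suc n / - 1))" for n
  proof -
    have "lor (1 / p ^ Suc n) = lor (p ^ Suc n)" using p_pos by (intro lor_inverse) simp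
    then show ?thesis
      unfolding power_int_of_nat power_int_minus_of_nat power_one_over
      using lorm_uminus[of "p ^ Suc n"] by simp
  qed
  ultimately have "(\<lambda>n. - (lorm (- 1 * p ^ Suc n) + lorm (p ^ Suc n / - 1))) sums (Q 1 - 1 / 4)"
    by (simp add: lor_def)
  from sums_minus[OF this] have "(\<Sum>n. lorm (- 1 * p ^ Suc n) + lorm (p ^ Suc n / - 1)) = 1 / 4 - Q 1"
    by (simp add: sums_iff)
  with tendsto_V_sums[of "- 1"] have "((\<lambda>u. V (- u) - lorm (- u)) \<longlongrightarrow> 1 / 4 - Q 1) (at_left 1)"
    by simp
  moreover have "((\<lambda>u. lorm (- u)) \<longlongrightarrow> lorm (- 1)) (at_left 1)"
    unfolding lorm_def by (intro tendsto_intros idt) auto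
  ultimately have "((\<lambda>u. V (- u) - lorm (- u) + lorm (- u)) \<longlongrightarrow> 1 / 4 - Q 1 + lorm (- 1)) (at_left 1)"
    by (rule tendsto_add)
  then show ?thesis by (simp add: lorm_def)
qed

text \<open>The product formula at - u in the limit u -> 1. As B is odd under inversion of s, the
  product of the two limits is - B^2.\<close>

lemma B_square:
  assumes s: "s > 0"
  shows "(B s)\<^sup>2 = Q 1 - Q s"
proof -
  have "((\<lambda>u. S (- u) s * S (- u) (1 / s)) \<longlongrightarrow> B s * B (1 / s)) (at_left 1)"
    using s by (intro tendsto_mult tendsto_B) auto
  moreover have "\<forall>\<^sub>F u in at_left 1. S (- u) s * S (- u) (1 / s) = V (- u) + Q s"
    using eventually_at_left_1[OF p_less_1]
  proof eventually_elim
    case (elim u)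
    then show ?case using p_pos s by (intro S_product) auto
  qed
  ultimately have "((\<lambda>u. V (- u) + Q s) \<longlongrightarrow> B s * B (1 / s)) (at_left 1)"
    by (rule Lim_transform_eventually)
  moreover have "((\<lambda>u. V (- u) + Q s) \<longlongrightarrow> - Q 1 + Q s) (at_left 1)"
    by (intro tendsto_intros tendsto_V_minus)
  ultimately have "B s * B (1 / s) = - Q 1 + Q s"
    using tendsto_unique by (metis trivial_limit_at_left_real)
  then show ?thesis using B_inverse[OF s] by (simp add: power2_eq_square)
qed

end

subsection \<open>Theta quotients\<close>

text \<open>Expansion to second order in elementary symmetric sums. In the induction each remainder
  grows by b_n times the remainder of one order less, so the four bounds b0 to b3 follow one
  another.\<close>

lemma prod_one_plus_bound:
  fixes b :: "nat \<Rightarrow> real"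
  assumes "\<And>i. b i \<ge> 0"
  defines "A \<equiv> \<lambda>n. \<Sum>i<n. b i"
  shows "\<bar>(\<Prod>i<n. 1 + b i) - 1 - A n - ((A n)\<^sup>2 - (\<Sum>i<n. (b i)\<^sup>2)) / 2\<bar> \<le> A n ^ 3 * exp (A n)"
proof -
  define P where "P n = (\<Prod>i<n. 1 + b i)" for n
  define E2 where "E2 n = ((A n)\<^sup>2 - (\<Sum>i<n. (b i)\<^sup>2)) / 2" for n
  have nn: "A n \<ge> 0" for n using assms(1) by (auto simp: A_def intro: sum_nonneg)
  have AS: "A (Suc n) = A n + b n" for n by (simp add: A_def)
  have PS: "P (Suc n) = P n * (1 + b n)" for n by (simp add: P_def)
  have ES: "E2 (Suc n) = E2 n + A n * b n" for n
    by (simp add: E2_def AS power2_eq_square field_simps)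
  have exp_mono: "exp (A n) \<le> exp (A (Suc n))" for n using assms(1)[of n] by (simp add: AS)
  have b0: "1 \<le> P n \<and> P n \<le> exp (A n)" for n
  proof (induction n)
    case (Suc n)
    have "P n * (1 + b n) \<le> exp (A n) * exp (b n)"
      using Suc assms(1)[of n] exp_ge_add_one_self[of "b n"] by (intro mult_mono) auto
    moreover have "1 * 1 \<le> P n * (1 + b n)"
      using Suc assms(1)[of n] by (intro mult_mono) auto
    ultimately show ?case by (simp add: PS AS exp_add)
  qed (simp add: P_def A_def)
  have b1: "0 \<le> P n - 1 \<and> P n - 1 \<le> A n * exp (A n)" for n
  proof (induction n)
    case (Suc n)
    have "P (Suc n) - 1 = (P n - 1) + b n * P n" by (simp add: PS algebra_simps)
    also have "\<dots> \<le> A n * exp (A n) + b n * exp (A n)"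
      using Suc b0[of n] assms(1)[of n] by (intro add_mono mult_left_mono) auto
    also have "\<dots> \<le> A (Suc n) * exp (A (Suc n))"
      using exp_mono[of n] nn[of "Suc n"] unfolding AS distrib_right[symmetric] by (intro mult_left_mono)
    finally show ?case using b0[of "Suc n"] by simp
  qed (simp add: P_def A_def)
  have b2: "0 \<le> P n - 1 - A n \<and> P n - 1 - A n \<le> (A n)\<^sup>2 * exp (A n)" for n
  proof (induction n)
    case (Suc n)
    have e: "P (Suc n) - 1 - A (Suc n) = (P n - 1 - A n) + b n * (P n - 1)" by (simp add: PS AS algebra_simps)
    also have "\<dots> \<le> (A n)\<^sup>2 * exp (A n) + b n * (A n * exp (A n))"
      using Suc b1[of n] assms(1)[of n] by (intro add_mono mult_left_mono) auto
    also have "\<dots> = ((A n)\<^sup>2 + b n * A n) * exp (A n)" by (simp add: algebra_simps)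
    also have "\<dots> \<le> (A (Suc n))\<^sup>2 * exp (A (Suc n))"
      using exp_mono[of n] nn[of n] assms(1)[of n] by (intro mult_mono) (auto simp: AS power2_eq_square algebra_simps)
    finally have "P (Suc n) - 1 - A (Suc n) \<le> (A (Suc n))\<^sup>2 * exp (A (Suc n))" .
    moreover have "0 \<le> P (Suc n) - 1 - A (Suc n)"
      unfolding e using Suc b1[of n] assms(1)[of n] by auto
    ultimately show ?case by simp
  qed (simp add: P_def A_def)
  have b3: "0 \<le> P n - 1 - A n - E2 n \<and> P n - 1 - A n - E2 n \<le> A n ^ 3 * exp (A n)" for n
  proof (induction n)
    case (Suc n)
    have e: "P (Suc n) - 1 - A (Suc n) - E2 (Suc n) = (P n - 1 - A n - E2 n) + b n * (P n - 1 - A n)"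
      by (simp add: PS AS ES algebra_simps)
    also have "\<dots> \<le> A n ^ 3 * exp (A n) + b n * ((A n)\<^sup>2 * exp (A n))"
      using Suc b2[of n] assms(1)[of n] by (intro add_mono mult_left_mono) auto
    also have "\<dots> = (A n ^ 3 + b n * (A n)\<^sup>2) * exp (A n)" by (simp add: algebra_simps)
    also have "\<dots> \<le> A (Suc n) ^ 3 * exp (A (Suc n))"
      using exp_mono[of n] nn[of n] assms(1)[of n]
      by (intro mult_mono) (auto simp: AS power2_eq_square power3_eq_cube algebra_simps)
    finally have "P (Suc n) - 1 - A (Suc n) - E2 (Suc n) \<le> A (Suc n) ^ 3 * exp (A (Suc n))" .
    moreover have "0 \<le> P (Suc n) - 1 - A (Suc n) - E2 (Suc n)"
      unfolding e using Suc b2[of n] assms(1)[of n] by auto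
    ultimately show ?case by simp
  qed (simp add: P_def A_def E2_def)
  show ?thesis using b3[of n] by (simp add: P_def E2_def)
qed

text \<open>The enumeration runs 0, -1, 1, -2, ... Its first 2 N values are - N to N - 1, exactly
  the indices that occur in the first N factors of the theta product.\<close>

lemma int_decode_even_odd: "int_decode (2 * n) = int n" "int_decode (Suc (2 * n)) = - int n - 1"
  by (simp_all add: int_decode_def sum_decode_def)

context nome_square
begin

text \<open>The theta function at - y. All its factors are positive for y > 0.\<close>

definition th :: "real \<Rightarrow> real" where
  "th y = (\<Prod>n. (1 + y * p ^ n) * (1 + p ^ Suc n / y))"

lemma th_has_prod:
  assumes y: "y > 0"
  shows "(\<lambda>n. (1 + y * p ^ n) * (1 + p ^ Suc n / y)) has_prod th y" "th y > 0"
proof -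
  have s: "summable (\<lambda>n. y * p ^ n)" "summable (\<lambda>n. p ^ Suc n / y)"
  proof -
    have "summable (\<lambda>n. p ^ n)" "summable (\<lambda>n. p ^ Suc n)"
      using p_pos p_less_1 by (auto simp: summable_Suc_iff intro!: summable_mult summable_geometric)
    from summable_mult[OF this(1), of y] summable_divide[OF this(2), of y]
    show "summable (\<lambda>n. y * p ^ n)" "summable (\<lambda>n. p ^ Suc n / y)" .
  qed
  have "convergent_prod (\<lambda>n. 1 + y * p ^ n)" "convergent_prod (\<lambda>n. 1 + p ^ Suc n / y)"
    using s y p_pos by (intro abs_convergent_prod_imp_convergent_prod summable_imp_abs_convergent_prod; simp)+
  then have "convergent_prod (\<lambda>n. (1 + y * p ^ n) * (1 + p ^ Suc n / y))"
    by (rule convergent_prod_mult)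
  then show h: "(\<lambda>n. (1 + y * p ^ n) * (1 + p ^ Suc n / y)) has_prod th y"
    unfolding th_def by (rule convergent_prod_has_prod)
  have "(1 + y * p ^ n) * (1 + p ^ Suc n / y) > 0" for n
    using y p_pos by (intro mult_pos_pos add_pos_pos) auto
  then show "th y > 0"
    using has_prod_pos[OF h] by auto
qed

lemma th_LIMSEQ: "y > 0 \<Longrightarrow> (\<lambda>N. \<Prod>n<N. (1 + y * p ^ n) * (1 + p ^ Suc n / y)) \<longlonglongrightarrow> th y"
  using has_prod_imp_tendsto'[OF th_has_prod(1)] .

text \<open>Each factor of the quotient collapses since
  \<open>(1 + x w) (1 + x / w) = (1 + x)\<^sup>2 + (w + 1 / w - 2) x\<close>.\<close>

lemma th_ratio_LIMSEQ:
  assumes s: "s > 0" and w: "w > 0"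
  shows "(\<lambda>N. \<Prod>i<2 * N. 1 + (1 - w)\<^sup>2 / w * lor (s * p powi int_decode i)) \<longlonglongrightarrow> th (s * w) * th (s / w) / (th s)\<^sup>2"
proof -
  define d where "d = (1 - w)\<^sup>2 / w"
  have factor: "(1 + x * w) * (1 + x / w) / (1 + x)\<^sup>2 = 1 + d * lor x" if "x > 0" for x
  proof -
    have "(1 + x * w) * (1 + x / w) = (1 + x)\<^sup>2 + d * x"
      using w by (simp add: d_def power2_eq_square field_simps)
    then show ?thesis using that by (simp add: lor_def add_divide_distrib)
  qed
  let ?P = "\<lambda>y N. \<Prod>n<N. (1 + y * p ^ n) * (1 + p ^ Suc n / y)"
  have eq: "?P (s * w) N * ?P (s / w) N / (?P s N)\<^sup>2 = (\<Prod>i<2 * N. 1 + d * lor (s * p powi int_decode i))" for N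
  proof (induction N)
    case 0
    then show ?case by simp
  next
    case (Suc N)
    have x: "s * p ^ N > 0" "p ^ Suc N / s > 0" using s p_pos by auto
    have "(1 + s * w * p ^ N) * (1 + p ^ Suc N / (s * w)) * ((1 + s / w * p ^ N) * (1 + p ^ Suc N / (s / w))) / ((1 + s * p ^ N) * (1 + p ^ Suc N / s))\<^sup>2 =
       ((1 + s * p ^ N * w) * (1 + s * p ^ N / w) / (1 + s * p ^ N)\<^sup>2) * ((1 + p ^ Suc N / s * w) * (1 + p ^ Suc N / s / w) / (1 + p ^ Suc N / s)\<^sup>2)"
      by (simp add: power_mult_distrib mult_ac)
    also have "\<dots> = (1 + d * lor (s * p ^ N)) * (1 + d * lor (p ^ Suc N / s))"
      unfolding factor[OF x(1)] factor[OF x(2)] ..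
    also have "lor (s * p ^ N) = lor (s * p powi int_decode (2 * N))"
      unfolding int_decode_even_odd power_int_of_nat ..
    also have "lor (p ^ Suc N / s) = lor (s * p powi int_decode (Suc (2 * N)))"
    proof -
      have "- int N - 1 = - int (Suc N)" by simp
      then have "s * p powi int_decode (Suc (2 * N)) = 1 / (p ^ Suc N / s)"
        unfolding int_decode_even_odd by (simp only: power_int_minus_of_nat power_one_over) simp
      then show ?thesis using lor_inverse[OF x(2)] by simp
    qed
    finally have st: "(1 + s * w * p ^ N) * (1 + p ^ Suc N / (s * w)) * ((1 + s / w * p ^ N) * (1 + p ^ Suc N / (s / w))) / ((1 + s * p ^ N) * (1 + p ^ Suc N / s))\<^sup>2 =
       (1 + d * lor (s * p powi int_decode (2 * N))) * (1 + d * lor (s * p powi int_decode (Suc (2 * N))))" .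
    have sp: "a * a' * (b * b') / (c * c')\<^sup>2 = (a * b / c\<^sup>2) * (a' * b' / c'\<^sup>2)" for a a' b b' c c' :: real
      by (simp add: power_mult_distrib)
    have "?P (s * w) (Suc N) * ?P (s / w) (Suc N) / (?P s (Suc N))\<^sup>2 =
       (?P (s * w) N * ?P (s / w) N / (?P s N)\<^sup>2) *
       ((1 + s * w * p ^ N) * (1 + p ^ Suc N / (s * w)) * ((1 + s / w * p ^ N) * (1 + p ^ Suc N / (s / w))) / ((1 + s * p ^ N) * (1 + p ^ Suc N / s))\<^sup>2)"
      unfolding prod.lessThan_Suc by (rule sp)
    also have "\<dots> = (\<Prod>i<2 * N. 1 + d * lor (s * p powi int_decode i)) * ((1 + d * lor (s * p powi int_decode (2 * N))) * (1 + d * lor (s * p powi int_decode (Suc (2 * N)))))"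
      unfolding Suc st ..
    also have "\<dots> = (\<Prod>i<2 * Suc N. 1 + d * lor (s * p powi int_decode i))"
      by (simp add: mult.assoc)
    finally show ?case .
  qed
  have "(\<lambda>N. ?P (s * w) N * ?P (s / w) N / (?P s N)\<^sup>2) \<longlonglongrightarrow> th (s * w) * th (s / w) / (th s)\<^sup>2"
    using s w th_has_prod(2)[OF s] by (intro tendsto_intros th_LIMSEQ) auto
  then show ?thesis unfolding eq d_def .
qed

text \<open>With s = r u^2 and w = u^2 this is the reciprocal of the theta prefactor of the unfolded
  correlation: th(r) th(r u^4) / th(r u^2)^2.\<close>

definition T :: "real \<Rightarrow> real \<Rightarrow> real" where
  "T s w = th (s * w) * th (s / w) / (th s)\<^sup>2"

lemma T_bound:
  assumes s: "s > 0" and w: "w > 0"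
  defines "d \<equiv> (1 - w)\<^sup>2 / w"
  shows "\<bar>T s w - 1 - d * Q s - d\<^sup>2 * ((Q s)\<^sup>2 - Q2 s) / 2\<bar> \<le> (d * Q s) ^ 3 * exp (d * Q s)"
proof -
  define b where "b = (\<lambda>i. d * lor (s * p powi int_decode i))"
  have nn: "b i \<ge> 0" for i unfolding b_def d_def using s w by (intro mult_nonneg_nonneg divide_nonneg_nonneg lor_nonneg) auto
  have "(\<lambda>i. lor (s * p powi int_decode i)) sums Q s"
    unfolding Q_def by (rule int_infsum_decode[OF summable_Q[OF s]])
  from sums_mult[OF this, of d] have s1: "b sums (d * Q s)" by (simp add: b_def)
  have "(\<lambda>i. (lor (s * p powi int_decode i))\<^sup>2) sums Q2 s"
    unfolding Q2_def by (rule int_infsum_decode[OF summable_Q2[OF s]])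
  from sums_mult[OF this, of "d\<^sup>2"] have s2: "(\<lambda>i. (b i)\<^sup>2) sums (d\<^sup>2 * Q2 s)" by (simp add: b_def power_mult_distrib)
  have sub: "filterlim (\<lambda>N::nat. 2 * N) at_top at_top" by real_asymp
  have l1: "(\<lambda>N. \<Sum>i<2 * N. b i) \<longlonglongrightarrow> d * Q s"
    using filterlim_compose[OF s1[unfolded sums_def] sub] .
  have l2: "(\<lambda>N. \<Sum>i<2 * N. (b i)\<^sup>2) \<longlonglongrightarrow> d\<^sup>2 * Q2 s"
    using filterlim_compose[OF s2[unfolded sums_def] sub] .
  have l3: "(\<lambda>N. \<Prod>i<2 * N. 1 + b i) \<longlonglongrightarrow> T s w"
    using th_ratio_LIMSEQ[OF s w] by (simp add: T_def b_def d_def)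
  have "\<bar>T s w - 1 - d * Q s - ((d * Q s)\<^sup>2 - d\<^sup>2 * Q2 s) / 2\<bar> \<le> (d * Q s) ^ 3 * exp (d * Q s)"
  proof (rule tendsto_le[OF sequentially_bot])
    show "(\<lambda>N. (\<Sum>i<2 * N. b i) ^ 3 * exp (\<Sum>i<2 * N. b i)) \<longlonglongrightarrow> (d * Q s) ^ 3 * exp (d * Q s)"
      by (intro tendsto_intros l1)
    show "(\<lambda>N. \<bar>(\<Prod>i<2 * N. 1 + b i) - 1 - (\<Sum>i<2 * N. b i) - ((\<Sum>i<2 * N. b i)\<^sup>2 - (\<Sum>i<2 * N. (b i)\<^sup>2)) / 2\<bar>)
        \<longlonglongrightarrow> \<bar>T s w - 1 - d * Q s - ((d * Q s)\<^sup>2 - d\<^sup>2 * Q2 s) / 2\<bar>"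
      by (intro tendsto_intros l1 l2 l3) auto
  qed (use prod_one_plus_bound[OF nn] in auto)
  then show ?thesis by (simp add: power_mult_distrib algebra_simps)
qed

text \<open>By \<open>Q_square\<close> the second-order coefficient is affine in Q, so continuity of
  Q carries it to the limit along a moving parameter.\<close>

lemma tendsto_T:
  assumes r: "r > 0" and f: "(f \<longlongrightarrow> r) (at_left 1)"
    and w: "\<forall>\<^sub>F u in at_left 1. w u > 0 \<and> w u \<noteq> 1" and d: "((\<lambda>u. (1 - w u)\<^sup>2 / w u) \<longlongrightarrow> 0) (at_left 1)"
  shows "((\<lambda>u. (T (f u) (w u) - 1 - (1 - w u)\<^sup>2 / w u * Q (f u)) / ((1 - w u)\<^sup>2 / w u)\<^sup>2) \<longlongrightarrow> ((Q r)\<^sup>2 - Q2 r) / 2) (at_left 1)"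
proof -
  let ?d = "\<lambda>u. (1 - w u)\<^sup>2 / w u"
  have Ql: "((\<lambda>u. Q (f u)) \<longlongrightarrow> Q r) (at_left 1)"
    by (rule tendsto_Q[OF r f])
  have e: "(Q s)\<^sup>2 - Q2 s = 2 * sigma_cubic - 4 * sigma * Q s" if "s > 0" for s using Q_square[OF that] .
  have h: "((\<lambda>u. (2 * sigma_cubic - 4 * sigma * Q (f u)) / 2) \<longlongrightarrow> (2 * sigma_cubic - 4 * sigma * Q r) / 2) (at_left 1)"
    by (intro tendsto_intros Ql) auto
  have g: "((\<lambda>u. ?d u * (Q (f u) ^ 3 * exp (?d u * Q (f u)))) \<longlongrightarrow> 0 * (Q r ^ 3 * exp (0 * Q r))) (at_left 1)"
    by (intro tendsto_intros Ql d)
  have "((\<lambda>u. (T (f u) (w u) - 1 - ?d u * Q (f u)) / (?d u)\<^sup>2 - (2 * sigma_cubic - 4 * sigma * Q (f u)) / 2) \<longlongrightarrow> 0) (at_left 1)"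
  proof (rule Lim_null_comparison)
    show "((\<lambda>u. ?d u * (Q (f u) ^ 3 * exp (?d u * Q (f u)))) \<longlongrightarrow> 0) (at_left 1)"
      using g by simp
    show "\<forall>\<^sub>F u in at_left 1. norm ((T (f u) (w u) - 1 - ?d u * Q (f u)) / (?d u)\<^sup>2 - (2 * sigma_cubic - 4 * sigma * Q (f u)) / 2)
         \<le> ?d u * (Q (f u) ^ 3 * exp (?d u * Q (f u)))"
      using w order_tendstoD(1)[OF f r]
    proof eventually_elim
      case (elim u)
      have dp: "?d u > 0" using elim by simp
      let ?X = "T (f u) (w u) - 1 - ?d u * Q (f u)"
      let ?Y = "2 * sigma_cubic - 4 * sigma * Q (f u)"
      have "\<bar>?X - (?d u)\<^sup>2 * ?Y / 2\<bar> \<le> (?d u * Q (f u)) ^ 3 * exp (?d u * Q (f u))"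
        using T_bound[of "f u" "w u"] elim e[of "f u"] by simp
      then have "\<bar>?X - (?d u)\<^sup>2 * ?Y / 2\<bar> / (?d u)\<^sup>2 \<le> (?d u * Q (f u)) ^ 3 * exp (?d u * Q (f u)) / (?d u)\<^sup>2"
        by (intro divide_right_mono) auto
      also have "\<bar>?X - (?d u)\<^sup>2 * ?Y / 2\<bar> / (?d u)\<^sup>2 = \<bar>?X / (?d u)\<^sup>2 - ?Y / 2\<bar>"
      proof -
        have "\<bar>x - d\<^sup>2 * y / 2\<bar> / d\<^sup>2 = \<bar>x / d\<^sup>2 - y / 2\<bar>" if "d > 0" for d x y :: real
        proof -
          have "x / d\<^sup>2 - y / 2 = (x - d\<^sup>2 * y / 2) / d\<^sup>2" using that by (simp add: diff_divide_distrib)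
          then show ?thesis by (simp add: abs_divide)
        qed
        from this[OF dp] show ?thesis .
      qed
      also have "(?d u * Q (f u)) ^ 3 * exp (?d u * Q (f u)) / (?d u)\<^sup>2 = ?d u * (Q (f u) ^ 3 * exp (?d u * Q (f u)))"
      proof -
        have "(d * x) ^ 3 * y / d\<^sup>2 = d * (x ^ 3 * y)" if "d > 0" for d x y :: real
          using that by (simp add: power2_eq_square power3_eq_cube)
        from this[OF dp] show ?thesis .
      qed
      finally show ?case by simp
    qed
  qed
  from tendsto_add[OF this h] show ?thesis
    unfolding e[OF r] by simp
qed

subsection \<open>The limit of the unfolded correlation function\<close>

lemma S_pos:
  assumes "p < u" "u < 1" "s > 0"
  shows "S u s > 0"
proof -
  have u: "p < \<bar>u\<bar>" "\<bar>u\<bar> < 1" "u > 0" using assms p_pos by auto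
  let ?f = "\<lambda>n. u powi n / (1 + s * p powi n)"
  have nn: "0 < ?f n" for n
    using u one_plus_pos[OF assms(3), of n] by simp
  have "?f 0 \<le> S u s"
    unfolding S_def
    using finite_sum_le_infsum[OF summable_S[OF u(1,2) assms(3)], of "{0}"] nn less_imp_le by auto
  with nn[of 0] show ?thesis by linarith
qed

text \<open>Numerator and denominator are multiplied by their common partner
  \<open>S u (1 / (r * u\<^sup>2))\<close>. The first product is V + Q, the second is V_twist and
  free of r.\<close>

lemma S_quotient:
  assumes u: "p < u" "u < 1" and r: "r > 0"
  shows "S u (r * u\<^sup>2) / S u (r * u) = (Q (r * u\<^sup>2) + V u) / V_twist u"
proof -
  have u0: "u > 0" using u p_pos by auto
  define s where "s = r * u\<^sup>2"
  have s: "s > 0" using r u0 by (simp add: s_def)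
  have "S u s * S u (1 / s) = V u + Q s"
    using u u0 s by (intro S_product) auto
  moreover have "S u (r * u) * S u (1 / s) = V_twist u"
    using S_product2[OF u, of "r * u"] r u0 by (simp add: s_def power2_eq_square mult.assoc)
  moreover have "S u (1 / s) > 0" "S u (r * u) > 0"
    using S_pos[OF u] s r u0 by auto
  moreover from this have "S u s / S u (r * u) = (S u s * S u (1 / s)) / (S u (r * u) * S u (1 / s))"
    by simp
  ultimately show ?thesis
    unfolding s_def[symmetric] by (simp add: add.commute)
qed

text \<open>The n-th term of V - V_twist divided by (1 - u)^2 / u. The finite geometric sums are
  what remains of (1/u)^a - u^b after a factor 1 - u has been taken out.\<close>

definition vterm :: "nat \<Rightarrow> real \<Rightarrow> real" where
  "vterm n u = real (Suc n) * p ^ Suc n * u / ((1 - p ^ Suc n) * (1 - u * p ^ Suc n) * (u - p ^ Suc n)) *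
     ((1 / u) ^ n * (\<Sum>i<2 * n + 1. u ^ i) - p ^ Suc n * ((1 / u) ^ Suc n * (\<Sum>i<2 * n + 3. u ^ i)))"

lemma geometric_gap: "u > 0 \<Longrightarrow> (1 - u) * ((1 / u) ^ a * (\<Sum>i<a + b. u ^ i)) = (1 / u) ^ a - u ^ b" for u :: real
proof -
  assume u: "u > 0"
  have "(1 - u) * (\<Sum>i<a + b. u ^ i) = 1 - u ^ (a + b)"
    by (rule one_diff_power_eq[symmetric])
  then have "(1 - u) * ((1 / u) ^ a * (\<Sum>i<a + b. u ^ i)) = (1 / u) ^ a * (1 - u ^ (a + b))"
    by (metis mult.left_commute)
  also have "\<dots> = (1 / u) ^ a - u ^ b"
    using u by (simp add: right_diff_distrib power_add power_one_over)
  finally show ?thesis .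
qed

text \<open>The double poles agree, and each remaining term of the difference is divisible by (1 -
  u)^2. Hence the limit at u = 1 can be taken termwise after the division.\<close>

lemma V_minus_V_twist:
  assumes u: "p < u" "u < 1"
  shows "(\<lambda>n. (1 - u)\<^sup>2 / u * vterm n u) sums (V u - V_twist u)"
proof -
  have u0: "u > 0" using u p_pos by auto
  have u': "p < \<bar>u\<bar>" "\<bar>u\<bar> < 1" using u u0 by auto
  have "real (Suc n) * p ^ Suc n / (1 - p ^ Suc n) * (u ^ Suc n + (1 / u) ^ Suc n) -
     real (Suc n) * p ^ Suc n * (u ^ Suc n / (u - p ^ Suc n) + (1 / u) ^ n / (1 - u * p ^ Suc n)) =
     (1 - u)\<^sup>2 / u * vterm n u" for n
  proof -
    define P where "P = p ^ Suc n"
    define N where "N = real (Suc n)"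
    define v where "v = (1 / u) ^ n"
    define y where "y = u ^ Suc n"
    have P: "P \<noteq> 1" "P < 1" "P \<le> p" using pow_less_1[of n] pow_le_p[of n] by (auto simp: P_def)
    have nz: "1 - P \<noteq> 0" "u - P \<noteq> 0" using P u by auto
    have "u * P < 1 * 1" using u u0 P p_pos by (intro mult_strict_mono) (auto simp: P_def)
    then have nz2: "1 - u * P \<noteq> 0" by auto
    have g1: "(1 - u) * ((1 / u) ^ n * (\<Sum>i<2 * n + 1. u ^ i)) = v - y"
      using geometric_gap[OF u0, of n "Suc n"] by (simp add: v_def y_def mult_2)
    have g2: "(1 - u) * ((1 / u) ^ Suc n * (\<Sum>i<2 * n + 3. u ^ i)) = v / u - u * y"
    proof -
      have e: "Suc n + Suc (Suc n) = 2 * n + 3" by simp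
      have "(1 / u) ^ Suc n - u ^ Suc (Suc n) = v / u - u * y" by (simp add: v_def y_def)
      then show ?thesis
        using geometric_gap[OF u0, of "Suc n" "Suc (Suc n)", unfolded e] by (simp only:)
    qed
    have "(1 - u)\<^sup>2 / u * vterm n u = N * P * (1 - u) / ((1 - P) * (1 - u * P) * (u - P)) *
       ((1 - u) * ((1 / u) ^ n * (\<Sum>i<2 * n + 1. u ^ i)) - P * ((1 - u) * ((1 / u) ^ Suc n * (\<Sum>i<2 * n + 3. u ^ i))))"
    proof -
      have "(1 - u)\<^sup>2 / u * (a * u / c * (x - P * y)) = a * (1 - u) / c * ((1 - u) * x - P * ((1 - u) * y))" for a c x y
      proof -
        have "(1 - u) * x - P * ((1 - u) * y) = (1 - u) * (x - P * y)" by (simp add: algebra_simps)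
        then show ?thesis using u0 by (simp add: power2_eq_square)
      qed
      then show ?thesis unfolding vterm_def P_def N_def .
    qed
    also have "\<dots> = N * P * (1 - u) / ((1 - P) * (1 - u * P) * (u - P)) * ((v - y) - P * (v / u - u * y))"
      unfolding g1 g2 ..
    also have "(v - y) - P * (v / u - u * y) = v / u * (u - P) - y * (1 - u * P)"
      using u0 by (simp add: field_simps)
    also have "N * P * (1 - u) / ((1 - P) * (1 - u * P) * (u - P)) * (v / u * (u - P) - y * (1 - u * P)) =
       N * P * (1 - u) / (1 - P) * (v / u / (1 - u * P) - y / (u - P))"
    proof -
      have "a / (b * c * d) * (x * d - y * c) = a / b * (x / c - y / d)" if "c \<noteq> 0" "d \<noteq> 0" for a b c d x y :: real
        using that by (simp add: diff_divide_distrib right_diff_distrib mult_ac)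
      from this[OF nz2 nz(2)] show ?thesis .
    qed
    also have "\<dots> = N * P / (1 - P) * ((1 - u) * (v / u / (1 - u * P)) - (1 - u) * (y / (u - P)))"
    proof -
      have "a * h / b * (x - y) = a / b * (h * x - h * y)" for a b h x y :: real
        unfolding right_diff_distrib[symmetric] by simp
      then show ?thesis .
    qed
    also have "(1 - u) * (v / u / (1 - u * P)) = v / u - (1 - P) * (v / (1 - u * P))"
      using nz2 u0 by (simp add: field_simps)
    also have "(1 - u) * (y / (u - P)) = (1 - P) * (y / (u - P)) - y"
      using nz by (simp add: field_simps)
    also have "N * P / (1 - P) * (v / u - (1 - P) * (v / (1 - u * P)) - ((1 - P) * (y / (u - P)) - y)) =
       N * P / (1 - P) * (y + v / u) - N * P * (y / (u - P) + v / (1 - u * P))"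
    proof -
      have "a / b * (x - b * z - (b * w - y)) = a / b * (y + x) - a * (w + z)" if "b \<noteq> 0" for a b x y z w :: real
        using that by (simp add: field_simps)
      from this[OF nz(1)] show ?thesis .
    qed
    finally have fin: "(1 - u)\<^sup>2 / u * vterm n u = N * P / (1 - P) * (y + v / u) - N * P * (y / (u - P) + v / (1 - u * P))" .
    have "(1 / u) ^ Suc n = v / u" by (simp add: v_def)
    then show ?thesis unfolding fin N_def[symmetric] P_def[symmetric] y_def[symmetric] v_def[symmetric] by (simp only:)
  qed
  with sums_diff[OF V_sums1[OF u'] V_twist_sums[OF u]] show ?thesis by simp
qed

lemma tendsto_V_minus_V_twist:
  "((\<lambda>u. (V u - V_twist u) / ((1 - u)\<^sup>2 / u)) \<longlongrightarrow> sigma_cubic) (at_left 1)"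
proof -
  note idt = tendsto_ident_at[of 1 "{..<1::real}"]
  let ?c = "sqrt p"
  let ?b = "\<lambda>n. 2 * ((real (Suc n))\<^sup>2 * lorm (p ^ Suc n)) - real (Suc n) * (p ^ Suc n * (1 + p ^ Suc n) / (1 - p ^ Suc n) ^ 3)"
  let ?K = "6 / ((1 - p) * (1 - p) * (?c - p))"
  let ?M = "\<lambda>n. ?K * ((real (Suc n))\<^sup>2 * ?c ^ Suc n)"
  have "((\<lambda>u. \<Sum>n. vterm n u) \<longlongrightarrow> (\<Sum>n. ?b n)) (at_left 1)"
  proof (rule tendsto_suminf[where M = ?M])
    fix n
    define P where "P = p ^ Suc n"
    have P: "P < 1" using pow_less_1[of n] by (auto simp: P_def)
    have "((\<lambda>u. vterm n u) \<longlongrightarrow> real (Suc n) * P * 1 / ((1 - P) * (1 - 1 * P) * (1 - P)) *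
     ((1 / 1) ^ n * (\<Sum>i<2 * n + 1. 1 ^ i) - P * ((1 / 1) ^ Suc n * (\<Sum>i<2 * n + 3. 1 ^ i)))) (at_left 1)"
      unfolding vterm_def P_def[symmetric] using P by (intro tendsto_intros idt) auto
    moreover have "real (Suc n) * P * 1 / ((1 - P) * (1 - 1 * P) * (1 - P)) *
     ((1 / 1) ^ n * (\<Sum>i<2 * n + 1. 1 ^ i) - P * ((1 / 1) ^ Suc n * (\<Sum>i<2 * n + 3. 1 ^ i))) = ?b n"
    proof -
      have e: "real (2 * n + 1) = 2 * real (Suc n) - 1" "real (2 * n + 3) = 2 * real (Suc n) + 1" by auto
      have "N * P * 1 / ((1 - P) * (1 - 1 * P) * (1 - P)) * ((2 * N - 1) - P * (2 * N + 1)) =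
         2 * (N\<^sup>2 * (P / (1 - P)\<^sup>2)) - N * (P * (1 + P) / (1 - P) ^ 3)" for N
      proof -
        define Z where "Z = 1 - P"
        have Z: "Z \<noteq> 0" "P = 1 - Z" using P by (auto simp: Z_def)
        show ?thesis unfolding mult_1 Z_def[symmetric] using Z(1) unfolding Z(2)
          by (simp add: power2_eq_square power3_eq_cube field_simps)
      qed
      from this[of "real (Suc n)"] show ?thesis
        unfolding P_def[symmetric] lorm_def e[symmetric] by simp
    qed
    ultimately show "((\<lambda>u. vterm n u) \<longlongrightarrow> ?b n) (at_left 1)" by (simp only:)
  next
    show "summable ?M"
      using square_geometric_sums[of ?c] sqrt_p by (intro summable_mult) (auto simp: sums_iff)
    show "\<forall>\<^sub>F u in at_left 1. \<forall>n. norm (vterm n u) \<le> ?M n"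
      using eventually_at_left_1[OF sqrt_p(2)]
    proof eventually_elim
      case (elim u)
      have u: "u > 0" using elim sqrt_p by auto
      show ?case
      proof
        fix n
        define P where "P = p ^ Suc n"
        define v where "v = (1 / u) ^ n"
        have P: "0 < P" "P < 1" "P \<le> p" using pow_less_1[of n] pow_le_p[of n] p_pos by (auto simp: P_def)
        have g: "0 \<le> (\<Sum>i<m. u ^ i) \<and> (\<Sum>i<m. u ^ i) \<le> real m" for m
        proof -
          have "(\<Sum>i<m. u ^ i) \<le> (\<Sum>i<m. 1)" using elim u by (intro sum_mono) (auto intro: power_le_one)
          then show ?thesis using u by (auto intro: sum_nonneg)
        qed
        have v: "0 < v" "v \<le> (1 / u) ^ Suc n" "(1 / u) ^ Suc n > 0"
          using u elim by (auto simp: v_def field_simps)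
        have d1: "1 - P \<ge> 1 - p" "u - P \<ge> ?c - p" using P elim by auto
        have "u * P \<le> 1 * p" using P u elim by (intro mult_mono) auto
        then have d2: "1 - u * P \<ge> 1 - p" by simp
        have D: "(1 - p) * (1 - p) * (?c - p) \<le> (1 - P) * (1 - u * P) * (u - P)"
          using d1 d2 p_less_1 sqrt_p by (intro mult_mono) auto
        have D0: "(1 - p) * (1 - p) * (?c - p) > 0" using p_less_1 sqrt_p by simp
        define X where "X = (1 / u) ^ n * (\<Sum>i<2 * n + 1. u ^ i)"
        define Y where "Y = (1 / u) ^ Suc n * (\<Sum>i<2 * n + 3. u ^ i)"
        have X: "0 \<le> X" "X \<le> (1 / u) ^ Suc n * (3 * real (Suc n))"
        proof -
          show "0 \<le> X" using u g[of "2 * n + 1"] by (simp add: X_def)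
          have "X \<le> (1 / u) ^ Suc n * real (2 * n + 1)"
            unfolding X_def v_def[symmetric] using v g[of "2 * n + 1"] by (intro mult_mono) auto
          also have "\<dots> \<le> (1 / u) ^ Suc n * (3 * real (Suc n))" using v by (intro mult_left_mono) auto
          finally show "X \<le> (1 / u) ^ Suc n * (3 * real (Suc n))" .
        qed
        have Y: "0 \<le> Y" "Y \<le> (1 / u) ^ Suc n * (3 * real (Suc n))"
        proof -
          show "0 \<le> Y" using u g[of "2 * n + 3"] by (simp add: Y_def)
          have "Y \<le> (1 / u) ^ Suc n * real (2 * n + 3)"
            unfolding Y_def using v g[of "2 * n + 3"] by (intro mult_left_mono) auto
          also have "\<dots> \<le> (1 / u) ^ Suc n * (3 * real (Suc n))" using v by (intro mult_left_mono) auto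
          finally show "Y \<le> (1 / u) ^ Suc n * (3 * real (Suc n))" .
        qed
        have "P * Y \<le> 1 * Y" using P Y by (intro mult_right_mono) auto
        moreover have "0 \<le> P * Y" using P Y by simp
        moreover define Z where "Z = (1 / u) ^ Suc n * (3 * real (Suc n))"
        ultimately have "\<bar>X - P * Y\<bar> \<le> 2 * Z"
          using X Y unfolding Z_def[symmetric] by linarith
        moreover have "a * (6 * b) = 2 * (a * (3 * b))" for a b :: real by simp
        ultimately have XY: "\<bar>X - P * Y\<bar> \<le> (1 / u) ^ Suc n * (6 * real (Suc n))"
          unfolding Z_def by presburger
        have "norm (vterm n u) = real (Suc n) * P * u / ((1 - P) * (1 - u * P) * (u - P)) * \<bar>X - P * Y\<bar>"
        proof -
          have "1 - P > 0" "1 - u * P > 0" "u - P > 0" using d1 d2 p_less_1 sqrt_p by auto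
          then show ?thesis
            unfolding vterm_def P_def[symmetric] X_def[symmetric] Y_def[symmetric]
            using P u by (simp add: abs_mult)
        qed
        also have "\<dots> \<le> real (Suc n) * P * 1 / ((1 - p) * (1 - p) * (?c - p)) * ((1 / u) ^ Suc n * (6 * real (Suc n)))"
        proof (rule mult_mono)
          have "real (Suc n) * P * u \<le> real (Suc n) * P * 1"
            using P elim by (intro mult_left_mono) auto
          then show "real (Suc n) * P * u / ((1 - P) * (1 - u * P) * (u - P)) \<le> real (Suc n) * P * 1 / ((1 - p) * (1 - p) * (?c - p))"
            using P by (intro frac_le D D0) auto
          show "0 \<le> real (Suc n) * P * 1 / ((1 - p) * (1 - p) * (?c - p))"
            using P D0 by (intro divide_nonneg_nonneg) auto
        qed (use XY in auto)
        also have "\<dots> = ?K * ((real (Suc n))\<^sup>2 * (P * (1 / u) ^ Suc n))"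
          by (simp add: power2_eq_square)
        also have "P * (1 / u) ^ Suc n = (p / u) ^ Suc n" by (simp add: P_def power_divide)
        also have "?K * ((real (Suc n))\<^sup>2 * (p / u) ^ Suc n) \<le> ?K * ((real (Suc n))\<^sup>2 * (p / ?c) ^ Suc n)"
          using D0 p_pos u elim sqrt_p by (intro mult_left_mono power_mono divide_left_mono) auto
        finally show "norm (vterm n u) \<le> ?M n" using sqrt_p by simp
      qed
    qed
    show "at_left (1::real) \<noteq> bot" by simp
  qed
  \<comment> \<open>The two forms of \<open>sigma_cubic\<close> meet here: twice the one minus the
    other.\<close>
  moreover have "(\<Sum>n. ?b n) = 2 * sigma_cubic - sigma_cubic"
    using sums_diff[OF sums_mult[OF sigma_cubic_sums(2), of 2] sigma_cubic_sums(1)] by (simp add: sums_iff)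
  moreover have "\<forall>\<^sub>F u in at_left 1. (\<Sum>n. vterm n u) = (V u - V_twist u) / ((1 - u)\<^sup>2 / u)"
    using eventually_at_left_1[OF p_less_1]
  proof eventually_elim
    case (elim u)
    then have d: "(1 - u)\<^sup>2 / u \<noteq> 0" using p_pos by auto
    have "(\<lambda>n. (1 - u)\<^sup>2 / u * vterm n u / ((1 - u)\<^sup>2 / u)) sums ((V u - V_twist u) / ((1 - u)\<^sup>2 / u))"
      using elim by (intro sums_divide V_minus_V_twist) auto
    then show ?case using d by (simp add: sums_iff)
  qed
  ultimately show ?thesis by (auto intro: Lim_transform_eventually)
qed

text \<open>The quotient of Szego series is 1 + D X with X = Q + D rho, and T = 1 + D' Q + D'^2 tau.
  Since D' = 4 D + D^2, the fourth power and T agree to first order in D. At second order 4 rho + 6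
  X^2 - Q - 16 tau remains.\<close>

lemma tendsto_main_quotient:
  assumes r: "r > 0"
  defines "D \<equiv> \<lambda>u::real. (1 - u)\<^sup>2 / u"
  shows "((\<lambda>u. ((S u (r * u\<^sup>2) / S u (r * u)) ^ 4 / T (r * u\<^sup>2) (u\<^sup>2) - 1) / (D u)\<^sup>2) \<longlongrightarrow> 6 * Q2 r - Q r) (at_left 1)"
proof -
  note idt = tendsto_ident_at[of 1 "{..<1::real}"]
  define s where "s = (\<lambda>u. r * u\<^sup>2)"
  have sl: "(s \<longlongrightarrow> r) (at_left 1)"
  proof -
    have "(s \<longlongrightarrow> r * 1\<^sup>2) (at_left 1)" unfolding s_def by (intro tendsto_intros idt)
    then show ?thesis by simp
  qed
  have Ql: "((\<lambda>u. Q (s u)) \<longlongrightarrow> Q r) (at_left 1)" by (rule tendsto_Q[OF r sl])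
  have Dl: "(D \<longlongrightarrow> 0) (at_left 1)"
  proof -
    have "(D \<longlongrightarrow> (1 - 1)\<^sup>2 / 1) (at_left 1)" unfolding D_def by (intro tendsto_intros idt) auto
    then show ?thesis by simp
  qed
  define D' where "D' = (\<lambda>u::real. (1 - u\<^sup>2)\<^sup>2 / u\<^sup>2)"
  \<comment> \<open>From (1 - u^2)^2 / u^2 = D (1 + u)^2 / u and (1 + u)^2 / u = 4 + D.\<close>
  have D'D: "D' u = 4 * D u + (D u)\<^sup>2" if "u > 0" for u
    using that by (simp add: D'_def D_def power2_eq_square field_simps)
  have D'l: "(D' \<longlongrightarrow> 0) (at_left 1)"
  proof -
    have "(D' \<longlongrightarrow> (1 - 1\<^sup>2)\<^sup>2 / 1\<^sup>2) (at_left 1)" unfolding D'_def by (intro tendsto_intros idt) auto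
    then show ?thesis by simp
  qed
  define k where "k = (\<lambda>u. V_twist u - lorm u)"
  define d where "d = (\<lambda>u. (V u - V_twist u) / D u)"
  have dl: "(d \<longlongrightarrow> sigma_cubic) (at_left 1)" using tendsto_V_minus_V_twist by (simp add: d_def D_def)
  have ev: "\<forall>\<^sub>F u in at_left 1. p < u \<and> u < 1" by (rule eventually_at_left_1[OF p_less_1])
  have kl: "(k \<longlongrightarrow> 2 * sigma) (at_left 1)"
  proof -
    have "((\<lambda>u. (V u - lorm u) - D u * d u) \<longlongrightarrow> 2 * sigma - 0 * sigma_cubic) (at_left 1)"
      by (intro tendsto_intros tendsto_V_plus Dl dl)
    moreover have "\<forall>\<^sub>F u in at_left 1. (V u - lorm u) - D u * d u = k u"
      using ev
    proof eventually_elim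
      case (elim u)
      then have "D u \<noteq> 0" using p_pos by (auto simp: D_def)
      then show ?case by (simp add: d_def k_def)
    qed
    ultimately show ?thesis by (auto intro: Lim_transform_eventually)
  qed
  define rho where "rho = (\<lambda>u. (d u - k u * Q (s u)) / (1 + D u * k u))"
  \<comment> \<open>By \<open>Q_square\<close> this is (Q^2 - Q2) / 2, the common limit of rho and
    tau. The limit 6 Q^2 - Q - 12 w then reduces to 6 Q2 - Q.\<close>
  define w where "w = sigma_cubic - 2 * sigma * Q r"
  have rhol: "(rho \<longlongrightarrow> w) (at_left 1)"
  proof -
    have "(rho \<longlongrightarrow> (sigma_cubic - 2 * sigma * Q r) / (1 + 0 * (2 * sigma))) (at_left 1)"
      unfolding rho_def by (intro tendsto_intros dl kl Ql Dl) auto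
    then show ?thesis by (simp add: w_def)
  qed
  define tau where "tau = (\<lambda>u. (T (s u) (u\<^sup>2) - 1 - D' u * Q (s u)) / (D' u)\<^sup>2)"
  have taul: "(tau \<longlongrightarrow> w) (at_left 1)"
  proof -
    have "(tau \<longlongrightarrow> ((Q r)\<^sup>2 - Q2 r) / 2) (at_left 1)"
      unfolding tau_def D'_def
    proof (rule tendsto_T[OF r sl])
      show "\<forall>\<^sub>F u in at_left 1. u\<^sup>2 > 0 \<and> u\<^sup>2 \<noteq> (1::real)"
        using ev by eventually_elim (use p_pos in \<open>auto simp: power2_eq_1_iff\<close>)
      show "((\<lambda>u. (1 - u\<^sup>2)\<^sup>2 / u\<^sup>2) \<longlongrightarrow> 0) (at_left (1::real))"
        using D'l by (simp add: D'_def)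
    qed
    then show ?thesis using Q_square[OF r] by (simp add: w_def diff_divide_distrib mult.assoc)
  qed
  have Tl: "((\<lambda>u. 1 + D' u * Q (s u) + (D' u)\<^sup>2 * tau u) \<longlongrightarrow> 1 + 0 * Q r + 0\<^sup>2 * w) (at_left 1)"
    by (intro tendsto_intros D'l Ql taul)
  define X where "X = (\<lambda>u. Q (s u) + D u * rho u)"
  have Xl: "(X \<longlongrightarrow> Q r + 0 * w) (at_left 1)" unfolding X_def by (intro tendsto_intros Ql Dl rhol)
  have "((\<lambda>u. (4 * rho u + 6 * (X u)\<^sup>2 - Q (s u) - (4 + D u)\<^sup>2 * tau u + 4 * D u * X u ^ 3 + (D u)\<^sup>2 * X u ^ 4) / (1 + D' u * Q (s u) + (D' u)\<^sup>2 * tau u))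
     \<longlongrightarrow> (4 * w + 6 * (Q r + 0 * w)\<^sup>2 - Q r - (4 + 0)\<^sup>2 * w + 4 * 0 * (Q r + 0 * w) ^ 3 + 0\<^sup>2 * (Q r + 0 * w) ^ 4) / (1 + 0 * Q r + 0\<^sup>2 * w)) (at_left 1)"
    by (intro tendsto_divide Tl) (intro tendsto_intros rhol Xl Ql Dl taul, simp)
  also have "(4 * w + 6 * (Q r + 0 * w)\<^sup>2 - Q r - (4 + 0)\<^sup>2 * w + 4 * 0 * (Q r + 0 * w) ^ 3 + 0\<^sup>2 * (Q r + 0 * w) ^ 4) / (1 + 0 * Q r + 0\<^sup>2 * w) = 6 * Q2 r - Q r"
    using Q_square[OF r] by (simp add: w_def)
  finally have L: "((\<lambda>u. (4 * rho u + 6 * (X u)\<^sup>2 - Q (s u) - (4 + D u)\<^sup>2 * tau u + 4 * D u * X u ^ 3 + (D u)\<^sup>2 * X u ^ 4) / (1 + D' u * Q (s u) + (D' u)\<^sup>2 * tau u))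
     \<longlongrightarrow> 6 * Q2 r - Q r) (at_left 1)" .
  have Dk: "((\<lambda>u. 1 + D u * k u) \<longlongrightarrow> 1 + 0 * (2 * sigma)) (at_left 1)" by (intro tendsto_intros Dl kl)
  have "\<forall>\<^sub>F u in at_left 1. (4 * rho u + 6 * (X u)\<^sup>2 - Q (s u) - (4 + D u)\<^sup>2 * tau u + 4 * D u * X u ^ 3 + (D u)\<^sup>2 * X u ^ 4) / (1 + D' u * Q (s u) + (D' u)\<^sup>2 * tau u)
      = ((S u (r * u\<^sup>2) / S u (r * u)) ^ 4 / T (r * u\<^sup>2) (u\<^sup>2) - 1) / (D u)\<^sup>2"
    using ev order_tendstoD(1)[OF Dk, of 0, simplified] order_tendstoD(1)[OF Tl, of 0, simplified]
  proof eventually_elim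
    case (elim u)
    have u0: "u > 0" using elim p_pos by auto
    have Dn: "D u > 0" using elim u0 by (simp add: D_def)
    have D'n: "D' u > 0" using Dn D'D[OF u0] by (simp add: add_pos_pos)
    have lorm: "lorm u = 1 / D u" by (simp add: lorm_def D_def)
    have R: "S u (r * u\<^sup>2) / S u (r * u) = 1 + D u * X u"
    proof -
      have "S u (r * u\<^sup>2) / S u (r * u) = (Q (s u) + V u) / V_twist u"
        using S_quotient[OF _ _ r] elim by (simp add: s_def)
      also have "V_twist u = (1 + D u * k u) / D u" using Dn lorm by (simp add: k_def field_simps)
      also have "V u = D u * d u + (1 + D u * k u) / D u" using Dn lorm by (simp add: d_def k_def field_simps)
      also have "(Q (s u) + (D u * d u + (1 + D u * k u) / D u)) / ((1 + D u * k u) / D u) = 1 + D u * X u"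
      proof -
        have "(q + (D * d + K / D)) / (K / D) = 1 + D * (q + D * ((d - k * q) / K))"
          if "D > 0" "K > 0" "K = 1 + D * k" for q D d k K :: real
        proof -
          have "q * K = q + D * k * q" using that(3) by (simp add: algebra_simps)
          then have e: "q + D * ((d - k * q) / K) = (q + D * d) / K" using that(2) by (simp add: field_simps)
          show ?thesis unfolding e using that(1,2) by (simp add: field_simps)
        qed
        from this[OF Dn elim(2) refl] show ?thesis unfolding X_def rho_def .
      qed
      finally show ?thesis .
    qed
    have TT: "T (s u) (u\<^sup>2) = 1 + D' u * Q (s u) + (D' u)\<^sup>2 * tau u"
      using D'n by (simp add: tau_def)
    have poly: "(1 + D u * X u) ^ 4 - (1 + D' u * Q (s u) + (D' u)\<^sup>2 * tau u) =
       (D u)\<^sup>2 * (4 * rho u + 6 * (X u)\<^sup>2 - Q (s u) - (4 + D u)\<^sup>2 * tau u + 4 * D u * X u ^ 3 + (D u)\<^sup>2 * X u ^ 4)"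
    proof -
      have "(1 + a * x) ^ 4 - (1 + (4 * a + a\<^sup>2) * q + (4 * a + a\<^sup>2)\<^sup>2 * t) =
       a\<^sup>2 * (4 * ro + 6 * x\<^sup>2 - q - (4 + a)\<^sup>2 * t + 4 * a * x ^ 3 + a\<^sup>2 * x ^ 4)" if "x = q + a * ro" for a x q t ro :: real
      proof -
        have A: "(1 + a * x) ^ 4 = 1 + 4 * a * x + 6 * a\<^sup>2 * x\<^sup>2 + 4 * a ^ 3 * x ^ 3 + a ^ 4 * x ^ 4"
          by (simp add: power2_eq_square power3_eq_cube power4_eq_xxxx algebra_simps)
        have B: "4 * a * x = 4 * a * q + 4 * a\<^sup>2 * ro" unfolding that by (simp add: power2_eq_square algebra_simps)
        have C: "(4 * a + a\<^sup>2)\<^sup>2 = a\<^sup>2 * (4 + a)\<^sup>2" by (simp add: power2_eq_square algebra_simps)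
        show ?thesis
          unfolding A B C by (simp add: power2_eq_square power3_eq_cube power4_eq_xxxx algebra_simps)
      qed
      from this[OF X_def[THEN fun_cong]] show ?thesis unfolding D'D[OF u0] .
    qed
    have Tp: "1 + D' u * Q (s u) + (D' u)\<^sup>2 * tau u > 0" using elim(3) .
    have e: "T (r * u\<^sup>2) (u\<^sup>2) = T (s u) (u\<^sup>2)" by (simp add: s_def)
    have f: "((1 + D u * X u) ^ 4 / (1 + D' u * Q (s u) + (D' u)\<^sup>2 * tau u) - 1) =
       ((1 + D u * X u) ^ 4 - (1 + D' u * Q (s u) + (D' u)\<^sup>2 * tau u)) / (1 + D' u * Q (s u) + (D' u)\<^sup>2 * tau u)"
      using Tp by (simp add: diff_divide_distrib)
    show ?case
      unfolding R e TT f poly using Dn by simp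
  qed
  with L show ?thesis by (rule Lim_transform_eventually)
qed

text \<open>The correlation function in u = x^2: the fourth powers come from the determinant of
  squared kernels, the denominator from the two equal one-point functions.\<close>

definition Greal :: "real \<Rightarrow> real \<Rightarrow> real" where
  "Greal u r = ((S u (r * u\<^sup>2)) ^ 4 - (S (- u) (r * u\<^sup>2)) ^ 4) / ((S u (r * u)) ^ 4 * T (r * u\<^sup>2) (u\<^sup>2))"

text \<open>The off-diagonal kernel stays bounded while the diagonal one grows like 1 / (1 - u). Its
  fourth power therefore enters only at order (1 - u)^4, with the coefficient - B^4 = - (Q 1 - Q
  r)^2.\<close>

lemma tendsto_Greal:
  assumes r: "r > 0"
  shows "((\<lambda>u. (Greal u r - 1) / (1 - u) ^ 4) \<longlongrightarrow> 6 * Q2 r - Q r - (Q 1 - Q r)\<^sup>2) (at_left 1)"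
proof -
  note idt = tendsto_ident_at[of 1 "{..<1::real}"]
  let ?D = "\<lambda>u::real. (1 - u)\<^sup>2 / u"
  have l1: "((\<lambda>u. r * u) \<longlongrightarrow> r) (at_left 1)"
    using tendsto_mult[OF tendsto_const idt, of r] by simp
  have l2: "((\<lambda>u. r * u\<^sup>2) \<longlongrightarrow> r) (at_left 1)"
    using tendsto_mult[OF tendsto_const tendsto_power[OF idt], of r 2] by simp
  have T1: "((\<lambda>u. T (r * u\<^sup>2) (u\<^sup>2)) \<longlongrightarrow> 1) (at_left 1)"
  proof -
    let ?d = "\<lambda>u::real. (1 - u\<^sup>2)\<^sup>2 / u\<^sup>2"
    have dl: "(?d \<longlongrightarrow> 0) (at_left 1)"
    proof -
      have "(?d \<longlongrightarrow> (1 - 1\<^sup>2)\<^sup>2 / 1\<^sup>2) (at_left 1)" by (intro tendsto_intros idt) auto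
      then show ?thesis by simp
    qed
    have ev: "\<forall>\<^sub>F u in at_left 1. u\<^sup>2 > 0 \<and> u\<^sup>2 \<noteq> (1::real)"
      using eventually_at_left_1[OF p_less_1] by eventually_elim (use p_pos in \<open>auto simp: power2_eq_1_iff\<close>)
    have "((\<lambda>u. 1 + ?d u * Q (r * u\<^sup>2) + (?d u)\<^sup>2 * ((T (r * u\<^sup>2) (u\<^sup>2) - 1 - ?d u * Q (r * u\<^sup>2)) / (?d u)\<^sup>2))
        \<longlongrightarrow> 1 + 0 * Q r + 0\<^sup>2 * (((Q r)\<^sup>2 - Q2 r) / 2)) (at_left 1)"
      by (intro tendsto_intros dl tendsto_Q[OF r l2] tendsto_T[OF r l2 ev dl])
    moreover have "\<forall>\<^sub>F u in at_left 1. 1 + ?d u * Q (r * u\<^sup>2) + (?d u)\<^sup>2 * ((T (r * u\<^sup>2) (u\<^sup>2) - 1 - ?d u * Q (r * u\<^sup>2)) / (?d u)\<^sup>2) = T (r * u\<^sup>2) (u\<^sup>2)"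
      using ev by eventually_elim simp
    ultimately show ?thesis by (auto intro: Lim_transform_eventually)
  qed
  \<comment> \<open>The factor 1 / u^2 converts the scale D^2 = (1 - u)^4 / u^2 into (1 -
    u)^4.\<close>
  have "((\<lambda>u. ((S u (r * u\<^sup>2) / S u (r * u)) ^ 4 / T (r * u\<^sup>2) (u\<^sup>2) - 1) / (?D u)\<^sup>2 * (1 / u\<^sup>2)
     - S (- u) (r * u\<^sup>2) ^ 4 / (((1 - u) * S u (r * u)) ^ 4 * T (r * u\<^sup>2) (u\<^sup>2)))
     \<longlongrightarrow> (6 * Q2 r - Q r) * (1 / 1\<^sup>2) - B r ^ 4 / (1 ^ 4 * 1)) (at_left 1)"
    by (intro tendsto_intros tendsto_main_quotient r tendsto_B[OF r l2] tendsto_S_pole[OF r l1] idt T1) auto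
  also have "B r ^ 4 = (Q 1 - Q r)\<^sup>2"
    using B_square[OF r] by (metis power2_eq_square power4_eq_xxxx mult.assoc)
  finally have "((\<lambda>u. ((S u (r * u\<^sup>2) / S u (r * u)) ^ 4 / T (r * u\<^sup>2) (u\<^sup>2) - 1) / (?D u)\<^sup>2 * (1 / u\<^sup>2)
     - S (- u) (r * u\<^sup>2) ^ 4 / (((1 - u) * S u (r * u)) ^ 4 * T (r * u\<^sup>2) (u\<^sup>2)))
     \<longlongrightarrow> 6 * Q2 r - Q r - (Q 1 - Q r)\<^sup>2) (at_left 1)" by simp
  moreover have "\<forall>\<^sub>F u in at_left 1. ((S u (r * u\<^sup>2) / S u (r * u)) ^ 4 / T (r * u\<^sup>2) (u\<^sup>2) - 1) / (?D u)\<^sup>2 * (1 / u\<^sup>2)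
     - S (- u) (r * u\<^sup>2) ^ 4 / (((1 - u) * S u (r * u)) ^ 4 * T (r * u\<^sup>2) (u\<^sup>2)) = (Greal u r - 1) / (1 - u) ^ 4"
    using eventually_at_left_1[OF p_less_1]
  proof eventually_elim
    case (elim u)
    have u0: "u > 0" using elim p_pos by auto
    define a where "a = S u (r * u\<^sup>2)"
    define b where "b = S (- u) (r * u\<^sup>2)"
    define c where "c = S u (r * u)"
    define t where "t = T (r * u\<^sup>2) (u\<^sup>2)"
    define h where "h = 1 - u"
    have "((a / c) ^ 4 / t - 1) / (h\<^sup>2 / u)\<^sup>2 * (1 / u\<^sup>2) - b ^ 4 / ((h * c) ^ 4 * t) =
      ((a ^ 4 - b ^ 4) / (c ^ 4 * t) - 1) / h ^ 4"
    proof -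
      have "((a / c) ^ 4 / t - 1) / (h\<^sup>2 / u)\<^sup>2 * (1 / u\<^sup>2) = (a ^ 4 / (c ^ 4 * t) - 1) / h ^ 4"
        using u0 by (simp add: power_divide)
      moreover have "b ^ 4 / ((h * c) ^ 4 * t) = b ^ 4 / (c ^ 4 * t) / h ^ 4"
        by (simp add: power_mult_distrib)
      ultimately show ?thesis
        by (simp add: diff_divide_distrib)
    qed
    then show ?case unfolding Greal_def a_def b_def c_def t_def h_def .
  qed
  ultimately show ?thesis by (rule Lim_transform_eventually)
qed

end

subsection \<open>Lattice sums\<close>

text \<open>The logarithmic derivative of the reflection formula for Gamma. One more differentiation
  gives the bilateral sum of 1 / (z + m)^2, since Polygamma 1 at z and at 1 - z are its two
  halves.\<close>

lemma Digamma_reflection: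
  fixes z :: complex
  assumes "z \<notin> \<int>"
  shows "Digamma z - Digamma (1 - z) = - (of_real pi * (cos (of_real pi * z) / sin (of_real pi * z)))"
proof -
  have z1: "1 - z \<notin> \<int>" using assms by (metis Ints_1 Ints_diff diff_diff_eq2 add_diff_cancel_left')
  have nz: "sin (of_real pi * z) \<noteq> 0"
    using assms by (auto simp: sin_eq_0 mult.commute)
  have np: "z \<notin> \<int>\<^sub>\<le>\<^sub>0" "1 - z \<notin> \<int>\<^sub>\<le>\<^sub>0" using assms z1 nonpos_Ints_Int by blast+
  have d1: "((\<lambda>z. Gamma z * Gamma (1 - z)) has_field_derivative
      (Gamma z * Digamma z) * Gamma (1 - z) + Gamma z * (Gamma (1 - z) * Digamma (1 - z) * (- 1))) (at z)"
    using np by (auto intro!: derivative_eq_intros)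
  have d2: "((\<lambda>z. of_real pi / sin (of_real pi * z)) has_field_derivative
      - (of_real pi * (cos (of_real pi * z) * of_real pi)) / (sin (of_real pi * z))\<^sup>2) (at z)"
    using nz by (auto intro!: derivative_eq_intros simp: power2_eq_square)
  have "(\<lambda>z::complex. Gamma z * Gamma (1 - z)) = (\<lambda>z. of_real pi / sin (of_real pi * z))"
    by (rule ext) (rule Gamma_reflection_complex)
  with DERIV_unique[OF d1] d2 have "Gamma z * Gamma (1 - z) * (Digamma z - Digamma (1 - z)) =
      - (of_real pi * (cos (of_real pi * z) * of_real pi)) / (sin (of_real pi * z))\<^sup>2"
    by (auto simp: algebra_simps)
  then have "of_real pi / sin (of_real pi * z) * (Digamma z - Digamma (1 - z)) =
      of_real pi / sin (of_real pi * z) * - (of_real pi * (cos (of_real pi * z) / sin (of_real pi * z)))"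
    unfolding Gamma_reflection_complex using nz by (simp add: power2_eq_square)
  then show ?thesis
    using nz by (subst (asm) mult_cancel_left) auto
qed

lemma Polygamma_1_reflection:
  fixes z :: complex
  assumes "z \<notin> \<int>"
  shows "Polygamma 1 z + Polygamma 1 (1 - z) = (of_real pi / sin (of_real pi * z))\<^sup>2"
proof -
  have z1: "1 - z \<notin> \<int>" using assms by (metis Ints_1 Ints_diff diff_diff_eq2 add_diff_cancel_left')
  have nz: "sin (of_real pi * z) \<noteq> 0"
    using assms by (auto simp: sin_eq_0 mult.commute)
  have np: "z \<notin> \<int>\<^sub>\<le>\<^sub>0" "1 - z \<notin> \<int>\<^sub>\<le>\<^sub>0" using assms z1 nonpos_Ints_Int by blast+
  have d1: "((\<lambda>z. Digamma z - Digamma (1 - z)) has_field_derivative Polygamma 1 z - Polygamma 1 (1 - z) * (- 1)) (at z)"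
    using np by (auto intro!: derivative_eq_intros)
  have d2: "((\<lambda>z. - (of_real pi * (cos (of_real pi * z) / sin (of_real pi * z)))) has_field_derivative
     - (of_real pi * (((- sin (of_real pi * z) * of_real pi) * sin (of_real pi * z) - cos (of_real pi * z) * (cos (of_real pi * z) * of_real pi)) / (sin (of_real pi * z) * sin (of_real pi * z))))) (at z)"
    by (rule derivative_eq_intros refl nz | simp add: algebra_simps)+
  have op: "open (- \<int> :: complex set)" using closed_Ints by (simp add: open_Compl)
  have "((\<lambda>z. - (of_real pi * (cos (of_real pi * z) / sin (of_real pi * z)))) has_field_derivative Polygamma 1 z - Polygamma 1 (1 - z) * (- 1)) (at z)"
    by (rule has_field_derivative_transform_within_open[OF d1 op]) (use assms Digamma_reflection in auto)
  from DERIV_unique[OF this d2]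
  have "Polygamma 1 z + Polygamma 1 (1 - z) = - (of_real pi * (((- sin (of_real pi * z) * of_real pi) * sin (of_real pi * z) - cos (of_real pi * z) * (cos (of_real pi * z) * of_real pi)) / (sin (of_real pi * z) * sin (of_real pi * z))))"
    by simp
  also have "\<dots> = of_real pi ^ 2 * ((sin (of_real pi * z))\<^sup>2 + (cos (of_real pi * z))\<^sup>2) / (sin (of_real pi * z))\<^sup>2"
  proof -
    have "- (a * (((- s * a) * s - c * (c * a)) / (s * s))) = a ^ 2 * (s\<^sup>2 + c\<^sup>2) / s\<^sup>2" for a s c :: complex
    proof -
      have "- (a * ((- s * a) * s - c * (c * a))) = a ^ 2 * (s\<^sup>2 + c\<^sup>2)"
        by (simp add: power2_eq_square algebra_simps)
      then show ?thesis by (simp only: power2_eq_square times_divide_eq_right minus_divide_left)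
    qed
    then show ?thesis .
  qed
  also have "(sin (of_real pi * z))\<^sup>2 + (cos (of_real pi * z))\<^sup>2 = 1"
    by (rule sin_cos_squared_add)
  finally show ?thesis by (simp add: power_divide)
qed

lemma inverse_square_summable:
  fixes z :: complex
  shows "summable (\<lambda>k. norm (1 / (z + of_nat k)\<^sup>2))"
proof (rule summable_comparison_test_ev)
  show "summable (\<lambda>k. 4 * (1 / (real k)\<^sup>2))"
    by (intro summable_mult) (use inverse_power_summable[of 2, where 'a = real] in \<open>simp add: inverse_eq_divide\<close>)
  obtain N :: nat where N: "2 * norm z + 1 \<le> real N" using real_arch_simple by blast
  show "\<forall>\<^sub>F k in sequentially. norm (norm (1 / (z + of_nat k)\<^sup>2)) \<le> 4 * (1 / (real k)\<^sup>2)"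
    using eventually_ge_at_top[of N]
  proof eventually_elim
    case (elim k)
    have k: "2 * norm z + 1 \<le> real k" using N elim by (meson of_nat_le_iff order_trans)
    have "norm (z + of_nat k) \<ge> norm (of_nat k :: complex) - norm z" by (metis add.commute norm_diff_ineq)
    then have "norm (z + of_nat k) \<ge> real k / 2" using k by simp
    moreover have "real k > 0" using k norm_ge_zero[of z] by linarith
    ultimately have "(real k / 2)\<^sup>2 \<le> (norm (z + of_nat k))\<^sup>2" by (intro power_mono) auto
    then have "1 / (norm (z + of_nat k))\<^sup>2 \<le> 1 / (real k / 2)\<^sup>2"
      using \<open>real k > 0\<close> by (intro divide_left_mono mult_pos_pos) (auto intro!: zero_less_power order_less_le_trans[of 0 "(real k / 2)\<^sup>2"])
    then show ?case by (simp add: norm_divide norm_power power_divide)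
  qed
qed

lemma inverse_square_has_sum_int:
  fixes z :: complex
  assumes "z \<notin> \<int>"
  shows "((\<lambda>m::int. 1 / (z + of_int m)\<^sup>2) has_sum (of_real pi / sin (of_real pi * z))\<^sup>2) UNIV"
proof -
  have z1: "1 - z \<notin> \<int>" using assms by (metis Ints_1 Ints_diff diff_diff_eq2 add_diff_cancel_left')
  have P: "(\<lambda>k. 1 / (x + of_nat k)\<^sup>2) sums Polygamma 1 x" if "x \<notin> \<int>" for x :: complex
  proof -
    have "x \<noteq> 0" using that by auto
    from Polygamma_LIMSEQ[OF this, of 1] show ?thesis
      by (simp add: inverse_eq_divide power2_eq_square)
  qed
  have H: "((\<lambda>k. 1 / (x + of_nat k)\<^sup>2) has_sum Polygamma 1 x) UNIV" if "x \<notin> \<int>" for x :: complex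
    by (rule norm_summable_imp_has_sum[OF inverse_square_summable P[OF that]])
  have A: "((\<lambda>m::int. 1 / (z + of_int m)\<^sup>2) has_sum Polygamma 1 z) (range int)"
    using H[OF assms] by (subst has_sum_reindex) (auto simp: o_def)
  have e: "(z + of_int (- int (Suc k)))\<^sup>2 = (1 - z + of_nat k)\<^sup>2" for k
    by (simp add: power2_eq_square algebra_simps)
  have B: "((\<lambda>m::int. 1 / (z + of_int m)\<^sup>2) has_sum Polygamma 1 (1 - z)) (range (\<lambda>n. - int (Suc n)))"
    using H[OF z1] by (subst has_sum_reindex) (auto simp: o_def e inj_on_def simp del: of_int_minus of_nat_Suc)
  have "((\<lambda>m::int. 1 / (z + of_int m)\<^sup>2) has_sum (Polygamma 1 z + Polygamma 1 (1 - z))) UNIV"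
    unfolding int_UNIV_split by (rule has_sum_Un_disjoint[OF A B]) auto
  then show ?thesis unfolding Polygamma_1_reflection[OF assms] .
qed

text \<open>The row sum in the multiplicative variable exp(i a): after scaling by 2 pi, sin^2 is
  expressed through E = exp(i a / 2). The value is - lorm at exp(i a).\<close>

lemma inverse_square_row_has_sum:
  fixes a :: complex
  assumes "exp (\<i> * a) \<noteq> 1"
  shows "((\<lambda>m::int. 1 / (a - 2 * of_real pi * of_int m)\<^sup>2) has_sum - (exp (\<i> * a) / (1 - exp (\<i> * a))\<^sup>2)) UNIV"
proof -
  define y where "y = a / (2 * of_real pi)"
  define E where "E = exp (\<i> * a / 2)"
  have a: "a = 2 * of_real pi * y" by (simp add: y_def)
  have y: "y \<notin> \<int>"
  proof
    assume "y \<in> \<int>"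
    then obtain k where "y = of_int k" by (auto elim: Ints_cases)
    then have "\<i> * a = of_int (2 * k) * (of_real pi * \<i>)" by (simp add: a)
    then have "exp (\<i> * a) = 1" by (simp add: exp_eq_1)
    with assms show False by simp
  qed
  have "((\<lambda>m::int. 1 / (y + of_int m)\<^sup>2) has_sum (of_real pi / sin (of_real pi * y))\<^sup>2) UNIV"
    by (rule inverse_square_has_sum_int[OF y])
  then have "((\<lambda>m::int. 1 / (y + of_int (- m))\<^sup>2) has_sum (of_real pi / sin (of_real pi * y))\<^sup>2) UNIV"
    by (rule has_sum_reindex_bij_betw[where g = uminus, THEN iffD2, rotated]) (auto intro!: bij_betwI[where g = uminus])
  then have "((\<lambda>m::int. (1 / (2 * of_real pi)\<^sup>2) * (1 / (y + of_int (- m))\<^sup>2)) has_sum (1 / (2 * of_real pi)\<^sup>2) * (of_real pi / sin (of_real pi * y))\<^sup>2) UNIV"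
    by (rule has_sum_cmult_right)
  moreover have "(1 / (2 * of_real pi)\<^sup>2) * (1 / (y + of_int (- m))\<^sup>2) = 1 / (a - 2 * of_real pi * of_int m)\<^sup>2" for m
  proof -
    have e: "a - 2 * of_real pi * of_int m = 2 * of_real pi * (y - of_int m)"
      by (simp add: a right_diff_distrib)
    show ?thesis unfolding e power_mult_distrib by simp
  qed
  moreover have "(1 / (2 * of_real pi)\<^sup>2) * (of_real pi / sin (of_real pi * y))\<^sup>2 = - (exp (\<i> * a) / (1 - exp (\<i> * a))\<^sup>2)"
  proof -
    have E0: "E \<noteq> 0" by (simp add: E_def)
    have EE: "exp (\<i> * a) = E\<^sup>2" unfolding E_def by (simp add: power2_eq_square exp_add[symmetric])
    have "sin (of_real pi * y) = (E - 1 / E) / (2 * \<i>)"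
    proof -
      have "\<i> * (of_real pi * y) = \<i> * a / 2" by (simp add: a)
      then have e: "exp (\<i> * (of_real pi * y)) = E" by (simp only: E_def)
      show ?thesis
        by (simp only: sin_exp_eq exp_minus inverse_eq_divide e)
    qed
    then have s: "(sin (of_real pi * y))\<^sup>2 = - (1 - E\<^sup>2)\<^sup>2 / (4 * E\<^sup>2)"
      using E0 by (simp add: power_divide power_mult_distrib) (simp add: field_simps power2_eq_square)
    have "(1 / (2 * of_real pi)\<^sup>2) * (of_real pi / sin (of_real pi * y))\<^sup>2 = 1 / (4 * (sin (of_real pi * y))\<^sup>2)"
      by (simp add: power_divide power_mult_distrib)
    also have "\<dots> = - (E\<^sup>2 / (1 - E\<^sup>2)\<^sup>2)"
      unfolding s using E0 by simp
    finally show ?thesis unfolding EE .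
  qed
  ultimately show ?thesis by simp
qed

text \<open>The exponent is half of 3: from (1 + |m|)(1 + |n|) <= 4 (m^2 + n^2) the cubic decay over
  the lattice is dominated by a product of two such factors.\<close>

lemma powr_three_halves_summable_int: "(\<lambda>m::int. (1 + \<bar>real_of_int m\<bar>) powr (- (3 / 2))) summable_on UNIV"
proof -
  have "summable (\<lambda>n. real n powr (- (3 / 2)))" by (simp add: summable_real_powr_iff)
  then have s: "summable (\<lambda>n. real (Suc n) powr (- (3 / 2)))" by (subst summable_Suc_iff)
  then have s': "summable (\<lambda>n. real (Suc (Suc n)) powr (- (3 / 2)))" by (subst summable_Suc_iff)
  show ?thesis
  proof (rule summable_on_int_split)
    show "(\<lambda>n. (1 + \<bar>real_of_int (int n)\<bar>) powr (- (3 / 2))) summable_on UNIV"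
      using s by (subst summable_on_UNIV_nonneg_real_iff) (auto simp: add_ac)
    show "(\<lambda>n. (1 + \<bar>real_of_int (- int (Suc n))\<bar>) powr (- (3 / 2))) summable_on UNIV"
      using s' by (subst summable_on_UNIV_nonneg_real_iff) (auto simp: add_ac)
  qed
qed

lemma lattice_pt_eq: "lattice_pt q (m, n) = Complex (2 * pi * of_int m) (- 2 * ln q * of_int n)"
  by (simp add: lattice_pt_def tau_def complex_eq_iff)

lemma lattice_summable:
  assumes q: "0 < q" "q < 1"
  shows "(\<lambda>x. 1 / (w - lattice_pt q x)\<^sup>2 - 1 / (lattice_pt q x)\<^sup>2) summable_on UNIV"
proof -
  let ?t = "\<lambda>x. 1 / (w - lattice_pt q x)\<^sup>2 - 1 / (lattice_pt q x)\<^sup>2"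
  define c where "c = min (2 * pi) (- 2 * ln q)"
  have c: "c > 0" using q by (auto simp: c_def)
  have norm_ge: "c\<^sup>2 * ((of_int m)\<^sup>2 + (of_int n)\<^sup>2) \<le> (norm (lattice_pt q (m, n)))\<^sup>2" for m n
  proof -
    have "c\<^sup>2 \<le> (2 * pi)\<^sup>2" "c\<^sup>2 \<le> (- 2 * ln q)\<^sup>2"
      using c by (intro power_mono; simp add: c_def)+
    then have "c\<^sup>2 * (of_int m)\<^sup>2 + c\<^sup>2 * (of_int n)\<^sup>2 \<le> (2 * pi)\<^sup>2 * (of_int m)\<^sup>2 + (- 2 * ln q)\<^sup>2 * (of_int n)\<^sup>2"
      by (intro add_mono mult_right_mono) auto
    then show ?thesis
      unfolding lattice_pt_eq by (simp add: cmod_power2 power_mult_distrib distrib_left)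
  qed
  \<comment> \<open>Outside this finite set |l| >= 2 |w|, so w - l is at least |l| / 2 in modulus
    and the difference of inverse squares is O(|l|^(-3)).\<close>
  define F where "F = {x. norm (lattice_pt q x) < 2 * norm w \<or> x = (0, 0)}"
  have finF: "finite F"
  proof -
    obtain k :: nat where k: "2 * norm w / c \<le> real k" using real_arch_simple by blast
    have "F \<subseteq> {- int k..int k} \<times> {- int k..int k}"
    proof
      fix x assume "x \<in> F"
      obtain m n where x: "x = (m, n)" by (cases x)
      show "x \<in> {- int k..int k} \<times> {- int k..int k}"
      proof (cases "x = (0, 0)")
        case False
        with \<open>x \<in> F\<close> have l: "norm (lattice_pt q (m, n)) < 2 * norm w" by (auto simp: F_def x)
        have b: "\<bar>real_of_int j\<bar> \<le> real k" if "(real_of_int j)\<^sup>2 \<le> (of_int m)\<^sup>2 + (of_int n)\<^sup>2" for j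
        proof -
          have "(c * \<bar>of_int j\<bar>)\<^sup>2 \<le> (norm (lattice_pt q (m, n)))\<^sup>2"
            using order_trans[OF mult_left_mono[OF that, of "c\<^sup>2"] norm_ge[of m n]] by (simp add: power_mult_distrib)
          then have "c * \<bar>of_int j\<bar> \<le> norm (lattice_pt q (m, n))"
            by (rule power2_le_imp_le) simp
          then have "\<bar>of_int j\<bar> \<le> 2 * norm w / c" using c l by (simp add: field_simps)
          with k show ?thesis by linarith
        qed
        have "\<bar>real_of_int m\<bar> \<le> real k" "\<bar>real_of_int n\<bar> \<le> real k" by (rule b; simp)+
        then have "\<bar>m\<bar> \<le> int k" "\<bar>n\<bar> \<le> int k" by linarith+
        then show ?thesis by (auto simp: x)
      qed auto
    qed
    then show ?thesis by (rule finite_subset) auto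
  qed
  let ?b = "\<lambda>(m::int, n::int). (1 + \<bar>real_of_int m\<bar>) powr (- (3 / 2)) * (1 + \<bar>real_of_int n\<bar>) powr (- (3 / 2))"
  \<comment> \<open>The 12 is 3 divided by (1/2)^2, from the bounds on 2 l - w and w - l. The 8
    offsets (4 N^2)^(3/2) = 8 N^3, and c^3 comes from |l| >= c N.\<close>
  define K where "K = 12 * norm w * (8 / c ^ 3)"
  have bs: "(\<lambda>x. K * ?b x) summable_on UNIV"
  proof -
    have "(\<lambda>x. norm (?b x)) summable_on (UNIV \<times> UNIV)"
      by (subst Infinite_Sum.abs_summable_on_Sigma_iff)
        (auto simp: abs_mult infsum_cmult_right' intro!: summable_on_cmult_right summable_on_cmult_left powr_three_halves_summable_int)
    then have "?b summable_on (UNIV \<times> UNIV)" by (rule abs_summable_summable)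
    then show ?thesis by (intro summable_on_cmult_right) simp
  qed
  have "?t summable_on (- F)"
  proof (rule abs_summable_summable, rule summable_on_comparison_test[OF summable_on_subset_banach[OF bs subset_UNIV]])
    fix x assume "x \<in> - F"
    obtain m n where x: "x = (m, n)" by (cases x)
    define l where "l = lattice_pt q x"
    define N where "N = sqrt ((of_int m)\<^sup>2 + (of_int n)\<^sup>2)"
    have l: "2 * norm w \<le> norm l" and mn: "(m, n) \<noteq> (0, 0)" using \<open>x \<in> - F\<close> by (auto simp: F_def l_def x)
    have Z1: "1 \<le> m\<^sup>2 + n\<^sup>2"
    proof -
      have "m\<^sup>2 + n\<^sup>2 \<noteq> 0" using mn by (simp add: sum_power2_eq_zero_iff)
      moreover have "m\<^sup>2 + n\<^sup>2 \<ge> 0" by simp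
      ultimately show ?thesis by linarith
    qed
    have N2: "N\<^sup>2 = (of_int m)\<^sup>2 + (of_int n)\<^sup>2" by (simp add: N_def)
    have "real_of_int 1 \<le> real_of_int (m\<^sup>2 + n\<^sup>2)" using Z1 by (simp only: of_int_le_iff)
    then have N1: "1 \<le> N\<^sup>2" unfolding N2 by simp
    have N0: "N > 0" using N1 by (simp add: N_def zero_less_power2)
    have cN: "c * N \<le> norm l"
    proof -
      have "(c * N)\<^sup>2 \<le> (norm l)\<^sup>2" using norm_ge[of m n] by (simp add: l_def x N2 power_mult_distrib)
      then show ?thesis by (rule power2_le_imp_le) simp
    qed
    have l0: "norm l > 0" using cN c N0 by (smt (verit) mult_pos_pos)
    have wl: "norm (w - l) \<ge> norm l / 2"
      using norm_triangle_ineq2[of l w] l by (simp add: norm_minus_commute)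
    have lw: "norm (2 * l - w) \<le> 3 * norm l"
    proof -
      have "norm (2 * l) = 2 * norm l" by (simp add: norm_mult)
      then show ?thesis using norm_triangle_ineq4[of "2 * l" w] l norm_ge_zero[of w] by linarith
    qed
    have nz: "l \<noteq> 0" "w - l \<noteq> 0" using l0 wl by auto
    have "1 / (w - l)\<^sup>2 - 1 / l\<^sup>2 = w * (2 * l - w) / ((w - l)\<^sup>2 * l\<^sup>2)"
    proof -
      have "1 / (w - l)\<^sup>2 - 1 / l\<^sup>2 = (l\<^sup>2 - (w - l)\<^sup>2) / ((w - l)\<^sup>2 * l\<^sup>2)"
        using nz by (simp add: diff_frac_eq)
      also have "l\<^sup>2 - (w - l)\<^sup>2 = w * (2 * l - w)" by (simp add: power2_eq_square algebra_simps)
      finally show ?thesis .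
    qed
    then have "norm (1 / (w - l)\<^sup>2 - 1 / l\<^sup>2) = norm w * norm (2 * l - w) / ((norm (w - l))\<^sup>2 * (norm l)\<^sup>2)"
      by (simp add: norm_mult norm_divide norm_power)
    also have "\<dots> \<le> norm w * (3 * norm l) / ((norm l / 2)\<^sup>2 * (norm l)\<^sup>2)"
      using lw wl l0 by (intro frac_le mult_left_mono mult_right_mono power_mono mult_nonneg_nonneg) auto
    also have "\<dots> = 12 * norm w / norm l ^ 3"
      using l0 by (simp add: power2_eq_square power3_eq_cube)
    also have "\<dots> \<le> 12 * norm w / (c * N) ^ 3"
    proof (intro divide_left_mono power_mono mult_pos_pos zero_less_power)
      show "c * N \<le> norm l" "0 \<le> c * N" "0 < c" "0 < N" "0 < norm l" "0 \<le> 12 * norm w"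
        using cN c N0 l0 by auto
    qed
    also have "\<dots> = K * (1 / (8 * N ^ 3))" by (simp add: K_def power_mult_distrib)
    also have "\<dots> \<le> K * ?b x"
    proof (rule mult_left_mono)
      let ?X = "(1 + \<bar>real_of_int m\<bar>) * (1 + \<bar>real_of_int n\<bar>)"
      have "\<bar>real_of_int j\<bar> \<le> (real_of_int j)\<^sup>2" for j
      proof -
        have "\<bar>j\<bar> * 1 \<le> \<bar>j\<bar> * \<bar>j\<bar>"
        proof (cases "j = 0")
          case False
          then show ?thesis by (intro mult_left_mono) simp_all
        qed simp
        then have "\<bar>j\<bar> \<le> j\<^sup>2" by (simp add: power2_eq_square)
        then have "real_of_int \<bar>j\<bar> \<le> real_of_int (j\<^sup>2)" by (simp only: of_int_le_iff)
        then show ?thesis by simp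
      qed
      from this[of m] this[of n] N1 have "?X \<le> 4 * N\<^sup>2"
        using sum_squares_bound[of "\<bar>real_of_int m\<bar>" "\<bar>real_of_int n\<bar>"] unfolding N2
        by (simp add: algebra_simps)
      moreover have X0: "?X > 0" by (intro mult_pos_pos) auto
      ultimately have "?X powr (3 / 2) \<le> (4 * N\<^sup>2) powr (3 / 2)"
        by (intro powr_mono2) auto
      also have "4 * N\<^sup>2 = (2 * N) powr 2" using N0 by (simp add: powr_numeral power_mult_distrib)
      also have "\<dots> powr (3 / 2) = (2 * N) powr 3" by (simp add: powr_powr)
      also have "\<dots> = 8 * N ^ 3" using N0 by (simp add: powr_numeral power_mult_distrib)
      finally have "1 / (8 * N ^ 3) \<le> 1 / ?X powr (3 / 2)"
        using X0 N0 by (intro divide_left_mono mult_pos_pos) auto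
      also have "\<dots> = ?b x" using X0 by (simp add: x powr_minus_divide powr_mult)
      finally show "1 / (8 * N ^ 3) \<le> ?b x" .
      show "K \<ge> 0" using c by (simp add: K_def)
    qed
    finally show "norm (?t x) \<le> K * ?b x" unfolding l_def .
  qed auto
  then have "?t summable_on (- F \<union> F)"
    using finF by (intro summable_on_Un_disjoint) auto
  then show ?thesis by simp
qed

text \<open>Twice zeta(2) / (2 pi)^2. The index m = 0 contributes nothing because 1 / 0 = 0.\<close>

lemma inverse_square_nonzero_int: "((\<lambda>m::int. 1 / (2 * of_real pi * of_int m :: complex)\<^sup>2) has_sum (1 / 12)) UNIV"
proof -
  have s: "(\<lambda>n. 1 / (real n + 1)\<^sup>2) sums (pi\<^sup>2 / 6)" using inverse_squares_sums by (simp add: add.commute)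
  define C where "C = 1 / (2 * pi)\<^sup>2"
  have H0: "((\<lambda>n. C * (1 / (real n + 1)\<^sup>2)) has_sum (C * (pi\<^sup>2 / 6))) UNIV"
    by (rule norm_summable_imp_has_sum[OF _ sums_mult[OF s]])
       (use sums_mult[OF s, of C] in \<open>simp add: sums_iff abs_mult C_def\<close>)
  have v: "C * (pi\<^sup>2 / 6) = 1 / 24" by (simp add: C_def power_mult_distrib)
  let ?f = "\<lambda>m::int. 1 / (2 * pi * of_int m)\<^sup>2"
  have e: "?f (int (Suc n)) = C * (1 / (real n + 1)\<^sup>2)" "?f (- int (Suc n)) = C * (1 / (real n + 1)\<^sup>2)" for n
    by (simp_all add: C_def power_mult_distrib power2_eq_square add_ac)
       (simp add: algebra_simps)
  have "(?f has_sum (1 / 24)) (range (\<lambda>n. int (Suc n)))"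
    using H0 unfolding v by (subst has_sum_reindex) (auto simp: o_def e inj_on_def simp del: of_nat_Suc of_int_of_nat_eq)
  moreover have "(?f has_sum (1 / 24)) (range (\<lambda>n. - int (Suc n)))"
    using H0 unfolding v by (subst has_sum_reindex) (auto simp: o_def e inj_on_def simp del: of_nat_Suc of_int_of_nat_eq of_int_minus)
  ultimately have "(?f has_sum (1 / 24 + 1 / 24)) (range (\<lambda>n. int (Suc n)) \<union> range (\<lambda>n. - int (Suc n)))"
    by (rule has_sum_Un_disjoint) auto
  then have "(?f has_sum (?f 0 + (1 / 24 + 1 / 24))) (insert 0 (range (\<lambda>n. int (Suc n)) \<union> range (\<lambda>n. - int (Suc n))))"
    by (intro has_sum_insert) auto
  also have "insert 0 (range (\<lambda>n. int (Suc n)) \<union> range (\<lambda>n. - int (Suc n))) = UNIV"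
  proof -
    have "x \<in> insert 0 (range (\<lambda>n. int (Suc n)) \<union> range (\<lambda>n. - int (Suc n)))" for x
    proof (cases x rule: int_cases3)
      case (pos n)
      then have "x = int (Suc (n - 1))" by simp
      then show ?thesis by blast
    next
      case (neg n)
      then have "x = - int (Suc (n - 1))" by simp
      then show ?thesis by blast
    qed simp
    then show ?thesis by blast
  qed
  finally have "(?f has_sum (1 / 12)) UNIV" by simp
  then have "((\<lambda>m. complex_of_real (?f m)) has_sum complex_of_real (1 / 12)) UNIV"
    by (rule has_sum_of_real)
  then show ?thesis by simp
qed


section \<open>Row-by-row summation of the Weierstrass function\<close>

lemma exp_lattice_row:
  assumes "q > 0"
  shows "exp (\<i> * (w - 2 * of_real pi * tau q * of_int n)) = exp (\<i> * w) * of_real ((q\<^sup>2) powi (- n))"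
proof -
  have "\<i> * (w - 2 * of_real pi * tau q * of_int n) = \<i> * w + of_real (of_int (- n) * (2 * ln q))"
    by (simp add: tau_def algebra_simps)
  moreover have "exp (2 * ln q) = q\<^sup>2"
    using assms by (simp add: exp_double)
  then have "exp (of_int (- n) * (2 * ln q)) = (q\<^sup>2) powi (- n)"
    using exp_power_int[of "2 * ln q" "- n"] by (simp only:)
  ultimately show ?thesis
    by (simp only: exp_add exp_of_real)
qed

locale nome =
  fixes q :: real
  assumes q_pos: "0 < q" and q_less_1: "q < 1"

sublocale nome \<subseteq> nome_square "q\<^sup>2"
  by standard (use q_pos q_less_1 in \<open>auto simp: power_less_one_iff\<close>)

context nome_square
begin

text \<open>The index n = 0 contributes \<open>lorm 1 = 0\<close>, so the sum counts every positive
  index twice.\<close>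

lemma lorm_powi_has_sum: "((\<lambda>n. lorm (p powi n)) has_sum 2 * sigma) UNIV"
proof -
  have nn: "lorm (p ^ Suc n) \<ge> 0" for n using p_pos by (simp add: lorm_def)
  have inv: "lorm (p powi (- int (Suc n))) = lorm (p ^ Suc n)" for n
    unfolding power_int_minus_of_nat power_one_over using p_pos by (intro lorm_inverse) auto
  have s1: "summable (\<lambda>n. norm (lorm (p ^ Suc n)))"
    using summable_sigma nn by simp
  have s: "(\<lambda>n. lorm (p powi n)) summable_on UNIV"
  proof (rule summable_on_int_split)
    have "summable (\<lambda>n. norm (lorm (p ^ n)))"
      using s1 by (subst (asm) summable_Suc_iff)
    then show "(\<lambda>n. lorm (p powi int n)) summable_on UNIV"
      unfolding power_int_of_nat by (rule norm_summable_imp_summable_on)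
    show "(\<lambda>n. lorm (p powi (- int (Suc n)))) summable_on UNIV"
      unfolding inv using s1 by (rule norm_summable_imp_summable_on)
  qed
  have "(\<lambda>n. lorm (p ^ Suc n) + lorm (p ^ Suc n)) sums (sigma + sigma)"
    unfolding sigma_def by (intro sums_add summable_sums summable_sigma)
  moreover have "(\<lambda>n. lorm (p ^ Suc n) + lorm (p ^ Suc n)) sums (infsum (\<lambda>n. lorm (p powi n)) UNIV - lorm (p powi 0))"
    using int_infsum_sums[OF s] unfolding inv power_int_of_nat .
  ultimately have "infsum (\<lambda>n. lorm (p powi n)) UNIV - lorm (p powi 0) = sigma + sigma"
    using sums_unique2 by blast
  then have "infsum (\<lambda>n. lorm (p powi n)) UNIV = 2 * sigma"
    by (simp add: lorm_def)
  with s show ?thesis using has_sum_infsum by metis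
qed

end

context nome
begin

text \<open>Row n sums to - lorm at x q^(-2 n) by the sine formula. Of the subtracted terms 1 / l^2,
  the row n = 0 gives - 1 / 12 and all the others together give 2 sigma.\<close>

lemma wp_real:
  assumes w: "exp (\<i> * w) = of_real x" and x: "\<And>n. x * (q\<^sup>2) powi n \<noteq> 1"
    and L: "((\<lambda>n. lorm (x * (q\<^sup>2) powi n)) has_sum L) UNIV"
  shows "wp q w = of_real (- 1 / 12 + 2 * sigma - L)"
proof -
  let ?t = "\<lambda>l. 1 / (w - lattice_pt q l)\<^sup>2 - 1 / (lattice_pt q l)\<^sup>2"
  let ?P = "\<lambda>n. (q\<^sup>2) powi n"
  have s: "?t summable_on UNIV" by (rule lattice_summable[OF q_pos q_less_1])
  have l0: "lattice_pt q (0, 0) = 0" by (simp add: lattice_pt_def)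
  \<comment> \<open>By 1 / 0 = 0 the index (0, 0) contributes exactly the separate term 1 / w^2, so
    the sum can be taken over the full lattice.\<close>
  have "wp q w = ?t (0, 0) + infsum ?t (UNIV - {(0, 0)})"
    by (simp add: wp_def l0)
  also have "\<dots> = infsum ?t (insert (0, 0) (UNIV - {(0, 0)}))"
    by (rule infsum_insert[symmetric]) (auto intro: summable_on_subset_banach[OF s])
  also have "insert (0, 0) (UNIV - {(0, 0)}) = (UNIV :: (int \<times> int) set)" by auto
  finally have "(?t has_sum wp q w) (UNIV \<times> UNIV)" using has_sum_infsum[OF s] by simp
  then have T: "((\<lambda>(n, m). ?t (m, n)) has_sum wp q w) (UNIV \<times> UNIV)"
    by (subst (asm) has_sum_swap) (simp add: case_prod_unfold)
  have lat: "w' - lattice_pt q (m, n) = (w' - 2 * of_real pi * tau q * of_int n) - 2 * of_real pi * of_int m" for w' m n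
    by (simp add: lattice_pt_def)
  have clorm: "of_real a / (1 - of_real a)\<^sup>2 = (of_real (lorm a) :: complex)" for a
    by (simp add: lorm_def)
  have row1: "((\<lambda>m. 1 / (w - lattice_pt q (m, n))\<^sup>2) has_sum of_real (- lorm (x * ?P (- n)))) UNIV" for n
  proof -
    have e: "exp (\<i> * (w - 2 * of_real pi * tau q * of_int n)) = of_real (x * ?P (- n))"
      unfolding exp_lattice_row[OF q_pos] w by simp
    have "exp (\<i> * (w - 2 * of_real pi * tau q * of_int n)) \<noteq> 1"
      unfolding e using x[of "- n"] by (metis of_real_eq_1_iff)
    from inverse_square_row_has_sum[OF this] show ?thesis
      unfolding lat e clorm by simp
  qed
  have row2: "((\<lambda>m. 1 / (lattice_pt q (m, n))\<^sup>2) has_sum of_real (if n = 0 then 1 / 12 else - lorm (?P (- n)))) UNIV" for n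
  proof (cases "n = 0")
    case True
    then show ?thesis using inverse_square_nonzero_int by (simp add: lattice_pt_def)
  next
    case False
    have e: "exp (\<i> * (0 - 2 * of_real pi * tau q * of_int n)) = of_real (?P (- n))"
      unfolding exp_lattice_row[OF q_pos] by simp
    have "exp (\<i> * (0 - 2 * of_real pi * tau q * of_int n)) \<noteq> 1"
      unfolding e using powi_neq_1[of "- n"] False by (metis of_real_eq_1_iff neg_equal_0_iff_equal)
    from inverse_square_row_has_sum[OF this] have "((\<lambda>m. 1 / (0 - lattice_pt q (m, n))\<^sup>2) has_sum of_real (- lorm (?P (- n)))) UNIV"
      unfolding lat e clorm by simp
    then show ?thesis using False by simp
  qed
  have row: "((\<lambda>m. ?t (m, n)) has_sum of_real (- lorm (x * ?P (- n)) + (lorm (?P (- n)) - (if n = 0 then 1 / 12 else 0)))) UNIV" for n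
  proof -
    have "((\<lambda>m. 1 / (w - lattice_pt q (m, n))\<^sup>2 + - (1 / (lattice_pt q (m, n))\<^sup>2)) has_sum of_real (- lorm (x * ?P (- n))) + - of_real (if n = 0 then 1 / 12 else - lorm (?P (- n)))) UNIV"
      using row2[of n] by (intro has_sum_add row1) (simp add: has_sum_uminus)
    moreover have "lorm 1 = 0" by (simp add: lorm_def)
    ultimately show ?thesis by (cases "n = 0") simp_all
  qed
  have 1: "((\<lambda>n. of_real (- lorm (x * ?P (- n)) + (lorm (?P (- n)) - (if n = 0 then 1 / 12 else 0)))) has_sum wp q w) UNIV"
    by (rule has_sum_SigmaD[OF T]) (use row in auto)
  have bij: "bij_betw uminus UNIV (UNIV :: int set)" by (auto intro!: bij_betwI[where g = uminus])
  have A: "((\<lambda>n. lorm (x * ?P (- n))) has_sum L) UNIV"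
    using has_sum_reindex_bij_betw[OF bij, of "\<lambda>n. lorm (x * ?P n)"] L by simp
  have B: "((\<lambda>n. lorm (?P (- n))) has_sum 2 * sigma) UNIV"
    using has_sum_reindex_bij_betw[OF bij, of "\<lambda>n. lorm (?P n)"] lorm_powi_has_sum by simp
  have C: "((\<lambda>n::int. if n = 0 then 1 / 12 else 0) has_sum (1 / 12 :: real)) UNIV"
    by (rule has_sum_finite_neutralI[of "{0}"]) auto
  have "((\<lambda>n. - lorm (x * ?P (- n)) + (lorm (?P (- n)) + - (if n = 0 then 1 / 12 else 0))) has_sum (- L + (2 * sigma + - (1 / 12)))) UNIV"
    using A C by (intro has_sum_add B) (simp_all add: has_sum_uminus)
  from has_sum_of_real[OF this, where 'a = complex]
  have 2: "((\<lambda>n. of_real (- lorm (x * ?P (- n)) + (lorm (?P (- n)) - (if n = 0 then 1 / 12 else 0)))) has_sum complex_of_real (- L + (2 * sigma + - (1 / 12)))) UNIV"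
    by simp
  from has_sum_unique[OF 1 2] show ?thesis by (simp add: algebra_simps)
qed

end

subsection \<open>Half-period values and theta constants\<close>

lemma int_parity_has_sum:
  fixes f :: "int \<Rightarrow> real"
  assumes "f summable_on UNIV"
  shows "(\<lambda>n. f (2 * n)) summable_on UNIV" "(\<lambda>n. f (2 * n + 1)) summable_on UNIV"
    "infsum f UNIV = (\<Sum>\<^sub>\<infinity>n. f (2 * n)) + (\<Sum>\<^sub>\<infinity>n. f (2 * n + 1))"
proof -
  let ?A = "range (\<lambda>n::int. 2 * n)" and ?B = "range (\<lambda>n::int. 2 * n + 1)"
  have U: "(UNIV :: int set) = ?A \<union> ?B"
  proof -
    have "x \<in> ?A \<union> ?B" for x :: int
      by (cases "even x") (auto elim!: evenE oddE)
    then show ?thesis by blast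
  qed
  have d: "?A \<inter> ?B = {}" by (auto simp: image_iff) presburger
  have sA: "f summable_on ?A" and sB: "f summable_on ?B"
    using assms summable_on_subset_banach by blast+
  have iA: "inj (\<lambda>n::int. 2 * n)" and iB: "inj (\<lambda>n::int. 2 * n + 1)" by (auto simp: inj_on_def)
  show "(\<lambda>n. f (2 * n)) summable_on UNIV" "(\<lambda>n. f (2 * n + 1)) summable_on UNIV"
    using sA sB summable_on_reindex[OF iA, of f] summable_on_reindex[OF iB, of f] by (simp_all add: o_def)
  have "infsum f UNIV = infsum f ?A + infsum f ?B"
    by (subst U, rule infsum_Un_disjoint[OF sA sB d])
  also have "infsum f ?A = (\<Sum>\<^sub>\<infinity>n. f (2 * n))" using infsum_reindex[OF iA, of f] by (simp add: o_def)
  also have "infsum f ?B = (\<Sum>\<^sub>\<infinity>n. f (2 * n + 1))" using infsum_reindex[OF iB, of f] by (simp add: o_def)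
  finally show "infsum f UNIV = (\<Sum>\<^sub>\<infinity>n. f (2 * n)) + (\<Sum>\<^sub>\<infinity>n. f (2 * n + 1))" .
qed

text \<open>Despite the names, \<open>theta3\<close> and \<open>theta4\<close> are half the squares
  of the classical theta constants, and \<open>theta2\<close> is half the square of the classical
  one divided by sqrt q.\<close>

definition theta3 :: "real \<Rightarrow> real" where
  "theta3 q = nome_square.S (q\<^sup>2) q 1"

definition theta4 :: "real \<Rightarrow> real" where
  "theta4 q = nome_square.S (q\<^sup>2) (- q) 1"

definition theta2 :: "real \<Rightarrow> real" where
  "theta2 q = nome_square.S (q\<^sup>2) q q"

context nome
begin

lemma q_nz [simp]: "q \<noteq> 0"
  using q_pos by simp

lemma q_annulus: "q\<^sup>2 < \<bar>q\<bar>" "\<bar>q\<bar> < 1" "q\<^sup>2 < \<bar>- q\<bar>" "\<bar>- q\<bar> < 1" "q\<^sup>2 < q"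
  using q_pos q_less_1 by (auto simp: power2_eq_square)

lemma p_over_q: "q\<^sup>2 / q = q" "q\<^sup>2 / - q = - q"
  by (simp_all add: power2_eq_square)

definition c0 :: real where
  "c0 = - 1 / 12 + 2 * sigma"

definition P :: "real \<Rightarrow> real" where
  "P s = c0 + Q s"

lemma wp_negative_real:
  assumes w: "exp (\<i> * w) = of_real (- s)" and s: "s > 0"
  shows "wp q w = of_real (P s)"
proof -
  have "wp q w = of_real (- 1 / 12 + 2 * sigma - (- Q s))"
  proof (rule wp_real[OF w])
    show "- s * (q\<^sup>2) powi n \<noteq> 1" for n
      using powi_pos[of n] s by (smt (verit) mult_minus_left mult_pos_pos)
    have "lorm (- s * (q\<^sup>2) powi n) = - lor (s * (q\<^sup>2) powi n)" for n
      using lorm_uminus[of "s * (q\<^sup>2) powi n"] by simp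
    then show "((\<lambda>n. lorm (- s * (q\<^sup>2) powi n)) has_sum - Q s) UNIV"
      using has_sum_infsum[OF summable_Q[OF s]] by (simp add: has_sum_uminus Q_def)
  qed
  then show ?thesis by (simp add: P_def c0_def)
qed

lemma wp_phi_neg_eq: "r > 0 \<Longrightarrow> wp_phi_neg q r = P r"
proof -
  assume r: "r > 0"
  have "exp (\<i> * phi (of_real (- r))) = of_real (- r)"
    unfolding phi_def using r by (simp add: exp_Ln)
  from wp_negative_real[OF this r] show ?thesis by (simp add: wp_phi_neg_def)
qed

lemma e1_eq: "e1 q = P 1"
proof -
  have "exp (\<i> * of_real pi) = of_real (- 1)" by simp
  from wp_negative_real[OF this] show ?thesis by (simp add: e1_def)
qed

lemma exp_tau: "exp (\<i> * (of_real pi * tau q)) = of_real q"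
proof -
  have "\<i> * (of_real pi * tau q) = of_real (ln q)" by (simp add: tau_def)
  then show ?thesis using q_pos by (simp only: exp_of_real) simp
qed

lemma e2_eq: "e2 q = P q"
proof -
  have "exp (\<i> * (of_real pi + of_real pi * tau q)) = of_real (- q)"
    unfolding distrib_left exp_add exp_tau by simp
  from wp_negative_real[OF this q_pos] show ?thesis by (simp add: e2_def)
qed

text \<open>This half period corresponds to the positive number x = q, so the row sums form V
  instead of - Q.\<close>

lemma e3_eq: "e3 q = c0 - V q"
proof -
  have "wp q (of_real pi * tau q) = of_real (- 1 / 12 + 2 * sigma - V q)"
  proof (rule wp_real[OF exp_tau _ V_eq_lorm_sum])
    show "q * (q\<^sup>2) powi n \<noteq> 1" for n
      using u_minus_powi_nz[OF q_annulus(5) q_less_1, of "- n"] q_pos by (auto simp: power_int_minus field_simps)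
  qed (use q_annulus in auto)
  then show ?thesis by (simp add: e3_def c0_def)
qed

lemma V_minus_q: "V (- q) = - Q q"
proof -
  have "lorm (- q * (q\<^sup>2) powi n) = - lor (q * (q\<^sup>2) powi n)" for n
    using lorm_uminus[of "q * (q\<^sup>2) powi n"] by simp
  then have "((\<lambda>n. lorm (- q * (q\<^sup>2) powi n)) has_sum - Q q) UNIV"
    using has_sum_infsum[OF summable_Q[OF q_pos]] by (simp add: has_sum_uminus Q_def)
  then show ?thesis using V_eq_lorm_sum[OF q_annulus(3,4)] has_sum_unique by blast
qed

text \<open>As - q is fixed by u -> q^2 / u, the partner in the product formula is s times the
  series itself.\<close>

lemma S_minus_q_square: "s > 0 \<Longrightarrow> s * (S (- q) s)\<^sup>2 = Q s - Q q"
proof -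
  assume s: "s > 0"
  have e: "s * x\<^sup>2 = x * (s * x)" for x by (simp add: power2_eq_square)
  have "s * S (- q) s = S (- q) (1 / s)" using S_swap[of s "- q"] s by (simp add: p_over_q)
  then show ?thesis
    unfolding e using S_product[OF q_annulus(3,4) s] V_minus_q by simp
qed

lemma S_q_square: "s > 0 \<Longrightarrow> s * (S q s)\<^sup>2 = Q s + V q"
proof -
  assume s: "s > 0"
  have e: "s * x\<^sup>2 = x * (s * x)" for x by (simp add: power2_eq_square)
  have "s * S q s = S q (1 / s)" using S_swap[of s q] s by (simp add: p_over_q)
  then show ?thesis
    unfolding e using S_product[OF q_annulus(1,2) s] by simp
qed

lemma theta4_square: "(theta4 q)\<^sup>2 = e1 q - e2 q"
  using S_minus_q_square[of 1] by (simp add: theta4_def e1_eq e2_eq P_def)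

lemma theta3_square: "(theta3 q)\<^sup>2 = e1 q - e3 q"
  using S_q_square[of 1] by (simp add: theta3_def e1_eq e3_eq P_def)

lemma theta2_square: "q * (theta2 q)\<^sup>2 = e2 q - e3 q"
  using S_q_square[of q] q_pos by (simp add: theta2_def e2_eq e3_eq P_def)

lemma theta2_pos: "theta2 q > 0"
  unfolding theta2_def by (rule S_pos) (use q_annulus q_pos q_less_1 in auto)

text \<open>Only the terms n >= 0 are kept, with 1 + q^(2 n) <= 2. The growth as q -> 1 drives the
  estimate of the modulus.\<close>

lemma theta3_ge: "theta3 q \<ge> 1 / (2 * (1 - q))"
proof -
  let ?f = "\<lambda>n::int. q powi n / (1 + 1 * (q\<^sup>2) powi n)"
  have s: "?f summable_on UNIV" using summable_S[OF q_annulus(1,2), of 1] by simp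
  have nn: "0 \<le> ?f n" for n
    using q_pos by (auto intro!: divide_nonneg_nonneg)
  have "infsum ?f (range int) \<le> infsum ?f UNIV"
    by (rule infsum_mono_neutral) (use s nn in \<open>auto intro: summable_on_subset_banach\<close>)
  also have "\<dots> = theta3 q" by (simp add: theta3_def S_def)
  finally have 1: "infsum ?f (range int) \<le> theta3 q" .
  have "((\<lambda>n. ?f (int n)) has_sum infsum ?f (range int)) UNIV"
    using has_sum_infsum[OF summable_on_subset_banach[OF s subset_UNIV], of "range int"]
    by (subst (asm) has_sum_reindex) (auto simp: o_def)
  then have F: "(\<lambda>n. ?f (int n)) sums infsum ?f (range int)" by (rule has_sum_imp_sums)
  have G: "(\<lambda>n. q ^ n / 2) sums (1 / (1 - q) / 2)"
    using q_pos q_less_1 by (intro sums_divide geometric_sums) auto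
  have "1 / (1 - q) / 2 \<le> infsum ?f (range int)"
  proof (rule sums_le[OF _ G F])
    fix n
    have "(q\<^sup>2) ^ n \<le> 1" using q_pos q_less_1 by (intro power_le_one) (auto simp: power_le_one)
    moreover have "0 < 1 + (q\<^sup>2) ^ n" using q_pos by (intro add_pos_pos) auto
    ultimately have "q ^ n / 2 \<le> q ^ n / (1 + (q\<^sup>2) ^ n)"
      using q_pos by (intro divide_left_mono) auto
    then show "q ^ n / 2 \<le> ?f (int n)" by simp
  qed
  with 1 show ?thesis by (simp add: field_simps)
qed

text \<open>The term n = 0 is 1 / 2, and the terms at n and - n are each at most q^|n|. Below q =
  1/5 the total deviation is less than 1 / 2.\<close>

lemma theta4_near_half: "\<bar>theta4 q - 1 / 2\<bar> \<le> 2 * q / (1 - q)"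
proof -
  let ?f = "\<lambda>n::int. (- q) powi n / (1 + 1 * (q\<^sup>2) powi n)"
  have s: "?f summable_on UNIV" using summable_S[OF q_annulus(3,4), of 1] by simp
  have F: "(\<lambda>n. ?f (int (Suc n)) + ?f (- int (Suc n))) sums (theta4 q - 1 / 2)"
    using int_infsum_sums[OF s] by (simp add: theta4_def S_def)
  have G: "(\<lambda>n. 2 * (q * q ^ n)) sums (2 * (q * (1 / (1 - q))))"
    using q_pos q_less_1 by (intro sums_mult geometric_sums) auto
  have "norm (?f (int (Suc n)) + ?f (- int (Suc n))) \<le> 2 * (q * q ^ n)" for n
  proof -
    have pp: "(q\<^sup>2) ^ Suc n > 0" using q_pos by simp
    have "norm (?f (int (Suc n))) = q ^ Suc n / (1 + (q\<^sup>2) ^ Suc n)"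
      unfolding power_int_of_nat using q_pos pp
      by (simp only: real_norm_def abs_divide power_abs abs_minus_cancel abs_of_pos mult_1 add_pos_pos zero_less_one)
    also have "\<dots> \<le> q ^ Suc n / 1"
    proof -
      have "1 + (q\<^sup>2) ^ Suc n > 0" "q ^ Suc n > 0" using pp q_pos by (linarith, simp)
      then show ?thesis using pp by (intro divide_left_mono mult_pos_pos) linarith+
    qed
    finally have a: "norm (?f (int (Suc n))) \<le> q * q ^ n" by simp
    have "norm (?f (- int (Suc n))) = (1 / q) ^ Suc n / (1 + (1 / q\<^sup>2) ^ Suc n)"
    proof -
      have "\<bar>1 / - q\<bar> = 1 / q" "(1 / q\<^sup>2) ^ Suc n > 0" using q_pos by auto
      then show ?thesis
        unfolding power_int_minus_of_nat
        by (simp only: real_norm_def abs_divide[of "_ ^ _"] power_abs abs_of_pos mult_1 add_pos_pos zero_less_one)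
    qed
    also have "\<dots> \<le> (1 / q) ^ Suc n / (1 / q\<^sup>2) ^ Suc n"
    proof -
      have a: "(1 / q\<^sup>2) ^ Suc n > 0" "(1 / q) ^ Suc n > 0" using q_pos by simp_all
      then have "1 + (1 / q\<^sup>2) ^ Suc n > 0" by linarith
      with a show ?thesis by (intro divide_left_mono mult_pos_pos) linarith+
    qed
    also have "\<dots> = q * q ^ n" unfolding power_divide[symmetric] by (simp add: power2_eq_square)
    finally show ?thesis using a norm_triangle_ineq[of "?f (int (Suc n))" "?f (- int (Suc n))"] by linarith
  qed
  then have "norm (\<Sum>n. ?f (int (Suc n)) + ?f (- int (Suc n))) \<le> (\<Sum>n. 2 * (q * q ^ n))"
    by (rule norm_suminf_le) (rule sums_summable[OF G])
  then have "\<bar>theta4 q - 1 / 2\<bar> \<le> 2 * (q * (1 / (1 - q)))"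
    unfolding sums_unique[OF F, symmetric] sums_unique[OF G, symmetric] by simp
  then show ?thesis by simp
qed

text \<open>The even and the odd indices of the bilateral series are series of the same kind for the
  nome q^2; the sign of q only affects the odd ones.\<close>

lemma landen: "theta3 q = theta3 (q\<^sup>2) + q * theta2 (q\<^sup>2)" "theta4 q = theta3 (q\<^sup>2) - q * theta2 (q\<^sup>2)"
proof -
  have sq: "nome (q\<^sup>2)" using q_pos q_less_1 by unfold_locales (auto simp: power_less_one_iff)
  interpret n2: nome "q\<^sup>2" by (rule sq)
  have even: "x powi (2 * n) = (x\<^sup>2) powi n" for x :: real and n
    by (simp add: power_int_mult)
  have odd: "x powi (2 * n + 1) = (x\<^sup>2) powi n * x" if "x \<noteq> 0" for x :: real and n
    using that by (simp add: power_int_add power_int_mult)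
  let ?f = "\<lambda>n. q powi n / (1 + 1 * (q\<^sup>2) powi n)" and ?g = "\<lambda>n. (- q) powi n / (1 + 1 * (q\<^sup>2) powi n)"
  have fs: "?f summable_on UNIV" using summable_S[OF q_annulus(1,2), of 1] by simp
  have gs: "?g summable_on UNIV" using summable_S[OF q_annulus(3,4), of 1] by simp
  have A: "theta3 (q\<^sup>2) = (\<Sum>\<^sub>\<infinity>n. (q\<^sup>2) powi n / (1 + ((q\<^sup>2)\<^sup>2) powi n))"
    by (simp only: theta3_def n2.S_def mult_1)
  have B: "q * theta2 (q\<^sup>2) = (\<Sum>\<^sub>\<infinity>n. (q\<^sup>2) powi n * q / (1 + ((q\<^sup>2)\<^sup>2) powi n * q\<^sup>2))"
    unfolding theta2_def n2.S_def infsum_cmult_right'[symmetric] by (simp add: mult_ac)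
  have f1: "?f (2 * n) = (q\<^sup>2) powi n / (1 + ((q\<^sup>2)\<^sup>2) powi n)" for n by (simp only: even mult_1)
  have f2: "?f (2 * n + 1) = (q\<^sup>2) powi n * q / (1 + ((q\<^sup>2)\<^sup>2) powi n * q\<^sup>2)" for n by (simp add: odd)
  have g1: "?g (2 * n) = (q\<^sup>2) powi n / (1 + ((q\<^sup>2)\<^sup>2) powi n)" for n by (simp only: even mult_1 power2_minus)
  have g2: "?g (2 * n + 1) = - ((q\<^sup>2) powi n * q / (1 + ((q\<^sup>2)\<^sup>2) powi n * q\<^sup>2))" for n by (simp add: odd)
  have "theta3 q = infsum ?f UNIV" "theta4 q = infsum ?g UNIV"
    by (simp_all only: theta3_def theta4_def S_def)
  then show "theta3 q = theta3 (q\<^sup>2) + q * theta2 (q\<^sup>2)" "theta4 q = theta3 (q\<^sup>2) - q * theta2 (q\<^sup>2)"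
    unfolding A B int_parity_has_sum(3)[OF fs] int_parity_has_sum(3)[OF gs] f1 f2 g1 g2 infsum_uminus by simp_all
qed

lemma square_nome: "nome (q\<^sup>2)"
  using q_pos q_less_1 by unfold_locales (auto simp: power_less_one_iff)

text \<open>The identity \<open>\<theta>\<^sub>3 \<theta>\<^sub>4 = \<theta>\<^sub>4(q\<^sup>2)\<^sup>2\<close> propagates positivity from small nomes to all nomes.\<close>

lemma theta_product: "theta4 q * theta3 q = (theta4 (q\<^sup>2))\<^sup>2"
proof -
  interpret n2: nome "q\<^sup>2" by (rule square_nome)
  have "theta4 q * theta3 q = (theta3 (q\<^sup>2))\<^sup>2 - q\<^sup>2 * (theta2 (q\<^sup>2))\<^sup>2"
    unfolding landen by (simp add: power2_eq_square algebra_simps)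
  then show ?thesis
    unfolding n2.theta3_square n2.theta2_square n2.theta4_square by simp
qed

lemma theta3_pos: "theta3 q > 0"
  using theta3_ge q_less_1 by (smt (verit) divide_pos_pos)

text \<open>The quotient \<open>(theta4 (q\<^sup>2))\<^sup>2 / theta3 q\<close> is positive, and it
  is at most \<open>theta4 (q\<^sup>2)\<close> because theta4(q^2) <= theta3(q^2) <= theta3(q). The
  bound 1 is carried along for use near q = 1.\<close>

lemma theta4_step: "theta4 (q\<^sup>2) > 0 \<Longrightarrow> theta4 (q\<^sup>2) \<le> 1 \<Longrightarrow> theta4 q > 0 \<and> theta4 q \<le> 1"
proof -
  assume a: "theta4 (q\<^sup>2) > 0" "theta4 (q\<^sup>2) \<le> 1"
  interpret n2: nome "q\<^sup>2" by (rule square_nome)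
  have eq: "theta4 q = (theta4 (q\<^sup>2))\<^sup>2 / theta3 q"
    using theta_product theta3_pos by (simp add: field_simps)
  have "theta4 (q\<^sup>2) \<le> theta3 (q\<^sup>2)"
    using n2.landen n2.square_nome nome.theta2_pos q_pos by (smt (verit) mult_pos_pos n2.q_pos)
  also have "\<dots> \<le> theta3 q" unfolding landen(1) using n2.theta2_pos q_pos by simp
  finally have "theta4 (q\<^sup>2) * theta4 (q\<^sup>2) \<le> theta4 (q\<^sup>2) * theta3 q"
    using a by (intro mult_left_mono) auto
  then have "theta4 q \<le> theta4 (q\<^sup>2)"
    unfolding eq using theta3_pos by (simp add: field_simps power2_eq_square)
  moreover have "theta4 q > 0"
    unfolding eq using theta3_pos a by (intro divide_pos_pos) auto
  ultimately show ?thesis using a by simp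
qed

end

text \<open>Repeated squaring brings q below 1/5, where the direct estimate holds.
  \<open>theta4_step\<close> then leads back up.\<close>

lemma theta4_range:
  assumes "0 < q" "q < 1"
  shows "theta4 q > 0 \<and> theta4 q \<le> 1"
proof -
  have "(\<lambda>k. q ^ 2 ^ k) \<longlonglongrightarrow> 0"
  proof -
    have "filterlim (\<lambda>k::nat. (2::nat) ^ k) at_top at_top" by real_asymp
    from filterlim_compose[OF LIMSEQ_power_zero[of q] this] assms show ?thesis by simp
  qed
  then obtain k where k: "q ^ 2 ^ k < 1 / 5"
    using order_tendstoD(2)[of _ 0 sequentially "1 / 5"] eventually_happens by (metis (no_types, lifting) sequentially_bot zero_less_divide_1_iff zero_less_numeral)
  have base: "theta4 x > 0 \<and> theta4 x \<le> 1" if "0 < x" "x < 1 / 5" for x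
  proof -
    interpret nome x using that by unfold_locales auto
    have "2 * x / (1 - x) < 1 / 2" using that by (simp add: field_simps)
    then show ?thesis using theta4_near_half by linarith
  qed
  have "\<forall>q. 0 < q \<and> q < 1 \<and> q ^ 2 ^ k < 1 / 5 \<longrightarrow> theta4 q > 0 \<and> theta4 q \<le> 1"
  proof (induction k)
    case 0
    then show ?case using base by simp
  next
    case (Suc k)
    show ?case
    proof (intro allI impI)
      fix q :: real assume q: "0 < q \<and> q < 1 \<and> q ^ 2 ^ Suc k < 1 / 5"
      interpret nome q using q by unfold_locales auto
      have "(q\<^sup>2) ^ 2 ^ k < 1 / 5" using q by (simp add: power_mult[symmetric])
      then have "theta4 (q\<^sup>2) > 0 \<and> theta4 (q\<^sup>2) \<le> 1"
        using Suc square_nome nome.q_pos nome.q_less_1 by blast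
      then show "theta4 q > 0 \<and> theta4 q \<le> 1" using theta4_step by blast
    qed
  qed
  then show ?thesis using assms k by blast
qed

context nome
begin

lemma e_order: "e1 q > e2 q" "e2 q > e3 q"
  using theta4_square theta4_range[OF q_pos q_less_1] theta2_square theta2_pos q_pos
  by (smt (verit) zero_less_power mult_pos_pos)+

text \<open>The identity lor x - lorm x = - 4 lorm(x^2) relates Q 1 to the even-indexed part of the
  sum of lorm over powers of p, and Q q - V q to the odd-indexed part. Together the two parts make 2
  sigma.\<close>

lemma e_sum: "e1 q + e2 q + e3 q = 0"
proof -
  let ?p = "\<lambda>n. (q\<^sup>2) powi n"
  have l: "lor x - lorm x = - (4 * lorm (x\<^sup>2))" if "x > 0" "x \<noteq> 1" for x
  proof -
    have "1 - x\<^sup>2 = (1 - x) * (1 + x)" by (simp add: power2_eq_square algebra_simps)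
    then have e: "(1 - x\<^sup>2)\<^sup>2 = (1 - x)\<^sup>2 * (1 + x)\<^sup>2" by (simp add: power_mult_distrib)
    have nz: "(1 - x)\<^sup>2 \<noteq> 0" "(1 + x)\<^sup>2 \<noteq> 0" using that by auto
    have "lor x - lorm x = (x * (1 - x)\<^sup>2 - x * (1 + x)\<^sup>2) / ((1 - x)\<^sup>2 * (1 + x)\<^sup>2)"
      unfolding lor_def lorm_def using nz by (simp add: diff_frac_eq mult_ac)
    also have "x * (1 - x)\<^sup>2 - x * (1 + x)\<^sup>2 = - (4 * x\<^sup>2)" by (simp add: power2_eq_square algebra_simps)
    finally show ?thesis unfolding lorm_def e by simp
  qed
  have sq: "(?p n)\<^sup>2 = ?p (2 * n)" for n by (metis mult.commute power_int_mult power_int_numeral)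
  have L: "((\<lambda>n. lorm (?p n)) has_sum 2 * sigma) UNIV" by (rule lorm_powi_has_sum)
  have Ls: "(\<lambda>n. lorm (?p n)) summable_on UNIV" using L by (rule has_sum_imp_summable)
  note par = int_parity_has_sum[OF Ls]
  define X where "X = (\<Sum>\<^sub>\<infinity>n. lorm (?p (2 * n)))"
  define Y where "Y = (\<Sum>\<^sub>\<infinity>n. lorm (?p (2 * n + 1)))"
  have XY: "X + Y = 2 * sigma" using par(3) infsumI[OF L] by (simp add: X_def Y_def)
  have "((\<lambda>n. lor (q * ?p n) + - lorm (q * ?p n)) has_sum (Q q + - V q)) UNIV"
    using has_sum_infsum[OF summable_Q[OF q_pos]] V_eq_lorm_sum[OF q_annulus(1,2)]
    by (intro has_sum_add) (simp_all add: Q_def has_sum_uminus)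
  moreover have "lor (q * ?p n) + - lorm (q * ?p n) = - 4 * lorm (?p (2 * n + 1))" for n
  proof -
    have "q * ?p n \<noteq> 1"
      using u_minus_powi_nz[OF q_annulus(5) q_less_1, of "- n"] q_pos by (auto simp: power_int_minus field_simps)
    moreover have "(q * ?p n)\<^sup>2 = ?p (2 * n + 1)" by (simp add: power_mult_distrib sq power_int_add)
    ultimately show ?thesis using l[of "q * ?p n"] q_pos by simp
  qed
  ultimately have "((\<lambda>n. - 4 * lorm (?p (2 * n + 1))) has_sum (Q q + - V q)) UNIV" by simp
  moreover have "((\<lambda>n. - 4 * lorm (?p (2 * n + 1))) has_sum - 4 * Y) UNIV"
    unfolding Y_def by (intro has_sum_cmult_right has_sum_infsum par(2))
  ultimately have 1: "Q q - V q = - 4 * Y" using has_sum_unique by fastforce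
  \<comment> \<open>The identity fails at n = 0, where lorm 1 is 0 by convention but lor 1 = 1 / 4;
    the last summand corrects this.\<close>
  have "((\<lambda>n. lorm (?p n) + - 4 * lorm (?p (2 * n)) + (if n = 0 then 1 / 4 else 0)) has_sum (2 * sigma + - 4 * X + 1 / 4)) UNIV"
  proof (intro has_sum_add L)
    show "((\<lambda>n. - 4 * lorm (?p (2 * n))) has_sum - 4 * X) UNIV"
      unfolding X_def by (intro has_sum_cmult_right has_sum_infsum par(1))
    show "((\<lambda>n::int. if n = 0 then 1 / 4 else 0) has_sum (1 / 4 :: real)) UNIV"
      by (rule has_sum_finite_neutralI[of "{0}"]) auto
  qed
  moreover have "lorm (?p n) + - 4 * lorm (?p (2 * n)) + (if n = 0 then 1 / 4 else 0) = lor (1 * ?p n)" for n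
  proof (cases "n = 0")
    case True
    then show ?thesis by (simp add: lorm_def lor_def)
  next
    case False
    then show ?thesis using l[OF powi_pos powi_neq_1[OF False]] by (simp add: sq)
  qed
  ultimately have "Q 1 = 2 * sigma + - 4 * X + 1 / 4"
    unfolding Q_def by (simp only: infsumI)
  with 1 XY show ?thesis
    by (simp add: e1_eq e2_eq e3_eq P_def c0_def)
qed

section \<open>The Weierstrass differential equation on the real segment\<close>

definition G2 :: real where
  "G2 = 12 * sigma_cubic + 6 * c0\<^sup>2"

text \<open>The left side is the second derivative of P in ln s, and P absorbs the linear term of
  \<open>Q_square\<close>. \<open>G2\<close> is so far only an expression in the Lambert series;
  that it equals g2 / 2 follows from the cubic below.\<close>

lemma second_order: "s > 0 \<Longrightarrow> Q s - 6 * Q2 s = G2 - 6 * (P s)\<^sup>2"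
proof -
  assume s: "s > 0"
  have "Q s - 6 * Q2 s = Q s - 6 * (Q s)\<^sup>2 + 12 * sigma_cubic - 24 * sigma * Q s"
    using Q2_eq[OF s] by simp
  also have "\<dots> = G2 - 6 * (P s)\<^sup>2"
    by (simp add: G2_def P_def c0_def power2_eq_square algebra_simps)
  finally show ?thesis .
qed

lemma DERIV_P: "((\<lambda>t. P (exp t)) has_real_derivative Qd (exp t)) (at t)"
  unfolding P_def by (auto intro!: derivative_eq_intros DERIV_Q)

lemma first_integral:
  obtains K where "\<And>t. (Qd (exp t))\<^sup>2 = - 4 * P (exp t) ^ 3 + 2 * G2 * P (exp t) + K"
proof -
  let ?F = "\<lambda>t. (Qd (exp t))\<^sup>2 + 4 * P (exp t) ^ 3 - 2 * G2 * P (exp t)"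
  have "(?F has_real_derivative 0) (at t)" for t
  proof -
    have "(?F has_real_derivative (2 * Qd (exp t) * (Q (exp t) - 6 * Q2 (exp t)) + 4 * (3 * (P (exp t))\<^sup>2 * Qd (exp t)) - 2 * G2 * Qd (exp t))) (at t)"
      by (rule derivative_eq_intros DERIV_Qd DERIV_P refl | simp)+
    moreover have "2 * Qd (exp t) * (Q (exp t) - 6 * Q2 (exp t)) + 4 * (3 * (P (exp t))\<^sup>2 * Qd (exp t)) - 2 * G2 * Qd (exp t) = 0"
      unfolding second_order[OF exp_gt_zero] by (simp add: algebra_simps)
    ultimately show ?thesis by simp
  qed
  then have "\<exists>c. \<forall>t\<in>UNIV. ?F t = c"
    by (intro has_field_derivative_zero_constant) auto
  then obtain K where "\<And>t. ?F t = K" by auto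
  then have "(Qd (exp t))\<^sup>2 = - 4 * P (exp t) ^ 3 + 2 * G2 * P (exp t) + K" for t
    using \<open>\<And>t. ?F t = K\<close>[of t] by linarith
  then show ?thesis using that by blast
qed

lemma Qd_one: "Qd 1 = 0"
  using Qd_inverse[of 1] by simp

lemma Qd_q: "Qd q = 0"
proof -
  have "Qd ((q\<^sup>2) powi 1 * (1 / q)) = Qd (1 / q)" by (rule Qd_shift)
  moreover have "(q\<^sup>2) powi 1 * (1 / q) = q" by (simp add: power2_eq_square)
  ultimately show ?thesis using Qd_inverse[OF q_pos] by simp
qed

lemma e3_sum: "e3 q = - e1 q - e2 q"
  using e_sum by simp

text \<open>By inversion and shift symmetry the derivative of P vanishes at s = 1 and s = q, so e1
  and e2 are roots of the first integral. Subtracting the two equations and dividing by e1 - e2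
  gives G2. The cubic has no quadratic term, hence the third root is - e1 - e2 = e3.\<close>

lemma G2_eq: "G2 = 2 * ((e1 q)\<^sup>2 + e1 q * e2 q + (e2 q)\<^sup>2)"
  and cubic: "\<And>t. (Qd (exp t))\<^sup>2 = 4 * ((e1 q - P (exp t)) * (P (exp t) - e2 q) * (P (exp t) - e3 q))"
proof -
  obtain K where K: "\<And>t. (Qd (exp t))\<^sup>2 = - 4 * P (exp t) ^ 3 + 2 * G2 * P (exp t) + K"
    using first_integral by blast
  have 1: "- 4 * e1 q ^ 3 + 2 * G2 * e1 q + K = 0"
    using K[of 0] Qd_one by (simp add: e1_eq)
  have 2: "- 4 * e2 q ^ 3 + 2 * G2 * e2 q + K = 0"
    using K[of "ln q"] Qd_q q_pos by (simp add: e2_eq)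
  have "(e1 q - e2 q) * (2 * G2 - 4 * ((e1 q)\<^sup>2 + e1 q * e2 q + (e2 q)\<^sup>2)) = 0"
    using 1 2 by (simp add: power2_eq_square power3_eq_cube algebra_simps)
  then show G: "G2 = 2 * ((e1 q)\<^sup>2 + e1 q * e2 q + (e2 q)\<^sup>2)"
    using e_order(1) by simp
  have K': "K = 4 * e1 q ^ 3 - 2 * G2 * e1 q" using 1 by simp
  show "(Qd (exp t))\<^sup>2 = 4 * ((e1 q - P (exp t)) * (P (exp t) - e2 q) * (P (exp t) - e3 q))" for t
    unfolding K K' G e3_sum by (simp add: power2_eq_square power3_eq_cube algebra_simps)
qed

lemma g2_half: "g2 q / 2 = G2"
  unfolding G2_eq g2_def e3_sum by (simp add: power2_eq_square algebra_simps)

text \<open>The link between the coefficient of the boundary expansion and its expression through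
  wp.\<close>

lemma kappa_eq: "r > 0 \<Longrightarrow> kappa q r = 6 * Q2 r - Q r - (Q 1 - Q r)\<^sup>2"
  unfolding kappa_def wp_phi_neg_eq g2_half
  using second_order[of r] by (simp add: e1_eq P_def power2_eq_square algebra_simps)

lemma kappa_quadratic: "r > 0 \<Longrightarrow> kappa q r = 5 * (P r)\<^sup>2 + 2 * e1 q * P r - ((e1 q)\<^sup>2 + g2 q / 2)"
  by (simp add: kappa_def wp_phi_neg_eq)

lemma P_inverse: "s > 0 \<Longrightarrow> P (1 / s) = P s"
  by (simp add: P_def Q_inverse)

lemma P_shift: "P (q\<^sup>2 * s) = P s"
  using Q_shift[of 1 s] by (simp add: P_def)

lemma kappa_symmetric:
  assumes "r > 0"
  shows "kappa q (1 / r) = kappa q r" "kappa q (q\<^sup>2 * r) = kappa q r" "kappa q (q\<^sup>2 / r) = kappa q r"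
proof -
  show "kappa q (1 / r) = kappa q r" "kappa q (q\<^sup>2 * r) = kappa q r"
    using assms q_pos by (simp_all add: kappa_quadratic P_inverse P_shift)
  have "kappa q (q\<^sup>2 / r) = kappa q (q\<^sup>2 * (1 / r))" by simp
  also have "\<dots> = kappa q r"
    using assms q_pos by (simp only: kappa_quadratic P_inverse P_shift zero_less_power mult_pos_pos zero_less_divide_1_iff)
  finally show "kappa q (q\<^sup>2 / r) = kappa q r" .
qed

end

subsection \<open>Boundary asymptotics\<close>

lemma smalloI_of_quotient:
  fixes f :: "real \<Rightarrow> complex" and g :: "real \<Rightarrow> real"
  assumes f: "\<forall>\<^sub>F x in F. f x = of_real (h x)" and g: "\<forall>\<^sub>F x in F. g x \<noteq> 0"
    and lim: "((\<lambda>x. (h x - 1) / g x) \<longlongrightarrow> k) F"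
  shows "(\<lambda>x. f x - (1 + of_real (k * g x))) \<in> o[F](\<lambda>x. of_real (g x))"
proof (rule smalloI_tendsto)
  have "((\<lambda>x. (h x - 1) / g x - k) \<longlongrightarrow> k - k) F"
    by (intro tendsto_intros lim)
  from tendsto_of_real[OF this, where 'a = complex]
  have "((\<lambda>x. complex_of_real ((h x - 1) / g x - k)) \<longlongrightarrow> 0) F" by simp
  moreover have "\<forall>\<^sub>F x in F. complex_of_real ((h x - 1) / g x - k) = (f x - (1 + of_real (k * g x))) / of_real (g x)"
    using f g by eventually_elim (simp add: field_simps)
  ultimately show "((\<lambda>x. (f x - (1 + of_real (k * g x))) / of_real (g x)) \<longlongrightarrow> 0) F"
    by (rule Lim_transform_eventually)
  show "\<forall>\<^sub>F x in F. complex_of_real (g x) \<noteq> 0" using g by simp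
qed

context nome_square
begin

section \<open>The reflection u to p / u and r to 1 / r\<close>

lemma S_unshift: "u \<noteq> 0 \<Longrightarrow> s \<noteq> 0 \<Longrightarrow> S u (s / p) = u * S u s"
  using S_shift[of u "s / p"] by (simp add: field_simps)

lemma S_reflect: "t > 0 \<Longrightarrow> v \<noteq> 0 \<Longrightarrow> S (p / v) t = S v (1 / t) / t"
  using S_swap[of t v] by (simp add: field_simps)

lemma th_inverse_shift: "th (1 / y) = th (p * y)"
  unfolding th_def by (rule prodinf_cong) (simp add: mult_ac)

lemma th_shift:
  assumes y: "y > 0"
  shows "th (p * y) = th y / y"
proof -
  let ?P = "\<lambda>y N. \<Prod>n<N. (1 + y * p ^ n) * (1 + p ^ Suc n / y)"
  have py: "p * y > 0" using y p_pos by simp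
  \<comment> \<open>The partial products for p y and y differ only in their end factors. Written
    without division this is an induction on N, and the factors p^N drop out in the limit.\<close>
  have eq: "?P (p * y) N * ((1 + y) * (1 + p ^ N / y)) = ?P y N * ((1 + y * p ^ N) * (1 + 1 / y))" for N
  proof (induction N)
    case (Suc N)
    have e: "(1 + p * y * p ^ N) = 1 + y * p ^ Suc N" "p ^ Suc N / (p * y) = p ^ N / y" by (simp_all add: mult_ac)
    have "?P (p * y) (Suc N) * ((1 + y) * (1 + p ^ Suc N / y)) =
       (?P (p * y) N * ((1 + y) * (1 + p ^ N / y))) * ((1 + y * p ^ Suc N) * (1 + p ^ Suc N / y))"
      unfolding prod.lessThan_Suc e by (simp only: mult_ac)
    also have "\<dots> = ?P y (Suc N) * ((1 + y * p ^ Suc N) * (1 + 1 / y))"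
      unfolding Suc prod.lessThan_Suc by (simp only: mult_ac)
    finally show ?case .
  qed simp
  have pN: "(\<lambda>N. p ^ N) \<longlonglongrightarrow> 0" using p_pos p_less_1 by (intro LIMSEQ_power_zero) auto
  have "(\<lambda>N. ?P (p * y) N * ((1 + y) * (1 + p ^ N / y))) \<longlonglongrightarrow> th (p * y) * ((1 + y) * (1 + 0 / y))"
    using y by (intro tendsto_intros th_LIMSEQ[OF py] pN) auto
  moreover have "(\<lambda>N. ?P y N * ((1 + y * p ^ N) * (1 + 1 / y))) \<longlonglongrightarrow> th y * ((1 + y * 0) * (1 + 1 / y))"
    by (intro tendsto_intros th_LIMSEQ[OF y] pN)
  ultimately have "th (p * y) * ((1 + y) * (1 + 0 / y)) = th y * ((1 + y * 0) * (1 + 1 / y))"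
    unfolding eq using LIMSEQ_unique by blast
  then have e: "th (p * y) * (1 + y) = th y / y * (1 + y)"
    using y by (simp add: field_simps)
  have "1 + y \<noteq> 0" using y by simp
  from e show ?thesis unfolding mult_right_cancel[OF \<open>1 + y \<noteq> 0\<close>] .
qed

lemma th_inverse: "y > 0 \<Longrightarrow> th (1 / y) = th y / y"
  by (simp add: th_inverse_shift th_shift)

text \<open>With u = p / v the arguments r u^4 and r u^2 are p^4 a and p^2 b. Four shifts of theta
  and two squared shifts, followed by inversion, leave the factor v^8 / p^4.\<close>

lemma T_reflect:
  assumes v: "v > 0" and r: "r > 0"
  shows "T (r * (p / v)\<^sup>2) ((p / v)\<^sup>2) = v ^ 8 / p ^ 4 * T (1 / r * v\<^sup>2) (v\<^sup>2)"
proof -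
  define a where "a = r / v ^ 4"
  define b where "b = r / v\<^sup>2"
  have ab: "a > 0" "b > 0" using v r by (auto simp: a_def b_def)
  have pa: "p * a > 0" "p * (p * a) > 0" "p * (p * (p * a)) > 0" "p * b > 0" using ab p_pos by auto
  have A: "th (p * (p * (p * (p * a)))) = th a / (p ^ 6 * a ^ 4)"
    unfolding th_shift[OF pa(3)] th_shift[OF pa(2)] th_shift[OF pa(1)] th_shift[OF ab(1)]
    by (simp add: power_numeral_reduce mult_ac)
  have B: "th (p * (p * b)) = th b / (p * b\<^sup>2)"
    unfolding th_shift[OF pa(4)] th_shift[OF ab(2)] by (simp add: power2_eq_square mult_ac)
  have 1: "r * (p / v)\<^sup>2 * (p / v)\<^sup>2 = p * (p * (p * (p * a)))" "r * (p / v)\<^sup>2 / (p / v)\<^sup>2 = r" "r * (p / v)\<^sup>2 = p * (p * b)"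
    using v by (simp_all add: a_def b_def power_divide power_numeral_reduce mult_ac)
  have 2: "1 / r * v\<^sup>2 * v\<^sup>2 = 1 / a" "1 / r * v\<^sup>2 / v\<^sup>2 = 1 / r" "1 / r * v\<^sup>2 = 1 / b"
    using v by (simp_all add: a_def b_def power_numeral_reduce)
  have "T (r * (p / v)\<^sup>2) ((p / v)\<^sup>2) = th a * th r / (th b)\<^sup>2 * (b ^ 4 / (p ^ 4 * a ^ 4))"
    unfolding T_def 1(1,2) unfolding 1(3) A B using ab by (simp add: power_mult_distrib power_divide) (simp add: power_numeral_reduce mult_ac)
  also have "b ^ 4 / (p ^ 4 * a ^ 4) = v ^ 8 / p ^ 4"
  proof -
    have ba: "b ^ 4 = r ^ 4 / v ^ 8" "a ^ 4 = r ^ 4 / (v ^ 8 * v ^ 8)"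
      by (simp_all add: a_def b_def power_divide power_mult[symmetric] power_add[symmetric])
    have "(x / y) / (z * (x / (y * y))) = y / z" if "x \<noteq> 0" "y \<noteq> 0" for x y z :: real
      using that by simp
    from this[of "r ^ 4" "v ^ 8"] v r show ?thesis unfolding ba by simp
  qed
  finally have L: "T (r * (p / v)\<^sup>2) ((p / v)\<^sup>2) = th a * th r / (th b)\<^sup>2 * (v ^ 8 / p ^ 4)" .
  have "T (1 / r * v\<^sup>2) (v\<^sup>2) = (th a / a) * (th r / r) / (th b / b)\<^sup>2"
    unfolding T_def 2(1,2) unfolding 2(3) th_inverse[OF ab(1)] th_inverse[OF ab(2)] th_inverse[OF r] ..
  also have "\<dots> = th a * th r / (th b)\<^sup>2 * (b\<^sup>2 / (a * r))"
    by (simp add: power_divide)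
  also have "b\<^sup>2 / (a * r) = 1" using v r by (simp add: a_def b_def power_divide power_numeral_reduce)
  finally show ?thesis unfolding L by (simp add: mult_ac)
qed

text \<open>Each kernel in the numerator acquires the factor c, each one in the denominator the
  factor d. Since c^4 = d^4 v^8 / p^4, these cancel against the factor of T.\<close>

lemma Greal_reflect:
  assumes v: "v > 0" and r: "r > 0"
  shows "Greal (p / v) r = Greal v (1 / r)"
proof -
  define c where "c = v ^ 4 / (r * p\<^sup>2)"
  define d where "d = v\<^sup>2 / (r * p)"
  have S1: "S (p / w) (r * (p / v)\<^sup>2) = c * S w (1 / r * v\<^sup>2)" if "w\<^sup>2 = v\<^sup>2" "w \<noteq> 0" for w
  proof -
    have t: "r * (p / v)\<^sup>2 > 0" using v r p_pos by simp
    have e: "1 / (r * (p / v)\<^sup>2) = 1 / r * v\<^sup>2 / p / p" using v r by (simp add: power2_eq_square)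
    have "S w (1 / r * v\<^sup>2 / p / p) = w\<^sup>2 * S w (1 / r * v\<^sup>2)"
      using S_unshift[OF that(2), of "1 / r * v\<^sup>2 / p"] S_unshift[OF that(2), of "1 / r * v\<^sup>2"] v r by (simp add: power2_eq_square)
    then show ?thesis
      unfolding S_reflect[OF t that(2)] e that(1) using v r by (simp add: c_def power_numeral_reduce)
  qed
  have S2: "S (p / v) (r * (p / v)) = d * S v (1 / r * v)"
  proof -
    have t: "r * (p / v) > 0" using v r p_pos by simp
    have e: "1 / (r * (p / v)) = 1 / r * v / p" using v r by simp
    show ?thesis
      unfolding S_reflect[OF t v[THEN less_imp_neq, THEN not_sym]] e using S_unshift[of v "1 / r * v"] v r
      by (simp add: d_def power_numeral_reduce)
  qed
  have S3: "S (- (p / v)) (r * (p / v)\<^sup>2) = c * S (- v) (1 / r * v\<^sup>2)"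
    using S1[of "- v"] v by simp
  have cd: "c ^ 4 = d ^ 4 * (v ^ 8 / p ^ 4)"
    using v r by (simp add: c_def d_def power_divide power_mult_distrib power_mult[symmetric])
  have d0: "d ^ 4 * (v ^ 8 / p ^ 4) \<noteq> 0" using v r by (simp add: d_def)
  have fin: "((k * l * x) - (k * l * y)) / ((k * z) * (l * w)) = (x - y) / (z * w)" if "k * l \<noteq> 0" for k l x y z w :: real
    using that by (simp add: right_diff_distrib[symmetric])
  show ?thesis
    unfolding Greal_def S1[OF refl v[THEN less_imp_neq, THEN not_sym]] S2 S3 T_reflect[OF v r] power_mult_distrib cd
    by (rule fin[OF d0])
qed

end

context nome
begin

section \<open>Passage from the complex kernels to the real series, and the two boundary
  expansions\<close>

lemma szego_real:
  assumes "q\<^sup>2 < \<bar>a * b\<bar>" "\<bar>a * b\<bar> < 1" "s > 0"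
  shows "szego q (of_real a) (of_real b) s = of_real (S (a * b) s)"
proof -
  have e: "q powi (2 * n) = (q\<^sup>2) powi n" for n by (simp add: power_int_mult)
  have "((\<lambda>n. complex_of_real ((a * b) powi n / (1 + s * (q\<^sup>2) powi n))) has_sum of_real (S (a * b) s)) UNIV"
    unfolding S_def by (intro has_sum_of_real has_sum_infsum summable_S assms)
  moreover have "complex_of_real ((a * b) powi n / (1 + s * (q\<^sup>2) powi n)) = (of_real a * cnj (of_real b)) powi n / of_real (1 + s * q powi (2 * n))" for n
    by (simp add: e)
  ultimately show ?thesis
    unfolding szego_def by (simp only: infsumI)
qed

lemma theta_real: "y > 0 \<Longrightarrow> theta q (of_real (- y)) = of_real (th y)"
proof -
  assume y: "y > 0"
  have "(\<lambda>n. complex_of_real ((1 + y * (q\<^sup>2) ^ n) * (1 + (q\<^sup>2) ^ Suc n / y))) has_prod of_real (th y)"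
    using th_has_prod(1)[OF y] by (subst has_prod_of_real_iff)
  moreover have "complex_of_real ((1 + y * (q\<^sup>2) ^ n) * (1 + (q\<^sup>2) ^ Suc n / y)) =
     (1 - of_real (- y) * of_real (q ^ (2 * n))) * (1 - of_real (q ^ (2 * n + 2)) / of_real (- y))" for n
    by (simp add: power_mult power_add power2_eq_square)
  ultimately show ?thesis
    unfolding theta_def using has_prod_unique by (metis (no_types, lifting) has_prod_cong)
qed

lemma G_vee_real:
  assumes x: "q < x" "x < 1" and r: "r > 0"
  shows "G_vee q x r = of_real (Greal (x\<^sup>2) r)"
proof -
  define u where "u = x\<^sup>2"
  have x0: "x > 0" using x q_pos by simp
  have u: "q\<^sup>2 < u" "u < 1" "u > 0"
    using x x0 q_pos by (auto simp: u_def power_strict_mono power_less_one_iff)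
  have xx: "x * x = u" "- x * - x = u" "- x * x = - u" "x * - x = - u" by (simp_all add: u_def power2_eq_square)
  have n: "norm (complex_of_real (- x)) = x" "norm (complex_of_real x) = x" using x0 by auto
  have s1: "r * x\<^sup>2 * x\<^sup>2 = r * u\<^sup>2" "r * x\<^sup>2 = r * u" "r * x ^ 4 = r * u\<^sup>2" "r * x ^ 4 * x ^ 4 = r * u\<^sup>2 * u\<^sup>2"
    by (simp_all add: u_def power_numeral_reduce)
  have pos: "r * u\<^sup>2 > 0" "r * u > 0" "r * u\<^sup>2 * u\<^sup>2 > 0" using r u by auto
  have sz: "szego q (of_real a) (of_real b) s = of_real (S (a * b) s)" if "a \<in> {x, - x}" "b \<in> {x, - x}" "s > 0" for a b s
    using that u xx by (intro szego_real) auto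
  have r1: "rho1 q (of_real y) r = of_real (th r / th (r * u\<^sup>2) * (S u (r * u))\<^sup>2)" if "y = x \<or> y = - x" for y
  proof -
    have ny: "norm (complex_of_real y) = x" "y * y = u" "y \<in> {x, - x}" using that n xx by auto
    have e: "- r * x ^ 4 = - (r * u\<^sup>2)" using s1(3) by simp
    show ?thesis
      unfolding rho1_def ny(1) s1(2) e using sz[OF ny(3,3) pos(2)] theta_real[OF r] theta_real[OF pos(1)]
      by (simp add: ny(2) del: of_real_minus)
  qed
  have r2: "rho2 q (of_real (- x)) (of_real x) r = of_real (th r / th (r * u\<^sup>2 * u\<^sup>2) * ((S u (r * u\<^sup>2)) ^ 4 - (S (- u) (r * u\<^sup>2)) ^ 4))"
  proof -
    have a: "- r * x ^ 4 * x ^ 4 = - (r * u\<^sup>2 * u\<^sup>2)" using s1(4) by simp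
    have sx: "szego q (of_real (- x)) (of_real (- x)) (r * u\<^sup>2) = of_real (S u (r * u\<^sup>2))"
      "szego q (of_real x) (of_real x) (r * u\<^sup>2) = of_real (S u (r * u\<^sup>2))"
      "szego q (of_real (- x)) (of_real x) (r * u\<^sup>2) = of_real (S (- u) (r * u\<^sup>2))"
      "szego q (of_real x) (of_real (- x)) (r * u\<^sup>2) = of_real (S (- u) (r * u\<^sup>2))"
      using sz[of "- x" "- x"] sz[of x x] sz[of "- x" x] sz[of x "- x"] pos xx by auto
    have p4: "y ^ 2 * y ^ 2 = y ^ 4" for y :: complex by (simp add: power_numeral_reduce)
    show ?thesis
      unfolding rho2_def Let_def n a s1(1) theta_real[OF r] theta_real[OF pos(3)] det_2
      by (simp only: vec_lambda_beta vector_2 sx p4 of_real_mult of_real_divide of_real_diff of_real_power)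
  qed
  have nz: "th r \<noteq> 0" "th (r * u\<^sup>2) \<noteq> 0" "th (r * u\<^sup>2 * u\<^sup>2) \<noteq> 0" "S u (r * u) \<noteq> 0"
    using th_has_prod(2) r pos S_pos[OF u(1,2) pos(2)] by (metis less_irrefl)+
  have "th r / th (r * u\<^sup>2 * u\<^sup>2) * X / ((th r / th (r * u\<^sup>2) * (S u (r * u))\<^sup>2) * (th r / th (r * u\<^sup>2) * (S u (r * u))\<^sup>2)) =
     X / ((S u (r * u)) ^ 4 * T (r * u\<^sup>2) (u\<^sup>2))" for X
  proof -
    have "a / b * X / ((a / c * d\<^sup>2) * (a / c * d\<^sup>2)) = X / (d ^ 4 * (b * a / c\<^sup>2))" if "a \<noteq> 0" "b \<noteq> 0" "c \<noteq> 0" "d \<noteq> 0" for a b c d :: real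
      using that by (simp add: power_numeral_reduce)
    moreover have "r * u\<^sup>2 / u\<^sup>2 = r" using u by simp
    ultimately show ?thesis unfolding T_def using nz by simp
  qed
  then show ?thesis
    unfolding G_vee_def unfolded_corr_def r2 using r1[of x] r1[of "- x"]
    by (simp only: simp_thms of_real_mult[symmetric] of_real_divide[symmetric] Greal_def u_def[symmetric])
qed

lemma G_vee_at_1:
  assumes r: "r > 0"
  shows "(\<lambda>x. G_vee q x r - (1 + of_real (kappa q r * (1 - x\<^sup>2) ^ 4))) \<in> o[at_left 1](\<lambda>x. of_real ((1 - x\<^sup>2) ^ 4))"
proof (rule smalloI_of_quotient)
  have ev: "\<forall>\<^sub>F x in at_left 1. q < x \<and> x < 1" by (rule eventually_at_left_1[OF q_less_1])
  then show "\<forall>\<^sub>F x in at_left 1. G_vee q x r = of_real (Greal (x\<^sup>2) r)"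
    by eventually_elim (use G_vee_real r in auto)
  have ev2: "\<forall>\<^sub>F x in at_left 1. x\<^sup>2 < (1::real)"
    using ev by eventually_elim (use q_pos in \<open>auto simp: power_less_one_iff abs_less_iff power2_less_1_iff\<close>)
  then show "\<forall>\<^sub>F x in at_left (1::real). (1 - x\<^sup>2) ^ 4 \<noteq> 0"
    by eventually_elim auto
  have "((\<lambda>x. x\<^sup>2) \<longlongrightarrow> (1::real)\<^sup>2) (at_left 1)" by (intro tendsto_intros)
  then have "filterlim (\<lambda>x. x\<^sup>2) (at_left 1) (at_left (1::real))"
    using ev2 by (auto simp: filterlim_at elim: eventually_mono)
  from filterlim_compose[OF tendsto_Greal[OF r] this]
  show "((\<lambda>x. (Greal (x\<^sup>2) r - 1) / (1 - x\<^sup>2) ^ 4) \<longlongrightarrow> kappa q r) (at_left 1)"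
    by (simp add: kappa_eq[OF r])
qed

lemma G_vee_at_q:
  assumes r: "r > 0"
  shows "(\<lambda>x. G_vee q x r - (1 + of_real (kappa q r / q ^ 8 * (x\<^sup>2 - q\<^sup>2) ^ 4))) \<in> o[at_right q](\<lambda>x. of_real ((x\<^sup>2 - q\<^sup>2) ^ 4))"
proof (rule smalloI_of_quotient)
  have ev: "\<forall>\<^sub>F x in at_right q. q < x \<and> x < 1"
    using q_less_1 by (intro eventually_at_rightI[of q 1]) auto
  then show "\<forall>\<^sub>F x in at_right q. G_vee q x r = of_real (Greal (x\<^sup>2) r)"
    by eventually_elim (use G_vee_real r in auto)
  have ev2: "\<forall>\<^sub>F x in at_right q. q\<^sup>2 < x\<^sup>2"
    using ev by eventually_elim (use q_pos in \<open>auto intro: power_strict_mono\<close>)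
  then show "\<forall>\<^sub>F x in at_right q. (x\<^sup>2 - q\<^sup>2) ^ 4 \<noteq> 0"
    by eventually_elim auto
  have "((\<lambda>x. q\<^sup>2 / x\<^sup>2) \<longlongrightarrow> q\<^sup>2 / q\<^sup>2) (at_right q)" using q_pos by (intro tendsto_intros) auto
  moreover have "\<forall>\<^sub>F x in at_right q. q\<^sup>2 / x\<^sup>2 < 1"
    using ev2 by eventually_elim (use q_pos in \<open>auto simp: divide_less_eq_1\<close>)
  ultimately have "filterlim (\<lambda>x. q\<^sup>2 / x\<^sup>2) (at_left 1) (at_right q)"
    by (auto simp: filterlim_at elim: eventually_mono)
  moreover have r': "1 / r > 0" using r by simp
  ultimately have "((\<lambda>x. (Greal (q\<^sup>2 / x\<^sup>2) (1 / r) - 1) / (1 - q\<^sup>2 / x\<^sup>2) ^ 4) \<longlongrightarrow> kappa q (1 / r)) (at_right q)"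
    using filterlim_compose[OF tendsto_Greal[OF r']] by (simp add: kappa_eq[OF r'])
  \<comment> \<open>Dividing by x^8 turns (1 - q^2 / x^2)^4 into (x^2 - q^2)^4. As x tends to q,
    this is the origin of the constant q^8.\<close>
  then have "((\<lambda>x. (Greal (q\<^sup>2 / x\<^sup>2) (1 / r) - 1) / (1 - q\<^sup>2 / x\<^sup>2) ^ 4 / x ^ 8) \<longlongrightarrow> kappa q (1 / r) / q ^ 8) (at_right q)"
    using q_pos by (intro tendsto_intros) auto
  moreover have "\<forall>\<^sub>F x in at_right q. (Greal (q\<^sup>2 / x\<^sup>2) (1 / r) - 1) / (1 - q\<^sup>2 / x\<^sup>2) ^ 4 / x ^ 8 = (Greal (x\<^sup>2) r - 1) / (x\<^sup>2 - q\<^sup>2) ^ 4"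
    using ev
  proof eventually_elim
    case (elim x)
    have x0: "x > 0" using elim q_pos by simp
    have "q\<^sup>2 / (q\<^sup>2 / x\<^sup>2) = x\<^sup>2" using x0 by simp
    then have "Greal (x\<^sup>2) r = Greal (q\<^sup>2 / x\<^sup>2) (1 / r)"
      using Greal_reflect[of "q\<^sup>2 / x\<^sup>2" r] x0 q_pos r by simp
    moreover have "1 - q\<^sup>2 / x\<^sup>2 = (x\<^sup>2 - q\<^sup>2) / x\<^sup>2" using x0 by (simp add: field_simps)
    ultimately show ?case using x0 by (simp add: power_divide power_mult[symmetric])
  qed
  ultimately show "((\<lambda>x. (Greal (x\<^sup>2) r - 1) / (x\<^sup>2 - q\<^sup>2) ^ 4) \<longlongrightarrow> kappa q r / q ^ 8) (at_right q)"
    unfolding kappa_symmetric(1)[OF r] by (rule Lim_transform_eventually)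
qed

subsection \<open>The fundamental cell\<close>

lemma powi_bounds: "m \<ge> 1 \<Longrightarrow> (q\<^sup>2) powi m \<le> q\<^sup>2" "m \<ge> 2 \<Longrightarrow> (q\<^sup>2) powi m < q\<^sup>2" "m \<le> 0 \<Longrightarrow> (q\<^sup>2) powi m \<ge> 1"
proof -
  have le1: "(q\<^sup>2) powi k \<le> 1" if "k \<ge> 0" for k
    using powi_less_1[of k] that by (cases "k = 0") auto
  have split: "(q\<^sup>2) powi m = q\<^sup>2 * (q\<^sup>2) powi (m - 1)" for m
    using powi_add[of 1 "m - 1"] by simp
  show "m \<ge> 1 \<Longrightarrow> (q\<^sup>2) powi m \<le> q\<^sup>2"
    unfolding split[of m] using le1[of "m - 1"] q_pos by (simp add: mult_left_le)
  show "m \<ge> 2 \<Longrightarrow> (q\<^sup>2) powi m < q\<^sup>2"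
    unfolding split[of m] using powi_less_1[of "m - 1"] q_pos by simp
  show "m \<le> 0 \<Longrightarrow> (q\<^sup>2) powi m \<ge> 1"
    using le1[of "- m"] powi_pos[of m] by (simp add: power_int_minus inverse_le_1_iff)
qed

text \<open>For a pure scaling q^2 < q excludes any nonzero exponent. For an inversion s s' lies in
  [q^2, 1]: exponent 1 forces both points to be q, and an exponent <= 0 forces both to be 1.\<close>

lemma cell_unique:
  assumes s: "q \<le> s" "s \<le> 1" and s': "q \<le> s'" "s' \<le> 1"
    and rel: "s' = (q\<^sup>2) powi m * s \<or> s' = (q\<^sup>2) powi m / s"
  shows "s' = s"
  using rel
proof
  assume e: "s' = (q\<^sup>2) powi m * s"
  have qq: "q\<^sup>2 < q" by (rule q_annulus)
  have *: False if "t' = (q\<^sup>2) powi k * t" "k \<ge> 1" "q \<le> t'" "q \<le> t" "t \<le> 1" for t t' k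
  proof -
    have "(q\<^sup>2) powi k * t \<le> q\<^sup>2 * 1"
      using that powi_bounds(1)[of k] q_pos by (intro mult_mono) auto
    with that qq show False by linarith
  qed
  have "s = (q\<^sup>2) powi (- m) * s'" using e powi_pos[of m] by (simp add: power_int_minus)
  with *[OF e] *[of s "- m" s'] s s' have "m = 0" by (cases "m \<ge> 1"; cases "- m \<ge> 1") auto
  with e show ?thesis by simp
next
  assume e: "s' = (q\<^sup>2) powi m / s"
  have s0: "s > 0" "s' > 0" using s s' q_pos by auto
  then have e': "s * s' = (q\<^sup>2) powi m" using e by simp
  have lo: "q * q \<le> s * s'" using s s' q_pos by (intro mult_mono) auto
  have "m \<le> 1"
  proof (rule ccontr)
    assume "\<not> m \<le> 1"
    then have "(q\<^sup>2) powi m < q\<^sup>2" by (intro powi_bounds(2)) auto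
    with lo e' show False by (simp add: power2_eq_square)
  qed
  then consider "m = 1" | "m \<le> 0" by linarith
  then show ?thesis
  proof cases
    case 1
    then have ss: "s * s' = q * q" using e' by (simp add: power2_eq_square)
    have "s = q"
    proof (rule ccontr)
      assume "s \<noteq> q"
      then have "q * q < s * s'" using s s' q_pos by (intro mult_less_le_imp_less) auto
      with ss show False by simp
    qed
    with ss q_pos show ?thesis by simp
  next
    case 2
    then have "s * s' \<ge> 1" using powi_bounds(3) e' by simp
    moreover have "s * s' \<le> s" "s * s' \<le> s'" using s s' s0 by (auto simp: mult_left_le mult_left_le_one_le)
    ultimately show ?thesis using s s' by linarith
  qed
qed

text \<open>The maps t -> q^(2 k) t and t -> q^(2 k) / t are closed under composition and contain
  the generators and their inverses; conversely each is a word in the generators.\<close>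

lemma sym_orbit_eq:
  assumes r: "r > 0"
  shows "sym_orbit q r = (\<Union>k. {(q\<^sup>2) powi k * r, (q\<^sup>2) powi k / r})"
proof -
  let ?R = "{0::real<..}"
  let ?G = "BijGroup ?R"
  define f where "f = restrict (\<lambda>t::real. 1 / t) ?R"
  define g where "g = restrict (\<lambda>t. q\<^sup>2 * t) ?R"
  let ?H = "{f, g}"
  have fB: "f \<in> Bij ?R"
    unfolding f_def Bij_def by (auto intro!: bij_betwI[where g = "\<lambda>t. 1 / t"])
  have gB: "g \<in> Bij ?R"
    unfolding g_def Bij_def using q_pos by (auto intro!: bij_betwI[where g = "\<lambda>t. t / q\<^sup>2"])
  have HB: "?H \<subseteq> carrier ?G" using fB gB by (simp add: BijGroup_def)
  have GG: "group ?G" by (rule group_BijGroup)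
  have gen_B: "h \<in> Bij ?R" if "h \<in> generate ?G ?H" for h
    using group.generate_incl[OF GG HB] that by (auto simp: BijGroup_def)
  have mult: "mult ?G h1 h2 = compose ?R h1 h2" if "h1 \<in> Bij ?R" "h2 \<in> Bij ?R" for h1 h2
    using that by (simp add: BijGroup_def)
  have fi: "m_inv ?G f = f"
  proof -
    have "mult ?G f f = one ?G"
      unfolding mult[OF fB fB] by (auto simp: BijGroup_def compose_def f_def fun_eq_iff)
    then show ?thesis using group.inv_equality[OF GG] fB by (simp add: BijGroup_def)
  qed
  define g' where "g' = restrict (\<lambda>t. t / q\<^sup>2) ?R"
  have g'B: "g' \<in> Bij ?R"
    unfolding g'_def Bij_def using q_pos by (auto intro!: bij_betwI[where g = "\<lambda>t. q\<^sup>2 * t"])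
  have gi: "m_inv ?G g = g'"
  proof -
    have "mult ?G g' g = one ?G"
      unfolding mult[OF g'B gB] using q_pos by (auto simp: BijGroup_def compose_def g_def g'_def fun_eq_iff)
    then show ?thesis using group.inv_equality[OF GG] gB g'B by (simp add: BijGroup_def)
  qed
  define sc where "sc = (\<lambda>k::int. restrict (\<lambda>t. (q\<^sup>2) powi k * t) ?R)"
  define rf where "rf = (\<lambda>k::int. restrict (\<lambda>t. (q\<^sup>2) powi k / t) ?R)"
  have comp: "compose ?R (sc k) (sc l) = sc (k + l)" "compose ?R (sc k) (rf l) = rf (k + l)"
    "compose ?R (rf k) (sc l) = rf (k - l)" "compose ?R (rf k) (rf l) = sc (k - l)" for k l
    by (auto simp: compose_def sc_def rf_def fun_eq_iff power_int_add power_int_diff mult_ac zero_less_mult_iff)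
  have basic: "f = rf 0" "g = sc 1" "g' = sc (- 1)" "one ?G = sc 0"
    by (auto simp: f_def g_def g'_def sc_def rf_def fun_eq_iff BijGroup_def power_int_minus divide_inverse)
  have shape: "\<exists>k. h = sc k \<or> h = rf k" if "h \<in> generate ?G ?H" for h
    using that
  proof (induction rule: generate.induct)
    case one
    show ?case using basic by blast
  next
    case (incl h)
    then show ?case using basic by blast
  next
    case (inv h)
    then show ?case using basic fi gi by (metis empty_iff insert_iff)
  next
    case (eng h1 h2)
    then have "mult ?G h1 h2 = compose ?R h1 h2" using mult gen_B by blast
    with eng comp show ?case by metis
  qed
  have sc_gen: "sc k \<in> generate ?G ?H" for k
  proof (induction k rule: int_induct[where k = 0])
    case base
    show ?case using generate.one[of ?G ?H] by (simp add: basic)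
  next
    case (step1 i)
    have "mult ?G g (sc i) \<in> generate ?G ?H"
      by (rule generate.eng[OF generate.incl step1(2)]) simp
    moreover have "mult ?G g (sc i) = compose ?R g (sc i)" using mult gB gen_B step1 by blast
    ultimately show ?case unfolding basic(2) comp by (simp add: add.commute)
  next
    case (step2 i)
    have "mult ?G g' (sc i) \<in> generate ?G ?H"
      using generate.eng[OF generate.inv step2(2), of g] gi by simp
    moreover have "mult ?G g' (sc i) = compose ?R g' (sc i)" using mult g'B gen_B step2 by blast
    ultimately show ?case unfolding basic(3) comp by (simp add: add.commute)
  qed
  have rf_gen: "rf k \<in> generate ?G ?H" for k
  proof -
    have "mult ?G (sc k) f \<in> generate ?G ?H" by (intro generate.eng sc_gen generate.incl) auto
    moreover have "mult ?G (sc k) f = compose ?R (sc k) f" using mult fB gen_B sc_gen by blast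
    ultimately show ?thesis unfolding basic(1) comp by simp
  qed
  have "sym_orbit q r = (\<lambda>h. h r) ` generate ?G ?H"
    by (simp add: sym_orbit_def f_def g_def)
  also have "\<dots> = (\<Union>k. {(q\<^sup>2) powi k * r, (q\<^sup>2) powi k / r})"
  proof (intro equalityI subsetI)
    fix x assume "x \<in> (\<lambda>h. h r) ` generate ?G ?H"
    then obtain h where "h \<in> generate ?G ?H" "x = h r" by blast
    with shape obtain k where "h = sc k \<or> h = rf k" by blast
    with \<open>x = h r\<close> r show "x \<in> (\<Union>k. {(q\<^sup>2) powi k * r, (q\<^sup>2) powi k / r})"
      by (auto simp: sc_def rf_def)
  next
    fix x assume "x \<in> (\<Union>k. {(q\<^sup>2) powi k * r, (q\<^sup>2) powi k / r})"
    then obtain k where "x = (q\<^sup>2) powi k * r \<or> x = (q\<^sup>2) powi k / r" by auto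
    then have "x = sc k r \<or> x = rf k r" using r by (auto simp: sc_def rf_def)
    with sc_gen rf_gen show "x \<in> (\<lambda>h. h r) ` generate ?G ?H" by blast
  qed
  finally show ?thesis .
qed

lemma orbit_meets_cell:
  assumes r: "r > 0"
  shows "\<exists>!s. s \<in> sym_orbit q r \<and> (q, s) \<in> Omega"
proof -
  have O: "(q, s) \<in> Omega \<longleftrightarrow> q \<le> s \<and> s \<le> 1" for s
    using q_pos q_less_1 by (auto simp: Omega_def)
  define L where "L = - ln q"
  have L: "L > 0" using q_pos q_less_1 by (simp add: L_def)
  \<comment> \<open>The floor places ln y in [ln q, - ln q); points above 1 are then folded back by
    inversion.\<close>
  define k where "k = \<lfloor>(ln r + L) / (2 * L)\<rfloor>"
  define y where "y = (q\<^sup>2) powi k * r"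
  have y0: "y > 0" using r by (simp add: y_def)
  have lny: "ln y = ln r - 2 * L * of_int k"
  proof -
    have "(q\<^sup>2) powi k = exp (of_int k * (2 * ln q))"
    proof -
      have "exp (2 * ln q) = q\<^sup>2" using q_pos by (simp add: exp_double)
      then show ?thesis using exp_power_int[of "2 * ln q" k] by (simp only:)
    qed
    then have "ln ((q\<^sup>2) powi k) = of_int k * (2 * ln q)" by simp
    then show ?thesis using r by (simp add: y_def ln_mult L_def)
  qed
  have "of_int k \<le> (ln r + L) / (2 * L)" "(ln r + L) / (2 * L) < of_int k + 1"
    unfolding k_def by linarith+
  then have "2 * L * of_int k \<le> ln r + L" "ln r + L < 2 * L * (of_int k + 1)"
    using L by (simp_all add: field_simps)
  then have lo: "- L \<le> ln y" and hi: "ln y < L" unfolding lny by (simp_all add: algebra_simps)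
  have lo': "q \<le> y" using lo y0 q_pos by (simp add: L_def)
  have hi': "y < 1 / q" using hi y0 q_pos by (simp add: L_def ln_div[symmetric] flip: ln_inverse) (simp add: inverse_eq_divide)
  define s where "s = (if y \<le> 1 then y else 1 / y)"
  have "s \<in> sym_orbit q r"
  proof -
    have "1 / y = (q\<^sup>2) powi (- k) / r" by (simp add: y_def power_int_minus field_simps)
    then show ?thesis unfolding sym_orbit_eq[OF r] s_def by (auto simp: y_def)
  qed
  moreover have "q \<le> s \<and> s \<le> 1"
    using lo' hi' y0 q_pos by (auto simp: s_def field_simps)
  moreover have "s' = s" if a: "s' \<in> sym_orbit q r" "q \<le> s'" "s' \<le> 1" for s'
  proof -
    obtain i where i: "s = (q\<^sup>2) powi i * r \<or> s = (q\<^sup>2) powi i / r"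
      using \<open>s \<in> sym_orbit q r\<close> unfolding sym_orbit_eq[OF r] by auto
    obtain j where j: "s' = (q\<^sup>2) powi j * r \<or> s' = (q\<^sup>2) powi j / r"
      using a(1) unfolding sym_orbit_eq[OF r] by auto
    have nz: "(q\<^sup>2) powi i \<noteq> 0" using powi_pos[of i] by simp
    have "s' = (q\<^sup>2) powi (j - i) * s \<or> s' = (q\<^sup>2) powi (j + i) / s"
    proof -
      have d: "(q\<^sup>2) powi (j - i) = (q\<^sup>2) powi j / (q\<^sup>2) powi i" by (simp add: power_int_diff)
      show ?thesis using i j r nz unfolding d powi_add by auto
    qed
    then show ?thesis
      using cell_unique[OF _ _ a(2,3)] \<open>q \<le> s \<and> s \<le> 1\<close> by blast
  qed
  ultimately show ?thesis unfolding O by blast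
qed

end

lemma fundamental_cell_Omega: "fundamental_cell Omega"
  unfolding fundamental_cell_def
proof (intro conjI ballI allI impI)
  show "Omega \<subseteq> {0<..<1} \<times> {0<..}" by (auto simp: Omega_def)
  fix q r :: real assume "q \<in> {0<..<1}" "r > 0"
  then interpret nome q by unfold_locales auto
  show "\<exists>!s. s \<in> sym_orbit q r \<and> (q, s) \<in> Omega"
    by (rule orbit_meets_cell[OF \<open>r > 0\<close>])
qed

context nome
begin

subsection \<open>Monotonicity along the real segment\<close>

lemma P_le_e1: "s > 0 \<Longrightarrow> P s \<le> e1 q"
  using B_square[of s] zero_le_power2[of "B s"] by (simp add: e1_eq P_def)

lemma P_ge_e2: "s > 0 \<Longrightarrow> P s \<ge> e2 q"
  using S_minus_q_square[of s] mult_nonneg_nonneg[of s "(S (- q) s)\<^sup>2"] by (simp add: e2_eq P_def)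

lemma ln_q_neg: "ln q < 0"
  using q_pos q_less_1 by simp

lemma isCont_P_exp: "isCont (\<lambda>t. P (exp t)) t"
  using DERIV_P DERIV_isCont by blast

lemma isCont_Qd_exp: "isCont (\<lambda>t. Qd (exp t)) t"
  using DERIV_Qd DERIV_isCont by blast

lemma P_exp_ends: "P (exp 0) = e1 q" "P (exp (ln q)) = e2 q"
  using q_pos by (simp_all add: e1_eq e2_eq)

text \<open>If e1 were attained inside, an interior minimum of P on [t, 0] would be critical with a
  value above e2, hence equal to e1 by the cubic. P would then be constant on [t, 0], against its
  second-order equation.\<close>

lemma P_exp_less_e1:
  assumes e2: "\<And>s. q < s \<Longrightarrow> s < 1 \<Longrightarrow> P s > e2 q" and t: "ln q < t" "t < 0"
  shows "P (exp t) < e1 q"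
proof (rule ccontr)
  assume "\<not> P (exp t) < e1 q"
  then have Pt: "P (exp t) = e1 q" using P_le_e1[of "exp t"] by simp
  have const: "P (exp x) = e1 q" if x: "t \<le> x" "x \<le> 0" for x
  proof -
    have "\<exists>m\<in>{t..0}. \<forall>y\<in>{t..0}. P (exp m) \<le> P (exp y)"
      using t by (intro continuous_attains_inf) (auto intro!: continuous_at_imp_continuous_on isCont_P_exp)
    then obtain m where m: "t \<le> m" "m \<le> 0" "\<And>y. t \<le> y \<Longrightarrow> y \<le> 0 \<Longrightarrow> P (exp m) \<le> P (exp y)" by auto
    have "P (exp m) = e1 q"
    proof (cases "m = t \<or> m = 0")
      case True
      then show ?thesis using Pt P_exp_ends by auto
    next
      case False
      with m have mm: "t < m" "m < 0" by auto
      have "Qd (exp m) = 0"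
      proof (rule DERIV_local_min[OF DERIV_P])
        show "0 < min (m - t) (- m)" using mm by simp
        show "\<forall>y. \<bar>m - y\<bar> < min (m - t) (- m) \<longrightarrow> P (exp m) \<le> P (exp y)"
          using m(3) by (auto simp: abs_less_iff)
      qed
      moreover have "q < exp m" "exp m < 1"
        using t mm q_pos by (metis exp_less_mono exp_ln less_trans, simp)
      then have "P (exp m) > e2 q" by (rule e2)
      ultimately show ?thesis using cubic[of m] e_order by auto
    qed
    with m(3)[OF x] P_le_e1[of "exp x"] show ?thesis by simp
  qed
  have m: "t < t / 2" "t / 2 < 0" using t by auto
  have Qz: "Qd (exp x) = 0" if "t < x" "x < 0" for x
  proof (rule DERIV_local_min[OF DERIV_P])
    show "0 < min (x - t) (- x)" using that by simp
    show "\<forall>y. \<bar>x - y\<bar> < min (x - t) (- x) \<longrightarrow> P (exp x) \<le> P (exp y)"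
      using that const by (auto simp: abs_less_iff)
  qed
  have "Q (exp (t / 2)) - 6 * Q2 (exp (t / 2)) = 0"
  proof (rule DERIV_local_min[OF DERIV_Qd])
    show "0 < min (t / 2 - t) (- (t / 2))" using m by simp
    show "\<forall>y. \<bar>t / 2 - y\<bar> < min (t / 2 - t) (- (t / 2)) \<longrightarrow> Qd (exp (t / 2)) \<le> Qd (exp y)"
      using m Qz by (auto simp: abs_less_iff)
  qed
  \<comment> \<open>On a constant stretch the second derivative G2 - 6 e1^2 would vanish, but it
    equals - 2 (e1 - e2)(e1 - e3).\<close>
  then have "G2 - 6 * (e1 q)\<^sup>2 = 0"
    unfolding second_order[OF exp_gt_zero] using const[of "t / 2"] m by simp
  moreover have "6 * (e1 q)\<^sup>2 - G2 = 2 * ((e1 q - e2 q) * (e1 q - e3 q))"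
    unfolding G2_eq e3_sum by (simp add: power2_eq_square algebra_simps)
  ultimately show False using e_order by simp
qed

text \<open>By \<open>S_minus_q_square\<close> this says that \<open>S (- q)\<close> has no zero on
  (q, 1). It is stated as a property of the nome so that it can be inherited from q^2.\<close>

definition separated :: bool where
  "separated \<longleftrightarrow> (\<forall>s. q < s \<longrightarrow> s < 1 \<longrightarrow> P s > e2 q)"

text \<open>Pairing n with - n - 1 extracts the factor s - q, the known zero at s = q. What remains
  is an alternating series whose first term exceeds the sum of all the others.\<close>

lemma separated_small:
  assumes "q < 1 / 5"
  shows separated
  unfolding separated_def
proof (intro allI impI)
  fix s assume s: "q < s" "s < 1"
  have s0: "s > 0" using s q_pos by simp
  let ?f = "\<lambda>n::int. (- q) powi n / (1 + s * (q\<^sup>2) powi n)"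
  define a where "a = (\<lambda>k. q ^ k * (1 - q ^ (2 * k + 1)) / ((1 + s * q ^ (2 * k)) * (q ^ (2 * k + 2) + s)))"
  have pair: "?f (int k) + ?f (- int (Suc k)) = (s - q) * ((- 1) ^ k * a k)" for k
  proof -
    define x where "x = q ^ k"
    have x: "x > 0" using q_pos by (simp add: x_def)
    have e1: "(q\<^sup>2) ^ k = x\<^sup>2" by (simp add: x_def power_mult[symmetric] mult.commute)
    have e: "(q\<^sup>2) ^ k = x\<^sup>2" "(q\<^sup>2) ^ Suc k = q\<^sup>2 * x\<^sup>2" "q ^ (2 * k + 1) = q * x\<^sup>2" "q ^ (2 * k) = x\<^sup>2" "q ^ (2 * k + 2) = q\<^sup>2 * x\<^sup>2"
      unfolding power_Suc power_add power_mult e1 by (simp_all add: mult_ac power2_eq_square)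
    have pos: "1 + s * x\<^sup>2 > 0" "q\<^sup>2 * x\<^sup>2 + s > 0" using s0 x q_pos by (auto intro!: add_pos_pos)
    have f1: "?f (int k) = (- 1) ^ k * (x / (1 + s * x\<^sup>2))"
      unfolding power_int_of_nat e(1) by (simp add: x_def power_minus[of q])
    have "?f (- int (Suc k)) = (1 / - q) ^ Suc k / (1 + s * (1 / (q\<^sup>2 * x\<^sup>2)))"
      unfolding power_int_minus_of_nat power_one_over[of "q\<^sup>2"] e(2) ..
    also have "(1 / - q) ^ Suc k = - ((- 1) ^ k / (q * x))"
    proof -
      have "(- q) ^ Suc k = (- 1) ^ k * (- (q * x))" by (simp add: x_def power_minus[of q k])
      then show ?thesis unfolding power_one_over by (cases "even k") auto
    qed
    also have "1 + s * (1 / (q\<^sup>2 * x\<^sup>2)) = (q\<^sup>2 * x\<^sup>2 + s) / (q\<^sup>2 * x\<^sup>2)"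
      using x q_pos by (simp add: field_simps)
    also have "- ((- 1) ^ k / (q * x)) / ((q\<^sup>2 * x\<^sup>2 + s) / (q\<^sup>2 * x\<^sup>2)) = (- 1) ^ k * (- (q * x / (q\<^sup>2 * x\<^sup>2 + s)))"
      using x q_pos by (simp add: power2_eq_square)
    finally have f2: "?f (- int (Suc k)) = (- 1) ^ k * (- (q * x / (q\<^sup>2 * x\<^sup>2 + s)))" .
    have "x / (1 + s * x\<^sup>2) - q * x / (q\<^sup>2 * x\<^sup>2 + s) = (s - q) * (x * (1 - q * x\<^sup>2) / ((1 + s * x\<^sup>2) * (q\<^sup>2 * x\<^sup>2 + s)))"
    proof -
      have "x * (q\<^sup>2 * x\<^sup>2 + s) - q * x * (1 + s * x\<^sup>2) = (s - q) * (x * (1 - q * x\<^sup>2))"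
        by (simp add: power2_eq_square algebra_simps)
      then show ?thesis using pos by (simp add: diff_frac_eq mult_ac)
    qed
    then show ?thesis
      unfolding f1 f2 a_def x_def[symmetric] e(3-5) by (simp only: distrib_left[symmetric] mult.left_commute diff_conv_add_uminus[symmetric])
  qed
  have sm: "?f summable_on UNIV" by (rule summable_S[OF q_annulus(3,4) s0])
  have Ssums: "(\<lambda>k. (s - q) * ((- 1) ^ k * a k)) sums S (- q) s"
    using int_infsum_pair_sums[OF sm] unfolding pair S_def .
  have a0: "a 0 = (1 - q) / ((1 + s) * (q\<^sup>2 + s))" by (simp add: a_def power2_eq_square)
  have ab: "0 \<le> a k" "a k \<le> q ^ k / s" for k
  proof -
    have l: "q ^ (2 * k + 1) \<le> 1" "q ^ (2 * k + 1) \<ge> 0" using q_pos q_less_1 by (auto intro: power_le_one simp del: power_Suc simp: Suc_eq_plus1[symmetric])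
    have d: "s \<le> (1 + s * q ^ (2 * k)) * (q ^ (2 * k + 2) + s)"
    proof -
      have "1 * s \<le> (1 + s * q ^ (2 * k)) * (q ^ (2 * k + 2) + s)"
        using s0 q_pos by (intro mult_mono) auto
      then show ?thesis by simp
    qed
    show "0 \<le> a k" unfolding a_def using l d s0 q_pos by (intro divide_nonneg_nonneg mult_nonneg_nonneg) auto
    have "a k \<le> q ^ k * 1 / s"
      unfolding a_def using l d s0 q_pos by (intro frac_le mult_left_mono) auto
    then show "a k \<le> q ^ k / s" by simp
  qed
  have qs: "summable (\<lambda>k. q ^ k / s)"
    using q_pos q_less_1 by (intro summable_divide summable_geometric) auto
  have as: "summable (\<lambda>k. norm ((- 1) ^ k * a k))"
    by (rule summable_comparison_test'[OF qs, of 0]) (use ab in \<open>auto simp: abs_mult power_abs\<close>)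
  have tail: "norm (\<Sum>k. (- 1) ^ Suc k * a (Suc k)) \<le> q / (1 - q) / s"
  proof -
    have G: "(\<lambda>k. q * q ^ k / s) sums (q * (1 / (1 - q)) / s)"
      using q_pos q_less_1 by (intro sums_divide sums_mult geometric_sums) auto
    have "norm (\<Sum>k. (- 1) ^ Suc k * a (Suc k)) \<le> (\<Sum>k. q * q ^ k / s)"
    proof (rule norm_suminf_le)
      show "norm ((- 1) ^ Suc k * a (Suc k)) \<le> q * q ^ k / s" for k
        using ab(1)[of "Suc k"] ab(2)[of "Suc k"] by (simp add: abs_mult power_abs)
    qed (rule sums_summable[OF G])
    then show ?thesis unfolding sums_unique[OF G, symmetric] by simp
  qed
  have head: "(\<Sum>k. (- 1) ^ k * a k) = a 0 + (\<Sum>k. (- 1) ^ Suc k * a (Suc k))"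
    using suminf_split_head[OF summable_norm_cancel[OF as]] by simp
  have "q / (1 - q) / s < a 0"
  proof -
    \<comment> \<open>Equivalent to q^2 + 4 q < 1; this is where q < 1/5 enters. With q^2 <= s q and
      s < 1 it makes \<open>a 0\<close> exceed the tail bound.\<close>
    have "2 * q * (1 + q) < (1 - q)\<^sup>2"
    proof -
      have "q * q < 1 / 5 * q" using assms q_pos by (intro mult_strict_right_mono) auto
      then have "4 * q + q * q < 1" using assms by linarith
      then show ?thesis by (simp add: power2_eq_square algebra_simps)
    qed
    moreover have "q * ((1 + s) * (q\<^sup>2 + s)) \<le> q * (2 * (s * (1 + q)))"
    proof -
      have "q\<^sup>2 \<le> s * q" using s q_pos by (simp add: power2_eq_square)
      then have "(1 + s) * (q\<^sup>2 + s) \<le> 2 * (s * q + s)" using s s0 q_pos by (intro mult_mono) auto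
      then show ?thesis using q_pos by (intro mult_left_mono) (auto simp: algebra_simps)
    qed
    moreover have "q * (2 * (s * (1 + q))) = s * (2 * q * (1 + q))" by simp
    ultimately have "q * ((1 + s) * (q\<^sup>2 + s)) < s * (1 - q)\<^sup>2"
      using s0 by (smt (verit) mult_strict_left_mono)
    then show ?thesis
      unfolding a0 using s0 q_pos q_less_1 by (simp add: divide_simps power2_eq_square add_pos_pos mult_ac)
  qed
  with tail head have "(\<Sum>k. (- 1) ^ k * a k) > 0" by (simp add: abs_le_iff)
  then have "S (- q) s > 0"
    using sums_unique[OF Ssums] suminf_mult[OF summable_norm_cancel[OF as], of "s - q"] s by simp
  then have "s * (S (- q) s)\<^sup>2 > 0" using s0 by simp
  then show "P s > e2 q" unfolding S_minus_q_square[OF s0] by (simp add: P_def e2_eq)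
qed

text \<open>Strictly between e2 and e1 the cubic is nonzero, so the derivative cannot vanish inside.
  The mean value theorem supplies one point where it is positive, and the intermediate value theorem
  excludes a change of sign.\<close>

lemma Qd_exp_pos:
  assumes sep: separated and t: "ln q < t" "t < 0"
  shows "Qd (exp t) > 0"
proof -
  have rng: "q < exp x" "exp x < 1" if "ln q < x" "x < 0" for x
    using that q_pos by (metis exp_less_mono exp_ln, simp)
  have nz: "Qd (exp x) \<noteq> 0" if x: "ln q < x" "x < 0" for x
  proof -
    have "P (exp x) > e2 q" using sep rng[OF x] by (auto simp: separated_def)
    moreover have "P (exp x) < e1 q"
      using P_exp_less_e1[OF _ x] sep by (auto simp: separated_def)
    ultimately have "(e1 q - P (exp x)) * (P (exp x) - e2 q) * (P (exp x) - e3 q) > 0"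
      using e_order by (intro mult_pos_pos) auto
    with cubic[of x] show ?thesis by auto
  qed
  have "\<exists>z. ln q < z \<and> z < 0 \<and> P (exp 0) - P (exp (ln q)) = (0 - ln q) * Qd (exp z)"
    using ln_q_neg DERIV_P by (intro MVT2) auto
  then obtain z where z: "ln q < z" "z < 0" "e1 q - e2 q = (0 - ln q) * Qd (exp z)"
    unfolding P_exp_ends by auto
  then have zp: "Qd (exp z) > 0"
    using e_order(1) ln_q_neg by (metis diff_0 diff_gt_0_iff_gt zero_less_mult_pos neg_0_less_iff_less)
  show ?thesis
  proof (rule ccontr)
    assume "\<not> Qd (exp t) > 0"
    then have tn: "Qd (exp t) \<le> 0" by simp
    have c: "\<forall>x. a \<le> x \<and> x \<le> b \<longrightarrow> isCont (\<lambda>t. Qd (exp t)) x" for a b using isCont_Qd_exp by blast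
    show False
    proof (cases "t \<le> z")
      case True
      then obtain x where "t \<le> x" "x \<le> z" "Qd (exp x) = 0"
        using IVT[of "\<lambda>t. Qd (exp t)" t 0 z] tn zp c by auto
      with nz[of x] t z show False by auto
    next
      case False
      then obtain x where "z \<le> x" "x \<le> t" "Qd (exp x) = 0"
        using IVT2[of "\<lambda>t. Qd (exp t)" t 0 z] tn zp c by auto
      with nz[of x] t z show False by auto
    qed
  qed
qed

lemma P_strict_mono:
  assumes sep: separated and s: "q \<le> s" "s < s'" "s' \<le> 1"
  shows "P s < P s'"
proof -
  have s0: "s > 0" "s' > 0" using s q_pos by auto
  have "P (exp (ln s)) < P (exp (ln s'))"
  proof (rule DERIV_pos_imp_increasing_open[where f = "\<lambda>t. P (exp t)"])
    show "ln s < ln s'" using s s0 by simp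
    fix x assume x: "ln s < x" "x < ln s'"
    have "ln q \<le> ln s" "ln s' \<le> 0" using s s0 q_pos by auto
    with x have "Qd (exp x) > 0" by (intro Qd_exp_pos[OF sep]) auto
    with DERIV_P show "\<exists>y. ((\<lambda>t. P (exp t)) has_real_derivative y) (at x) \<and> 0 < y" by blast
  next
    show "continuous_on {ln s..ln s'} (\<lambda>t. P (exp t))"
      by (intro continuous_at_imp_continuous_on ballI isCont_P_exp)
  qed
  then show ?thesis using s0 by simp
qed

end

text \<open>Strict monotonicity is inherited from the nome \<open>q\<^sup>2\<close> by \<open>q\<close>: a zero of \<open>S (- q)\<close> at \<open>s\<close>
  would give \<open>P s = P (q\<^sup>2 / s)\<close> for the nome \<open>q\<^sup>2\<close>.\<close>

context nome
begin

lemma separated_step: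
  assumes sep: "nome.separated (q\<^sup>2)"
  shows separated
  unfolding separated_def
proof (intro allI impI)
  interpret n2: nome "q\<^sup>2" by (rule square_nome)
  fix s assume s: "q < s" "s < 1"
  have s0: "s > 0" using s q_pos by simp
  have "P s \<noteq> e2 q"
  proof
    assume "P s = e2 q"
    then have "s * (S (- q) s)\<^sup>2 = 0" unfolding S_minus_q_square[OF s0] by (simp add: P_def e2_eq)
    then have S0: "S (- q) s = 0" using s0 by simp
    have even: "x powi (2 * n) = (x\<^sup>2) powi n" for x :: real and n
      by (simp add: power_int_mult)
    have odd: "x powi (2 * n + 1) = (x\<^sup>2) powi n * x" if "x \<noteq> 0" for x :: real and n
      using that by (simp add: power_int_add power_int_mult)
    let ?g = "\<lambda>n. (- q) powi n / (1 + s * (q\<^sup>2) powi n)"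
    have gs: "?g summable_on UNIV" using summable_S[OF q_annulus(3,4) s0] .
    have g1: "?g (2 * n) = (q\<^sup>2) powi n / (1 + s * ((q\<^sup>2)\<^sup>2) powi n)" for n by (simp only: even power2_minus)
    have o: "(- q) powi (2 * n + 1) = (q\<^sup>2) powi n * (- q)" "(q\<^sup>2) powi (2 * n + 1) = ((q\<^sup>2)\<^sup>2) powi n * q\<^sup>2" for n
      using odd[of "- q" n] odd[of "q\<^sup>2" n] by simp_all
    have g2: "?g (2 * n + 1) = - q * ((q\<^sup>2) powi n / (1 + (q\<^sup>2 * s) * ((q\<^sup>2)\<^sup>2) powi n))" for n
      unfolding o by (simp add: mult_ac)
    \<comment> \<open>Splitting by parity leads to two series at u = q^2, the fixed point for the
      squared nome. Their equality after squaring becomes an equality of values of Q.\<close>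
    have "S (- q) s = n2.S (q\<^sup>2) s - q * n2.S (q\<^sup>2) (q\<^sup>2 * s)"
      unfolding S_def n2.S_def int_parity_has_sum(3)[OF gs] g1 g2 infsum_cmult_right' by simp
    with S0 have "n2.S (q\<^sup>2) s = q * n2.S (q\<^sup>2) (q\<^sup>2 * s)" by simp
    then have "s * (n2.S (q\<^sup>2) s)\<^sup>2 = (q\<^sup>2 * s) * (n2.S (q\<^sup>2) (q\<^sup>2 * s))\<^sup>2"
      by (simp add: power_mult_distrib)
    moreover have "q\<^sup>2 * s > 0" using s0 q_pos by simp
    ultimately have "n2.Q s = n2.Q (q\<^sup>2 * s)"
      using n2.S_q_square[OF s0] n2.S_q_square[of "q\<^sup>2 * s"] by linarith
    then have "n2.P s = n2.P (q\<^sup>2 * s)" by (simp add: n2.P_def)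
    also have "\<dots> = n2.P (1 / (q\<^sup>2 * s))" using s0 q_pos by (simp add: n2.P_inverse)
    also have "\<dots> = n2.P ((q\<^sup>2)\<^sup>2 * (1 / (q\<^sup>2 * s)))" by (rule n2.P_shift[symmetric])
    also have "(q\<^sup>2)\<^sup>2 * (1 / (q\<^sup>2 * s)) = q\<^sup>2 / s" by (simp add: power2_eq_square)
    finally have eq: "n2.P s = n2.P (q\<^sup>2 / s)" .
    \<comment> \<open>Here s > q is used: s and q^2 / s are distinct points of [q^2, 1], so
      monotonicity for the nome q^2 gives the contradiction.\<close>
    have "q\<^sup>2 / s < s"
    proof -
      have "q\<^sup>2 < s * s" using s q_pos by (simp add: power2_eq_square mult_strict_mono)
      then show ?thesis using s0 by (simp add: divide_less_eq)
    qed
    moreover have "q\<^sup>2 \<le> q\<^sup>2 / s" using s s0 q_pos by (simp add: pos_le_divide_eq mult_left_le)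
    ultimately have "n2.P (q\<^sup>2 / s) < n2.P s" using s by (intro n2.P_strict_mono[OF sep]) auto
    with eq show False by simp
  qed
  then show "P s > e2 q" using P_ge_e2[OF s0] by simp
qed

end

lemma nome_separated:
  assumes "0 < q" "q < 1"
  shows "nome.separated q"
proof -
  have "(\<lambda>k. q ^ 2 ^ k) \<longlonglongrightarrow> 0"
  proof -
    have "filterlim (\<lambda>k::nat. (2::nat) ^ k) at_top at_top" by real_asymp
    from filterlim_compose[OF LIMSEQ_power_zero[of q] this] assms show ?thesis by simp
  qed
  then obtain k where k: "q ^ 2 ^ k < 1 / 5"
    using order_tendstoD(2)[of _ 0 sequentially "1 / 5"] eventually_happens by (metis (no_types, lifting) sequentially_bot zero_less_divide_1_iff zero_less_numeral)
  have "\<forall>q. 0 < q \<and> q < 1 \<and> q ^ 2 ^ k < 1 / 5 \<longrightarrow> nome.separated q"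
  proof (induction k)
    case 0
    show ?case
    proof (intro allI impI)
      fix q :: real assume q: "0 < q \<and> q < 1 \<and> q ^ 2 ^ 0 < 1 / 5"
      interpret nome q using q by unfold_locales auto
      show separated using separated_small q by simp
    qed
  next
    case (Suc k)
    show ?case
    proof (intro allI impI)
      fix q :: real assume q: "0 < q \<and> q < 1 \<and> q ^ 2 ^ Suc k < 1 / 5"
      interpret nome q using q by unfold_locales auto
      have "(q\<^sup>2) ^ 2 ^ k < 1 / 5" using q by (simp add: power_mult[symmetric])
      then have "nome.separated (q\<^sup>2)"
        using Suc square_nome nome.q_pos nome.q_less_1 by blast
      then show separated by (rule separated_step)
    qed
  qed
  then show ?thesis using assms k by blast
qed

context nome
begin

lemma separated: separated
  by (rule nome_separated[OF q_pos q_less_1])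

lemmas P_mono = P_strict_mono[OF separated]
lemmas Qd_pos = Qd_exp_pos[OF separated]

lemma P_range:
  assumes "q < s" "s < 1"
  shows "e2 q < P s" "P s < e1 q"
  using P_mono[of q s] P_mono[of s 1] assms by (simp_all add: e1_eq e2_eq)

subsection \<open>The sign change\<close>

text \<open>\<open>wp_plus\<close> is the larger root of the quadratic in wp that defines kappa. The
  quadratic is positive at e1 and negative at e2, so the larger root lies between them and the other
  one lies below e2.\<close>

lemma wp_plus_root: "5 * (wp_plus q)\<^sup>2 + 2 * e1 q * wp_plus q - ((e1 q)\<^sup>2 + g2 q / 2) = 0"
  and kappa_factor: "r > 0 \<Longrightarrow> kappa q r = 5 * (P r - wp_plus q) * (P r - (- 2 * e1 q / 5 - wp_plus q))"
  and wp_plus_range: "e2 q < wp_plus q" "wp_plus q < e1 q" "- 2 * e1 q / 5 - wp_plus q < e2 q"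
proof -
  define D where "D = sqrt (24 * (e1 q)\<^sup>2 + 10 * g2 q)"
  have g2: "g2 q \<ge> 0" by (simp add: g2_def)
  have D2: "D\<^sup>2 = 24 * (e1 q)\<^sup>2 + 10 * g2 q" and D0: "D \<ge> 0" using g2 by (simp_all add: D_def)
  have w: "wp_plus q = - e1 q / 5 + D / 10" by (simp add: wp_plus_def D_def)
  define w' where "w' = - e1 q / 5 - D / 10"
  have w': "- 2 * e1 q / 5 - wp_plus q = w'" by (simp add: w w'_def)
  have fac: "5 * x\<^sup>2 + 2 * e1 q * x - ((e1 q)\<^sup>2 + g2 q / 2) = 5 * (x - wp_plus q) * (x - w')" for x
  proof -
    have "5 * (x - wp_plus q) * (x - w') = 5 * x\<^sup>2 + 2 * e1 q * x + (e1 q)\<^sup>2 / 5 - D\<^sup>2 / 20"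
      by (simp add: w w'_def power2_eq_square algebra_simps)
    moreover have "(e1 q)\<^sup>2 / 5 - D\<^sup>2 / 20 = - ((e1 q)\<^sup>2 + g2 q / 2)"
      unfolding D2 by (simp add: field_simps)
    ultimately show ?thesis by linarith
  qed
  show "5 * (wp_plus q)\<^sup>2 + 2 * e1 q * wp_plus q - ((e1 q)\<^sup>2 + g2 q / 2) = 0" unfolding fac by simp
  show "kappa q r = 5 * (P r - wp_plus q) * (P r - (- 2 * e1 q / 5 - wp_plus q))" if "r > 0"
    unfolding kappa_quadratic[OF that] fac w' ..
  have le: "w' \<le> wp_plus q" using D0 by (simp add: w w'_def)
  have "5 * (e1 q)\<^sup>2 + 2 * e1 q * e1 q - ((e1 q)\<^sup>2 + g2 q / 2) = 2 * ((e1 q - e2 q) * (e1 q - e3 q))"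
    unfolding g2_half G2_eq e3_sum by (simp add: power2_eq_square algebra_simps)
  also have "\<dots> > 0" using e_order by simp
  finally have A: "(e1 q - wp_plus q) * (e1 q - w') > 0" unfolding fac by (simp add: zero_less_mult_iff)
  have "5 * (e2 q)\<^sup>2 + 2 * e1 q * e2 q - ((e1 q)\<^sup>2 + g2 q / 2) = - (2 * ((e1 q - e2 q) * (e2 q - e3 q)) + (e1 q - e2 q)\<^sup>2)"
    unfolding g2_half G2_eq e3_sum by (simp add: power2_eq_square algebra_simps)
  also have "\<dots> < 0"
  proof -
    have "(e1 q - e2 q) * (e2 q - e3 q) > 0" using e_order by simp
    then show ?thesis using zero_le_power2[of "e1 q - e2 q"] by linarith
  qed
  finally have B: "(e2 q - wp_plus q) * (e2 q - w') < 0" unfolding fac by (simp add: mult_less_0_iff)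
  have b: "e2 q < wp_plus q \<and> w' < e2 q" using B le by (auto simp: mult_less_0_iff)
  then show "e2 q < wp_plus q" "- 2 * e1 q / 5 - wp_plus q < e2 q" unfolding w' by auto
  show "wp_plus q < e1 q" using A b e_order(1) by (auto simp: zero_less_mult_iff)
qed

text \<open>The substitution s = P(exp x) has ds/dx equal to twice the square root in the integrand.
  So the integral from wp_plus to e1 is - 2 t, where P(exp t) = wp_plus, and r0 = exp t.\<close>

lemma r0_characterization:
  obtains t where "ln q < t" "t < 0" "P (exp t) = wp_plus q" "r0 q = exp t"
proof -
  have "\<exists>t\<ge>ln q. t \<le> 0 \<and> P (exp t) = wp_plus q"
  proof (rule IVT)
    show "P (exp (ln q)) \<le> wp_plus q" "wp_plus q \<le> P (exp 0)" unfolding P_exp_ends using wp_plus_range by auto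
  qed (use ln_q_neg isCont_P_exp in auto)
  then obtain t where t: "ln q \<le> t" "t \<le> 0" "P (exp t) = wp_plus q" by blast
  have tne: "ln q < t" "t < 0"
    using t P_exp_ends wp_plus_range by (metis less_irrefl order_le_less)+
  let ?h = "\<lambda>t. P (exp t)"
  have mono: "?h x < ?h y" if "ln q \<le> x" "x < y" "y \<le> 0" for x y
  proof (rule P_mono)
    show "q \<le> exp x" using that(1) q_pos by (metis exp_le_cancel_iff exp_ln)
  qed (use that in auto)
  have inj: "inj_on ?h {t..0}"
    using mono tne by (intro linorder_inj_onI) (auto simp: less_le_not_le, (smt (verit))+)
  define g where "g = the_inv_into {t..0} ?h"
  have gh: "g (?h x) = x" if "t \<le> x" "x \<le> 0" for x
    unfolding g_def using inj that by (intro the_inv_into_f_f) auto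
  have cont_h: "continuous_on {t..0} ?h"
    by (intro continuous_at_imp_continuous_on ballI isCont_P_exp)
  have img: "?h ` {t..0} = {wp_plus q..e1 q}"
  proof (intro equalityI subsetI)
    fix y assume "y \<in> ?h ` {t..0}"
    then obtain x where x: "t \<le> x" "x \<le> 0" "y = ?h x" by auto
    have "?h t \<le> ?h x" using mono[of t x] x tne by (cases "t = x") auto
    moreover have "?h x \<le> e1 q" by (rule P_le_e1) simp
    ultimately show "y \<in> {wp_plus q..e1 q}" using x t by simp
  next
    fix y assume "y \<in> {wp_plus q..e1 q}"
    then have "\<exists>x\<ge>t. x \<le> 0 \<and> ?h x = y"
      using t tne P_exp_ends isCont_P_exp by (intro IVT) auto
    then show "y \<in> ?h ` {t..0}" by auto
  qed
  have cont_g: "continuous_on {wp_plus q..e1 q} g"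
    unfolding img[symmetric] by (rule continuous_on_inv[OF cont_h]) (auto simp: gh)
  have hg: "?h (g y) = y" "t \<le> g y" "g y \<le> 0" if "wp_plus q \<le> y" "y \<le> e1 q" for y
  proof -
    have "y \<in> ?h ` {t..0}" using that img by simp
    then obtain x where "t \<le> x" "x \<le> 0" "y = ?h x" by auto
    then show "?h (g y) = y" "t \<le> g y" "g y \<le> 0" using gh by auto
  qed
  have "((\<lambda>s. 1 / sqrt ((e1 q - s) * (s - e2 q) * (s - e3 q))) has_integral (2 * g (e1 q) - 2 * g (wp_plus q))) {wp_plus q..e1 q}"
  \<comment> \<open>The integrand is singular at e1, but the primitive, twice the inverse function
    of P(exp x), is continuous up to the endpoint.\<close>
  proof (rule fundamental_theorem_of_calculus_interior)
    show "wp_plus q \<le> e1 q" using wp_plus_range by simp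
    show "continuous_on {wp_plus q..e1 q} (\<lambda>x. 2 * g x)" by (intro continuous_intros cont_g)
    fix y assume y: "y \<in> {wp_plus q<..<e1 q}"
    define x where "x = g y"
    have hx: "?h x = y" "t \<le> x" "x \<le> 0" using hg[of y] y by (auto simp: x_def)
    have xr: "ln q < x" "x < 0" using hx y tne P_exp_ends by (auto simp: order_le_less)
    have pos: "Qd (exp x) > 0" by (rule Qd_pos[OF xr])
    have sq: "(Qd (exp x))\<^sup>2 = 4 * ((e1 q - y) * (y - e2 q) * (y - e3 q))" using cubic[of x] hx by simp
    have "(e1 q - y) * (y - e2 q) * (y - e3 q) = (Qd (exp x) / 2)\<^sup>2" using sq by (simp add: power_divide)
    then have rt: "sqrt ((e1 q - y) * (y - e2 q) * (y - e3 q)) = Qd (exp x) / 2" using pos by simp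
    have "(g has_real_derivative inverse (Qd (exp x))) (at y)"
    proof (rule DERIV_inverse_function[where f = ?h and a = "wp_plus q" and b = "e1 q"])
      show "(?h has_real_derivative Qd (exp x)) (at (g y))" unfolding x_def[symmetric] by (rule DERIV_P)
      show "isCont g y"
        using cont_g y by (intro continuous_on_interior[where S = "{wp_plus q..e1 q}"]) auto
    qed (use pos y hg in auto)
    then have "((\<lambda>x. 2 * g x) has_real_derivative 2 * inverse (Qd (exp x))) (at y)"
      by (rule DERIV_cmult)
    then show "((\<lambda>x. 2 * g x) has_vector_derivative 1 / sqrt ((e1 q - y) * (y - e2 q) * (y - e3 q))) (at y)"
      unfolding rt has_real_derivative_iff_has_vector_derivative[symmetric] by (simp add: inverse_eq_divide)
  qed
  then have "integral {wp_plus q..e1 q} (\<lambda>s. 1 / sqrt ((e1 q - s) * (s - e2 q) * (s - e3 q))) = 2 * g (e1 q) - 2 * g (wp_plus q)"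
    by (rule integral_unique)
  moreover have "g (e1 q) = 0" "g (wp_plus q) = t"
    using gh[of 0] gh[of t] t tne P_exp_ends by auto
  ultimately have "r0 q = exp t" by (simp add: r0_def)
  with tne t(3) show ?thesis using that by blast
qed

lemma r0_range: "q < r0 q" "r0 q < 1" and P_r0: "P (r0 q) = wp_plus q"
proof -
  obtain t where t: "ln q < t" "t < 0" "P (exp t) = wp_plus q" "r0 q = exp t"
    using r0_characterization by blast
  have "exp (ln q) < exp t" using t by simp
  then show "q < r0 q" "r0 q < 1" "P (r0 q) = wp_plus q" using t q_pos by auto
qed

lemma kappa_negative:
  assumes "q < r" "r < r0 q"
  shows "kappa q r < 0"
proof -
  have r: "r > 0" "r < 1" using assms q_pos r0_range by auto
  have "P r < wp_plus q" using P_mono[of r "r0 q"] assms r0_range P_r0 by simp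
  moreover have "P r > - 2 * e1 q / 5 - wp_plus q" using P_range(1)[of r] assms r wp_plus_range(3) by simp
  ultimately show ?thesis unfolding kappa_factor[OF r(1)] by (simp add: mult_less_0_iff)
qed

lemma kappa_positive:
  assumes "r0 q < r" "r < 1"
  shows "kappa q r > 0"
proof -
  have r: "r > 0" "q < r" using assms q_pos r0_range by auto
  have "P r > wp_plus q" using P_mono[of "r0 q" r] assms r0_range P_r0 by simp
  moreover have "P r > - 2 * e1 q / 5 - wp_plus q" using P_range(1)[of r] assms r wp_plus_range(3) by simp
  ultimately show ?thesis unfolding kappa_factor[OF r(1)] by (simp add: zero_less_mult_iff)
qed

subsection \<open>The limit of large nome\<close>

text \<open>After mapping [e2, e1] affinely onto [-1, 1], the arcsine removes two factors of the
  cubic. Its derivative is 2 sqrt(P - e3), which varies only between 2 sqrt(e2 - e3) and 2 sqrt(e1 -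
  e3).\<close>

lemma angle_bounds:
  fixes t :: real
  assumes t: "ln q \<le> t" "t < 0"
  defines "m \<equiv> (e1 q + e2 q) / 2" and "d \<equiv> (e1 q - e2 q) / 2"
  shows "- t * (2 * sqrt (e2 q - e3 q)) \<le> pi / 2 - arcsin ((P (exp t) - m) / d)"
    "pi / 2 - arcsin ((P (exp t) - m) / d) \<le> - t * (2 * sqrt (e1 q - e3 q))"
proof -
  have d: "d > 0" using e_order by (simp add: d_def)
  define Y where "Y = (\<lambda>x. (P (exp x) - m) / d)"
  have Yr: "-1 \<le> Y x" "Y x \<le> 1" for x
    using P_le_e1[of "exp x"] P_ge_e2[of "exp x"] d by (simp_all add: Y_def m_def d_def field_simps)
  have der: "((\<lambda>x. arcsin (Y x)) has_real_derivative 2 * sqrt (P (exp x) - e3 q)) (at x)" if x: "ln q < x" "x < 0" for x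
  proof -
    have rng: "q < exp x" "exp x < 1" using x q_pos by (metis exp_less_mono exp_ln, simp)
    note Pr = P_range[OF rng]
    have Yx: "-1 < Y x" "Y x < 1" using Pr d by (simp_all add: Y_def m_def d_def field_simps)
    have Y': "(Y has_real_derivative Qd (exp x) / d) (at x)"
      unfolding Y_def using d by (auto intro!: derivative_eq_intros DERIV_P)
    have D: "((\<lambda>x. arcsin (Y x)) has_real_derivative inverse (sqrt (1 - (Y x)\<^sup>2)) * (Qd (exp x) / d)) (at x)"
      by (rule DERIV_chain2[OF DERIV_arcsin Y']) (use Yx in auto)
    have "1 - (Y x)\<^sup>2 = (e1 q - P (exp x)) * (P (exp x) - e2 q) / d\<^sup>2"
    proof -
      have "(Y x)\<^sup>2 = (P (exp x) - m)\<^sup>2 / d\<^sup>2" unfolding Y_def by (rule power_divide)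
      then have "1 - (Y x)\<^sup>2 = (d\<^sup>2 - (P (exp x) - m)\<^sup>2) / d\<^sup>2" using d by (simp add: diff_divide_distrib)
      also have "d\<^sup>2 - (P (exp x) - m)\<^sup>2 = (e1 q - P (exp x)) * (P (exp x) - e2 q)"
        by (simp add: d_def m_def power2_eq_square field_simps)
      finally show ?thesis .
    qed
    then have "sqrt (1 - (Y x)\<^sup>2) = sqrt ((e1 q - P (exp x)) * (P (exp x) - e2 q)) / d"
      using d by (simp add: real_sqrt_divide)
    moreover have "Qd (exp x) = 2 * (sqrt ((e1 q - P (exp x)) * (P (exp x) - e2 q)) * sqrt (P (exp x) - e3 q))"
    proof -
      have "Qd (exp x) = sqrt ((Qd (exp x))\<^sup>2)" using Qd_pos[OF x] by simp
      also have "\<dots> = sqrt (2\<^sup>2 * (((e1 q - P (exp x)) * (P (exp x) - e2 q)) * (P (exp x) - e3 q)))"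
        unfolding cubic by simp
      finally show ?thesis by (simp only: real_sqrt_mult real_sqrt_abs abs_numeral)
    qed
    moreover have "sqrt ((e1 q - P (exp x)) * (P (exp x) - e2 q)) > 0" using Pr by simp
    ultimately have "inverse (sqrt (1 - (Y x)\<^sup>2)) * (Qd (exp x) / d) = 2 * sqrt (P (exp x) - e3 q)"
      using d by (simp add: field_simps)
    with D show ?thesis by (simp only:)
  qed
  have "continuous_on {t..0} (\<lambda>x. arcsin (Y x))"
    unfolding Y_def using Yr d unfolding Y_def
    by (intro continuous_on_arcsin continuous_intros continuous_at_imp_continuous_on ballI isCont_P_exp) auto
  moreover have "(\<lambda>x. arcsin (Y x)) differentiable (at x)" if "t < x" "x < 0" for x
    using der[of x] that t unfolding real_differentiable_def by (meson le_less_trans)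
  ultimately obtain l z where l: "t < z" "z < 0" "DERIV (\<lambda>x. arcsin (Y x)) z :> l"
      "arcsin (Y 0) - arcsin (Y t) = (0 - t) * l"
    using MVT[of t 0 "\<lambda>x. arcsin (Y x)"] t by blast
  from l have z: "t < z" "z < 0" "arcsin (Y 0) - arcsin (Y t) = (0 - t) * (2 * sqrt (P (exp z) - e3 q))"
    using DERIV_unique[OF l(3) der[of z]] t by simp_all
  have Y0: "Y 0 = 1" using d P_exp_ends by (simp add: Y_def m_def d_def field_simps)
  have eq: "pi / 2 - arcsin (Y t) = - t * (2 * sqrt (P (exp z) - e3 q))" using z(3) by (simp add: Y0)
  have b: "sqrt (e2 q - e3 q) \<le> sqrt (P (exp z) - e3 q)" "sqrt (P (exp z) - e3 q) \<le> sqrt (e1 q - e3 q)"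
    using P_le_e1[of "exp z"] P_ge_e2[of "exp z"] by simp_all
  have t0: "- t \<ge> 0" using t by simp
  show "- t * (2 * sqrt (e2 q - e3 q)) \<le> pi / 2 - arcsin ((P (exp t) - m) / d)"
    using eq b t0 unfolding Y_def by (simp only:) (intro mult_left_mono, auto)
  show "pi / 2 - arcsin ((P (exp t) - m) / d) \<le> - t * (2 * sqrt (e1 q - e3 q))"
    using eq b t0 unfolding Y_def by (simp only:) (intro mult_left_mono, auto)
qed

text \<open>The left side is the squared complementary modulus, a quotient of theta constants. The
  numerator is bounded by 1 and the denominator grows like (1 - q)^(-2).\<close>

lemma modulus_bound: "(e1 q - e2 q) / (e1 q - e3 q) \<le> 4 * (1 - q)\<^sup>2"
proof -
  have t4: "(theta4 q)\<^sup>2 \<le> 1" using theta4_range[OF q_pos q_less_1] by (simp add: power_le_one)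
  have t3: "(1 / (2 * (1 - q)))\<^sup>2 \<le> (theta3 q)\<^sup>2" using theta3_ge q_less_1 by (intro power_mono) auto
  have "(e1 q - e2 q) / (e1 q - e3 q) = (theta4 q)\<^sup>2 / (theta3 q)\<^sup>2"
    unfolding theta4_square theta3_square ..
  also have "\<dots> \<le> 1 / (1 / (2 * (1 - q)))\<^sup>2"
    using t4 t3 q_less_1 by (intro frac_le) auto
  also have "(1 / (2 * (1 - q)))\<^sup>2 = 1 / (4 * (1 - q)\<^sup>2)"
    unfolding power_divide power_mult_distrib by simp
  also have "1 / (1 / (4 * (1 - q)\<^sup>2)) = 4 * (1 - q)\<^sup>2" by simp
  finally show ?thesis .
qed

text \<open>Over the whole segment [ln q, 0] the angle is pi. Up to ln r0 it is pi / 2 - arcsin y,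
  where y is the image of wp_plus and is small. Nearly constant speed makes the ratio of the times
  nearly 1 / 2.\<close>

lemma ln_r0_ratio:
  assumes q: "3 / 4 < q"
  shows "(1 / 2 - arcsin (12 * (1 - q)\<^sup>2) / pi) * sqrt (1 - 4 * (1 - q)\<^sup>2) \<le> ln (r0 q) / ln q"
    "ln (r0 q) / ln q \<le> (1 / 2 + arcsin (12 * (1 - q)\<^sup>2) / pi) / sqrt (1 - 4 * (1 - q)\<^sup>2)"
proof -
  define m where "m = (e1 q + e2 q) / 2"
  define d where "d = (e1 q - e2 q) / 2"
  define E where "E = e1 q - e3 q"
  define k where "k = (e1 q - e2 q) / E"
  have d: "d > 0" and E: "E > 0" using e_order by (simp_all add: d_def E_def)
  define D where "D = (1 - q)\<^sup>2"
  \<comment> \<open>From q > 3/4. It keeps 12 D in the domain of arcsin and 1 - 4 D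
    positive.\<close>
  have D: "0 < D" "D < 1 / 16"
  proof -
    show "0 < D" using q_less_1 by (simp add: D_def)
    have "D < (1 / 4)\<^sup>2" unfolding D_def using q q_less_1 by (intro power_strict_mono) auto
    then show "D < 1 / 16" by (simp add: power2_eq_square)
  qed
  have k: "k \<le> 4 * D" "k > 0" using modulus_bound e_order unfolding k_def E_def D_def by simp_all
  have e23: "e2 q - e3 q = (1 - k) * E" using E by (simp add: k_def E_def field_simps)
  obtain t where t: "ln q < t" "t < 0" "P (exp t) = wp_plus q" "r0 q = exp t"
    using r0_characterization by blast
  define y where "y = (wp_plus q - m) / d"
  have w: "wp_plus q = m + d * y" using d by (simp add: y_def)
  have e12: "e1 q = m + d" "e2 q = m - d" by (simp_all add: m_def d_def field_simps)
  have "d * (- 1) < d * y" "d * y < d * 1" using wp_plus_range(1,2) unfolding w e12 by simp_all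
  then have y1: "-1 < y" "y < 1" using d by (simp_all only: mult_less_cancel_left_pos)
  \<comment> \<open>The quadratic for wp_plus in the coordinate y. The left side carries m, which is
    at least E / 6, and the right side only d, so y is of the order of k.\<close>
  have root: "12 * m * y = d * (3 - 5 * y\<^sup>2 - 2 * y)"
  proof -
    have "5 * (m + d * y)\<^sup>2 + 2 * (m + d) * (m + d * y) - ((m + d)\<^sup>2 + 2 * ((m + d)\<^sup>2 + (m + d) * (m - d) + (m - d)\<^sup>2)) = 0"
      using wp_plus_root unfolding g2_half G2_eq unfolding w e12 .
    then have "d * (12 * m * y - d * (3 - 5 * y\<^sup>2 - 2 * y)) = 0"
      by (simp add: power2_eq_square algebra_simps)
    then show ?thesis using d by simp
  qed
  have m6: "6 * m \<ge> E" "m > 0"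
  proof -
    have "6 * m = E + (e2 q - e3 q)" unfolding E_def e3_sum by (simp add: m_def)
    then show "6 * m \<ge> E" "m > 0" using e_order E by simp_all
  qed
  have ybound: "\<bar>y\<bar> \<le> 12 * D"
  proof -
    have "y\<^sup>2 \<le> 1" using y1 by (simp add: abs_square_le_1)
    then have "\<bar>3 - 5 * y\<^sup>2 - 2 * y\<bar> \<le> 12" using y1 zero_le_power2[of y] unfolding abs_le_iff by linarith
    then have "d * \<bar>3 - 5 * y\<^sup>2 - 2 * y\<bar> \<le> d * 12" using d by (intro mult_left_mono) auto
    moreover have "\<bar>12 * m * y\<bar> = d * \<bar>3 - 5 * y\<^sup>2 - 2 * y\<bar>" unfolding root using d by (simp add: abs_mult)
    moreover have "\<bar>12 * m * y\<bar> = 12 * m * \<bar>y\<bar>" using m6 by (simp add: abs_mult)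
    ultimately have "m * \<bar>y\<bar> \<le> d" by linarith
    moreover have "E * \<bar>y\<bar> \<le> 6 * m * \<bar>y\<bar>" using m6 by (intro mult_right_mono) auto
    ultimately have "E * \<bar>y\<bar> \<le> 6 * d" by linarith
    then have "\<bar>y\<bar> \<le> 3 * k" using E by (simp add: k_def d_def field_simps)
    with k show ?thesis by linarith
  qed
  have D12: "12 * D \<le> 1" using D by simp
  have as: "- arcsin (12 * D) \<le> arcsin y" "arcsin y \<le> arcsin (12 * D)"
  proof -
    have "arcsin (- (12 * D)) \<le> arcsin y" using ybound D12 y1 by (intro arcsin_le_arcsin) auto
    then show "- arcsin (12 * D) \<le> arcsin y" using D12 D by (simp add: arcsin_minus)
    show "arcsin y \<le> arcsin (12 * D)" using ybound D12 y1 by (intro arcsin_le_arcsin) auto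
  qed
  have yt: "(P (exp t) - m) / d = y" by (simp add: t(3) y_def)
  have yq: "(P (exp (ln q)) - m) / d = - 1" using d unfolding P_exp_ends e12 by simp
  note A = angle_bounds[OF less_imp_le[OF t(1)] t(2), folded m_def d_def, unfolded yt]
  note B = angle_bounds[OF order_refl ln_q_neg, folded m_def d_def, unfolded yq]
  define l where "l = - t"
  define L where "L = - ln q"
  define s1 where "s1 = sqrt E"
  define s where "s = sqrt (1 - k)"
  have s: "s > 0" "s1 > 0" using k D E by (simp_all add: s_def s1_def)
  have sq: "sqrt (e2 q - e3 q) = s * s1" "sqrt (e1 q - e3 q) = s1"
    unfolding e23 s_def s1_def E_def by (simp_all add: real_sqrt_mult)
  have A1: "l * (2 * (s * s1)) \<le> pi / 2 - arcsin y" and A2: "pi / 2 - arcsin y \<le> l * (2 * s1)"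
    using A unfolding sq l_def by simp_all
  have B1: "L * (2 * (s * s1)) \<le> pi" and B2: "pi \<le> L * (2 * s1)"
    using B unfolding sq L_def by (simp_all add: arcsin_minus)
  have Lp: "L > 0" "l > 0" using ln_q_neg t by (simp_all add: L_def l_def)
  have ratio: "ln (r0 q) / ln q = l / L" unfolding t(4) by (simp add: l_def L_def)
  have smono: "sqrt (1 - 4 * D) \<le> s" "sqrt (1 - 4 * D) > 0" using k D by (simp_all add: s_def)
  have half: "0 \<le> 1 / 2 - arcsin (12 * D) / pi"
    using arcsin_ubound[of "12 * D"] D D12 by (simp add: field_simps)
  have as_pi: "1 / 2 - arcsin (12 * D) / pi \<le> (pi / 2 - arcsin y) / pi" "(pi / 2 - arcsin y) / pi \<le> 1 / 2 + arcsin (12 * D) / pi"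
    using divide_right_mono[OF as(1), of pi] divide_right_mono[OF as(2), of pi] by (simp_all add: diff_divide_distrib)
  have "(1 / 2 - arcsin (12 * D) / pi) * sqrt (1 - 4 * D) \<le> (pi / 2 - arcsin y) / pi * s"
    using as_pi(1) smono order_trans[OF half as_pi(1)] by (intro mult_mono) simp_all
  also have "\<dots> \<le> l / L"
  proof -
    have "(pi / 2 - arcsin y) * s * L \<le> l * (2 * s1) * s * L"
      using A2 s Lp by (intro mult_right_mono) auto
    also have "\<dots> = l * (L * (2 * (s * s1)))" by simp
    also have "\<dots> \<le> l * pi" using B1 Lp by (intro mult_left_mono) auto
    finally show ?thesis using Lp by (simp add: field_simps)
  qed
  finally show "(1 / 2 - arcsin (12 * (1 - q)\<^sup>2) / pi) * sqrt (1 - 4 * (1 - q)\<^sup>2) \<le> ln (r0 q) / ln q"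
    unfolding ratio D_def .
  have "l / L \<le> (pi / 2 - arcsin y) / pi / s"
  proof -
    have "l * s * pi \<le> l * s * (L * (2 * s1))" using B2 s Lp by (intro mult_left_mono) auto
    also have "\<dots> = L * (l * (2 * (s * s1)))" by simp
    also have "\<dots> \<le> L * (pi / 2 - arcsin y)" using A1 Lp by (intro mult_left_mono) auto
    finally show ?thesis using Lp s by (simp add: field_simps)
  qed
  also have "\<dots> \<le> (1 / 2 + arcsin (12 * D) / pi) / sqrt (1 - 4 * D)"
  proof (rule frac_le)
    show "0 \<le> 1 / 2 + arcsin (12 * D) / pi"
      using arcsin_le_arcsin[of 0 "12 * D"] D D12 by simp
  qed (use as_pi smono in auto)
  finally show "ln (r0 q) / ln q \<le> (1 / 2 + arcsin (12 * (1 - q)\<^sup>2) / pi) / sqrt (1 - 4 * (1 - q)\<^sup>2)"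
    unfolding ratio D_def .
qed

end

lemma r0_at_1: "(\<lambda>q. r0 q - (1 - 1 / 2 * (1 - q))) \<in> o[at_left 1](\<lambda>q. 1 - q)"
proof (rule smalloI_tendsto)
  have ev: "\<forall>\<^sub>F q in at_left 1. 3 / 4 < q \<and> q < (1::real)"
    by (rule eventually_at_leftI[of "3 / 4"]) auto
  have idt: "((\<lambda>u::real. u) \<longlongrightarrow> 1) (at_left 1)" by (simp add: tendsto_ident_at)
  have as: "((\<lambda>q::real. arcsin (12 * (1 - q)\<^sup>2)) \<longlongrightarrow> 0) (at_left 1)"
  proof -
    have "((\<lambda>q::real. 12 * (1 - q)\<^sup>2) \<longlongrightarrow> 12 * (1 - 1)\<^sup>2) (at_left 1)" by (intro tendsto_intros idt)
    then have "((\<lambda>q::real. 12 * (1 - q)\<^sup>2) \<longlongrightarrow> 0) (at_left 1)" by simp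
    from isCont_tendsto_compose[OF isCont_arcsin this] show ?thesis by simp
  qed
  have lo: "((\<lambda>q. (1 / 2 - arcsin (12 * (1 - q)\<^sup>2) / pi) * sqrt (1 - 4 * (1 - q)\<^sup>2)) \<longlongrightarrow> (1 / 2 - 0 / pi) * sqrt (1 - 4 * (1 - 1)\<^sup>2)) (at_left 1)"
    by (intro tendsto_intros as idt) auto
  have hi: "((\<lambda>q. (1 / 2 + arcsin (12 * (1 - q)\<^sup>2) / pi) / sqrt (1 - 4 * (1 - q)\<^sup>2)) \<longlongrightarrow> (1 / 2 + 0 / pi) / sqrt (1 - 4 * (1 - 1)\<^sup>2)) (at_left 1)"
    by (intro tendsto_intros as idt) auto
  have ratio: "((\<lambda>q. ln (r0 q) / ln q) \<longlongrightarrow> 1 / 2) (at_left 1)"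
  proof (rule real_tendsto_sandwich)
    show "\<forall>\<^sub>F q in at_left 1. (1 / 2 - arcsin (12 * (1 - q)\<^sup>2) / pi) * sqrt (1 - 4 * (1 - q)\<^sup>2) \<le> ln (r0 q) / ln q"
      using ev by eventually_elim (rule nome.ln_r0_ratio(1), unfold_locales, auto)
    show "\<forall>\<^sub>F q in at_left 1. ln (r0 q) / ln q \<le> (1 / 2 + arcsin (12 * (1 - q)\<^sup>2) / pi) / sqrt (1 - 4 * (1 - q)\<^sup>2)"
      using ev by eventually_elim (rule nome.ln_r0_ratio(2), unfold_locales, auto)
  qed (use lo hi in simp_all)
  have lnq: "(ln \<longlongrightarrow> (0::real)) (at_left 1)"
    using tendsto_ln[OF idt] by simp
  have lnr: "((\<lambda>q. ln (r0 q)) \<longlongrightarrow> 0) (at_left 1)"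
  proof -
    have "((\<lambda>q. ln (r0 q) / ln q * ln q) \<longlongrightarrow> 1 / 2 * 0) (at_left 1)"
      by (intro tendsto_mult ratio lnq)
    moreover have "\<forall>\<^sub>F q in at_left (1::real). ln (r0 q) / ln q * ln q = ln (r0 q)"
      using ev by eventually_elim simp
    ultimately show ?thesis by (auto intro: Lim_transform_eventually)
  qed
  have neg: "\<forall>\<^sub>F q in at_left 1. 0 < r0 q \<and> r0 q < 1"
    using ev
  proof eventually_elim
    case (elim q)
    then interpret nome q by unfold_locales auto
    show ?case using r0_range q_pos by auto
  qed
  have flt: "filterlim (\<lambda>q. ln (r0 q)) (at_left 0) (at_left 1)"
    using lnr neg by (auto simp: filterlim_at elim: eventually_mono)
  have "((\<lambda>x::real. (1 - exp x) / x) \<longlongrightarrow> - 1) (at_left 0)" by real_asymp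
  from filterlim_compose[OF this flt] have a: "((\<lambda>q. (1 - exp (ln (r0 q))) / ln (r0 q)) \<longlongrightarrow> - 1) (at_left 1)" .
  have b: "((\<lambda>q::real. ln q / (1 - q)) \<longlongrightarrow> - 1) (at_left 1)" by real_asymp
  \<comment> \<open>The product of the three quotients is (1 - r0) / (1 - q); their limits are - 1,
    1 / 2 and - 1.\<close>
  have "((\<lambda>q. 1 / 2 - (1 - exp (ln (r0 q))) / ln (r0 q) * (ln (r0 q) / ln q) * (ln q / (1 - q))) \<longlongrightarrow> 1 / 2 - (- 1) * (1 / 2) * (- 1)) (at_left 1)"
    by (intro tendsto_intros a b ratio)
  moreover have "\<forall>\<^sub>F q in at_left 1. 1 / 2 - (1 - exp (ln (r0 q))) / ln (r0 q) * (ln (r0 q) / ln q) * (ln q / (1 - q)) = (r0 q - (1 - 1 / 2 * (1 - q))) / (1 - q)"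
    using ev neg
  proof eventually_elim
    case (elim q)
    have nz: "ln q \<noteq> 0" "ln (r0 q) \<noteq> 0" "1 - q \<noteq> 0" using elim by auto
    have "(1 - exp (ln (r0 q))) / ln (r0 q) * (ln (r0 q) / ln q) * (ln q / (1 - q)) = (1 - r0 q) / (1 - q)"
      using nz elim by simp
    moreover have "(r0 q - (1 - 1 / 2 * (1 - q))) / (1 - q) = 1 / 2 - (1 - r0 q) / (1 - q)"
      using nz(3) by (simp add: field_simps)
    ultimately show ?case by (simp only:)
  qed
  ultimately show "((\<lambda>q. (r0 q - (1 - 1 / 2 * (1 - q))) / (1 - q)) \<longlongrightarrow> 0) (at_left 1)"
    by (auto intro: Lim_transform_eventually)
  show "\<forall>\<^sub>F q in at_left 1. 1 - q \<noteq> (0::real)" using ev by eventually_elim auto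
qed

subsection \<open>The limit of small nome\<close>

text \<open>Caratheodory's form of the derivative also covers parameters at which \<open>x q\<close>
  equals \<open>a\<close>.\<close>

lemma DERIV_tendsto_quotient:
  assumes "(f has_real_derivative D) (at a)" and x: "((\<lambda>q. (x q - a) / p q) \<longlongrightarrow> l) F"
    and p: "(p \<longlongrightarrow> 0) F" "\<forall>\<^sub>F q in F. p q \<noteq> (0::real)"
  shows "((\<lambda>q. (f (x q) - f a) / p q) \<longlongrightarrow> D * l) F"
proof -
  from assms(1) obtain g where g: "\<And>z. f z - f a = g z * (z - a)" "isCont g a" "g a = D"
    unfolding CARAT_DERIV by blast
  have "((\<lambda>q. (x q - a) / p q * p q + a) \<longlongrightarrow> l * 0 + a) F"
    by (intro tendsto_intros x p)
  moreover have "\<forall>\<^sub>F q in F. (x q - a) / p q * p q + a = x q"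
    using p(2) by eventually_elim simp
  ultimately have "(x \<longlongrightarrow> a) F" by (auto intro: Lim_transform_eventually)
  then have "((\<lambda>q. g (x q)) \<longlongrightarrow> D) F"
    using isCont_tendsto_compose[OF g(2)] g(3) by simp
  from tendsto_mult[OF this x] show ?thesis by (simp add: g(1))
qed

context nome
begin

text \<open>The central term is lor r, and the first pair gives q^2 (r + 1 / r). The upper error
  uses 1 / (1 - p) <= 1 + 2 p for p <= 1/2, the lower one lor x >= x - 2 x^2.\<close>

lemma Q_expansion:
  assumes r: "r > 0" and q: "q\<^sup>2 \<le> 1 / 2"
  defines "h \<equiv> r + 1 / r"
  shows "\<bar>Q r - lor r - q\<^sup>2 * h\<bar> \<le> 2 * (q\<^sup>2)\<^sup>2 * (h + h\<^sup>2)"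
    "0 \<le> Q2 r - (lor r)\<^sup>2" "Q2 r - (lor r)\<^sup>2 \<le> 2 * (q\<^sup>2)\<^sup>2 * h\<^sup>2"
proof -
  define p where "p = q\<^sup>2"
  have p: "0 < p" "p \<le> 1 / 2" using q q_pos by (simp_all add: p_def)
  have h: "h > 0" using r by (simp add: h_def add_pos_pos)
  have neg: "lor (r * (q\<^sup>2) powi (- int (Suc n))) = lor (p ^ Suc n / r)" for n
    unfolding power_int_minus_of_nat power_one_over p_def[symmetric]
    using lor_inverse[of "p ^ Suc n / r"] p r by simp
  have pos: "lor (r * (q\<^sup>2) powi (int (Suc n))) = lor (r * p ^ Suc n)" for n
    unfolding power_int_of_nat p_def ..
  have S1: "(\<lambda>n. lor (r * p ^ Suc n) + lor (p ^ Suc n / r)) sums (Q r - lor r)"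
    using int_infsum_sums[OF summable_Q[OF r]] unfolding neg pos by (simp add: Q_def)
  have S2: "(\<lambda>n. (lor (r * p ^ Suc n))\<^sup>2 + (lor (p ^ Suc n / r))\<^sup>2) sums (Q2 r - (lor r)\<^sup>2)"
    using int_infsum_sums[OF summable_Q2[OF r]] unfolding neg pos by (simp add: Q2_def)
  have nn: "0 \<le> lor (r * p ^ Suc n)" "0 \<le> lor (p ^ Suc n / r)" for n
    using r p by (auto intro!: lor_nonneg)
  have up: "lor (r * p ^ Suc n) \<le> r * p ^ Suc n" "lor (p ^ Suc n / r) \<le> p ^ Suc n / r" for n
    using r p by (auto intro!: lor_le)
  have G: "(\<lambda>n. p * h * p ^ n) sums (p * h * (1 / (1 - p)))"
    using p by (intro sums_mult geometric_sums) auto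
  have t1: "lor (r * p ^ Suc n) + lor (p ^ Suc n / r) \<le> p * h * p ^ n" for n
  proof -
    have "p * h * p ^ n = r * p ^ Suc n + p ^ Suc n / r" by (simp add: h_def algebra_simps)
    then show ?thesis using up[of n] by linarith
  qed
  have U: "Q r - lor r \<le> p * h * (1 / (1 - p))"
    by (rule sums_le[OF t1 S1 G])
  have "p * h * (1 / (1 - p)) \<le> p * h + 2 * p\<^sup>2 * h"
  proof -
    have "1 / (1 - p) \<le> 1 + 2 * p"
    proof -
      have "2 * p * p \<le> 1 * p" using p by (intro mult_right_mono) auto
      then have "1 \<le> (1 + 2 * p) * (1 - p)" by (simp add: algebra_simps)
      then show ?thesis using p by (simp add: divide_le_eq)
    qed
    then have "p * h * (1 / (1 - p)) \<le> p * h * (1 + 2 * p)"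
      using p h by (intro mult_left_mono) auto
    then show ?thesis by (simp add: power2_eq_square algebra_simps)
  qed
  with U have upper: "Q r - lor r - p * h \<le> 2 * p\<^sup>2 * h" by simp
  have lor_ge: "x - 2 * x\<^sup>2 \<le> lor x" if "x \<ge> 0" for x
  proof -
    have "(1 - 2 * x) * (1 + x)\<^sup>2 = 1 - x\<^sup>2 * (3 + 2 * x)" by (simp add: power2_eq_square algebra_simps)
    also have "\<dots> \<le> 1" using that by simp
    finally have "x * ((1 - 2 * x) * (1 + x)\<^sup>2) \<le> x * 1" using that by (intro mult_left_mono)
    moreover have "(1 + x)\<^sup>2 > 0" using that by simp
    moreover have "x - 2 * x\<^sup>2 = x * (1 - 2 * x)" by (simp add: power2_eq_square algebra_simps)
    ultimately show ?thesis unfolding lor_def by (simp only: pos_le_divide_eq mult.assoc mult_1_right)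
  qed
  have "lor (r * p) + lor (p / r) \<le> Q r - lor r"
  proof -
    have "(\<Sum>n\<in>{0}. lor (r * p ^ Suc n) + lor (p ^ Suc n / r)) \<le> Q r - lor r"
      using nn S1 unfolding sums_iff by (metis (no_types, lifting) add_nonneg_nonneg finite.emptyI finite.insertI sum_le_suminf)
    then show ?thesis by simp
  qed
  moreover have "r * p - 2 * (r * p)\<^sup>2 \<le> lor (r * p)" "p / r - 2 * (p / r)\<^sup>2 \<le> lor (p / r)"
    using r p by (intro lor_ge; simp)+
  moreover have "r * p - 2 * (r * p)\<^sup>2 + (p / r - 2 * (p / r)\<^sup>2) \<ge> p * h - 2 * p\<^sup>2 * h\<^sup>2"
  proof -
    have "r\<^sup>2 + (1 / r)\<^sup>2 \<le> h\<^sup>2" using r by (simp add: h_def power2_eq_square algebra_simps)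
    then have "2 * p\<^sup>2 * (r\<^sup>2 + (1 / r)\<^sup>2) \<le> 2 * p\<^sup>2 * h\<^sup>2" by (intro mult_left_mono) auto
    moreover have "r * p - 2 * (r * p)\<^sup>2 + (p / r - 2 * (p / r)\<^sup>2) = p * h - 2 * p\<^sup>2 * (r\<^sup>2 + (1 / r)\<^sup>2)"
      by (simp add: h_def power_mult_distrib power_divide algebra_simps)
    ultimately show ?thesis by linarith
  qed
  ultimately have lower: "Q r - lor r - p * h \<ge> - (2 * p\<^sup>2 * h\<^sup>2)" by linarith
  have "2 * p\<^sup>2 * h \<ge> 0" "2 * p\<^sup>2 * h\<^sup>2 \<ge> 0" using h by auto
  with upper lower have "\<bar>Q r - lor r - p * h\<bar> \<le> 2 * p\<^sup>2 * h + 2 * p\<^sup>2 * h\<^sup>2" by linarith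
  then show "\<bar>Q r - lor r - q\<^sup>2 * h\<bar> \<le> 2 * (q\<^sup>2)\<^sup>2 * (h + h\<^sup>2)"
    unfolding p_def[symmetric] by (simp add: distrib_left)
  have Z: "(\<lambda>n. 0) sums (0::real)" by simp
  show "0 \<le> Q2 r - (lor r)\<^sup>2" by (rule sums_le[OF _ Z S2]) simp
  have G2: "(\<lambda>n. (p * h)\<^sup>2 * p ^ n) sums ((p * h)\<^sup>2 * (1 / (1 - p)))"
    using p by (intro sums_mult geometric_sums) auto
  have "Q2 r - (lor r)\<^sup>2 \<le> (p * h)\<^sup>2 * (1 / (1 - p))"
  proof (rule sums_le[OF _ S2 G2])
    fix n
    let ?a = "lor (r * p ^ Suc n)" and ?b = "lor (p ^ Suc n / r)"
    have "?a\<^sup>2 + ?b\<^sup>2 \<le> (?a + ?b)\<^sup>2" using nn[of n] by (simp add: power2_sum del: power_Suc)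
    also have "\<dots> \<le> (p * h * p ^ n)\<^sup>2" using nn[of n] t1[of n] by (intro power_mono) auto
    also have "\<dots> = (p * h)\<^sup>2 * (p ^ n)\<^sup>2" by (simp add: power_mult_distrib)
    also have "\<dots> \<le> (p * h)\<^sup>2 * p ^ n"
    proof -
      have "p ^ n * p ^ n \<le> 1 * p ^ n" using p by (intro mult_right_mono power_le_one) auto
      then show ?thesis by (intro mult_left_mono) (auto simp: power2_eq_square)
    qed
    finally show "?a\<^sup>2 + ?b\<^sup>2 \<le> (p * h)\<^sup>2 * p ^ n" .
  qed
  also have "\<dots> \<le> (p * h)\<^sup>2 * 2" using p by (intro mult_left_mono) (auto simp: divide_le_eq)
  finally show "Q2 r - (lor r)\<^sup>2 \<le> 2 * (q\<^sup>2)\<^sup>2 * h\<^sup>2"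
    unfolding p_def[symmetric] by (simp add: power_mult_distrib mult_ac)
qed

end

text \<open>The first assumption says that the formal value of kappa at q = 0, namely 6 L^2 - L -
  (1/4 - L)^2 with L = lor a, vanishes. The limit is then the coefficient of q^2, in which D is the
  derivative of lor at a.\<close>

lemma tendsto_kappa_small_nome:
  assumes y: "5 * (lor a)\<^sup>2 - lor a / 2 - 1 / 16 = 0" and a: "0 < a"
  defines "h \<equiv> a + 1 / a" and "D \<equiv> (1 - a) / (1 + a) ^ 3"
  shows "((\<lambda>q. kappa q (a + l * q\<^sup>2) / q\<^sup>2) \<longlongrightarrow> l * D * (10 * lor a - 1 / 2) - h - 2 * (1 / 4 - lor a) * (2 - h)) (at_right 0)"
proof -
  let ?F = "at_right (0::real)"
  let ?Q = "\<lambda>q. nome_square.Q (q\<^sup>2)" and ?Q2 = "\<lambda>q. nome_square.Q2 (q\<^sup>2)"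
  define x where "x = (\<lambda>q::real. a + l * q\<^sup>2)"
  have idt: "((\<lambda>q::real. q) \<longlongrightarrow> 0) ?F" by (simp add: tendsto_ident_at)
  have p0: "((\<lambda>q::real. q\<^sup>2) \<longlongrightarrow> 0) ?F" using tendsto_power[OF idt, of 2] by simp
  have evq: "\<forall>\<^sub>F q in ?F. 0 < q \<and> q < 1 / 2"
    by (rule eventually_at_rightI[of 0 "1 / 2"]) auto
  have pn: "\<forall>\<^sub>F q in ?F. q\<^sup>2 \<noteq> (0::real)" using evq by eventually_elim auto
  have xa: "(x \<longlongrightarrow> a) ?F"
  proof -
    have "(x \<longlongrightarrow> a + l * 0) ?F" unfolding x_def by (intro tendsto_intros p0)
    then show ?thesis by simp
  qed
  have xl: "((\<lambda>q. (x q - a) / q\<^sup>2) \<longlongrightarrow> l) ?F"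
  proof -
    have "\<forall>\<^sub>F q in ?F. l = (x q - a) / q\<^sup>2" using pn by eventually_elim (simp add: x_def)
    then show ?thesis by (rule Lim_transform_eventually[OF tendsto_const])
  qed
  \<comment> \<open>Stated for an arbitrary convergent path, since it also serves the constant path
    1 for Q 1.\<close>
  have expand: "((\<lambda>q. (?Q q (x q) - lor (x q)) / q\<^sup>2) \<longlongrightarrow> b + 1 / b) ?F \<and> ((\<lambda>q. (?Q2 q (x q) - (lor (x q))\<^sup>2) / q\<^sup>2) \<longlongrightarrow> 0) ?F"
    if xb: "(x \<longlongrightarrow> b) ?F" and b: "b > 0" for x and b :: real
  proof -
    define H where "H = (\<lambda>q. x q + 1 / x q)"
    have Hl: "(H \<longlongrightarrow> b + 1 / b) ?F" unfolding H_def using b by (intro tendsto_intros xb) auto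
    have ev: "\<forall>\<^sub>F q in ?F. 0 < q \<and> q < 1 / 2 \<and> x q > 0"
      using evq order_tendstoD(1)[OF xb b] by eventually_elim auto
    have small: "q\<^sup>2 \<le> 1 / 2" if "0 < q" "q < 1 / 2" for q :: real
    proof -
      have "q\<^sup>2 < (1 / 2)\<^sup>2" using that by (intro power_strict_mono) auto
      then show ?thesis by (simp add: power2_eq_square)
    qed
    have z1: "((\<lambda>q. 2 * q\<^sup>2 * (H q + (H q)\<^sup>2)) \<longlongrightarrow> 2 * 0 * ((b + 1 / b) + (b + 1 / b)\<^sup>2)) ?F"
      by (intro tendsto_intros p0 Hl)
    have z2: "((\<lambda>q. 2 * q\<^sup>2 * (H q)\<^sup>2) \<longlongrightarrow> 2 * 0 * (b + 1 / b)\<^sup>2) ?F"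
      by (intro tendsto_intros p0 Hl)
    have "((\<lambda>q. (?Q q (x q) - lor (x q)) / q\<^sup>2 - H q) \<longlongrightarrow> 0) ?F"
    proof (rule Lim_null_comparison)
      show "((\<lambda>q. 2 * q\<^sup>2 * (H q + (H q)\<^sup>2)) \<longlongrightarrow> 0) ?F" using z1 by simp
      show "\<forall>\<^sub>F q in ?F. norm ((?Q q (x q) - lor (x q)) / q\<^sup>2 - H q) \<le> 2 * q\<^sup>2 * (H q + (H q)\<^sup>2)"
        using ev
      proof eventually_elim
        case (elim q)
        then interpret nome q by unfold_locales auto
        have e: "(?Q q (x q) - lor (x q)) / q\<^sup>2 - H q = (?Q q (x q) - lor (x q) - q\<^sup>2 * H q) / q\<^sup>2"
          using elim by (simp add: diff_divide_distrib)
        have "\<bar>?Q q (x q) - lor (x q) - q\<^sup>2 * H q\<bar> / q\<^sup>2 \<le> 2 * (q\<^sup>2)\<^sup>2 * (H q + (H q)\<^sup>2) / q\<^sup>2"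
          unfolding H_def using elim small by (intro divide_right_mono Q_expansion) auto
        also have "\<dots> = 2 * q\<^sup>2 * (H q + (H q)\<^sup>2)" using elim by (simp add: power2_eq_square)
        finally show ?case unfolding e by (simp add: abs_divide)
      qed
    qed
    from tendsto_add[OF this Hl] have A: "((\<lambda>q. (?Q q (x q) - lor (x q)) / q\<^sup>2) \<longlongrightarrow> b + 1 / b) ?F" by simp
    have "((\<lambda>q. (?Q2 q (x q) - (lor (x q))\<^sup>2) / q\<^sup>2) \<longlongrightarrow> 0) ?F"
    proof (rule Lim_null_comparison)
      show "((\<lambda>q. 2 * q\<^sup>2 * (H q)\<^sup>2) \<longlongrightarrow> 0) ?F" using z2 by simp
      show "\<forall>\<^sub>F q in ?F. norm ((?Q2 q (x q) - (lor (x q))\<^sup>2) / q\<^sup>2) \<le> 2 * q\<^sup>2 * (H q)\<^sup>2"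
        using ev
      proof eventually_elim
        case (elim q)
        then interpret nome q by unfold_locales auto
        have B: "0 \<le> ?Q2 q (x q) - (lor (x q))\<^sup>2" "?Q2 q (x q) - (lor (x q))\<^sup>2 \<le> 2 * (q\<^sup>2)\<^sup>2 * (H q)\<^sup>2"
          unfolding H_def using elim small by (intro Q_expansion; auto)+
        then have "(?Q2 q (x q) - (lor (x q))\<^sup>2) / q\<^sup>2 \<le> 2 * (q\<^sup>2)\<^sup>2 * (H q)\<^sup>2 / q\<^sup>2"
          by (intro divide_right_mono) auto
        also have "\<dots> = 2 * q\<^sup>2 * (H q)\<^sup>2" using elim by (simp add: power2_eq_square)
        finally show ?case using B(1) by simp
      qed
    qed
    with A show ?thesis by blast
  qed
  note E = expand[OF xa a]
  have one: "((\<lambda>q. (?Q q 1 - 1 / 4) / q\<^sup>2) \<longlongrightarrow> 2) ?F"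
    using expand[OF tendsto_const, of 1, THEN conjunct1] by (simp add: lor_def)
  have d1: "((\<lambda>q. (lor (x q) - lor a) / q\<^sup>2) \<longlongrightarrow> D * l) ?F"
    unfolding D_def by (rule DERIV_tendsto_quotient[OF DERIV_lor[OF a] xl p0 pn])
  have "((\<lambda>x. (lor x)\<^sup>2) has_real_derivative 2 * lor a * D) (at a)"
    unfolding D_def by (auto intro!: derivative_eq_intros DERIV_lor[OF a])
  from DERIV_tendsto_quotient[OF this xl p0 pn]
  have d2: "((\<lambda>q. ((lor (x q))\<^sup>2 - (lor a)\<^sup>2) / q\<^sup>2) \<longlongrightarrow> 2 * lor a * D * l) ?F" .
  define A where "A = (\<lambda>q. (?Q q (x q) - lor (x q)) / q\<^sup>2 + (lor (x q) - lor a) / q\<^sup>2)"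
  define A2 where "A2 = (\<lambda>q. (?Q2 q (x q) - (lor (x q))\<^sup>2) / q\<^sup>2 + ((lor (x q))\<^sup>2 - (lor a)\<^sup>2) / q\<^sup>2)"
  define A1 where "A1 = (\<lambda>q. (?Q q 1 - 1 / 4) / q\<^sup>2)"
  have Al: "(A \<longlongrightarrow> h + D * l) ?F" unfolding A_def h_def using E d1 by (intro tendsto_add) auto
  have A2l: "(A2 \<longlongrightarrow> 0 + 2 * lor a * D * l) ?F" unfolding A2_def using E d2 by (intro tendsto_add) auto
  have A1l: "(A1 \<longlongrightarrow> 2) ?F" unfolding A1_def by (rule one)
  have "((\<lambda>q. 6 * A2 q - A q - 2 * (1 / 4 - lor a) * (A1 q - A q) - q\<^sup>2 * (A1 q - A q)\<^sup>2)
     \<longlongrightarrow> 6 * (0 + 2 * lor a * D * l) - (h + D * l) - 2 * (1 / 4 - lor a) * (2 - (h + D * l)) - 0 * (2 - (h + D * l))\<^sup>2) ?F"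
    by (intro tendsto_intros Al A2l A1l p0)
  also have "6 * (0 + 2 * lor a * D * l) - (h + D * l) - 2 * (1 / 4 - lor a) * (2 - (h + D * l)) - 0 * (2 - (h + D * l))\<^sup>2
     = l * D * (10 * lor a - 1 / 2) - h - 2 * (1 / 4 - lor a) * (2 - h)"
    by (simp add: field_simps)
  finally have L: "((\<lambda>q. 6 * A2 q - A q - 2 * (1 / 4 - lor a) * (A1 q - A q) - q\<^sup>2 * (A1 q - A q)\<^sup>2)
     \<longlongrightarrow> l * D * (10 * lor a - 1 / 2) - h - 2 * (1 / 4 - lor a) * (2 - h)) ?F" .
  have "\<forall>\<^sub>F q in ?F. 6 * A2 q - A q - 2 * (1 / 4 - lor a) * (A1 q - A q) - q\<^sup>2 * (A1 q - A q)\<^sup>2 = kappa q (a + l * q\<^sup>2) / q\<^sup>2"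
    using evq order_tendstoD(1)[OF xa a]
  proof eventually_elim
    case (elim q)
    then interpret nome q by unfold_locales auto
    have q2: "q\<^sup>2 > 0" using elim by simp
    have e: "Q (x q) = lor a + q\<^sup>2 * A q" "Q2 (x q) = (lor a)\<^sup>2 + q\<^sup>2 * A2 q" "Q 1 = 1 / 4 + q\<^sup>2 * A1 q"
      using q2 by (simp_all add: A_def A2_def A1_def add_divide_distrib[symmetric])
    have "kappa q (x q) = q\<^sup>2 * (6 * A2 q - A q - 2 * (1 / 4 - lor a) * (A1 q - A q) - q\<^sup>2 * (A1 q - A q)\<^sup>2)
        + (5 * (lor a)\<^sup>2 - lor a / 2 - 1 / 16)"
      unfolding kappa_eq[OF elim(2)] e by (simp add: power2_eq_square field_simps)
    then show ?case unfolding y using q2 by (simp add: x_def)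
  qed
  with L show ?thesis by (rule Lim_transform_eventually)
qed

text \<open>The number c is the value of l at which the q^2-coefficient of kappa along a + l q^2
  vanishes. That coefficient is (l - c) K with K > 0, so its sign at l = c + e and l = c - e traps
  r0.\<close>

lemma r0_expansion:
  assumes a: "0 < a" "a < 1" and y: "5 * (lor a)\<^sup>2 - lor a / 2 - 1 / 16 = 0"
    and c: "c * ((1 - a) / (1 + a) ^ 3 * (10 * lor a - 1 / 2)) = (a + 1 / a) + 2 * (1 / 4 - lor a) * (2 - (a + 1 / a))"
  shows "(\<lambda>q. r0 q - (a + c * q\<^sup>2)) \<in> o[at_right 0](\<lambda>q. q\<^sup>2)"
proof (rule landau_o.smallI)
  fix e :: real assume e: "e > 0"
  let ?F = "at_right (0::real)"
  define K where "K = (1 - a) / (1 + a) ^ 3 * (10 * lor a - 1 / 2)"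
  \<comment> \<open>Since lor a is positive and lor a (5 lor a - 1/2) = 1/16, it is the larger root
    of the quadratic, where the derivative 10 lor a - 1/2 is positive.\<close>
  have K: "K > 0"
  proof -
    have "lor a > 0" by (rule lor_pos[OF a(1)])
    moreover have "lor a * (5 * lor a - 1 / 2) = 1 / 16" using y by (simp add: power2_eq_square algebra_simps)
    ultimately have "5 * lor a - 1 / 2 > 0" by (metis zero_less_mult_pos zero_less_divide_1_iff zero_less_numeral)
    then have "10 * lor a - 1 / 2 > 0" using \<open>lor a > 0\<close> by linarith
    then show ?thesis using a by (simp add: K_def)
  qed
  have lim: "((\<lambda>q. kappa q (a + l * q\<^sup>2) / q\<^sup>2) \<longlongrightarrow> (l - c) * K) ?F" for l
  proof -
    have "l * ((1 - a) / (1 + a) ^ 3) * (10 * lor a - 1 / 2) - (a + 1 / a) - 2 * (1 / 4 - lor a) * (2 - (a + 1 / a)) = (l - c) * K"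
    proof -
      have "l * D * X - h - Z = (l - c) * (D * X)" if "c * (D * X) = h + Z" for D X h Z :: real
        using that by (simp add: algebra_simps)
      from this[OF c] show ?thesis by (simp only: K_def)
    qed
    then show ?thesis using tendsto_kappa_small_nome[OF y a(1), of l] by simp
  qed
  have idt: "((\<lambda>q::real. q) \<longlongrightarrow> 0) ?F" by (simp add: tendsto_ident_at)
  have evq: "\<forall>\<^sub>F q in ?F. 0 < q \<and> q < (1::real)"
    by (rule eventually_at_rightI[of 0 1]) auto
  have rng: "\<forall>\<^sub>F q in ?F. q < a + l * q\<^sup>2 \<and> a + l * q\<^sup>2 < 1" for l
  proof -
    have "((\<lambda>q. a + l * q\<^sup>2 - q) \<longlongrightarrow> a + l * 0\<^sup>2 - 0) ?F" "((\<lambda>q. a + l * q\<^sup>2) \<longlongrightarrow> a + l * 0\<^sup>2) ?F"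
      by (intro tendsto_intros idt)+
    from order_tendstoD(1)[OF this(1), of 0] order_tendstoD(2)[OF this(2), of 1] a
    have "\<forall>\<^sub>F q in ?F. 0 < a + l * q\<^sup>2 - q" "\<forall>\<^sub>F q in ?F. a + l * q\<^sup>2 < 1" by auto
    then show ?thesis by eventually_elim auto
  qed
  have up: "\<forall>\<^sub>F q in ?F. kappa q (a + (c + e) * q\<^sup>2) / q\<^sup>2 > 0"
    using order_tendstoD(1)[OF lim[of "c + e"], of 0] e K by simp
  have lo: "\<forall>\<^sub>F q in ?F. kappa q (a + (c - e) * q\<^sup>2) / q\<^sup>2 < 0"
    using order_tendstoD(2)[OF lim[of "c - e"], of 0] e K by (simp add: mult_less_0_iff)
  show "\<forall>\<^sub>F q in ?F. norm (r0 q - (a + c * q\<^sup>2)) \<le> e * norm (q\<^sup>2)"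
    using evq rng[of "c + e"] rng[of "c - e"] up lo
  proof eventually_elim
    case (elim q)
    then interpret nome q by unfold_locales auto
    have q2: "q\<^sup>2 > 0" using elim by simp
    have k: "kappa q (a + (c + e) * q\<^sup>2) > 0" "kappa q (a + (c - e) * q\<^sup>2) < 0"
      using elim(4,5) q2 by (simp_all add: zero_less_divide_iff divide_less_0_iff)
    have "r0 q \<le> a + (c + e) * q\<^sup>2"
      using kappa_negative[of "a + (c + e) * q\<^sup>2"] k(1) elim(2) by (meson less_asym not_le)
    moreover have "a + (c - e) * q\<^sup>2 \<le> r0 q"
      using kappa_positive[of "a + (c - e) * q\<^sup>2"] k(2) elim(3) by (meson less_asym not_le)
    ultimately have "\<bar>r0 q - (a + c * q\<^sup>2)\<bar> \<le> e * q\<^sup>2"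
      by (simp add: abs_le_iff algebra_simps)
    then show ?case using q2 by simp
  qed
qed

section \<open>The explicit algebraic constants\<close>

definition r_crit_value :: real where
  "r_crit_value = 2 * sqrt 6 - 3 - 2 * sqrt (8 - 3 * sqrt 6)"

definition r0_coeff :: real where
  "r0_coeff = 8 / 3 * (- 72 + 22 * sqrt 6 + 3 * (4 * sqrt 6 - 1) * sqrt (8 - 3 * sqrt 6))"

lemma sqrt6_bounds: "2.449489742783178098 < sqrt 6" "sqrt 6 < 2.449489742783178099"
proof -
  show "2.449489742783178098 < sqrt 6" by (rule real_less_rsqrt) (simp add: power2_eq_square)
  show "sqrt 6 < 2.449489742783178099" by (rule real_less_lsqrt) (simp_all add: power2_eq_square)
qed

lemma sqrt_8_minus_3_sqrt6_bounds: "0.807174560829604998 < sqrt (8 - 3 * sqrt 6)" "sqrt (8 - 3 * sqrt 6) < 0.807174560829605005"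
proof -
  show "0.807174560829604998 < sqrt (8 - 3 * sqrt 6)"
  proof (rule real_less_rsqrt)
    have "(0.807174560829604998::real)\<^sup>2 < 8 - 3 * 2.449489742783178099" by (simp add: power2_eq_square)
    then show "(0.807174560829604998)\<^sup>2 < 8 - 3 * sqrt 6" using sqrt6_bounds by linarith
  qed
  show "sqrt (8 - 3 * sqrt 6) < 0.807174560829605005"
  proof (rule real_less_lsqrt)
    have "8 - 3 * 2.449489742783178098 < (0.807174560829605005::real)\<^sup>2" by (simp add: power2_eq_square)
    then show "8 - 3 * sqrt 6 < (0.807174560829605005)\<^sup>2" using sqrt6_bounds by linarith
  qed simp
qed

lemma r_crit_value_bounds: "r_crit_value \<in> {0.2846303639..<0.2846303640}"
  using sqrt6_bounds sqrt_8_minus_3_sqrt6_bounds by (simp add: r_crit_value_def)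

lemma r0_coeff_bounds: "r0_coeff \<in> {8.515307593..<8.515307594}"
proof -
  let ?a = "sqrt 6" and ?w = "sqrt (8 - 3 * sqrt 6)"
  have "(4 * 2.449489742783178098 - 1) * 0.807174560829604998 \<le> (4 * ?a - 1) * ?w"
    using sqrt6_bounds sqrt_8_minus_3_sqrt6_bounds by (intro mult_mono) auto
  moreover have "(4 * ?a - 1) * ?w \<le> (4 * 2.449489742783178099 - 1) * 0.807174560829605005"
    using sqrt6_bounds sqrt_8_minus_3_sqrt6_bounds by (intro mult_mono) auto
  ultimately show ?thesis
    unfolding r0_coeff_def mult.assoc using sqrt6_bounds by simp
qed

text \<open>All three are computations in the field generated by a = sqrt 6 and w, with w^2 = 8 - 3
  a. The first says lor r_c = (1 + sqrt 6) / 20, the third is the equation for c cleared of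
  denominators.\<close>

lemma r_crit_value_eqs:
  "(1 + r_crit_value)\<^sup>2 * (1 + sqrt 6) = 20 * r_crit_value"
  "r_crit_value = (1 - sqrt (4 - sqrt 6) / sqrt 5) / (1 + sqrt (4 - sqrt 6) / sqrt 5)"
  "r0_coeff * (sqrt 6 / 2) * (1 - r_crit_value) = (8 * sqrt 6 - 2) / 5 * (1 + r_crit_value) ^ 3"
proof -
  define a where "a = sqrt 6"
  define w where "w = sqrt (8 - 3 * a)"
  have a2: "a * a = 6" by (simp add: a_def)
  have w2: "w * w = 8 - 3 * a" using sqrt6_bounds by (simp add: w_def a_def)
  have rc: "r_crit_value = 2 * a - 3 - 2 * w" by (simp add: r_crit_value_def a_def w_def)
  have c: "r0_coeff = 8 / 3 * (- 72 + 22 * a + 3 * (4 * a - 1) * w)" by (simp add: r0_coeff_def a_def w_def)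
  have aax: "a * (a * x) = 6 * x" for x using a2 by (metis mult.assoc)
  have wwx: "w * (w * x) = 8 * x - 3 * (a * x)" for x
    using w2 by (metis (no_types, opaque_lifting) left_diff_distrib mult.assoc)
  have r1: "1 + r_crit_value = 2 * (a - 1 - w)" by (simp add: rc)
  have s2: "(a - 1 - w) * (a - 1 - w) = 15 - 5 * a - 2 * (a - 1) * w"
    by (simp add: algebra_simps a2 w2)
  have "(1 + r_crit_value)\<^sup>2 * (1 + a) = 4 * ((a - 1 - w) * (a - 1 - w)) * (1 + a)"
    unfolding r1 power_mult_distrib by (simp add: power2_eq_square)
  also have "\<dots> = 20 * r_crit_value"
    unfolding s2 rc by (simp add: algebra_simps a2 w2 aax wwx)
  finally show "(1 + r_crit_value)\<^sup>2 * (1 + sqrt 6) = 20 * r_crit_value" unfolding a_def .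
  have "(a - 1 - w) * (a - 1 - w) * (a - 1 - w) = 42 * a - 97 + (9 * a - 29) * w"
    unfolding s2 by (simp add: algebra_simps a2 w2 aax wwx)
  then have r3: "(1 + r_crit_value) ^ 3 = 8 * (42 * a - 97 + (9 * a - 29) * w)"
    unfolding r1 power_mult_distrib by (simp add: power3_eq_cube)
  have "r0_coeff * (a / 2) * (1 - r_crit_value) = (8 * a - 2) / 5 * (1 + r_crit_value) ^ 3"
    unfolding r3 unfolding c rc by (simp add: algebra_simps a2 w2 aax wwx) (simp add: field_simps)
  then show "r0_coeff * (sqrt 6 / 2) * (1 - r_crit_value) = (8 * sqrt 6 - 2) / 5 * (1 + r_crit_value) ^ 3" unfolding a_def .
  define z where "z = sqrt (4 - a) / sqrt 5"
  have a4: "a < 4" "a > 1" using sqrt6_bounds by (simp_all add: a_def)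
  have z2: "z * z = (4 - a) / 5" using a4 by (simp add: z_def)
  have z0: "z \<ge> 0" using a4 by (simp add: z_def)
  \<comment> \<open>From (4 - a)(a - 1)^2 / 5 = 8 - 3 a. This links the nested root of one closed
    form to that of the other.\<close>
  have "w = z * (a - 1)"
  proof (rule power2_eq_imp_eq)
    have "(z * (a - 1))\<^sup>2 = z * z * ((a - 1) * (a - 1))" by (simp only: power2_eq_square mult_ac)
    also have "\<dots> = (4 - a) / 5 * ((a - 1) * (a - 1))" unfolding z2 ..
    also have "\<dots> = 8 - 3 * a" by (simp add: algebra_simps a2 aax) (simp add: field_simps)
    finally show "w\<^sup>2 = (z * (a - 1))\<^sup>2" by (simp add: power2_eq_square w2)
  qed (use z0 a4 sqrt6_bounds in \<open>auto simp: w_def a_def\<close>)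
  then have rz: "r_crit_value = 2 * a - 3 - 2 * (z * (a - 1))" unfolding rc by simp
  have "r_crit_value * (1 + z) = 1 - z"
  proof -
    have zzx: "z * (z * x) = (4 - a) / 5 * x" for x using z2 by (metis mult.assoc)
    show ?thesis unfolding rz by (simp add: algebra_simps z2 zzx a2 aax) (simp add: field_simps a2)
  qed
  then have "r_crit_value = (1 - z) / (1 + z)" using z0 by (simp add: eq_divide_eq)
  then show "r_crit_value = (1 - sqrt (4 - sqrt 6) / sqrt 5) / (1 + sqrt (4 - sqrt 6) / sqrt 5)"
    unfolding z_def a_def .
qed

lemma r0_at_0: "(\<lambda>q. r0 q - (r_crit_value + r0_coeff * q\<^sup>2)) \<in> o[at_right 0](\<lambda>q. q\<^sup>2)"
proof (rule r0_expansion)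
  define a where "a = sqrt 6"
  have a2: "a * a = 6" by (simp add: a_def)
  have a1: "1 + a > 0" "a > 0" by (simp_all add: a_def add_pos_pos)
  show rc: "0 < r_crit_value" "r_crit_value < 1" using r_crit_value_bounds by simp_all
  \<comment> \<open>The positive root of 5 y^2 - y / 2 - 1 / 16.\<close>
  have L: "lor r_crit_value = (1 + a) / 20"
    using r_crit_value_eqs(1) rc unfolding lor_def a_def[symmetric] by (simp add: field_simps)
  show "5 * (lor r_crit_value)\<^sup>2 - lor r_crit_value / 2 - 1 / 16 = 0"
    unfolding L by (simp add: power2_eq_square field_simps a2)
  \<comment> \<open>From r + 1 / r + 2 = 1 / lor r = 20 / (1 + sqrt 6) = 4 (sqrt 6 - 1).\<close>
  have H: "r_crit_value + 1 / r_crit_value = 4 * a - 6"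
  proof -
    have "r_crit_value * (r_crit_value + 1 / r_crit_value + 2) = (1 + r_crit_value)\<^sup>2" using rc by (simp add: power2_eq_square field_simps)
    then have "r_crit_value * ((r_crit_value + 1 / r_crit_value + 2) * (1 + a)) = r_crit_value * 20"
      using r_crit_value_eqs(1) unfolding a_def[symmetric] by (simp add: mult.assoc[symmetric])
    then have "(r_crit_value + 1 / r_crit_value + 2) * (1 + a) = 20" using rc by simp
    moreover have "(4 * a - 4) * (1 + a) = 20" by (simp add: algebra_simps a2)
    ultimately have "r_crit_value + 1 / r_crit_value + 2 = 4 * a - 4" using a1 by (metis less_irrefl mult_right_cancel)
    then show ?thesis by simp
  qed
  have "(r_crit_value + 1 / r_crit_value) + 2 * (1 / 4 - lor r_crit_value) * (2 - (r_crit_value + 1 / r_crit_value)) = (8 * a - 2) / 5"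
    unfolding H L by (simp add: field_simps a2)
  moreover have "r0_coeff * ((1 - r_crit_value) / (1 + r_crit_value) ^ 3 * (10 * lor r_crit_value - 1 / 2)) = (8 * a - 2) / 5"
  proof -
    have "10 * lor r_crit_value - 1 / 2 = a / 2" unfolding L by (simp add: field_simps)
    then have "r0_coeff * ((1 - r_crit_value) / (1 + r_crit_value) ^ 3 * (10 * lor r_crit_value - 1 / 2)) = r0_coeff * (a / 2) * (1 - r_crit_value) / (1 + r_crit_value) ^ 3"
      by (simp only: times_divide_eq_left times_divide_eq_right mult_ac)
    also have "\<dots> = (8 * a - 2) / 5"
      unfolding a_def r_crit_value_eqs(3) using rc by simp
    finally show ?thesis .
  qed
  ultimately show "r0_coeff * ((1 - r_crit_value) / (1 + r_crit_value) ^ 3 * (10 * lor r_crit_value - 1 / 2)) = (r_crit_value + 1 / r_crit_value) + 2 * (1 / 4 - lor r_crit_value) * (2 - (r_crit_value + 1 / r_crit_value))"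
    by (simp only:)
qed

lemma r0_tendsto: "(r0 \<longlongrightarrow> r_crit_value) (at_right 0)"
proof -
  have idt: "((\<lambda>q::real. q) \<longlongrightarrow> 0) (at_right 0)" by (simp add: tendsto_ident_at)
  have p0: "((\<lambda>q::real. q\<^sup>2) \<longlongrightarrow> 0) (at_right 0)" using tendsto_power[OF idt, of 2] by simp
  have "((\<lambda>q. r0 q - (r_crit_value + r0_coeff * q\<^sup>2)) \<longlongrightarrow> 0) (at_right 0)"
  proof (rule Lim_null_comparison[OF _ p0])
    show "\<forall>\<^sub>F q in at_right 0. norm (r0 q - (r_crit_value + r0_coeff * q\<^sup>2)) \<le> q\<^sup>2"
      using landau_o.smallD[OF r0_at_0, of 1] by simp
  qed
  from tendsto_add[OF this tendsto_add[OF tendsto_const tendsto_mult[OF tendsto_const p0]], of r_crit_value r0_coeff]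
  show ?thesis by simp
qed

lemma r_crit_eq: "r_crit = r_crit_value"
  unfolding r_crit_def by (rule tendsto_Lim[OF _ r0_tendsto]) simp

theorem theorem1p6:
  shows
    "\<comment> \<open>(i)\<close>
     (\<forall>q\<in>{0<..<1}. \<forall>r>0.
        (\<lambda>x. G_vee q x r - (1 + of_real (kappa q r * (1 - x\<^sup>2) ^ 4)))
          \<in> o[at_left 1](\<lambda>x. of_real ((1 - x\<^sup>2) ^ 4)) \<and>
        (\<lambda>x. G_vee q x r - (1 + of_real (kappa q r / q ^ 8 * (x\<^sup>2 - q\<^sup>2) ^ 4)))
          \<in> o[at_right q](\<lambda>x. of_real ((x\<^sup>2 - q\<^sup>2) ^ 4)) \<and>
        kappa q (1 / r) = kappa q r \<and>
        kappa q (q\<^sup>2 * r) = kappa q r \<and>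
        kappa q (q\<^sup>2 / r) = kappa q r) \<and>
     fundamental_cell Omega \<and>
     \<comment> \<open>(ii)\<close>
     (\<forall>q\<in>{0<..<1}.
        e1 q > wp_plus q \<and> wp_plus q > e2 q \<and> e2 q > e3 q \<and>
        q < r0 q \<and> r0 q < 1 \<and>
        (\<forall>r\<in>{q<..<r0 q}. kappa q r < 0) \<and>
        (\<forall>r\<in>{r0 q<..<1}. kappa q r > 0)) \<and>
     \<comment> \<open>(iii)\<close>
     {(q, r). q \<in> {0<..<1} \<and> r = r0 q} \<subseteq> Omega \<and>
     \<comment> \<open>(a)\<close>
     (r0 \<longlongrightarrow> r_crit) (at_right 0) \<and>
     r_crit = (1 - sqrt (4 - sqrt 6) / sqrt 5) / (1 + sqrt (4 - sqrt 6) / sqrt 5) \<and>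
     r_crit = 2 * sqrt 6 - 3 - 2 * sqrt (8 - 3 * sqrt 6) \<and>
     r_crit \<in> {0.2846303639..<0.2846303640} \<and>
     \<comment> \<open>(b)\<close>
     (let c = 8 / 3 * (- 72 + 22 * sqrt 6 + 3 * (4 * sqrt 6 - 1) * sqrt (8 - 3 * sqrt 6)) in
        (\<lambda>q. r0 q - (r_crit + c * q\<^sup>2)) \<in> o[at_right 0](\<lambda>q. q\<^sup>2) \<and>
        c \<in> {8.515307593..<8.515307594}) \<and>
     \<comment> \<open>(c)\<close>
     (\<lambda>q. r0 q - (1 - 1 / 2 * (1 - q))) \<in> o[at_left 1](\<lambda>q. 1 - q)"
proof (intro conjI)
  show "\<forall>q\<in>{0<..<1}. \<forall>r>0.
        (\<lambda>x. G_vee q x r - (1 + of_real (kappa q r * (1 - x\<^sup>2) ^ 4)))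
          \<in> o[at_left 1](\<lambda>x. of_real ((1 - x\<^sup>2) ^ 4)) \<and>
        (\<lambda>x. G_vee q x r - (1 + of_real (kappa q r / q ^ 8 * (x\<^sup>2 - q\<^sup>2) ^ 4)))
          \<in> o[at_right q](\<lambda>x. of_real ((x\<^sup>2 - q\<^sup>2) ^ 4)) \<and>
        kappa q (1 / r) = kappa q r \<and>
        kappa q (q\<^sup>2 * r) = kappa q r \<and>
        kappa q (q\<^sup>2 / r) = kappa q r"
  proof (intro ballI allI impI)
    fix q r :: real assume "q \<in> {0<..<1}" and r: "r > 0"
    then interpret nome q by unfold_locales auto
    show "(\<lambda>x. G_vee q x r - (1 + of_real (kappa q r * (1 - x\<^sup>2) ^ 4)))
          \<in> o[at_left 1](\<lambda>x. of_real ((1 - x\<^sup>2) ^ 4)) \<and>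
        (\<lambda>x. G_vee q x r - (1 + of_real (kappa q r / q ^ 8 * (x\<^sup>2 - q\<^sup>2) ^ 4)))
          \<in> o[at_right q](\<lambda>x. of_real ((x\<^sup>2 - q\<^sup>2) ^ 4)) \<and>
        kappa q (1 / r) = kappa q r \<and>
        kappa q (q\<^sup>2 * r) = kappa q r \<and>
        kappa q (q\<^sup>2 / r) = kappa q r"
      by (intro conjI G_vee_at_1 G_vee_at_q kappa_symmetric r)
  qed
  show "fundamental_cell Omega" by (rule fundamental_cell_Omega)
  show "\<forall>q\<in>{0<..<1}.
        e1 q > wp_plus q \<and> wp_plus q > e2 q \<and> e2 q > e3 q \<and>
        q < r0 q \<and> r0 q < 1 \<and>
        (\<forall>r\<in>{q<..<r0 q}. kappa q r < 0) \<and>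
        (\<forall>r\<in>{r0 q<..<1}. kappa q r > 0)"
  proof
    fix q :: real assume "q \<in> {0<..<1}"
    then interpret nome q by unfold_locales auto
    show "e1 q > wp_plus q \<and> wp_plus q > e2 q \<and> e2 q > e3 q \<and>
        q < r0 q \<and> r0 q < 1 \<and>
        (\<forall>r\<in>{q<..<r0 q}. kappa q r < 0) \<and>
        (\<forall>r\<in>{r0 q<..<1}. kappa q r > 0)"
      by (intro conjI ballI wp_plus_range e_order r0_range kappa_negative kappa_positive; simp)
  qed
  show "{(q, r). q \<in> {0<..<1} \<and> r = r0 q} \<subseteq> Omega"
  proof clarify
    fix q :: real assume "q \<in> {0<..<1}"
    then interpret nome q by unfold_locales auto
    show "(q, r0 q) \<in> Omega"
      unfolding Omega_def using q_pos q_less_1 r0_range by simp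
  qed
  show "(r0 \<longlongrightarrow> r_crit) (at_right 0)" unfolding r_crit_eq by (rule r0_tendsto)
  show "r_crit = (1 - sqrt (4 - sqrt 6) / sqrt 5) / (1 + sqrt (4 - sqrt 6) / sqrt 5)"
    unfolding r_crit_eq by (rule r_crit_value_eqs(2))
  show "r_crit = 2 * sqrt 6 - 3 - 2 * sqrt (8 - 3 * sqrt 6)"
    unfolding r_crit_eq by (rule r_crit_value_def)
  show "r_crit \<in> {0.2846303639..<0.2846303640}"
    unfolding r_crit_eq by (rule r_crit_value_bounds)
  show "let c = 8 / 3 * (- 72 + 22 * sqrt 6 + 3 * (4 * sqrt 6 - 1) * sqrt (8 - 3 * sqrt 6)) in
        (\<lambda>q. r0 q - (r_crit + c * q\<^sup>2)) \<in> o[at_right 0](\<lambda>q. q\<^sup>2) \<and>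
        c \<in> {8.515307593..<8.515307594}"
    using r0_at_0 r0_coeff_bounds unfolding r_crit_eq r0_coeff_def Let_def by (rule conjI)
  show "(\<lambda>q. r0 q - (1 - 1 / 2 * (1 - q))) \<in> o[at_left 1](\<lambda>q. 1 - q)"
    by (rule r0_at_1)
qed

end
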